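(* Let $B$ be a Hopf algebra over $\mathbb{K}$ with antipode $S$ and let $J\in B\otimes B$ be a central twist for $B$ such that (i) $(e_1^2\otimes e_2^2)(J)$ is a twist for $B\otimes B$; (ii) $\Delta_{B\otimes B}(J) = (e_1^2 \otimes e_2^2)(J)\,(e_2^2 \otimes e_1^2)(J)\,(J\otimes J)$; (iii) $(S\otimes S)(J)=J$ and $(\mathrm{id}\otimes S)(J)=J^{-1}=(S\otimes \mathrm{id})(J)$. Let $m\geq 2$, let $X=\{s_1,\ldots,s_{m-1}\}$ be the set of transpositions $s_i=(i,i+1)$ generating $\Sigma_m$, let $M$ be the free monoid generated by $\{\overline{s}_i : 1\le i<m\}$, acting on $R=B^{\otimes m}$ via $\overline{s}_i\mapsto \sigma_{s_i}$, and equip the skew monoid algebra $R\# M$ with the bialgebra structure extending that of $R$ with $\Delta(\overline{s}_i)=J_{s_i}(\overline{s}_i\otimes\overline{s}_i)$ and $\epsilon(\overline{s}_i)=1$. Let $I$ be the ideal of $R\# M$ generated by $$\overline{s}_i^2 - t_{s_i}\ (1\le i<m),\qquad \overline{s}_i\overline{s}_{i+1}\overline{s}_i - \overline{s}_{i+1}\overline{s}_i\overline{s}_{i+1}\ (1\le i<m-1),\qquad \overline{s}_i\overline{s}_j-\overline{s}_j\overline{s}_i\ (|i-j|>1).$$ Then $H=(R\# M)/I$ is a Hopf algebra of dimension $\dim(B)^m\, m!$ with Hopf subalgebra $R=B^{\otimes m}$ and Hopf quotient $\mathbb{K}\Sigma_m$. Furthermore: (1) $\{\overline{w} : w\in\Sigma_m\}$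 is an $R$-basis of $H$; (2) there exists a $2$-cocycle $\gamma:\Sigma_m\times\Sigma_m\to Z(R)^\times$ such that $H\simeq R\#_\gamma\Sigma_m$, with multiplication given by $$(a\#\overline{w})(b\#\overline{v}) = a\,\sigma_w(b)\,\gamma(w,v)\#\overline{wv}$$ for all $a,b\in R$ and $w,v\in\Sigma_m$, where each $\gamma(w,v)$ is a (possibly empty) product of elements $\sigma_u(t_s)$ with $u\in\Sigma_m$ and $s\in X$; (3) $\epsilon(\gamma(w,v))=1$ for all $w,v\in\Sigma_m$; (4) if $B$ is semisimple, then $H$ is semisimple with integral $\int\sum_{w\in\Sigma_m}\overline{w}$, where $\int$ is the integral of $R$.
   Context: $\mathbb{K}$ is a field of characteristic zero; $\Sigma_m$ is the symmetric group on $\{1,\dots,m\}$, with permutations composed from right to left. Twist: an invertible element $J\in B\otimes B$ of a bialgebra $B$ is a twist for $B$ if $(\Delta_B\otimes\mathrm{id}_B)(J)(J\otimes 1_B)=(\mathrm{id}_B\otimes\Delta_B)(J)(1_B\otimes J)$ and $(\epsilon\otimes\mathrm{id})(J)=1=(\mathrm{id}\otimes\epsilon)(J)$. It is central if it is central in the algebra $B\otimes B$. $e_i^m:B\to B^{\otimes m}$ denotes the embedding of $B$ into the $i$th tensorand ($b\mapsto 1\otimes\cdots\otimes b\otimes\cdots\otimes 1$). For $w\in\Sigma_m$, $\sigma_w:R\to R$ is the bialgebra automorphism of $R=B^{\otimes m}$ permuting tensorands with $\sigma_w\circ e_i^m=e_{w(i)}^m$, i.e. $\sigma_w(a_1\otimes\cdots\otimes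 a_m)=a_{w^{-1}(1)}\otimes\cdots\otimes a_{w^{-1}(m)}$. For a transposition $s=(i\,j)$ with $i<j$: $J_s=(e_i^m\otimes e_j^m)(J)\in R\otimes R$ and $t_s=\mu_R(J_s)\in R$, where $\mu_R:R\otimes R\to R$ is the multiplication of $R$. The skew monoid algebra $R\#M$ is the free left $R$-module with basis the words of $M$ and multiplication determined by that of $R$ and $M$ and $\overline{s}\,a=\sigma_s(a)\,\overline{s}$ for $a\in R$, $s\in X$. Under the stated hypotheses the stated comultiplication and counit make $R\#M$ a bialgebra. For each $w\in\Sigma_m$ fix an expression $w=s_{i_1}\cdots s_{i_k}$ with $k$ minimal; $\overline{w}$ denotes the class of $\overline{s}_{i_1}\cdots\overline{s}_{i_k}$ in $H$. $Z(R)^\times$ denotes the group of units of the center of $R$. A map $\gamma:\Sigma_m\times\Sigma_m\to Z(R)^\times$ is a $2$-cocycle if $\gamma(w,v)\gamma(wv,u)=\sigma_w(\gamma(v,u))\gamma(w,vu)$ for all $u,v,w$ and $\gamma(\mathrm{id},w)=\gamma(w,\mathrm{id})=1$; the crossed product $R\#_\gamma\Sigma_m$ is the free left $R$-module with basis $\{1\#\overline{w}\}$ and the multiplication displayed in the claim. An integral of a Hopf algebra $K$ is a nonzero element $\Lambda$ with $h\Lambda=\epsilon(h)\Lambda$ for all $h\in K$ (unique up to scalars). *)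

theory Defs
  imports
    "HOL-Algebra.QuotRing"
    "HOL-Algebra.Sym_Groups"
    "HOL-Library.Equipollence"
    "Jordan_Normal_Form.Missing_VectorSpace"
begin

section \<open>Algebras over a field\<close>

text \<open>The locale \<^locale>\<open>algebra\<close> of HOL-Algebra is restricted to commutative algebras.\<close>

definition kalg :: "('k, 'n) ring_scheme \<Rightarrow> ('k, 'a, 'z) module_scheme \<Rightarrow> bool" where
  "kalg K A \<longleftrightarrow> vectorspace K A \<and> ring A \<and>
    (\<forall>c\<in>carrier K. \<forall>a\<in>carrier A. \<forall>b\<in>carrier A.
      (c \<odot>\<^bsub>A\<^esub> a) \<otimes>\<^bsub>A\<^esub> b = c \<odot>\<^bsub>A\<^esub> (a \<otimes>\<^bsub>A\<^esub> b) \<and>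
      a \<otimes>\<^bsub>A\<^esub> (c \<odot>\<^bsub>A\<^esub> b) = c \<odot>\<^bsub>A\<^esub> (a \<otimes>\<^bsub>A\<^esub> b))"

definition alg_hom ::
  "('k, 'n) ring_scheme \<Rightarrow> ('k, 'a, 'z) module_scheme \<Rightarrow> ('k, 'c, 'y) module_scheme \<Rightarrow> ('a \<Rightarrow> 'c) set"
  where "alg_hom K A C = ring_hom A C \<inter> module_hom K A C"

definition self_alg :: "('k, 'n) ring_scheme \<Rightarrow> ('k, 'k) module" where
  "self_alg K = \<lparr>carrier = carrier K, monoid.mult = monoid.mult K, one = one K, zero = zero K, add = add K,
     smult = monoid.mult K\<rparr>"

definition list_prod :: "('a, 'z) monoid_scheme \<Rightarrow> 'a list \<Rightarrow> 'a" where
  "list_prod G xs = foldr (\<lambda>x y. x \<otimes>\<^bsub>G\<^esub> y) xs \<one>\<^bsub>G\<^esub>"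

definition center :: "('a, 'z) monoid_scheme \<Rightarrow> 'a set" where
  "center R = {z \<in> carrier R. \<forall>x\<in>carrier R. z \<otimes>\<^bsub>R\<^esub> x = x \<otimes>\<^bsub>R\<^esub> z}"

definition quot_alg :: "('k, 'a, 'z) module_scheme \<Rightarrow> 'a set \<Rightarrow> ('k, 'a set) module" where
  "quot_alg A I =
    \<lparr>carrier = carrier (A Quot I), monoid.mult = monoid.mult (A Quot I), one = one (A Quot I),
     zero = zero (A Quot I), add = add (A Quot I),
     smult = (\<lambda>c X. \<Union>x\<in>X. I +>\<^bsub>A\<^esub> (c \<odot>\<^bsub>A\<^esub> x))\<rparr>"

definition left_ideal :: "'a set \<Rightarrow> ('a, 'z) ring_scheme \<Rightarrow> bool" where
  "left_ideal L A \<longleftrightarrow> additive_subgroup L A \<and> (\<forall>a\<in>carrier A. \<forall>x\<in>L. a \<otimes>\<^bsub>A\<^esub> x \<in> L)"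

text \<open>The left regular module is semisimple: each of its submodules is a direct summand.\<close>

definition semisimple :: "('a, 'z) ring_scheme \<Rightarrow> bool" where
  "semisimple A \<longleftrightarrow> ring A \<and>
    (\<forall>L. left_ideal L A \<longrightarrow>
      (\<exists>L'. left_ideal L' A \<and> L \<inter> L' = {\<zero>\<^bsub>A\<^esub>} \<and> L <+>\<^bsub>A\<^esub> L' = carrier A))"


section \<open>Crossed products\<close>

text \<open>
  The free left \<open>R\<close>-module on the elements of the monoid \<open>G\<close>, as finitely supported functions,
  with \<open>(a # x)(b # y) = a x(b) \<gamma>(x,y) # xy\<close>.  For \<open>\<gamma> = 1\<close> this is the skew monoid
  algebra \<open>R # G\<close>; for \<open>R = K\<close> and trivial action it is the monoid algebra \<open>K G\<close>.
\<close>

definition basis_elt :: "('r, 'z) ring_scheme \<Rightarrow> 'g \<Rightarrow> 'r \<Rightarrow> 'g \<Rightarrow> 'r" where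
  "basis_elt R x a = (\<lambda>y. if y = x then a else \<zero>\<^bsub>R\<^esub>)"

definition supp :: "('r, 'z) ring_scheme \<Rightarrow> ('g \<Rightarrow> 'r) \<Rightarrow> 'g set" where
  "supp R f = {x. f x \<noteq> \<zero>\<^bsub>R\<^esub>}"

definition crossed_alg ::
  "('k, 'r, 'z) module_scheme \<Rightarrow> ('g, 'y) monoid_scheme \<Rightarrow> ('g \<Rightarrow> 'r \<Rightarrow> 'r) \<Rightarrow> ('g \<Rightarrow> 'g \<Rightarrow> 'r) \<Rightarrow>
    ('k, 'g \<Rightarrow> 'r) module" where
  "crossed_alg R G act \<gamma> =
    \<lparr>carrier = {f. (\<forall>x. f x \<in> carrier R) \<and> finite (supp R f) \<and> supp R f \<subseteq> carrier G},
     monoid.mult = (\<lambda>f g z.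
       \<Oplus>\<^bsub>R\<^esub>p\<in>{(x, y). x \<in> supp R f \<and> y \<in> supp R g \<and> x \<otimes>\<^bsub>G\<^esub> y = z}.
         f (fst p) \<otimes>\<^bsub>R\<^esub> act (fst p) (g (snd p)) \<otimes>\<^bsub>R\<^esub> \<gamma> (fst p) (snd p)),
     one = basis_elt R \<one>\<^bsub>G\<^esub> \<one>\<^bsub>R\<^esub>,
     zero = (\<lambda>_. \<zero>\<^bsub>R\<^esub>),
     add = (\<lambda>f g x. f x \<oplus>\<^bsub>R\<^esub> g x),
     smult = (\<lambda>c f x. c \<odot>\<^bsub>R\<^esub> f x)\<rparr>"

definition monoid_alg :: "('k, 'n) ring_scheme \<Rightarrow> ('g, 'y) monoid_scheme \<Rightarrow> ('k, 'g \<Rightarrow> 'k) module"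
  where "monoid_alg K G = crossed_alg (self_alg K) G (\<lambda>_ a. a) (\<lambda>_ _. \<one>\<^bsub>K\<^esub>)"

definition free_monoid :: "'i set \<Rightarrow> 'i list monoid" where
  "free_monoid X = \<lparr>carrier = lists X, monoid.mult = (@), one = []\<rparr>"


section \<open>Tensor powers\<close>

type_synonym ('k, 'a) tensor = "((nat \<Rightarrow> 'a) \<Rightarrow> 'k) set"

text \<open>
  \<open>A\<^sup>\<otimes>\<^sup>n\<close> is the free vector space on the \<open>n\<close>-tuples, indexed by \<open>{1..n}\<close>, modulo the span of
  the multilinearity relations.  That span is a two-sided ideal of the monoid algebra of
  \<open>A\<^sup>n\<close> with componentwise multiplication, so the quotient carries the usual product
  \<open>(x\<^sub>1 \<otimes> \<dots> \<otimes> x\<^sub>n)(y\<^sub>1 \<otimes> \<dots> \<otimes> y\<^sub>n) = x\<^sub>1y\<^sub>1 \<otimes> \<dots> \<otimes> x\<^sub>ny\<^sub>n\<close>.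
\<close>

definition tuple_monoid :: "('a, 'z) monoid_scheme \<Rightarrow> nat \<Rightarrow> (nat \<Rightarrow> 'a) monoid" where
  "tuple_monoid A n =
    \<lparr>carrier = {1..n} \<rightarrow>\<^sub>E carrier A,
     monoid.mult = (\<lambda>x y. \<lambda>i\<in>{1..n}. x i \<otimes>\<^bsub>A\<^esub> y i),
     one = (\<lambda>i\<in>{1..n}. \<one>\<^bsub>A\<^esub>)\<rparr>"

definition tensor_free ::
  "('k, 'n) ring_scheme \<Rightarrow> ('k, 'a, 'z) module_scheme \<Rightarrow> nat \<Rightarrow> ('k, (nat \<Rightarrow> 'a) \<Rightarrow> 'k) module" where
  "tensor_free K A n = monoid_alg K (tuple_monoid A n)"

definition tensor_rel ::
  "('k, 'n) ring_scheme \<Rightarrow> ('k, 'a, 'z) module_scheme \<Rightarrow> nat \<Rightarrow> ((nat \<Rightarrow> 'a) \<Rightarrow> 'k) set" where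
  "tensor_rel K A n =
    (let F = tensor_free K A n; \<delta> = (\<lambda>x. basis_elt K x \<one>\<^bsub>K\<^esub>) in
     LinearCombinations.module.span K F
      ({\<delta> (x(i := a \<oplus>\<^bsub>A\<^esub> b)) \<ominus>\<^bsub>F\<^esub> (\<delta> (x(i := a)) \<oplus>\<^bsub>F\<^esub> \<delta> (x(i := b))) | x i a b.
          x \<in> {1..n} \<rightarrow>\<^sub>E carrier A \<and> i \<in> {1..n} \<and> a \<in> carrier A \<and> b \<in> carrier A} \<union>
       {\<delta> (x(i := c \<odot>\<^bsub>A\<^esub> a)) \<ominus>\<^bsub>F\<^esub> (c \<odot>\<^bsub>F\<^esub> \<delta> (x(i := a))) | x i a c.
          x \<in> {1..n} \<rightarrow>\<^sub>E carrier A \<and> i \<in> {1..n} \<and> a \<in> carrier A \<and> c \<in> carrier K}))"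

definition tensor_pow ::
  "('k, 'n) ring_scheme \<Rightarrow> ('k, 'a, 'z) module_scheme \<Rightarrow> nat \<Rightarrow> ('k, ('k, 'a) tensor) module" where
  "tensor_pow K A n = quot_alg (tensor_free K A n) (tensor_rel K A n)"

definition tens ::
  "('k, 'n) ring_scheme \<Rightarrow> ('k, 'a, 'z) module_scheme \<Rightarrow> nat \<Rightarrow> (nat \<Rightarrow> 'a) \<Rightarrow> ('k, 'a) tensor" where
  "tens K A n x = tensor_rel K A n +>\<^bsub>tensor_free K A n\<^esub> basis_elt K x \<one>\<^bsub>K\<^esub>"

text \<open>\<open>tens_list K A [a\<^sub>1, \<dots>, a\<^sub>n] = a\<^sub>1 \<otimes> \<dots> \<otimes> a\<^sub>n\<close>\<close>

definition tens_list ::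
  "('k, 'n) ring_scheme \<Rightarrow> ('k, 'a, 'z) module_scheme \<Rightarrow> 'a list \<Rightarrow> ('k, 'a) tensor" where
  "tens_list K A xs = tens K A (length xs) (\<lambda>i\<in>{1..length xs}. xs ! (i - 1))"

text \<open>
  For multilinear \<open>\<phi>\<close>, \<open>tens_lift K V \<phi>\<close> is the linear map with
  \<open>x\<^sub>1 \<otimes> \<dots> \<otimes> x\<^sub>n \<mapsto> \<phi> x\<close>; it is only ever applied to multilinear \<open>\<phi>\<close>, for which the
  value does not depend on the representative of the coset.
\<close>

definition tens_lift ::
  "('k, 'n) ring_scheme \<Rightarrow> ('k, 'v, 'z) module_scheme \<Rightarrow> ((nat \<Rightarrow> 'a) \<Rightarrow> 'v) \<Rightarrow> ('k, 'a) tensor \<Rightarrow> 'v" where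
  "tens_lift K V \<phi> t = the_elem ((\<lambda>f. \<Oplus>\<^bsub>V\<^esub>x\<in>supp K f. f x \<odot>\<^bsub>V\<^esub> \<phi> x) ` t)"

text \<open>\<open>tens_map2 K C f g = f \<otimes> g : A \<otimes> A \<rightarrow> C \<otimes> C\<close>\<close>

definition tens_map2 ::
  "('k, 'n) ring_scheme \<Rightarrow> ('k, 'c, 'z) module_scheme \<Rightarrow> ('a \<Rightarrow> 'c) \<Rightarrow> ('a \<Rightarrow> 'c) \<Rightarrow>
    ('k, 'a) tensor \<Rightarrow> ('k, 'c) tensor" where
  "tens_map2 K C f g = tens_lift K (tensor_pow K C 2) (\<lambda>x. tens_list K C [f (x 1), g (x 2)])"

definition mult_map ::
  "('k, 'n) ring_scheme \<Rightarrow> ('k, 'a, 'z) module_scheme \<Rightarrow> ('k, 'a) tensor \<Rightarrow> 'a" where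
  "mult_map K A = tens_lift K A (\<lambda>x. x 1 \<otimes>\<^bsub>A\<^esub> x 2)"

definition tens_emb ::
  "('k, 'n) ring_scheme \<Rightarrow> ('k, 'a, 'z) module_scheme \<Rightarrow> nat \<Rightarrow> nat \<Rightarrow> 'a \<Rightarrow> ('k, 'a) tensor" where
  "tens_emb K A m i a = tens K A m (\<lambda>j\<in>{1..m}. if j = i then a else \<one>\<^bsub>A\<^esub>)"

text \<open>\<open>tens_perm K A m w (a\<^sub>1 \<otimes> \<dots> \<otimes> a\<^sub>m)\<close> has \<open>a\<^sub>i\<close> in position \<open>w(i)\<close>.\<close>

definition tens_perm ::
  "('k, 'n) ring_scheme \<Rightarrow> ('k, 'a, 'z) module_scheme \<Rightarrow> nat \<Rightarrow> (nat \<Rightarrow> nat) \<Rightarrow>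
    ('k, 'a) tensor \<Rightarrow> ('k, 'a) tensor" where
  "tens_perm K A m w = tens_lift K (tensor_pow K A m) (\<lambda>x. tens K A m (\<lambda>i\<in>{1..m}. x (inv' w i)))"


section \<open>Bialgebras and Hopf algebras\<close>

record ('k, 'a) bialg = "('k, 'a) module" +
  comult :: "'a \<Rightarrow> ('k, 'a) tensor"
  counit :: "'a \<Rightarrow> 'k"

definition make_bialg ::
  "('k, 'a, 'z) module_scheme \<Rightarrow> ('a \<Rightarrow> ('k, 'a) tensor) \<Rightarrow> ('a \<Rightarrow> 'k) \<Rightarrow> ('k, 'a) bialg" where
  "make_bialg A \<Delta> \<epsilon> =
    \<lparr>carrier = carrier A, monoid.mult = monoid.mult A, one = one A, zero = zero A, add = add A,
     smult = smult A, comult = \<Delta>, counit = \<epsilon>\<rparr>"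

text \<open>
  \<open>\<Delta> \<otimes> id, id \<otimes> \<Delta> : A \<otimes> A \<rightarrow> A \<otimes> A \<otimes> A\<close> and \<open>\<epsilon> \<otimes> id, id \<otimes> \<epsilon> : A \<otimes> A \<rightarrow> A\<close>.
\<close>

definition comult_id ::
  "('k, 'n) ring_scheme \<Rightarrow> ('k, 'a) bialg \<Rightarrow> ('k, 'a) tensor \<Rightarrow> ('k, 'a) tensor" where
  "comult_id K A = tens_lift K (tensor_pow K A 3)
    (\<lambda>x. tens_lift K (tensor_pow K A 3) (\<lambda>y. tens_list K A [y 1, y 2, x 2]) (comult A (x 1)))"

definition id_comult ::
  "('k, 'n) ring_scheme \<Rightarrow> ('k, 'a) bialg \<Rightarrow> ('k, 'a) tensor \<Rightarrow> ('k, 'a) tensor" where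
  "id_comult K A = tens_lift K (tensor_pow K A 3)
    (\<lambda>x. tens_lift K (tensor_pow K A 3) (\<lambda>y. tens_list K A [x 1, y 1, y 2]) (comult A (x 2)))"

definition counit_id :: "('k, 'n) ring_scheme \<Rightarrow> ('k, 'a) bialg \<Rightarrow> ('k, 'a) tensor \<Rightarrow> 'a" where
  "counit_id K A = tens_lift K A (\<lambda>x. counit A (x 1) \<odot>\<^bsub>A\<^esub> x 2)"

definition id_counit :: "('k, 'n) ring_scheme \<Rightarrow> ('k, 'a) bialg \<Rightarrow> ('k, 'a) tensor \<Rightarrow> 'a" where
  "id_counit K A = tens_lift K A (\<lambda>x. counit A (x 2) \<odot>\<^bsub>A\<^esub> x 1)"

definition bialgebra :: "('k, 'n) ring_scheme \<Rightarrow> ('k, 'a) bialg \<Rightarrow> bool" where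
  "bialgebra K A \<longleftrightarrow> kalg K A \<and>
    comult A \<in> alg_hom K A (tensor_pow K A 2) \<and>
    counit A \<in> alg_hom K A (self_alg K) \<and>
    (\<forall>a\<in>carrier A.
      comult_id K A (comult A a) = id_comult K A (comult A a) \<and>
      counit_id K A (comult A a) = a \<and> id_counit K A (comult A a) = a)"

definition antipode :: "('k, 'n) ring_scheme \<Rightarrow> ('k, 'a) bialg \<Rightarrow> ('a \<Rightarrow> 'a) \<Rightarrow> bool" where
  "antipode K A S \<longleftrightarrow> S \<in> module_hom K A A \<and>
    (\<forall>a\<in>carrier A.
      tens_lift K A (\<lambda>x. S (x 1) \<otimes>\<^bsub>A\<^esub> x 2) (comult A a) = counit A a \<odot>\<^bsub>A\<^esub> \<one>\<^bsub>A\<^esub> \<and>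
      tens_lift K A (\<lambda>x. x 1 \<otimes>\<^bsub>A\<^esub> S (x 2)) (comult A a) = counit A a \<odot>\<^bsub>A\<^esub> \<one>\<^bsub>A\<^esub>)"

definition hopf_algebra :: "('k, 'n) ring_scheme \<Rightarrow> ('k, 'a) bialg \<Rightarrow> bool" where
  "hopf_algebra K A \<longleftrightarrow> bialgebra K A \<and> (\<exists>S. antipode K A S)"

definition bialg_hom ::
  "('k, 'n) ring_scheme \<Rightarrow> ('k, 'a) bialg \<Rightarrow> ('k, 'c) bialg \<Rightarrow> ('a \<Rightarrow> 'c) \<Rightarrow> bool" where
  "bialg_hom K A C f \<longleftrightarrow> bialgebra K A \<and> bialgebra K C \<and> f \<in> alg_hom K A C \<and>
    (\<forall>a\<in>carrier A. comult C (f a) = tens_map2 K C f f (comult A a) \<and> counit C (f a) = counit A a)"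

text \<open>Antipodes are unique on the carrier, so the quantifier over \<open>S\<close> and \<open>S'\<close> is harmless.\<close>

definition hopf_hom ::
  "('k, 'n) ring_scheme \<Rightarrow> ('k, 'a) bialg \<Rightarrow> ('k, 'c) bialg \<Rightarrow> ('a \<Rightarrow> 'c) \<Rightarrow> bool" where
  "hopf_hom K A C f \<longleftrightarrow> hopf_algebra K A \<and> hopf_algebra K C \<and> bialg_hom K A C f \<and>
    (\<forall>S S'. antipode K A S \<longrightarrow> antipode K C S' \<longrightarrow> (\<forall>a\<in>carrier A. f (S a) = S' (f a)))"

definition integral :: "('k, 'a) bialg \<Rightarrow> 'a \<Rightarrow> bool" where
  "integral A \<Lambda> \<longleftrightarrow> \<Lambda> \<in> carrier A \<and> \<Lambda> \<noteq> \<zero>\<^bsub>A\<^esub> \<and>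
    (\<forall>h\<in>carrier A. h \<otimes>\<^bsub>A\<^esub> \<Lambda> = counit A h \<odot>\<^bsub>A\<^esub> \<Lambda>)"

text \<open>
  On \<open>A\<^sup>\<otimes>\<^sup>m\<close> the comultiplication is the algebra map whose composite with the \<open>i\<close>th embedding
  \<open>e\<^sub>i\<close> is \<open>(e\<^sub>i \<otimes> e\<^sub>i) \<circ> \<Delta>\<close>; as \<open>a\<^sub>1 \<otimes> \<dots> \<otimes> a\<^sub>m = e\<^sub>1(a\<^sub>1) \<cdots> e\<^sub>m(a\<^sub>m)\<close>, it is given by a product.
\<close>

definition tensor_bialg :: "('k, 'n) ring_scheme \<Rightarrow> ('k, 'a) bialg \<Rightarrow> nat \<Rightarrow> ('k, ('k, 'a) tensor) bialg"
  where
  "tensor_bialg K A m =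
    (let R = tensor_pow K A m; RR = tensor_pow K R 2 in
     make_bialg R
      (tens_lift K RR (\<lambda>x. list_prod RR
        (map (\<lambda>i. tens_map2 K R (tens_emb K A m i) (tens_emb K A m i) (comult A (x i))) [1..<Suc m])))
      (tens_lift K (self_alg K) (\<lambda>x. list_prod K (map (\<lambda>i. counit A (x i)) [1..<Suc m]))))"

definition group_bialg :: "('k, 'n) ring_scheme \<Rightarrow> ('g, 'y) monoid_scheme \<Rightarrow> ('k, 'g \<Rightarrow> 'k) bialg" where
  "group_bialg K G =
    (let A = monoid_alg K G; AA = tensor_pow K A 2; \<delta> = (\<lambda>g. basis_elt K g \<one>\<^bsub>K\<^esub>) in
     make_bialg A
      (\<lambda>f. \<Oplus>\<^bsub>AA\<^esub>g\<in>supp K f. f g \<odot>\<^bsub>AA\<^esub> tens_list K A [\<delta> g, \<delta> g])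
      (\<lambda>f. \<Oplus>\<^bsub>K\<^esub>g\<in>supp K f. f g))"

text \<open>
  The structure maps of the quotient are well defined when \<open>I\<close> is a biideal, that is, when the
  projection \<open>a \<mapsto> I + a\<close> is a homomorphism of bialgebras.
\<close>

definition quot_bialg :: "('k, 'n) ring_scheme \<Rightarrow> ('k, 'a) bialg \<Rightarrow> 'a set \<Rightarrow> ('k, 'a set) bialg" where
  "quot_bialg K A I =
    (let Q = quot_alg A I; \<pi> = (\<lambda>a. I +>\<^bsub>A\<^esub> a) in
     make_bialg Q
      (\<lambda>X. the_elem ((\<lambda>x. tens_map2 K Q \<pi> \<pi> (comult A x)) ` X))
      (\<lambda>X. the_elem (counit A ` X)))"


section \<open>Twists\<close>

definition twist :: "('k, 'n) ring_scheme \<Rightarrow> ('k, 'a) bialg \<Rightarrow> ('k, 'a) tensor \<Rightarrow> bool" where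
  "twist K A J \<longleftrightarrow>
    (let A3 = tensor_pow K A 3;
         J_1 = tens_lift K A3 (\<lambda>x. tens_list K A [x 1, x 2, \<one>\<^bsub>A\<^esub>]) J;
         one_J = tens_lift K A3 (\<lambda>x. tens_list K A [\<one>\<^bsub>A\<^esub>, x 1, x 2]) J in
     J \<in> Units (tensor_pow K A 2) \<and>
     comult_id K A J \<otimes>\<^bsub>A3\<^esub> J_1 = id_comult K A J \<otimes>\<^bsub>A3\<^esub> one_J \<and>
     counit_id K A J = \<one>\<^bsub>A\<^esub> \<and> id_counit K A J = \<one>\<^bsub>A\<^esub>)"

text \<open>\<open>(e\<^sub>i \<otimes> e\<^sub>j)(J) \<in> R \<otimes> R\<close> and its image in \<open>R\<close>, for \<open>R = B\<^sup>\<otimes>\<^sup>m\<close>\<close>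

definition emb_twist ::
  "('k, 'n) ring_scheme \<Rightarrow> ('k, 'b) bialg \<Rightarrow> nat \<Rightarrow> ('k, 'b) tensor \<Rightarrow> nat \<Rightarrow> nat \<Rightarrow>
    ('k, ('k, 'b) tensor) tensor" where
  "emb_twist K B m J i j = tens_map2 K (tensor_pow K B m) (tens_emb K B m i) (tens_emb K B m j) J"

definition emb_twist_mult ::
  "('k, 'n) ring_scheme \<Rightarrow> ('k, 'b) bialg \<Rightarrow> nat \<Rightarrow> ('k, 'b) tensor \<Rightarrow> nat \<Rightarrow> nat \<Rightarrow> ('k, 'b) tensor"
  where "emb_twist_mult K B m J i j = mult_map K (tensor_pow K B m) (emb_twist K B m J i j)"


section \<open>The quotient of the skew monoid algebra\<close>

text \<open>The word \<open>[i\<^sub>1, \<dots>, i\<^sub>k]\<close> stands for \<open>s\<^sub>i\<^sub>1 \<cdots> s\<^sub>i\<^sub>k\<close>, where \<open>s\<^sub>i = (i, i+1)\<close>.\<close>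

definition word_perm :: "nat list \<Rightarrow> nat \<Rightarrow> nat" where
  "word_perm ws = foldr (\<lambda>i p. transpose i (Suc i) \<circ> p) ws id"

definition reduced_word :: "nat \<Rightarrow> (nat \<Rightarrow> nat) \<Rightarrow> nat list \<Rightarrow> bool" where
  "reduced_word m w ws \<longleftrightarrow> ws \<in> lists {1..<m} \<and> word_perm ws = w \<and>
    (\<forall>vs\<in>lists {1..<m}. word_perm vs = w \<longrightarrow> length ws \<le> length vs)"

definition word_act ::
  "('k, 'n) ring_scheme \<Rightarrow> ('k, 'b) bialg \<Rightarrow> nat \<Rightarrow> nat list \<Rightarrow> ('k, 'b) tensor \<Rightarrow> ('k, 'b) tensor" where
  "word_act K B m ws = foldr (\<lambda>i f. tens_perm K B m (transpose i (Suc i)) \<circ> f) ws id"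

text \<open>
  \<open>R # M\<close>; the comultiplication is the extension of that of \<open>R\<close> to an algebra map with
  \<open>s\<^sub>i \<mapsto> J\<^sub>i (s\<^sub>i \<otimes> s\<^sub>i)\<close>, written out on the \<open>R\<close>-basis of words.
\<close>

definition skew_bialg ::
  "('k, 'n) ring_scheme \<Rightarrow> ('k, 'b) bialg \<Rightarrow> ('k, 'b) tensor \<Rightarrow> nat \<Rightarrow>
    ('k, nat list \<Rightarrow> ('k, 'b) tensor) bialg" where
  "skew_bialg K B J m =
    (let R = tensor_bialg K B m;
         A = crossed_alg R (free_monoid {1..<m}) (word_act K B m) (\<lambda>_ _. \<one>\<^bsub>R\<^esub>);
         AA = tensor_pow K A 2;
         \<iota> = (\<lambda>a. basis_elt R [] a);
         s = (\<lambda>i. basis_elt R [i] \<one>\<^bsub>R\<^esub>) in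
     make_bialg A
      (\<lambda>f. \<Oplus>\<^bsub>AA\<^esub>ws\<in>supp R f. tens_map2 K A \<iota> \<iota> (comult R (f ws)) \<otimes>\<^bsub>AA\<^esub>
        list_prod AA (map (\<lambda>i. tens_map2 K A \<iota> \<iota> (emb_twist K B m J i (Suc i)) \<otimes>\<^bsub>AA\<^esub>
          tens_list K A [s i, s i]) ws))
      (\<lambda>f. \<Oplus>\<^bsub>K\<^esub>ws\<in>supp R f. counit R (f ws)))"

definition twisted_relations ::
  "('k, 'n) ring_scheme \<Rightarrow> ('k, 'b) bialg \<Rightarrow> ('k, 'b) tensor \<Rightarrow> nat \<Rightarrow>
    (nat list \<Rightarrow> ('k, 'b) tensor) set" where
  "twisted_relations K B J m =
    (let R = tensor_bialg K B m; A = skew_bialg K B J m;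
         s = (\<lambda>i. basis_elt R [i] \<one>\<^bsub>R\<^esub>) in
     {s i \<otimes>\<^bsub>A\<^esub> s i \<ominus>\<^bsub>A\<^esub> basis_elt R [] (emb_twist_mult K B m J i (Suc i)) | i.
        1 \<le> i \<and> i < m} \<union>
     {s i \<otimes>\<^bsub>A\<^esub> s (Suc i) \<otimes>\<^bsub>A\<^esub> s i \<ominus>\<^bsub>A\<^esub> s (Suc i) \<otimes>\<^bsub>A\<^esub> s i \<otimes>\<^bsub>A\<^esub> s (Suc i) | i.
        1 \<le> i \<and> Suc i < m} \<union>
     {s i \<otimes>\<^bsub>A\<^esub> s j \<ominus>\<^bsub>A\<^esub> s j \<otimes>\<^bsub>A\<^esub> s i | i j.
        1 \<le> i \<and> i < m \<and> 1 \<le> j \<and> j < m \<and> (Suc i < j \<or> Suc j < i)})"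

definition twisted_ideal ::
  "('k, 'n) ring_scheme \<Rightarrow> ('k, 'b) bialg \<Rightarrow> ('k, 'b) tensor \<Rightarrow> nat \<Rightarrow>
    (nat list \<Rightarrow> ('k, 'b) tensor) set" where
  "twisted_ideal K B J m = genideal (skew_bialg K B J m) (twisted_relations K B J m)"

definition twisted_hopf ::
  "('k, 'n) ring_scheme \<Rightarrow> ('k, 'b) bialg \<Rightarrow> ('k, 'b) tensor \<Rightarrow> nat \<Rightarrow>
    ('k, (nat list \<Rightarrow> ('k, 'b) tensor) set) bialg" where
  "twisted_hopf K B J m = quot_bialg K (skew_bialg K B J m) (twisted_ideal K B J m)"

definition twisted_proj ::
  "('k, 'n) ring_scheme \<Rightarrow> ('k, 'b) bialg \<Rightarrow> ('k, 'b) tensor \<Rightarrow> nat \<Rightarrow>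
    (nat list \<Rightarrow> ('k, 'b) tensor) \<Rightarrow> (nat list \<Rightarrow> ('k, 'b) tensor) set" where
  "twisted_proj K B J m f = twisted_ideal K B J m +>\<^bsub>skew_bialg K B J m\<^esub> f"

definition twisted_incl ::
  "('k, 'n) ring_scheme \<Rightarrow> ('k, 'b) bialg \<Rightarrow> ('k, 'b) tensor \<Rightarrow> nat \<Rightarrow>
    ('k, 'b) tensor \<Rightarrow> (nat list \<Rightarrow> ('k, 'b) tensor) set" where
  "twisted_incl K B J m a = twisted_proj K B J m (basis_elt (tensor_bialg K B m) [] a)"

definition twisted_word ::
  "('k, 'n) ring_scheme \<Rightarrow> ('k, 'b) bialg \<Rightarrow> ('k, 'b) tensor \<Rightarrow> nat \<Rightarrow>
    nat list \<Rightarrow> (nat list \<Rightarrow> ('k, 'b) tensor) set" where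
  "twisted_word K B J m ws =
    twisted_proj K B J m (basis_elt (tensor_bialg K B m) ws \<one>\<^bsub>tensor_bialg K B m\<^esub>)"

definition two_cocycle ::
  "('k, 'n) ring_scheme \<Rightarrow> ('k, 'b) bialg \<Rightarrow> nat \<Rightarrow>
    ((nat \<Rightarrow> nat) \<Rightarrow> (nat \<Rightarrow> nat) \<Rightarrow> ('k, 'b) tensor) \<Rightarrow> bool" where
  "two_cocycle K B m \<gamma> \<longleftrightarrow>
    (let R = tensor_bialg K B m; \<Sigma> = carrier (sym_group m) in
     (\<forall>w\<in>\<Sigma>. \<forall>v\<in>\<Sigma>. \<gamma> w v \<in> Units (R\<lparr>carrier := center R\<rparr>)) \<and>
     (\<forall>w\<in>\<Sigma>. \<forall>v\<in>\<Sigma>. \<forall>u\<in>\<Sigma>.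
       \<gamma> w v \<otimes>\<^bsub>R\<^esub> \<gamma> (w \<circ> v) u = tens_perm K B m w (\<gamma> v u) \<otimes>\<^bsub>R\<^esub> \<gamma> w (v \<circ> u)) \<and>
     (\<forall>w\<in>\<Sigma>. \<gamma> id w = \<one>\<^bsub>R\<^esub> \<and> \<gamma> w id = \<one>\<^bsub>R\<^esub>))"

end

theory Submission
  imports Defs
begin

text \<open>
  For commuting algebra maps \<open>f, g : B \<rightarrow> T\<close> let \<open>J(f, g)\<close> be the image of \<open>J\<close> under \<open>f \<otimes> g\<close> followed by
  multiplication.  Evaluating (ii) along four commuting maps and then inserting trivial ones shows that
  \<open>J(f, g)\<close> is symmetric and bimultiplicative for convolution; (iii) gives its inverse.  With
  \<open>t\<^sub>i\<^sub>j = J(e\<^sub>i, e\<^sub>j)\<close> all compatibilities can be tested on the generators \<open>e\<^sub>i(b)\<close> and \<open>s\<^sub>i\<close>, which makes \<open>H\<close>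
  a Hopf algebra.

  For freeness, \<open>\<gamma>(w, v)\<close> is defined as the product of \<open>t\<^sub>p\<close> over the pairs \<open>p\<close> inverted by \<open>w\<inverse>\<close> for
  which \<open>w\<inverse>p\<close> is inverted by \<open>v\<inverse>\<close>; the cocycle identity is then a comparison of exponents \<open>0, 1\<close>.  The universal
  property gives a map from \<open>H\<close> to the crossed product.  It is bijective because every word reduces, up to
  units of \<open>R\<close>, to a canonical word that depends only on its permutation.  Semisimplicity follows from
  Maschke's argument with the integral of \<open>H\<close>.
\<close>

text \<open>Nothing in the presentation excludes a collapse of H, so freeness needs a concrete
  model, and a model needs an associative product given in closed form. The formula for \<gamma>
  comes from drawing permutations as crossing strands: when lifts of w and v are multiplied, a pair
  of strands that crosses in w and again in v leaves one square of a generator, and the permutation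
  to its left carries the resulting factor to \<open>t_p\<close>. Along a reduced word no pair
  crosses twice, hence no factor appears there. Symmetry of J is what lets \<open>t_p\<close> depend
  on the unordered pair alone. On the tensor side J is a coset without a preferred expansion into
  elementary tensors. Every statement about J is therefore phrased as the value at J of a linear map
  on B \<otimes> B, and such maps are compared on x \<otimes> y, or on algebra generators when they
  are multiplicative. This is also why the hypotheses on J are first turned into identities between
  maps into an arbitrary algebra.\<close>

abbreviation (input) mult_in ("_ *[_]/ _" [70, 0, 71] 70) where "x *[A] y == x \<otimes>\<^bsub>A\<^esub> y"
abbreviation (input) add_in ("_ +[_]/ _" [65, 0, 66] 65) where "x +[A] y == x \<oplus>\<^bsub>A\<^esub> y"
abbreviation (input) smult_in ("_ .[_]/ _" [70, 0, 71] 70) where "c .[A] x == c \<odot>\<^bsub>A\<^esub> x"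
abbreviation (input) one_in ("\<one>[_]") where "\<one>[A] == \<one>\<^bsub>A\<^esub>"
abbreviation (input) zero_in ("\<zero>[_]") where "\<zero>[A] == \<zero>\<^bsub>A\<^esub>"
abbreviation (input) "cr A == carrier A"

section \<open>Algebras and their homomorphisms\<close>

lemma list_prod_Nil [simp]: "list_prod G [] = \<one>[G]"
 and list_prod_Cons [simp]: "list_prod G (x # xs) = x *[G] list_prod G xs"
 by (simp_all add: list_prod_def)

lemma list_prod_closed:
 "monoid G ==> set xs <= cr G ==> list_prod G xs : cr G"
 by (induction xs) (auto simp: monoid.m_closed)

lemma list_prod_append:
 "monoid G ==> set xs <= cr G ==> set ys <= cr G ==>
  list_prod G (xs @ ys) = list_prod G xs *[G] list_prod G ys"
 by (induction xs) (auto simp: monoid.m_assoc list_prod_closed)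

lemma list_prod_commute:
 assumes "monoid G" "z : cr G" "set xs <= cr G"
  "!!x. x : set xs ==> z *[G] x = x *[G] z"
 shows "z *[G] list_prod G xs = list_prod G xs *[G] z"
proof -
 interpret monoid G by fact
 show ?thesis using assms(3,4)
 proof (induction xs)
  case (Cons x xs)
  then have xs: "list_prod G xs : cr G" by (simp add: list_prod_closed[OF assms(1)])
  have "z *[G] (x *[G] list_prod G xs) = x *[G] (z *[G] list_prod G xs)"
   using Cons.prems assms(2) xs by (simp flip: m_assoc)
  then show ?case using Cons assms(2) xs by (simp add: m_assoc)
 qed (use assms in simp)
qed

text \<open>Factors with different indices commute, so the interleaved product can be sorted. This
  is what makes x \<mapsto> f_1(x_1) ... f_n(x_n) multiplicative in \<open>thom_hom\<close>.\<close>

lemma list_prod_mult: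
 assumes "monoid G" "distinct is" "!!i. i : set is ==> f i : cr G & g i : cr G"
  "!!i j. i : set is ==> j : set is ==> i ~= j ==> f i *[G] g j = g j *[G] f i"
 shows "list_prod G (map (%i. f i *[G] g i) is) =
  list_prod G (map f is) *[G] list_prod G (map g is)"
proof -
 interpret monoid G by fact
 show ?thesis using assms(2-4)
 proof (induction "is")
  case (Cons i "is")
  have c: "f i : cr G" "g i : cr G" "list_prod G (map f is) : cr G"
   "list_prod G (map g is) : cr G"
   using Cons.prems by (auto intro!: list_prod_closed[OF assms(1)])
  have "g i *[G] list_prod G (map f is) = list_prod G (map f is) *[G] g i"
   using Cons.prems by (intro list_prod_commute[OF assms(1)]) (auto intro!: sym[OF Cons.prems(3)])
  then have "f i *[G] g i *[G] (list_prod G (map f is) *[G] list_prod G (map g is)) =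
    f i *[G] list_prod G (map f is) *[G] (g i *[G] list_prod G (map g is))"
   using c by (simp add: m_assoc) (simp flip: m_assoc)
  moreover have "list_prod G (map (%i. f i *[G] g i) is) =
    list_prod G (map f is) *[G] list_prod G (map g is)"
   using Cons.prems by (intro Cons.IH) auto
  ultimately show ?case by simp
 qed simp
qed

lemma list_prod_one:
 "monoid G ==> (!!i. i : set is ==> f i = \<one>[G]) ==> list_prod G (map f is) = \<one>[G]"
 by (induction "is") (auto simp: monoid.l_one monoid.one_closed)

lemma list_prod_single:
 assumes "monoid G" "distinct is" "k : set is" "f k : cr G"
  "!!i. i : set is ==> i ~= k ==> f i = \<one>[G]"
 shows "list_prod G (map f is) = f k"
proof -
 interpret monoid G by fact
 show ?thesis using assms(2-5)
 proof (induction "is")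
  case (Cons i "is")
  show ?case
  proof (cases "i = k")
   case True
   then have "list_prod G (map f is) = \<one>[G]"
    using Cons.prems by (intro list_prod_one[OF assms(1)]) auto
   then show ?thesis using True Cons.prems by simp
  qed (use Cons in simp)
 qed simp
qed

text \<open>The negation is passed in as a function \<open>n\<close>, so that a ring whose record is
  assembled by hand can be verified by simplification, without an existence argument for
  inverses.\<close>

lemma ring_criteria:
 fixes A (structure)
 assumes "!!x y. x : cr A ==> y : cr A ==> x \<oplus> y : cr A" "\<zero> : cr A"
  "!!x y z. x : cr A ==> y : cr A ==> z : cr A ==> x \<oplus> y \<oplus> z = x \<oplus> (y \<oplus> z)"
  "!!x y. x : cr A ==> y : cr A ==> x \<oplus> y = y \<oplus> x"
  "!!x. x : cr A ==> \<zero> \<oplus> x = x"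
  "!!x. x : cr A ==> n x : cr A" "!!x. x : cr A ==> n x \<oplus> x = \<zero>"
  "!!x y. x : cr A ==> y : cr A ==> x \<otimes> y : cr A" "\<one> : cr A"
  "!!x y z. x : cr A ==> y : cr A ==> z : cr A ==> x \<otimes> y \<otimes> z = x \<otimes> (y \<otimes> z)"
  "!!x. x : cr A ==> \<one> \<otimes> x = x" "!!x. x : cr A ==> x \<otimes> \<one> = x"
  "!!x y z. x : cr A ==> y : cr A ==> z : cr A ==> (x \<oplus> y) \<otimes> z = x \<otimes> z \<oplus> y \<otimes> z"
  "!!x y z. x : cr A ==> y : cr A ==> z : cr A ==> z \<otimes> (x \<oplus> y) = z \<otimes> x \<oplus> z \<otimes> y"
 shows "ring A"
proof (rule ringI)
 show "abelian_group A"
 proof (rule abelian_groupI)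
  show "EX y:cr A. y \<oplus> x = \<zero>" if "x : cr A" for x
   using assms(6,7)[OF that] by blast
 qed (fact assms)+
 show "monoid A" by (rule monoidI) (fact assms)+
qed (fact assms)+

lemma module_homI:
 assumes "!!x. x : cr M ==> f x : cr N"
  "!!x y. x : cr M ==> y : cr M ==> f (x +[M] y) = f x +[N] f y"
  "!!c x. c : cr K ==> x : cr M ==> f (c .[M] x) = c .[N] f x"
 shows "f : module_hom K M N"
 using assms by (auto simp: module_hom_def)

lemma lin_closed: "f : module_hom K M N ==> x : cr M ==> f x : cr N"
 using module_hom_closed by blast

lemmas lin_add = module_hom_add and lin_smult = module_hom_smult

lemma lin_comp:
 "f : module_hom K M N ==> g : module_hom K N P ==> (%x. g (f x)) : module_hom K M P"
 by (rule module_homI) (simp_all add: lin_closed lin_add lin_smult)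

lemma lin_id: "(%x. x) : module_hom K M M"
 by (rule module_homI) auto

lemma lin_cong:
 assumes "f : module_hom K M N" "!!x. x : cr M ==> f x = g x" "ring M" "module K M"
 shows "g : module_hom K M N"
proof -
 interpret M: ring M by fact
 interpret N: module K M by fact
 show ?thesis
  using lin_closed[OF assms(1)] lin_add[OF assms(1)] lin_smult[OF assms(1)]
  by (intro module_homI) (simp_all flip: assms(2))
qed

lemma alg_homI:
 assumes "f : module_hom K A C"
  "!!x y. x : cr A ==> y : cr A ==> f (x *[A] y) = f x *[C] f y"
  "f \<one>[A] = \<one>[C]"
 shows "f : alg_hom K A C"
 using assms by (auto simp: alg_hom_def ring_hom_def lin_add intro: lin_closed)

lemma ah_lin: "f : alg_hom K A C ==> f : module_hom K A C"
 by (simp add: alg_hom_def)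

lemma ah_closed: "f : alg_hom K A C ==> a : cr A ==> f a : cr C"
 and ah_add: "f : alg_hom K A C ==> a : cr A ==> b : cr A ==>
  f (a +[A] b) = f a +[C] f b"
 and ah_smult: "f : alg_hom K A C ==> c : cr K ==> a : cr A ==>
  f (c .[A] a) = c .[C] f a"
 and ah_mult: "f : alg_hom K A C ==> a : cr A ==> b : cr A ==>
  f (a *[A] b) = f a *[C] f b"
 and ah_one: "f : alg_hom K A C ==> f \<one>[A] = \<one>[C]"
 by (auto simp: alg_hom_def ring_hom_def lin_smult)

lemma ah_comp:
 "f : alg_hom K A C ==> g : alg_hom K C D ==> (%x. g (f x)) : alg_hom K A D"
 by (rule alg_homI[OF lin_comp[OF ah_lin ah_lin]])
  (auto simp: ah_closed ah_mult ah_one)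

lemma ah_id: "(%x. x) : alg_hom K A A"
 by (rule alg_homI[OF lin_id]) auto

text \<open>Antihomomorphisms such as antipodes become algebra maps into the opposite algebra.
  Universal properties and arguments on generators then apply to them unchanged.\<close>

definition opp :: "('k, 'a, 'z) module_scheme => ('k, 'a) module" where
 "opp A = \<lparr>carrier = cr A, monoid.mult = (%x y. y *[A] x), one = one A, zero = zero A,
   add = add A, smult = smult A\<rparr>"

lemma opp_simps [simp]:
 "cr (opp A) = cr A" "x *[opp A] y = y *[A] x" "\<one>[opp A] = \<one>[A]" "\<zero>[opp A] = \<zero>[A]"
 "x +[opp A] y = x +[A] y" "c .[opp A] x = c .[A] x"
 by (simp_all add: opp_def)

text \<open>Generation as a K-algebra is encoded as minimality among the closed subsets, which is an
  induction principle in itself; no generated subalgebra has to be constructed.\<close>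

definition gens :: "('k, 'n) ring_scheme => ('k, 'a, 'z) module_scheme => 'a set => bool" where
 "gens K A X \<longleftrightarrow> X <= cr A &
  (ALL Y. X <= Y & Y <= cr A & \<one>[A] : Y &
   (ALL a:Y. ALL b:Y. a +[A] b : Y & a *[A] b : Y) & (ALL c:cr K. ALL a:Y. c .[A] a : Y)
   --> cr A <= Y)"

lemma gens_induct [consumes 2, case_names gen one add mult smult]:
 assumes "gens K A X" "a : cr A"
  "!!x. x : X ==> x : cr A ==> P x" "\<one>[A] : cr A ==> P \<one>[A]"
  "!!a b. a : cr A ==> b : cr A ==> P a ==> P b ==> P (a +[A] b)"
  "!!a b. a : cr A ==> b : cr A ==> P a ==> P b ==> P (a *[A] b)"
  "!!c a. c : cr K ==> a : cr A ==> P a ==> P (c .[A] a)"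
  "kalg K A"
 shows "P a"
proof -
 interpret ring A using assms(8) by (simp add: kalg_def)
 interpret V: module K A using assms(8) by (simp add: kalg_def vectorspace_def)
 have "cr A <= {a : cr A. P a}"
  using assms(1) unfolding gens_def
  by (elim conjE allE[where x = "{a : cr A. P a}"]) (rule mp, assumption, auto simp: assms(3-7))
 then show ?thesis using assms(2) by auto
qed

lemma gensI:
 assumes "X <= cr A"
  "!!Y a. X <= Y ==> Y <= cr A ==> \<one>[A] : Y ==> (!!a b. a : Y ==> b : Y ==> a +[A] b : Y) ==>
   (!!a b. a : Y ==> b : Y ==> a *[A] b : Y) ==> (!!c a. c : cr K ==> a : Y ==> c .[A] a : Y) ==>
   a : cr A ==> a : Y"
 shows "gens K A X"
 unfolding gens_def
proof (rule conjI[OF assms(1)], intro allI impI subsetI)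
 fix Y a assume "X <= Y & Y <= cr A & \<one>[A] : Y &
  (ALL a:Y. ALL b:Y. a +[A] b : Y & a *[A] b : Y) & (ALL c:cr K. ALL a:Y. c .[A] a : Y)"
  and "a : cr A"
 then show "a : Y" by - (rule assms(2), blast+)
qed

lemma centerI: "z : cr A ==> (!!x. x : cr A ==> z *[A] x = x *[A] z) ==> z : center A"
 and center_closed: "z : center A ==> z : cr A"
 and center_comm: "z : center A ==> x : cr A ==> z *[A] x = x *[A] z"
 by (auto simp: center_def)

locale base_field =
 fixes K :: "'k ring"
 assumes field_K: "field K"
begin

sublocale K: field K by (rule field_K)

lemma kalg_ring: "kalg K A ==> ring A"
 and kalg_vectorspace: "kalg K A ==> vectorspace K A"
 by (simp_all add: kalg_def)

lemma kalg_module: "kalg K A ==> module K A"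
 using kalg_vectorspace vectorspace_def by blast

lemma kalg_monoid: "kalg K A ==> monoid A"
 using kalg_ring ring.is_monoid by blast

lemma kalg_abelian_group: "kalg K A ==> abelian_group A"
 using kalg_ring ring.is_abelian_group by blast

lemma kalgI:
 assumes "ring A"
  "!!c x. c : cr K ==> x : cr A ==> c .[A] x : cr A"
  "!!c d x. c : cr K ==> d : cr K ==> x : cr A ==> (c +[K] d) .[A] x = c .[A] x +[A] d .[A] x"
  "!!c x y. c : cr K ==> x : cr A ==> y : cr A ==> c .[A] (x +[A] y) = c .[A] x +[A] c .[A] y"
  "!!c d x. c : cr K ==> d : cr K ==> x : cr A ==> (c *[K] d) .[A] x = c .[A] (d .[A] x)"
  "!!x. x : cr A ==> \<one>[K] .[A] x = x"
  "!!c x y. c : cr K ==> x : cr A ==> y : cr A ==> (c .[A] x) *[A] y = c .[A] (x *[A] y)"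
  "!!c x y. c : cr K ==> x : cr A ==> y : cr A ==> x *[A] (c .[A] y) = c .[A] (x *[A] y)"
 shows "kalg K A"
proof -
 interpret ring A by fact
 have "module K A"
  by (rule moduleI) (auto simp: K.is_cring is_abelian_group assms)
 then show ?thesis
  by (auto simp: kalg_def vectorspace_def field_K ring_axioms assms)
qed

context
 fixes A :: "('k, 'a, 'z) module_scheme"
 assumes A: "kalg K A"
begin

interpretation A: ring A by (rule kalg_ring[OF A])
interpretation V: module K A by (rule kalg_module[OF A])

lemma ka_closed [simp]:
 "x : cr A ==> y : cr A ==> x *[A] y : cr A"
 "x : cr A ==> y : cr A ==> x +[A] y : cr A"
 "x : cr A ==> y : cr A ==> x \<ominus>\<^bsub>A\<^esub> y : cr A"
 "c : cr K ==> x : cr A ==> c .[A] x : cr A"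
 "x : cr A ==> \<ominus>\<^bsub>A\<^esub> x : cr A"
 "\<one>[A] : cr A" "\<zero>[A] : cr A"
 by simp_all

lemma ka_basic [simp]:
 "x : cr A ==> x *[A] \<one>[A] = x" "x : cr A ==> \<one>[A] *[A] x = x"
 "x : cr A ==> x +[A] \<zero>[A] = x" "x : cr A ==> \<zero>[A] +[A] x = x"
 "x : cr A ==> x *[A] \<zero>[A] = \<zero>[A]" "x : cr A ==> \<zero>[A] *[A] x = \<zero>[A]"
 "x : cr A ==> \<one>[K] .[A] x = x" "x : cr A ==> \<zero>[K] .[A] x = \<zero>[A]"
 "c : cr K ==> c .[A] \<zero>[A] = \<zero>[A]"
 by (simp_all add: V.smult_r_null)

lemma ka_smult:
 "c : cr K ==> x : cr A ==> y : cr A ==> (c .[A] x) *[A] y = c .[A] (x *[A] y)"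
 "c : cr K ==> x : cr A ==> y : cr A ==> x *[A] (c .[A] y) = c .[A] (x *[A] y)"
 "c : cr K ==> x : cr A ==> y : cr A ==> c .[A] (x +[A] y) = c .[A] x +[A] c .[A] y"
 "c : cr K ==> d : cr K ==> x : cr A ==> (c +[K] d) .[A] x = c .[A] x +[A] d .[A] x"
 "c : cr K ==> d : cr K ==> x : cr A ==> c .[A] (d .[A] x) = (c *[K] d) .[A] x"
 using A by (simp_all add: kalg_def V.smult_r_distr V.smult_l_distr V.smult_assoc1)

lemma ka_simps:
 "x : cr A ==> y : cr A ==> z : cr A ==> x *[A] y *[A] z = x *[A] (y *[A] z)"
 "x : cr A ==> y : cr A ==> z : cr A ==> (x +[A] y) *[A] z = x *[A] z +[A] y *[A] z"
 "x : cr A ==> y : cr A ==> z : cr A ==> z *[A] (x +[A] y) = z *[A] x +[A] z *[A] y"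
 "x : cr A ==> y : cr A ==> z : cr A ==> x +[A] y +[A] z = x +[A] (y +[A] z)"
 "x : cr A ==> y : cr A ==> x +[A] y = y +[A] x"
 "x : cr A ==> y : cr A ==> z : cr A ==> x +[A] (y +[A] z) = y +[A] (x +[A] z)"
 by (simp_all add: A.m_assoc A.l_distr A.r_distr A.a_ac)

lemma ka_assoc: "x : cr A ==> y : cr A ==> z : cr A ==> x *[A] y *[A] z = x *[A] (y *[A] z)"
 by (rule ka_simps)

lemma ka_minus: "x : cr A ==> \<ominus>\<^bsub>A\<^esub> x = (\<ominus>\<^bsub>K\<^esub> \<one>[K]) .[A] x"
 by (simp add: V.smult_l_minus)

lemma ka_minus_eq_zero: "x : cr A ==> y : cr A ==> x \<ominus>\<^bsub>A\<^esub> y = \<zero>[A] \<longleftrightarrow> x = y"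
 by (simp add: a_minus_def A.add.inv_solve_right')

lemma opp_kalg: "kalg K (opp A)"
proof (rule kalgI)
 show "ring (opp A)"
  by (rule ring_criteria[where n = "%x. \<ominus>\<^bsub>A\<^esub> x"]) (simp_all add: A.ring_simprules)
qed (simp_all add: ka_smult)

lemma smult_one_comm:
 "c : cr K ==> x : cr A ==> (c .[A] \<one>[A]) *[A] x = x *[A] (c .[A] \<one>[A])"
 by (simp add: ka_smult)

end

lemma self_alg_simps [simp]:
 "cr (self_alg K) = cr K" "x *[self_alg K] y = x *[K] y" "\<one>[self_alg K] = \<one>[K]"
 "\<zero>[self_alg K] = \<zero>[K]" "x +[self_alg K] y = x +[K] y" "c .[self_alg K] x = c *[K] x"
 by (simp_all add: self_alg_def)

lemma self_kalg [simp]: "kalg K (self_alg K)"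
proof (rule kalgI)
 show "ring (self_alg K)"
  by (rule ring_criteria[where n = "%x. \<ominus>\<^bsub>K\<^esub> x"]) (simp_all add: K.ring_simprules)
qed (simp_all add: K.ring_simprules K.m_lcomm)

lemma lin_zero:
 assumes "f : module_hom K A C" "kalg K A" "kalg K C" shows "f \<zero>[A] = \<zero>[C]"
proof -
 have "f (\<zero>[K] .[A] \<zero>[A]) = \<zero>[K] .[C] f \<zero>[A]"
  using assms by (intro lin_smult[OF assms(1)]) auto
 then show ?thesis using assms lin_closed[OF assms(1)] by simp
qed

lemma lin_minus:
 assumes "f : module_hom K A C" "kalg K A" "kalg K C" "x : cr A" "y : cr A"
 shows "f (x \<ominus>\<^bsub>A\<^esub> y) = f x \<ominus>\<^bsub>C\<^esub> f y"
 using assms by (simp add: a_minus_def ka_minus lin_add lin_smult lin_closed)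

lemma lin_finsum:
 assumes "f : module_hom K A C" "kalg K A" "kalg K C" "finite I" "g : I \<rightarrow> cr A"
 shows "f (\<Oplus>\<^bsub>A\<^esub>i\<in>I. g i) = (\<Oplus>\<^bsub>C\<^esub>i\<in>I. f (g i))"
proof -
 interpret A: ring A by (rule kalg_ring[OF assms(2)])
 interpret C: ring C by (rule kalg_ring[OF assms(3)])
 show ?thesis using assms(4,5)
 proof (induction I)
  case (insert i I)
  then show ?case
   using lin_closed[OF assms(1)] by (simp add: Pi_iff lin_add[OF assms(1)])
 qed (simp add: lin_zero[OF assms(1-3)])
qed

lemma lin_add_maps:
 assumes "kalg K A" "kalg K C" "f : module_hom K A C" "g : module_hom K A C"
 shows "(%x. f x +[C] g x) : module_hom K A C"
 by (rule module_homI)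
  (use assms in \<open>simp_all add: lin_closed[OF assms(3)] lin_closed[OF assms(4)] lin_add lin_smult ka_smult ka_simps(4-)\<close>)

lemma lin_mult_left:
 assumes "kalg K A" "a : cr A" shows "(%x. a *[A] x) : module_hom K A A"
 by (rule module_homI) (use assms in \<open>simp_all add: ka_simps(3) ka_smult\<close>)

lemma lin_mult_right:
 assumes "kalg K A" "a : cr A" shows "(%x. x *[A] a) : module_hom K A A"
 by (rule module_homI) (use assms in \<open>simp_all add: ka_simps(2) ka_smult\<close>)

lemma alg_hom_list_prod:
 assumes "f : alg_hom K A C" "kalg K A" "set xs <= cr A"
 shows "f (list_prod A xs) = list_prod C (map f xs)"
 using assms(3)
 by (induction xs)
  (auto simp: ah_one[OF assms(1)] ah_mult[OF assms(1)] list_prod_closed kalg_monoid[OF assms(2)])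

lemma alg_hom_eq_gens:
 assumes "f : alg_hom K A C" "g : alg_hom K A C" "kalg K A" "gens K A X"
  "!!x. x : X ==> f x = g x" "a : cr A"
 shows "f a = g a"
 using assms(4,6)
 by (induction rule: gens_induct)
  (use assms in \<open>simp_all add: ah_one[OF assms(1)] ah_one[OF assms(2)] ah_add[OF assms(1)]
   ah_add[OF assms(2)] ah_mult[OF assms(1)] ah_mult[OF assms(2)]
   ah_smult[OF assms(1)] ah_smult[OF assms(2)]\<close>)

text \<open>The elements a for which f(a) commutes with z form a subalgebra. Centrality in tensor
  powers is reduced to generators in this way.\<close>

lemma commute_gens:
 assumes "kalg K A" "kalg K T" "f : alg_hom K A T" "gens K A X" "z : cr T"
  "!!x. x : X ==> z *[T] f x = f x *[T] z" "a : cr A"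
 shows "z *[T] f a = f a *[T] z"
 using assms(4,7)
proof (induction rule: gens_induct)
 case (mult a b)
 have "z *[T] (f a *[T] f b) = f a *[T] (z *[T] f b)"
  using assms mult by (simp add: ah_closed[OF assms(3)] flip: ka_assoc[OF assms(2)])
   (simp add: ah_closed[OF assms(3)] ka_assoc[OF assms(2)])
 then show ?case using assms mult by (simp add: ah_closed ka_assoc ah_mult[OF assms(3)])
qed (use assms in \<open>simp_all add: ah_one[OF assms(3)] ah_add[OF assms(3)]
   ah_smult[OF assms(3)] ah_closed ka_simps(2,3) ka_smult(1,2)\<close>)

text \<open>For a counit e this is the unit of the convolution product on maps from A to C.
  Inserting it into an identity between several maps is how single arguments get removed.\<close>

definition triv :: "('a => 'k) => ('k, 'c, 'z) module_scheme => 'a => 'c" where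
 "triv e C a = e a .[C] \<one>[C]"

lemma triv_hom:
 assumes "e : alg_hom K A (self_alg K)" "kalg K C" shows "triv e C : alg_hom K A C"
proof (rule alg_homI[OF module_homI])
 have [simp]: "e x : cr K" if "x : cr A" for x
  using ah_closed[OF assms(1) that] by simp
 note e = ah_one[OF assms(1)] ah_add[OF assms(1)] ah_mult[OF assms(1)] ah_smult[OF assms(1)]
 show "triv e C x : cr C" if "x : cr A" for x using that assms by (simp add: triv_def)
 show "triv e C (x +[A] y) = triv e C x +[C] triv e C y" if "x : cr A" "y : cr A" for x y
  using that assms by (simp add: triv_def e ka_smult)
 show "triv e C (c .[A] x) = c .[C] triv e C x" if "c : cr K" "x : cr A" for c x
  using that assms by (simp add: triv_def e ka_smult)
 show "triv e C (x *[A] y) = triv e C x *[C] triv e C y" if "x : cr A" "y : cr A" for x y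
  using that assms by (simp add: triv_def e ka_smult K.m_comm)
 show "triv e C \<one>[A] = \<one>[C]" using assms by (simp add: triv_def e)
qed

end

section \<open>Crossed products\<close>

text \<open>One locale covers the skew monoid algebra of words, the model of H over the symmetric
  group, group algebras, and the free algebra on tuples behind the tensor powers. The values of
  \<gamma> are central so that they can pass the coefficients.\<close>

locale crossed = base_field K for K :: "'k ring" +
 fixes R :: "('k, 'r, 'z) module_scheme" and G :: "('g, 'y) monoid_scheme"
  and act :: "'g => 'r => 'r" and \<gamma> :: "'g => 'g => 'r"
 assumes R [simp]: "kalg K R" and G: "monoid G"
  and act: "x : cr G ==> act x : alg_hom K R R"
  and act_one: "a : cr R ==> act \<one>[G] a = a"
  and act_mult: "x : cr G ==> y : cr G ==> a : cr R ==>
   act (x *[G] y) a = act x (act y a)"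
  and \<gamma>_center: "x : cr G ==> y : cr G ==> \<gamma> x y : center R"
  and cocycle: "x : cr G ==> y : cr G ==> z : cr G ==>
   \<gamma> x y *[R] \<gamma> (x *[G] y) z = act x (\<gamma> y z) *[R] \<gamma> x (y *[G] z)"
  and \<gamma>_one: "x : cr G ==> \<gamma> \<one>[G] x = \<one>[R]" "x : cr G ==> \<gamma> x \<one>[G] = \<one>[R]"
begin

abbreviation "C == crossed_alg R G act \<gamma>"
abbreviation "bas == basis_elt R"

interpretation R: ring R by (rule kalg_ring[OF R])
interpretation G: monoid G by (rule G)

lemma act_closed [simp]: "x : cr G ==> a : cr R ==> act x a : cr R"
 by (rule ah_closed[OF act])

lemma act_zero [simp]: "x : cr G ==> act x \<zero>[R] = \<zero>[R]"
 by (rule lin_zero[OF ah_lin[OF act]]) auto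

lemma \<gamma>_closed [simp]: "x : cr G ==> y : cr G ==> \<gamma> x y : cr R"
 by (rule center_closed[OF \<gamma>_center])

lemma crossed_simps:
 "f : cr C \<longleftrightarrow> (ALL x. f x : cr R) & finite (supp R f) & supp R f <= cr G"
 "(f +[C] g) = (%x. f x +[R] g x)" "(c .[C] f) = (%x. c .[R] f x)"
 "\<zero>[C] = (%_. \<zero>[R])" "\<one>[C] = bas \<one>[G] \<one>[R]"
 by (simp_all add: crossed_alg_def)

lemma bas_closed [simp]: "x : cr G ==> a : cr R ==> bas x a : cr C"
 by (auto simp: crossed_simps basis_elt_def supp_def intro: finite_subset[of _ "{x}"])

lemma supp_bas: "supp R (bas x a) <= {x}"
 by (auto simp: supp_def basis_elt_def)

lemma bas_add: "a : cr R ==> b : cr R ==> bas x (a +[R] b) = bas x a +[C] bas x b"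
 and bas_smult: "c : cr K ==> bas x (c .[R] a) = c .[C] bas x a"
 and bas_zero [simp]: "bas x \<zero>[R] = \<zero>[C]"
 by (auto simp: crossed_simps basis_elt_def)

lemma bas_lin: "x : cr G ==> bas x : module_hom K R C"
 by (rule module_homI) (auto simp: bas_add bas_smult)

lemma C_add_closed [simp]: "f : cr C ==> g : cr C ==> f +[C] g : cr C"
proof -
 assume fg: "f : cr C" "g : cr C"
 then have "supp R (f +[C] g) <= supp R f \<union> supp R g" by (auto simp: crossed_simps supp_def)
 with fg show ?thesis by (auto simp: crossed_simps(1) intro: finite_subset) (simp add: crossed_simps(2))
qed

lemma C_smult_closed [simp]: "c : cr K ==> f : cr C ==> c .[C] f : cr C"
proof -
 assume fg: "c : cr K" "f : cr C"
 then have "supp R (c .[C] f) <= supp R f" by (auto simp: crossed_simps supp_def)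
 with fg show ?thesis by (auto simp: crossed_simps(1) intro: finite_subset) (simp add: crossed_simps(3))
qed

lemma C_zero_closed [simp]: "\<zero>[C] : cr C"
 by (simp add: crossed_simps supp_def)

text \<open>Induction over a finite set containing the support: a point at which f vanishes costs
  nothing, at any other point one basis term is split off.\<close>

lemma crossed_induct [consumes 1, case_names zero bas add]:
 assumes "f : cr C" "P \<zero>[C]"
  "!!x a. x : cr G ==> a : cr R ==> P (bas x a)"
  "!!f g. f : cr C ==> g : cr C ==> P f ==> P g ==> P (f +[C] g)"
 shows "P f"
proof -
 have "f : cr C ==> supp R f <= S ==> P f" if "finite S" for S f
  using that
 proof (induction S arbitrary: f)
  case empty
  then have "f = \<zero>[C]" by (auto simp: supp_def crossed_simps)
  then show ?case using assms(2) by simp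
 next
  case (insert x S)
  show ?case
  proof (cases "f x = \<zero>[R]")
   case True
   then have "supp R f <= S" using insert.prems(2) by (auto simp: supp_def)
   then show ?thesis using insert by blast
  next
   case False
   let ?g = "f(x := \<zero>[R])"
   have fC: "!!y. f y : cr R" "finite (supp R f)" "supp R f <= cr G"
    using insert.prems(1) by (auto simp: crossed_simps)
   have s: "supp R ?g <= supp R f" "supp R ?g <= S" using insert.prems by (auto simp: supp_def)
   have g: "?g : cr C"
    using fC finite_subset[OF s(1)] s(1) by (simp add: crossed_simps subset_trans)
   have x: "x : cr G" using False fC(3) by (auto simp: supp_def)
   have "f = ?g +[C] bas x (f x)"
    using fC by (auto simp: crossed_simps basis_elt_def fun_eq_iff)
   moreover have "P (?g +[C] bas x (f x))"
    by (intro assms(4) assms(3) insert.IH[OF g s(2)] g x fC(1) bas_closed)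
   ultimately show ?thesis by simp
  qed
 qed
 from this[of "supp R f" f] assms(1) show ?thesis by (auto simp: crossed_simps)
qed

text \<open>A summand of the product, extended by zero to all pairs. Products of functions with
  different supports can then be summed over one common finite rectangle, as in the distributive
  laws.\<close>

definition pterm :: "('g => 'r) => ('g => 'r) => 'g => 'g \<times> 'g => 'r" where
 "pterm f g z p = (if fst p *[G] snd p = z
  then f (fst p) *[R] act (fst p) (g (snd p)) *[R] \<gamma> (fst p) (snd p) else \<zero>[R])"

lemma pterm_closed:
 "(!!x. f x : cr R) ==> (!!x. g x : cr R) ==> p : cr G \<times> cr G ==> pterm f g z p : cr R"
 by (auto simp: pterm_def)

lemma crossed_mult:
 assumes "f : cr C" "g : cr C" "finite S" "finite S'"
  "supp R f <= S" "supp R g <= S'" "S <= cr G" "S' <= cr G"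
 shows "(f *[C] g) z = (\<Oplus>\<^bsub>R\<^esub>p\<in>S \<times> S'. pterm f g z p)"
proof -
 have fg: "!!x. f x : cr R" "!!x. g x : cr R" using assms(1,2) by (auto simp: crossed_simps)
 have "(f *[C] g) z = (\<Oplus>\<^bsub>R\<^esub>p\<in>{(x, y). x : supp R f & y : supp R g & x *[G] y = z}.
   f (fst p) *[R] act (fst p) (g (snd p)) *[R] \<gamma> (fst p) (snd p))"
  by (simp add: crossed_alg_def)
 also have "... = (\<Oplus>\<^bsub>R\<^esub>p\<in>S \<times> S'. pterm f g z p)"
 proof (rule R.add.finprod_mono_neutral_cong_left)
  show "pterm f g z p = \<zero>[R]"
   if "p : S \<times> S' - {(x, y). x : supp R f & y : supp R g & x *[G] y = z}" for p
   using that assms(7,8) fg by (auto simp: pterm_def supp_def) (metis \<gamma>_closed act_closed act_zero R.l_null R.r_null subsetD)+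
  show "pterm f g z : S \<times> S' \<rightarrow> cr R" using assms(7,8) fg by (auto intro!: pterm_closed)
 qed (use assms in \<open>auto simp: pterm_def\<close>)
 finally show ?thesis .
qed

lemma C_mult_closed [simp]:
 assumes "f : cr C" "g : cr C" shows "f *[C] g : cr C"
proof -
 let ?S = "(%p. fst p *[G] snd p) ` (supp R f \<times> supp R g)"
 have f: "!!x. f x : cr R" "finite (supp R f)" "supp R f <= cr G"
  and g: "!!x. g x : cr R" "finite (supp R g)" "supp R g <= cr G"
  using assms by (auto simp: crossed_simps)
 note m = crossed_mult[OF assms f(2) g(2) order_refl order_refl f(3) g(3)]
 have "(f *[C] g) z = \<zero>[R]" if "z \<notin> ?S" for z
  unfolding m using that by (intro R.add.finprod_one_eqI) (auto simp: pterm_def)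
 then have "supp R (f *[C] g) <= ?S" by (auto simp: supp_def)
 moreover have "?S <= cr G" using f(3) g(3) by (auto intro!: G.m_closed)
 moreover have "(f *[C] g) z : cr R" for z
  unfolding m using f g by (intro R.finsum_closed) (auto intro!: pterm_closed)
 ultimately show ?thesis
  using f(2) g(2) by (auto simp: crossed_simps(1) dest: finite_subset)
qed

lemma bas_mult:
 assumes "x : cr G" "y : cr G" "a : cr R" "b : cr R"
 shows "bas x a *[C] bas y b = bas (x *[G] y) (a *[R] act x b *[R] \<gamma> x y)"
proof
 fix z
 have "(bas x a *[C] bas y b) z = (\<Oplus>\<^bsub>R\<^esub>p\<in>{x} \<times> {y}. pterm (bas x a) (bas y b) z p)"
  using assms by (intro crossed_mult bas_closed supp_bas) auto
 also have "{x} \<times> {y} = {(x, y)}" by auto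
 also have "(\<Oplus>\<^bsub>R\<^esub>p\<in>{(x, y)}. pterm (bas x a) (bas y b) z p) = pterm (bas x a) (bas y b) z (x, y)"
  using assms by (simp add: pterm_def basis_elt_def)
 finally show "(bas x a *[C] bas y b) z = bas (x *[G] y) (a *[R] act x b *[R] \<gamma> x y) z"
  using assms by (simp add: pterm_def basis_elt_def)
qed

lemma C_distr:
 assumes "f : cr C" "g : cr C" "h : cr C"
 shows "(f +[C] g) *[C] h = f *[C] h +[C] g *[C] h"
  "h *[C] (f +[C] g) = h *[C] f +[C] h *[C] g"
proof -
 let ?S = "supp R f \<union> supp R g" and ?T = "supp R h"
 have v: "!!x. f x : cr R" "!!x. g x : cr R" "!!x. h x : cr R"
  and fin: "finite ?S" "finite ?T" "?S <= cr G" "?T <= cr G"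
  using assms by (auto simp: crossed_simps)
 have s: "supp R (f +[C] g) <= ?S" by (auto simp: supp_def crossed_simps)
 have S: "x : cr G" if "x : ?S" for x using fin that by auto
 have T: "x : cr G" if "x : ?T" for x using fin that by auto
 show "(f +[C] g) *[C] h = f *[C] h +[C] g *[C] h"
 proof
  fix z
  have "((f +[C] g) *[C] h) z = (\<Oplus>\<^bsub>R\<^esub>p\<in>?S \<times> ?T. pterm (f +[C] g) h z p)"
   using assms fin s by (intro crossed_mult) auto
  also have "... = (\<Oplus>\<^bsub>R\<^esub>p\<in>?S \<times> ?T. pterm f h z p +[R] pterm g h z p)"
   using v S T by (intro R.finsum_cong')
    (auto simp: pterm_def crossed_simps(2) ka_simps(2)[OF R] intro!: pterm_closed R.add.m_closed)
  also have "... = (\<Oplus>\<^bsub>R\<^esub>p\<in>?S \<times> ?T. pterm f h z p) +[R] (\<Oplus>\<^bsub>R\<^esub>p\<in>?S \<times> ?T. pterm g h z p)"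
   using v S T by (intro R.finsum_addf) (auto intro!: pterm_closed)
  also have "... = (f *[C] h +[C] g *[C] h) z"
   using assms fin by (subst (1 2) crossed_mult[symmetric]) (auto simp: crossed_simps(2))
  finally show "((f +[C] g) *[C] h) z = (f *[C] h +[C] g *[C] h) z" .
 qed
 show "h *[C] (f +[C] g) = h *[C] f +[C] h *[C] g"
 proof
  fix z
  have "(h *[C] (f +[C] g)) z = (\<Oplus>\<^bsub>R\<^esub>p\<in>?T \<times> ?S. pterm h (f +[C] g) z p)"
   using assms fin s by (intro crossed_mult) auto
  also have "... = (\<Oplus>\<^bsub>R\<^esub>p\<in>?T \<times> ?S. pterm h f z p +[R] pterm h g z p)"
   using v S T by (intro R.finsum_cong')
    (auto simp: pterm_def crossed_simps(2) ka_simps(2,3)[OF R] ah_add[OF act] intro!: pterm_closed R.add.m_closed)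
  also have "... = (\<Oplus>\<^bsub>R\<^esub>p\<in>?T \<times> ?S. pterm h f z p) +[R] (\<Oplus>\<^bsub>R\<^esub>p\<in>?T \<times> ?S. pterm h g z p)"
   using v S T by (intro R.finsum_addf) (auto intro!: pterm_closed)
  also have "... = (h *[C] f +[C] h *[C] g) z"
   using assms fin by (subst (1 2) crossed_mult[symmetric]) (auto simp: crossed_simps(2))
  finally show "(h *[C] (f +[C] g)) z = (h *[C] f +[C] h *[C] g) z" .
 qed
qed

lemma C_mult_zero:
 assumes "f : cr C" shows "f *[C] \<zero>[C] = \<zero>[C]" "\<zero>[C] *[C] f = \<zero>[C]"
proof -
 have f: "finite (supp R f)" "supp R f <= cr G" using assms by (auto simp: crossed_simps)
 have s: "supp R \<zero>[C] <= {}" by (simp add: supp_def crossed_simps)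
 show "f *[C] \<zero>[C] = \<zero>[C]" "\<zero>[C] *[C] f = \<zero>[C]"
  using crossed_mult[OF assms C_zero_closed f(1) finite.emptyI order_refl s f(2)]
   crossed_mult[OF C_zero_closed assms finite.emptyI f(1) s order_refl _ f(2)]
  by (auto simp: fun_eq_iff crossed_simps(4))
qed

lemma bas_assoc:
 assumes "x : cr G" "y : cr G" "z : cr G" "a : cr R" "b : cr R" "c : cr R"
 shows "bas x a *[C] bas y b *[C] bas z c = bas x a *[C] (bas y b *[C] bas z c)"
proof -
 \<comment> \<open>The cocycle identity multiplied by \<open>act x (act y c)\<close>; centrality of
   \<open>\<gamma> x y\<close> moves it past this coefficient.\<close>
 have 1: "\<gamma> x y *[R] (act x (act y c) *[R] \<gamma> (x *[G] y) z) =
   act x (act y c) *[R] (act x (\<gamma> y z) *[R] \<gamma> x (y *[G] z))"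
  using assms cocycle[of x y z] center_comm[OF \<gamma>_center, of x y "act x (act y c)"]
  by (simp flip: R.m_assoc) (simp add: R.m_assoc)
 show ?thesis
  using assms by (simp add: bas_mult act_mult ah_mult[OF act] G.m_assoc R.m_assoc 1)
qed

lemma C_assoc:
 assumes "f : cr C" "g : cr C" "h : cr C"
 shows "f *[C] g *[C] h = f *[C] (g *[C] h)"
 using assms(1)
proof (induction f rule: crossed_induct)
 case (bas x a)
 show ?case using assms(2)
 proof (induction g rule: crossed_induct)
  case (bas y b)
  show ?case using assms(3)
  proof (induction h rule: crossed_induct)
   case (bas z c)
   then show ?case using \<open>x : _\<close> \<open>y : _\<close> \<open>a : _\<close> \<open>b : _\<close> by (intro bas_assoc)
  qed (use \<open>x : _\<close> \<open>y : _\<close> \<open>a : _\<close> \<open>b : _\<close> in \<open>simp_all add: C_distr C_mult_zero\<close>)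
 qed (use \<open>x : _\<close> \<open>a : _\<close> assms(3) in \<open>simp_all add: C_distr C_mult_zero\<close>)
qed (use assms(2,3) in \<open>simp_all add: C_distr C_mult_zero\<close>)

lemma C_one_closed [simp]: "\<one>[C] : cr C"
 by (simp only: crossed_simps(5) bas_closed G.one_closed ka_closed[OF R])

lemma C_one_mult:
 assumes "f : cr C" shows "\<one>[C] *[C] f = f" "f *[C] \<one>[C] = f"
proof -
 show "\<one>[C] *[C] f = f" using assms
  by (induction f rule: crossed_induct) 
   (simp_all add: C_distr C_mult_zero, simp add: crossed_simps(5) bas_mult \<gamma>_one act_one)
 show "f *[C] \<one>[C] = f" using assms
  by (induction f rule: crossed_induct) 
   (simp_all add: C_distr C_mult_zero, simp add: crossed_simps(5) bas_mult \<gamma>_one ah_one[OF act])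
qed

lemma C_smult_mult:
 assumes "c : cr K" "f : cr C" "g : cr C"
 shows "(c .[C] f) *[C] g = c .[C] (f *[C] g)" "f *[C] (c .[C] g) = c .[C] (f *[C] g)"
proof -
 have [simp]: "c .[C] (f +[C] g) = c .[C] f +[C] c .[C] g" if "f : cr C" "g : cr C" for f g
  using that assms(1) by (simp add: crossed_simps ka_smult)
 have [simp]: "c .[C] \<zero>[C] = \<zero>[C]" using assms(1) by (simp add: crossed_simps)
 have "(c .[C] f) *[C] g = c .[C] (f *[C] g) & f *[C] (c .[C] g) = c .[C] (f *[C] g)"
  using assms(2)
 proof (induction f rule: crossed_induct)
  case (bas x a)
  show ?case using assms(3)
  proof (induction g rule: crossed_induct)
   case (bas y b)
   then show ?case using \<open>x : _\<close> \<open>a : _\<close> assms(1)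
    by (simp add: bas_mult ka_smult ah_smult[OF act] flip: bas_smult)
  qed (use \<open>x : _\<close> \<open>a : _\<close> assms(1) in \<open>simp_all add: C_distr C_mult_zero\<close>)
 qed (use assms(1,3) in \<open>simp_all add: C_distr C_mult_zero\<close>)
 then show "(c .[C] f) *[C] g = c .[C] (f *[C] g)" "f *[C] (c .[C] g) = c .[C] (f *[C] g)"
  by auto
qed

lemma crossed_kalg [simp]: "kalg K C"
proof (rule kalgI)
 have neg: "(%x. \<ominus>\<^bsub>R\<^esub> f x) : cr C" if "f : cr C" for f
 proof -
  have "supp R (%x. \<ominus>\<^bsub>R\<^esub> f x) <= supp R f" by (auto simp: supp_def)
  then show ?thesis using that by (auto simp: crossed_simps dest: finite_subset)
 qed
 show "ring C"
  by (rule ring_criteria[where n = "%f x. \<ominus>\<^bsub>R\<^esub> f x"])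
   (simp_all add: C_assoc C_one_mult C_distr neg, simp_all add: crossed_simps(1-4) R.a_ac R.l_neg R.r_neg)
qed (simp_all add: C_smult_mult, simp_all add: crossed_simps ka_smult)

definition flift :: "('k, 't, 'w) module_scheme => ('g => 'r => 't) => ('g => 'r) => 't" where
 "flift T \<psi> f = (\<Oplus>\<^bsub>T\<^esub>x\<in>supp R f. \<psi> x (f x))"

context
 fixes T :: "('k, 't, 'w) module_scheme" and \<psi> :: "'g => 'r => 't"
 assumes T [simp]: "kalg K T" and \<psi>: "!!x. x : cr G ==> \<psi> x : module_hom K R T"
begin

interpretation T: ring T by (rule kalg_ring[OF T])

lemma \<psi>_closed [simp]: "x : cr G ==> a : cr R ==> \<psi> x a : cr T"
 by (rule lin_closed[OF \<psi>])

lemma flift_eq: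
 assumes "f : cr C" "finite S" "supp R f <= S" "S <= cr G"
 shows "flift T \<psi> f = (\<Oplus>\<^bsub>T\<^esub>x\<in>S. \<psi> x (f x))"
 unfolding flift_def
proof (rule T.add.finprod_mono_neutral_cong_left)
 show "\<psi> x (f x) = \<zero>[T]" if "x : S - supp R f" for x
  using that assms lin_zero[OF \<psi> R T, of x] by (auto simp: supp_def)
qed (use assms in \<open>auto simp: crossed_simps(1)\<close>)

lemma flift_lin: "flift T \<psi> : module_hom K C T"
proof (rule module_homI)
 show "flift T \<psi> f : cr T" if "f : cr C" for f
  unfolding flift_def using that by (intro T.finsum_closed) (auto simp: crossed_simps)
 show "flift T \<psi> (f +[C] g) = flift T \<psi> f +[T] flift T \<psi> g"
  if fg: "f : cr C" "g : cr C" for f g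
 proof -
  let ?S = "supp R f \<union> supp R g"
  have S: "finite ?S" "?S <= cr G" and v: "!!x. f x : cr R" "!!x. g x : cr R"
   using fg by (auto simp: crossed_simps(1))
  have "supp R (f +[C] g) <= ?S" by (auto simp: supp_def crossed_simps)
  then have "flift T \<psi> (f +[C] g) = (\<Oplus>\<^bsub>T\<^esub>x\<in>?S. \<psi> x ((f +[C] g) x))"
   using fg S by (intro flift_eq) auto
  also have "... = (\<Oplus>\<^bsub>T\<^esub>x\<in>?S. \<psi> x (f x) +[T] \<psi> x (g x))"
   using S v by (intro T.finsum_cong') (auto simp: crossed_simps(2) lin_add[OF \<psi>])
  also have "... = (\<Oplus>\<^bsub>T\<^esub>x\<in>?S. \<psi> x (f x)) +[T] (\<Oplus>\<^bsub>T\<^esub>x\<in>?S. \<psi> x (g x))"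
   using S v by (intro T.finsum_addf) auto
  also have "... = flift T \<psi> f +[T] flift T \<psi> g"
   using fg S by (subst (1 2) flift_eq[symmetric]) auto
  finally show ?thesis .
 qed
 show "flift T \<psi> (c .[C] f) = c .[T] flift T \<psi> f" if c: "c : cr K" and f: "f : cr C" for c f
 proof -
  have S: "finite (supp R f)" "supp R f <= cr G" and v: "!!x. f x : cr R"
   using f by (auto simp: crossed_simps(1))
  have "supp R (c .[C] f) <= supp R f" using c by (auto simp: supp_def crossed_simps)
  then have "flift T \<psi> (c .[C] f) = (\<Oplus>\<^bsub>T\<^esub>x\<in>supp R f. \<psi> x ((c .[C] f) x))"
   using f c S by (intro flift_eq) auto
  also have "... = (\<Oplus>\<^bsub>T\<^esub>x\<in>supp R f. c .[T] \<psi> x (f x))"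
   using S v c by (intro T.finsum_cong') (auto simp: crossed_simps(3) lin_smult[OF \<psi>])
  also have "... = c .[T] flift T \<psi> f" unfolding flift_def
   using S v c by (intro lin_finsum[symmetric] module_homI) (auto simp: ka_smult K.m_comm)
  finally show ?thesis .
 qed
qed

lemma flift_bas: "x : cr G ==> a : cr R ==> flift T \<psi> (bas x a) = \<psi> x a"
proof -
 assume "x : cr G" "a : cr R"
 then have "flift T \<psi> (bas x a) = (\<Oplus>\<^bsub>T\<^esub>y\<in>{x}. \<psi> y (bas x a y))"
  by (intro flift_eq bas_closed supp_bas) auto
 with \<open>x : cr G\<close> \<open>a : cr R\<close> show ?thesis by (simp add: basis_elt_def)
qed

end

lemma lin_eq_bas:
 assumes "kalg K T" "F : module_hom K C T" "F' : module_hom K C T"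
  "!!x a. x : cr G ==> a : cr R ==> F (bas x a) = F' (bas x a)" "f : cr C"
 shows "F f = F' f"
 using assms(5)
 by (induction f rule: crossed_induct)
  (use assms in \<open>simp_all add: lin_zero[OF assms(2)] lin_zero[OF assms(3)] lin_add[OF assms(2)] lin_add[OF assms(3)]\<close>)

lemma alg_hom_bas:
 assumes T: "kalg K T" and F: "F : module_hom K C T"
  and m: "!!x y a b. x : cr G ==> y : cr G ==> a : cr R ==> b : cr R ==>
   F (bas x a *[C] bas y b) = F (bas x a) *[T] F (bas y b)"
  and "F \<one>[C] = \<one>[T]"
 shows "F : alg_hom K C T"
proof (rule alg_homI[OF F])
 show "F \<one>[C] = \<one>[T]" by fact
 note F' = lin_closed[OF F] lin_add[OF F] lin_zero[OF F crossed_kalg T]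
 show "F (f *[C] g) = F f *[T] F g" if "f : cr C" "g : cr C" for f g
  using that(1)
 proof (induction f rule: crossed_induct)
  case (bas x a)
  show ?case using that(2)
  proof (induction g rule: crossed_induct)
   case (bas y b)
   then show ?case using m \<open>x : _\<close> \<open>a : _\<close> by blast
  qed (use \<open>x : _\<close> \<open>a : _\<close> T in \<open>simp_all add: F' ka_simps(3)\<close>)
 qed (use that(2) T in \<open>simp_all add: F' ka_simps(2)\<close>)
qed

text \<open>In h(a) u(x) h(b) u(y) the commutation rule \<open>uh\<close> collects the coefficients
  on the left and \<open>uu\<close> combines the basis elements, which reproduces the product of the
  crossed algebra. This is its universal property.\<close>

lemma lift_hom:
 assumes T: "kalg K T" and h: "h : alg_hom K R T" and u: "!!x. x : cr G ==> u x : cr T"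
  and u1: "u \<one>[G] = \<one>[T]"
  and uh: "!!x a. x : cr G ==> a : cr R ==> u x *[T] h a = h (act x a) *[T] u x"
  and uu: "!!x y. x : cr G ==> y : cr G ==> u x *[T] u y = h (\<gamma> x y) *[T] u (x *[G] y)"
 defines "F == flift T (%x a. h a *[T] u x)"
 shows "F : alg_hom K C T" "!!x a. x : cr G ==> a : cr R ==> F (bas x a) = h a *[T] u x"
proof -
 interpret T: ring T by (rule kalg_ring[OF T])
 have l: "(%a. h a *[T] u x) : module_hom K R T" if "x : cr G" for x
  using lin_comp[OF ah_lin[OF h] lin_mult_right[OF T u[OF that]]] .
 show b: "F (bas x a) = h a *[T] u x" if "x : cr G" "a : cr R" for x a
  unfolding F_def using that by (intro flift_bas T l)
 show "F : alg_hom K C T"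
 proof (rule alg_hom_bas[OF T])
  show "F : module_hom K C T" unfolding F_def by (intro flift_lin T l)
  show "F \<one>[C] = \<one>[T]" by (simp add: crossed_simps(5) b u1 ah_one[OF h])
  fix x y a b assume *: "x : cr G" "y : cr G" "a : cr R" "b : cr R"
  note c = u[OF *(1)] u[OF *(2)] u[OF G.m_closed[OF *(1,2)]] ah_closed[OF h *(3)] ah_closed[OF h *(4)]
   ah_closed[OF h act_closed[OF *(1,4)]] ah_closed[OF h \<gamma>_closed[OF *(1,2)]]
  have "h a *[T] u x *[T] (h b *[T] u y) = h a *[T] (u x *[T] h b) *[T] u y"
   using c by (simp add: T.m_assoc)
  also have "... = h a *[T] h (act x b) *[T] (u x *[T] u y)"
   using c * by (simp add: T.m_assoc uh)
  also have "... = h (a *[R] act x b *[R] \<gamma> x y) *[T] u (x *[G] y)"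
   using c * by (simp add: T.m_assoc uu ah_mult[OF h])
  finally show "F (bas x a *[C] bas y b) = F (bas x a) *[T] F (bas y b)"
   using * by (simp add: bas_mult b)
 qed
qed

lemma emb_hom: "bas \<one>[G] : alg_hom K R C"
 by (rule alg_homI[OF bas_lin]) (simp_all add: bas_mult act_one \<gamma>_one crossed_simps(5))

lemma bas_emb: "x : cr G ==> a : cr R ==> bas x a = bas \<one>[G] a *[C] bas x \<one>[R]"
 by (simp add: bas_mult act_one \<gamma>_one)

lemma bas_comm: "x : cr G ==> a : cr R ==>
  bas x \<one>[R] *[C] bas \<one>[G] a = bas \<one>[G] (act x a) *[C] bas x \<one>[R]"
 by (simp add: bas_mult act_one \<gamma>_one ah_one[OF act])

end

declare One_nat_def [simp del]


section \<open>Quotient algebras\<close>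

context base_field
begin

context
 fixes A :: "('k, 'a, 'z) module_scheme" and I :: "'a set"
 assumes A: "kalg K A" and I: "ideal I A"
begin

interpretation A: ring A by (rule kalg_ring[OF A])
interpretation I: ideal I A by (rule I)

lemma ideal_smult: "c : cr K ==> x : I ==> c .[A] x : I"
 using I.I_l_closed[of x "c .[A] \<one>[A]"] A I.a_subset by (auto simp: ka_smult)

lemma coset_iff: "x : cr A ==> y : I +>\<^bsub>A\<^esub> x \<longleftrightarrow> (EX h:I. y = h +[A] x)"
 by (auto simp: a_r_coset_def')

lemma coset_eqI: "x : cr A ==> y : I +>\<^bsub>A\<^esub> x ==> I +>\<^bsub>A\<^esub> y = I +>\<^bsub>A\<^esub> x"
 using A.a_repr_independence[OF _ _ I.a_subgroup] by blast

lemma coset_eq_iff: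
 assumes "x : cr A" "y : cr A"
 shows "I +>\<^bsub>A\<^esub> x = I +>\<^bsub>A\<^esub> y \<longleftrightarrow> x \<ominus>\<^bsub>A\<^esub> y : I"
proof
 assume "I +>\<^bsub>A\<^esub> x = I +>\<^bsub>A\<^esub> y"
 then have "x : I +>\<^bsub>A\<^esub> y" using I.a_rcos_self[OF assms(1)] by simp
 then obtain h where "h : I" "x = h +[A] y" using coset_iff assms by blast
 then show "x \<ominus>\<^bsub>A\<^esub> y : I"
  using assms I.a_subset by (simp add: a_minus_def A.a_assoc A.r_neg subset_iff)
next
 assume h: "x \<ominus>\<^bsub>A\<^esub> y : I"
 have "x = x \<ominus>\<^bsub>A\<^esub> y +[A] y" using assms by (simp add: a_minus_def A.a_assoc A.l_neg)
 with h show "I +>\<^bsub>A\<^esub> x = I +>\<^bsub>A\<^esub> y" using assms by (intro coset_eqI) (auto simp: coset_iff)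
qed

lemma quot_carrier: "cr (quot_alg A I) = (%x. I +>\<^bsub>A\<^esub> x) ` cr A"
 by (auto simp: quot_alg_def FactRing_simps)

lemma quot_cases: "X : cr (quot_alg A I) ==> (!!x. x : cr A ==> X = I +>\<^bsub>A\<^esub> x ==> P) ==> P"
 by (auto simp: quot_carrier)

lemma quot_simps:
 assumes "x : cr A" "y : cr A"
 shows "(I +>\<^bsub>A\<^esub> x) *[quot_alg A I] (I +>\<^bsub>A\<^esub> y) = I +>\<^bsub>A\<^esub> (x *[A] y)"
  "(I +>\<^bsub>A\<^esub> x) +[quot_alg A I] (I +>\<^bsub>A\<^esub> y) = I +>\<^bsub>A\<^esub> (x +[A] y)"
  "I +>\<^bsub>A\<^esub> x : cr (quot_alg A I)"
 using assms I.a_subset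
 by (simp_all add: quot_carrier) (simp_all add: quot_alg_def FactRing_simps I.rcoset_mult_add I.a_rcos_sum)

lemma quot_one: "\<one>[quot_alg A I] = I +>\<^bsub>A\<^esub> \<one>[A]"
 and quot_zero: "\<zero>[quot_alg A I] = I +>\<^bsub>A\<^esub> \<zero>[A]"
 using I.a_subset by (simp_all add: quot_alg_def FactRing_simps)

lemma quot_smult:
 assumes "x : cr A" "c : cr K"
 shows "c .[quot_alg A I] (I +>\<^bsub>A\<^esub> x) = I +>\<^bsub>A\<^esub> (c .[A] x)"
proof -
 have "I +>\<^bsub>A\<^esub> (c .[A] y) = I +>\<^bsub>A\<^esub> (c .[A] x)" if "y : I +>\<^bsub>A\<^esub> x" for y
 proof -
  from that obtain h where h: "h : I" and y: "y = h +[A] x" unfolding coset_iff[OF assms(1)] by (elim bexE)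
  have hc: "h : cr A" using h I.a_subset by (rule rev_subsetD)
  have "c .[A] y = c .[A] h +[A] c .[A] x"
   unfolding y by (rule ka_smult(3)[OF A assms(2) hc assms(1)])
  then have "c .[A] y : I +>\<^bsub>A\<^esub> (c .[A] x)"
   unfolding coset_iff[OF ka_closed(4)[OF A assms(2,1)]] using ideal_smult[OF assms(2) h] by (rule bexI)
  then show ?thesis by (rule coset_eqI[OF ka_closed(4)[OF A assms(2,1)]])
 qed
 then have "(\<Union>y\<in>I +>\<^bsub>A\<^esub> x. I +>\<^bsub>A\<^esub> (c .[A] y)) = (\<Union>y\<in>I +>\<^bsub>A\<^esub> x. I +>\<^bsub>A\<^esub> (c .[A] x))"
  by (rule SUP_cong[OF refl])
 also have "... = I +>\<^bsub>A\<^esub> (c .[A] x)" using I.a_rcos_self[OF assms(1)] by auto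
 finally show ?thesis by (simp add: quot_alg_def)
qed

lemma quot_kalg: "kalg K (quot_alg A I)"
proof (rule kalgI)
 note [elim] = quot_cases
 have q: "quot_alg A I = quot_alg A I" ..
 have "ring (A Quot I)" by (rule I.quotient_is_ring)
 then interpret Q: ring "A Quot I" .
 have e: "cr (quot_alg A I) = cr (A Quot I)" "!!x y. x *[quot_alg A I] y = x *[A Quot I] y"
  "!!x y. x +[quot_alg A I] y = x +[A Quot I] y" "\<one>[quot_alg A I] = \<one>[A Quot I]"
  "\<zero>[quot_alg A I] = \<zero>[A Quot I]"
  by (simp_all add: quot_alg_def)
 show "ring (quot_alg A I)"
  by (rule ring_criteria[where n = "%x. \<ominus>\<^bsub>A Quot I\<^esub> x"])
   (auto simp add: e Q.ring_simprules)
qed (use A in \<open>auto elim!: quot_cases simp: quot_simps quot_smult ka_smult\<close>)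

lemma proj_hom: "(%x. I +>\<^bsub>A\<^esub> x) : alg_hom K A (quot_alg A I)"
 by (rule alg_homI[OF module_homI]) (simp_all add: quot_simps quot_smult quot_one)

text \<open>Maps on a quotient are written as \<open>the_elem\<close> of the image of a coset; this
  is the well-definedness that gives the value a meaning.\<close>

lemma quot_image:
 assumes "kalg K T" "F : module_hom K A T" "!!x. x : I ==> F x = \<zero>[T]" "x : cr A"
 shows "F ` (I +>\<^bsub>A\<^esub> x) = {F x}"
proof -
 have "F y = F x" if "y : I +>\<^bsub>A\<^esub> x" for y
  using that assms I.a_subset lin_closed[OF assms(2)]
  by (auto simp: coset_iff lin_add[OF assms(2)] subset_iff)
 then have "F ` (I +>\<^bsub>A\<^esub> x) = (%_. F x) ` (I +>\<^bsub>A\<^esub> x)" by (rule image_cong[OF refl])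
 also have "... = {F x}" using I.a_rcos_self[OF assms(4)] by auto
 finally show ?thesis .
qed

lemma quot_lift:
 assumes "kalg K T" "F : module_hom K A T" "!!x. x : I ==> F x = \<zero>[T]"
 shows "x : cr A ==> the_elem (F ` (I +>\<^bsub>A\<^esub> x)) = F x"
  "(%X. the_elem (F ` X)) : module_hom K (quot_alg A I) T"
proof -
 show e: "the_elem (F ` (I +>\<^bsub>A\<^esub> x)) = F x" if "x : cr A" for x
  using quot_image[OF assms that] by simp
 show "(%X. the_elem (F ` X)) : module_hom K (quot_alg A I) T"
  by (rule module_homI)
   (use A in \<open>auto elim!: quot_cases simp: e quot_simps quot_smult lin_closed[OF assms(2)]
    lin_add[OF assms(2)] lin_smult[OF assms(2)]\<close>)
qed

lemma quot_lift_hom: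
 assumes "kalg K T" "F : alg_hom K A T" "!!x. x : I ==> F x = \<zero>[T]"
 shows "(%X. the_elem (F ` X)) : alg_hom K (quot_alg A I) T"
proof (rule alg_homI)
 note F = assms(1) ah_lin[OF assms(2)] assms(3)
 show "(%X. the_elem (F ` X)) : module_hom K (quot_alg A I) T" by (rule quot_lift[OF F])
 show "the_elem (F ` \<one>[quot_alg A I]) = \<one>[T]"
  by (simp add: quot_one quot_lift(1)[OF F] ah_one[OF assms(2)])
qed (auto elim!: quot_cases simp: quot_simps quot_lift(1)[OF assms(1) ah_lin[OF assms(2)] assms(3)]
 ah_mult[OF assms(2)])

end

lemma kernel_ideal:
 assumes "kalg K A" "kalg K T" "F : alg_hom K A T"
 shows "ideal {x : cr A. F x = \<zero>[T]} A"
proof -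
 have "ring_hom_ring A T F"
  using assms(3) by (intro ring_hom_ringI2 kalg_ring assms(1,2)) (simp add: alg_hom_def)
 from ring_hom_ring.kernel_is_ideal[OF this] show ?thesis by (simp only: a_kernel_def')
qed

section \<open>Tensor powers of algebras\<close>

lemma basis_elt_self: "basis_elt (self_alg K) = basis_elt K" and supp_self: "supp (self_alg K) = supp K"
 by (simp_all add: basis_elt_def supp_def fun_eq_iff)

lemma finsum_self: "finsum (self_alg K) f I = finsum K f I"
 by (simp add: finsum_def finprod_def self_alg_def)

abbreviation tup :: "('k, 'a, 'z) module_scheme => nat => (nat => 'a) set" where
 "tup A n == {1..n} \<rightarrow>\<^sub>E cr A"

abbreviation tpow :: "('k, 'a, 'z) module_scheme => nat => ('k, ('k, 'a) tensor) module" where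
 "tpow A n == tensor_pow K A n"

abbreviation tdel :: "(nat => 'a) => (nat => 'a) => 'k" where
 "tdel x == basis_elt K x \<one>[K]"

text \<open>Stated by updating a single coordinate, in the same shape as the generators of
  \<open>tensor_rel\<close>, so that the relations vanish by direct rewriting.\<close>

definition mlin :: "('k, 'a, 'z) module_scheme => nat => ('k, 'v, 'y) module_scheme => ((nat => 'a) => 'v) => bool"
 where
 "mlin A n V \<phi> \<longleftrightarrow> (ALL x:{1..n} \<rightarrow>\<^sub>E cr A. \<phi> x : cr V & (ALL i:{1..n}. ALL a:cr A.
  (ALL b:cr A. \<phi> (x(i := a +[A] b)) = \<phi> (x(i := a)) +[V] \<phi> (x(i := b))) &
  (ALL c:cr K. \<phi> (x(i := c .[A] a)) = c .[V] \<phi> (x(i := a)))))"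

lemma mlinI:
 assumes "!!x. x : {1..n} \<rightarrow>\<^sub>E cr A ==> \<phi> x : cr V"
  "!!x i a b. x : {1..n} \<rightarrow>\<^sub>E cr A ==> i : {1..n} ==> a : cr A ==> b : cr A ==>
   \<phi> (x(i := a +[A] b)) = \<phi> (x(i := a)) +[V] \<phi> (x(i := b))"
  "!!x i a c. x : {1..n} \<rightarrow>\<^sub>E cr A ==> i : {1..n} ==> a : cr A ==> c : cr K ==>
   \<phi> (x(i := c .[A] a)) = c .[V] \<phi> (x(i := a))"
 shows "mlin A n V \<phi>"
 using assms by (auto simp: mlin_def)

lemma mlinD:
 assumes "mlin A n V \<phi>" "x : {1..n} \<rightarrow>\<^sub>E cr A"
 shows "\<phi> x : cr V"
  "i : {1..n} ==> a : cr A ==> b : cr A ==>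
   \<phi> (x(i := a +[A] b)) = \<phi> (x(i := a)) +[V] \<phi> (x(i := b))"
  "i : {1..n} ==> a : cr A ==> c : cr K ==>
   \<phi> (x(i := c .[A] a)) = c .[V] \<phi> (x(i := a))"
 using assms unfolding mlin_def by blast+

lemma upd_tuple: "x : {1..n} \<rightarrow>\<^sub>E X ==> i : {1..n} ==> a : X ==> x(i := a) : {1..n::nat} \<rightarrow>\<^sub>E X"
 by (auto simp: PiE_iff extensional_def)

context
 fixes A :: "('k, 'a, 'z) module_scheme" and n :: nat
 assumes A: "kalg K A"
begin

interpretation A: ring A by (rule kalg_ring[OF A])

lemma tuple_monoid: "monoid (tuple_monoid A n)"
 by (rule monoidI)
  (auto simp: tuple_monoid_def PiE_iff A.m_assoc restrict_def extensional_def fun_eq_iff)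

interpretation F: crossed K "self_alg K" "tuple_monoid A n" "%_ a. a" "%_ _. \<one>[K]"
 by (intro crossed.intro[OF base_field_axioms] crossed_axioms.intro)
  (auto simp: tuple_monoid ah_id K.m_comm intro!: centerI)

abbreviation "tfree == tensor_free K A n"
abbreviation "trel == tensor_rel K A n"

lemma tfree_eq: "tfree = F.C" by (simp add: tensor_free_def monoid_alg_def)

interpretation W: module K tfree unfolding tfree_eq by (rule kalg_module[OF F.crossed_kalg])

lemma tfree_kalg: "kalg K tfree" by (simp add: tfree_eq)

lemma tup_mult: "x *[tuple_monoid A n] y = (\<lambda>i\<in>{1..n}. x i *[A] y i)"
 and tup_carrier: "cr (tuple_monoid A n) = tup A n"
 and tup_one: "\<one>[tuple_monoid A n] = (\<lambda>i\<in>{1..n}. \<one>[A])"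
 by (simp_all add: tuple_monoid_def)

lemma tdel_closed [simp]: "x : tup A n ==> tdel x : cr tfree"
 using F.bas_closed[of x "\<one>[K]"] by (simp add: tfree_eq basis_elt_self tup_carrier)

lemma tdel_mult: "x : tup A n ==> y : tup A n ==> tdel x *[tfree] tdel y = tdel (\<lambda>i\<in>{1..n}. x i *[A] y i)"
 using F.bas_mult[of x y "\<one>[K]" "\<one>[K]"] by (simp add: tfree_eq basis_elt_self tup_carrier tup_mult)

lemma tfree_induct [consumes 1, case_names zero del smult add]:
 assumes "f : cr tfree" "P \<zero>[tfree]" "!!x. x : tup A n ==> P (tdel x)"
  "!!c f. c : cr K ==> f : cr tfree ==> P f ==> P (c .[tfree] f)"
  "!!f g. f : cr tfree ==> g : cr tfree ==> P f ==> P g ==> P (f +[tfree] g)"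
 shows "P f"
 using assms(1) unfolding tfree_eq
proof (induction f rule: F.crossed_induct)
 case (bas x c)
 then have "basis_elt (self_alg K) x c = c .[F.C] tdel x"
  using F.bas_smult[of c x "\<one>[K]"] by (simp add: basis_elt_self)
 with bas show ?case using assms(3,4) tdel_closed by (simp add: tup_carrier flip: tfree_eq)
qed (use assms in \<open>simp_all flip: tfree_eq\<close>)

definition trel_add :: "(nat => 'a) => nat => 'a => 'a => (nat => 'a) => 'k" where
 "trel_add x i a b = tdel (x(i := a +[A] b)) \<ominus>\<^bsub>tfree\<^esub> (tdel (x(i := a)) +[tfree] tdel (x(i := b)))"

definition trel_smult :: "(nat => 'a) => nat => 'a => 'k => (nat => 'a) => 'k" where
 "trel_smult x i a c = tdel (x(i := c .[A] a)) \<ominus>\<^bsub>tfree\<^esub> (c .[tfree] tdel (x(i := a)))"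

definition trels :: "((nat => 'a) => 'k) set" where
 "trels = {trel_add x i a b | x i a b. x : tup A n & i : {1..n} & a : cr A & b : cr A} \<union>
  {trel_smult x i a c | x i a c. x : tup A n & i : {1..n} & a : cr A & c : cr K}"

lemma trels_intro:
 "x : tup A n ==> i : {1..n} ==> a : cr A ==> b : cr A ==> trel_add x i a b : trels"
 "x : tup A n ==> i : {1..n} ==> a : cr A ==> c : cr K ==> trel_smult x i a c : trels"
 unfolding trels_def by blast+

lemma trels_cases [consumes 1, case_names add smult]:
 assumes "r : trels"
 obtains x i a b where "x : tup A n" "i : {1..n}" "a : cr A" "b : cr A" "r = trel_add x i a b"
 | x i a c where "x : tup A n" "i : {1..n}" "a : cr A" "c : cr K" "r = trel_smult x i a c"
 using assms unfolding trels_def by blast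

lemma trel_eq: "trel = module.span K tfree trels"
 by (simp add: tensor_rel_def trels_def trel_add_def trel_smult_def Let_def)

lemma tdel_upd: "x : tup A n ==> i : {1..n} ==> a : cr A ==> tdel (x(i := a)) : cr tfree"
 by (intro tdel_closed upd_tuple)

lemma trel_carrier:
 assumes "x : tup A n" "i : {1..n}" "a : cr A"
 shows "b : cr A ==> trel_add x i a b : cr tfree" "c : cr K ==> trel_smult x i a c : cr tfree"
 unfolding trel_add_def trel_smult_def using assms A
 by (intro ka_closed(2-4)[OF tfree_kalg] tdel_upd; simp)+

lemma trels_closed: "trels <= cr tfree"
 unfolding trels_def using trel_carrier by blast

lemma trel_submodule: "LinearCombinations.submodule K trel tfree"
 unfolding trel_eq by (rule W.span_is_submodule[OF trels_closed])

lemma trels_trel: "trels <= trel"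
 unfolding trel_eq by (rule W.in_own_span[OF trels_closed])

lemma trel_least: "trels <= N ==> LinearCombinations.submodule K N tfree ==> trel <= N"
 unfolding trel_eq by (rule W.span_is_subset)

lemma trel_subset: "trel <= cr tfree"
 using trel_submodule by (simp add: LinearCombinations.submodule_def)

lemma trel_closed:
 "x : trel ==> y : trel ==> x +[tfree] y : trel" "\<zero>[tfree] : trel"
 "c : cr K ==> x : trel ==> c .[tfree] x : trel"
 using trel_submodule by (simp_all add: LinearCombinations.submodule_def)

lemma tuple_upd_mult:
 "x : tup A n ==> y : tup A n ==> i : {1..n} ==>
  (\<lambda>j\<in>{1..n}. y j *[A] (x(i := a)) j) = (\<lambda>j\<in>{1..n}. y j *[A] x j)(i := y i *[A] a)"
 "x : tup A n ==> y : tup A n ==> i : {1..n} ==>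
  (\<lambda>j\<in>{1..n}. (x(i := a)) j *[A] y j) = (\<lambda>j\<in>{1..n}. x j *[A] y j)(i := a *[A] y i)"
 by (auto simp: fun_eq_iff)

lemma tup_closed: "x : tup A n ==> y : tup A n ==> (\<lambda>i\<in>{1..n}. x i *[A] y i) : tup A n"
 by (auto simp: PiE_iff)

text \<open>Multiplying by a tuple acts on the varying coordinate and on the fixed ones separately,
  so a multilinearity relation turns into another one. Hence the span of the relations is an
  ideal.\<close>

lemma tdel_trels:
 assumes "y : tup A n" "r : trels"
 shows "tdel y *[tfree] r : trels" "r *[tfree] tdel y : trels"
proof -
 interpret FR: ring tfree by (rule kalg_ring[OF tfree_kalg])
 have y: "y i : cr A" if "i : {1..n}" for i using that assms(1) by auto
 have minus: "u *[tfree] (v \<ominus>\<^bsub>tfree\<^esub> w) = u *[tfree] v \<ominus>\<^bsub>tfree\<^esub> u *[tfree] w"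
  "(v \<ominus>\<^bsub>tfree\<^esub> w) *[tfree] u = v *[tfree] u \<ominus>\<^bsub>tfree\<^esub> w *[tfree] u"
  if "u : cr tfree" "v : cr tfree" "w : cr tfree" for u v w
  using that by (simp_all add: a_minus_def FR.r_distr FR.l_distr FR.r_minus FR.l_minus)
 have add: "tdel y *[tfree] trel_add x i a b = trel_add (\<lambda>j\<in>{1..n}. y j *[A] x j) i (y i *[A] a) (y i *[A] b)"
  "trel_add x i a b *[tfree] tdel y = trel_add (\<lambda>j\<in>{1..n}. x j *[A] y j) i (a *[A] y i) (b *[A] y i)"
  if x: "x : tup A n" "i : {1..n}" "a : cr A" "b : cr A" for x i a b
 proof -
  have u: "x(i := d) : tup A n" if "d : cr A" for d by (rule upd_tuple[OF x(1,2) that])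
  note c = u[OF x(3)] u[OF x(4)] u[OF A.a_closed[OF x(3,4)]]
  show "tdel y *[tfree] trel_add x i a b = trel_add (\<lambda>j\<in>{1..n}. y j *[A] x j) i (y i *[A] a) (y i *[A] b)"
   "trel_add x i a b *[tfree] tdel y = trel_add (\<lambda>j\<in>{1..n}. x j *[A] y j) i (a *[A] y i) (b *[A] y i)"
   using c[THEN tdel_closed] tdel_closed[OF assms(1)] tdel_mult[OF assms(1) c(1)] tdel_mult[OF c(1) assms(1)]
    tdel_mult[OF assms(1) c(2)] tdel_mult[OF c(2) assms(1)] tdel_mult[OF assms(1) c(3)] tdel_mult[OF c(3) assms(1)]
   unfolding trel_add_def
   by (simp_all only: minus FR.l_distr FR.r_distr ka_closed(2)[OF tfree_kalg] tuple_upd_mult[OF x(1) assms(1) x(2)]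
     A.l_distr[OF x(3,4) y[OF x(2)]] A.r_distr[OF x(3,4) y[OF x(2)]])
 qed
 have smult: "tdel y *[tfree] trel_smult x i a d = trel_smult (\<lambda>j\<in>{1..n}. y j *[A] x j) i (y i *[A] a) d"
  "trel_smult x i a d *[tfree] tdel y = trel_smult (\<lambda>j\<in>{1..n}. x j *[A] y j) i (a *[A] y i) d"
  if x: "x : tup A n" "i : {1..n}" "a : cr A" "d : cr K" for x i a d
 proof -
  have u: "x(i := d) : tup A n" if "d : cr A" for d by (rule upd_tuple[OF x(1,2) that])
  note c = u[OF x(3)] u[OF ka_closed(4)[OF A x(4,3)]]
  show "tdel y *[tfree] trel_smult x i a d = trel_smult (\<lambda>j\<in>{1..n}. y j *[A] x j) i (y i *[A] a) d"
   "trel_smult x i a d *[tfree] tdel y = trel_smult (\<lambda>j\<in>{1..n}. x j *[A] y j) i (a *[A] y i) d"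
   using c[THEN tdel_closed] tdel_closed[OF assms(1)] tdel_mult[OF assms(1) c(1)] tdel_mult[OF c(1) assms(1)]
    tdel_mult[OF assms(1) c(2)] tdel_mult[OF c(2) assms(1)] ka_closed(4)[OF tfree_kalg x(4) tdel_closed[OF c(1)]]
    x(4)
   unfolding trel_smult_def
   by (simp_all only: minus tuple_upd_mult[OF x(1) assms(1) x(2)]
     ka_smult(1)[OF A x(4,3) y[OF x(2)]] ka_smult(2)[OF A x(4) y[OF x(2)] x(3)]
     ka_smult(1,2)[OF tfree_kalg])
 qed
 show "tdel y *[tfree] r : trels"
  using assms(2)
 proof (cases r rule: trels_cases)
  case h: (add x i a b)
  show ?thesis unfolding h(5) add(1)[OF h(1-4)]
   by (intro trels_intro tup_closed h assms(1) A.m_closed y[OF h(2)])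
 next
  case h: (smult x i a c)
  show ?thesis unfolding h(5) smult(1)[OF h(1-4)]
   by (intro trels_intro tup_closed h assms(1) A.m_closed y[OF h(2)])
 qed
 show "r *[tfree] tdel y : trels"
  using assms(2)
 proof (cases r rule: trels_cases)
  case h: (add x i a b)
  show ?thesis unfolding h(5) add(2)[OF h(1-4)]
   by (intro trels_intro tup_closed h assms(1) A.m_closed y[OF h(2)])
 next
  case h: (smult x i a c)
  show ?thesis unfolding h(5) smult(2)[OF h(1-4)]
   by (intro trels_intro tup_closed h assms(1) A.m_closed y[OF h(2)])
 qed
qed

lemma trel_ideal: "ideal trel tfree"
proof -
 interpret FR: ring tfree by (rule kalg_ring[OF tfree_kalg])
 \<comment> \<open>\<open>?N\<close> collects the elements whose products with everything, on either
   side, lie in the span. It is a submodule that contains the relations, hence their span.\<close>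
 let ?N = "{r : cr tfree. ALL f:cr tfree. f *[tfree] r : trel & r *[tfree] f : trel}"
 have "f *[tfree] r : trel & r *[tfree] f : trel" if "r : trels" "f : cr tfree" for r f
  using that(2)
 proof (induction f rule: tfree_induct)
  case (del x)
  then show ?case using tdel_trels[OF del that(1)] trels_trel by blast
 qed (use subsetD[OF trels_closed that(1)] in \<open>simp_all add: trel_closed FR.l_distr FR.r_distr ka_smult(1,2)[OF tfree_kalg]\<close>)
 then have "trels <= ?N" using trels_closed by auto
 moreover have "LinearCombinations.submodule K ?N tfree"
  by (rule LinearCombinations.submodule.intro[OF W.module_axioms])
   (auto simp: trel_closed FR.l_distr FR.r_distr ka_smult(1,2)[OF tfree_kalg])
 ultimately have "trel <= ?N" by (rule trel_least)
 moreover have "additive_subgroup trel tfree"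
 proof (rule additive_subgroup.intro, rule group.subgroupI[OF abelian_group.a_group[OF kalg_abelian_group[OF tfree_kalg]]])
  show "inv\<^bsub>add_monoid tfree\<^esub> a : trel" if "a : trel" for a
   unfolding a_inv_def[symmetric] ka_minus[OF tfree_kalg subsetD[OF trel_subset that]]
   by (rule trel_closed(3)[OF _ that]) simp
 qed (use trel_subset trel_closed in auto)
 ultimately show ?thesis
  by (intro idealI[OF FR.ring_axioms]) (auto dest: additive_subgroup.a_subgroup)
qed

lemma tensor_kalg [simp]: "kalg K (tpow A n)"
 unfolding tensor_pow_def by (rule quot_kalg[OF tfree_kalg trel_ideal])

lemma tens_closed [simp]: "x : tup A n ==> tens K A n x : cr (tpow A n)"
 unfolding tensor_pow_def tens_def by (rule quot_simps(3)[OF tfree_kalg trel_ideal]) auto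

lemma tens_mult:
 "x : tup A n ==> y : tup A n ==> tens K A n x *[tpow A n] tens K A n y = tens K A n (\<lambda>i\<in>{1..n}. x i *[A] y i)"
 unfolding tensor_pow_def tens_def by (simp add: quot_simps[OF tfree_kalg trel_ideal] tdel_mult)

lemma tens_one: "\<one>[tpow A n] = tens K A n (\<lambda>i\<in>{1..n}. \<one>[A])"
 unfolding tensor_pow_def tens_def
 by (subst quot_one[OF tfree_kalg trel_ideal])
  (simp only: tfree_eq F.crossed_simps(5) basis_elt_self tup_one self_alg_simps)

lemma tens_mlin: "mlin A n (tpow A n) (tens K A n)"
proof (rule mlinI)
 note q = quot_simps[OF tfree_kalg trel_ideal] quot_smult[OF tfree_kalg trel_ideal]
 fix x i a b assume x: "x : tup A n" "i : {1..n}" "a : cr A" "b : cr A"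
 have c: "tdel (x(i := a)) : cr tfree" "tdel (x(i := b)) : cr tfree" "tdel (x(i := a +[A] b)) : cr tfree"
  using x by (simp_all add: tdel_upd)
 have "trel_add x i a b : trel" by (rule subsetD[OF trels_trel trels_intro(1)[OF x]])
 then show "tens K A n (x(i := a +[A] b)) = tens K A n (x(i := a)) +[tpow A n] tens K A n (x(i := b))"
  unfolding tensor_pow_def tens_def trel_add_def q(2)[OF c(1,2)]
  by (rule coset_eq_iff[OF tfree_kalg trel_ideal c(3) ka_closed(2)[OF tfree_kalg c(1,2)], THEN iffD2])
next
 note q = quot_simps[OF tfree_kalg trel_ideal] quot_smult[OF tfree_kalg trel_ideal]
 fix x i a d assume x: "x : tup A n" "i : {1..n}" "a : cr A" "d : cr K"
 have c: "tdel (x(i := a)) : cr tfree" "tdel (x(i := d .[A] a)) : cr tfree"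
  using x A by (simp_all add: tdel_upd)
 have "trel_smult x i a d : trel" by (rule subsetD[OF trels_trel trels_intro(2)[OF x]])
 then show "tens K A n (x(i := d .[A] a)) = d .[tpow A n] tens K A n (x(i := a))"
  unfolding tensor_pow_def tens_def trel_smult_def q(4)[OF c(1) x(4)]
  by (rule coset_eq_iff[OF tfree_kalg trel_ideal c(2) ka_closed(4)[OF tfree_kalg x(4) c(1)], THEN iffD2])
qed (rule tens_closed)

lemma tensor_induct [consumes 1, case_names tens smult add]:
 assumes "t : cr (tpow A n)" "!!x. x : tup A n ==> P (tens K A n x)"
  "!!c t. c : cr K ==> t : cr (tpow A n) ==> P t ==> P (c .[tpow A n] t)"
  "!!t u. t : cr (tpow A n) ==> u : cr (tpow A n) ==> P t ==> P u ==> P (t +[tpow A n] u)"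
 shows "P t"
proof -
 note q = quot_simps[OF tfree_kalg trel_ideal] quot_smult[OF tfree_kalg trel_ideal]
 have one: "(\<lambda>i\<in>{1..n}. \<one>[A]) : tup A n" by auto
 have "P (trel +>\<^bsub>tfree\<^esub> f)" if "f : cr tfree" for f
  using that
 proof (induction f rule: tfree_induct)
  case zero
  have "trel +>\<^bsub>tfree\<^esub> \<zero>[tfree] = \<zero>[tpow A n]"
   unfolding tensor_pow_def by (rule quot_zero[OF tfree_kalg trel_ideal, symmetric])
  then show ?case using assms(3)[OF K.zero_closed tens_closed[OF one] assms(2)[OF one]] one by simp
 next
  case (smult c f)
  then show ?case using assms(3)[OF smult(1), of "trel +>\<^bsub>tfree\<^esub> f"] by (simp add: tensor_pow_def q)
 next
  case (add f g)
  then show ?case using assms(4)[of "trel +>\<^bsub>tfree\<^esub> f" "trel +>\<^bsub>tfree\<^esub> g"] by (simp add: tensor_pow_def q)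
 qed (use assms(2) in \<open>simp add: tens_def\<close>)
 then show ?thesis using assms(1) unfolding tensor_pow_def by (auto elim: quot_cases[OF tfree_kalg trel_ideal])
qed

context
 fixes V :: "('k, 'v, 'y) module_scheme" and \<phi> :: "(nat => 'a) => 'v"
 assumes V: "kalg K V" and \<phi>: "mlin A n V \<phi>"
begin

text \<open>\<Phi> is the linear extension of \<phi> to the free space on tuples. Multilinearity
  says that it kills the generating relations, hence their span, and so \<open>tens_lift\<close>
  does not depend on the representative.\<close>

lemma tens_lift_aux:
 defines "\<Phi> == F.flift V (%x c. c .[V] \<phi> x)"
 shows "\<Phi> : module_hom K tfree V" "x : tup A n ==> \<Phi> (tdel x) = \<phi> x" "r : trel ==> \<Phi> r = \<zero>[V]"
  "tens_lift K V \<phi> = (%t. the_elem (\<Phi> ` t))"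
proof -
 have l: "(%c. c .[V] \<phi> x) : module_hom K (self_alg K) V" if "x : cr (tuple_monoid A n)" for x
  using that mlinD(1)[OF \<phi>] V by (intro module_homI) (auto simp: ka_smult tup_carrier)
 show lin: "\<Phi> : module_hom K tfree V" unfolding \<Phi>_def tfree_eq by (intro F.flift_lin V l)
 show d: "\<Phi> (tdel x) = \<phi> x" if "x : tup A n" for x
 proof -
  have "\<Phi> (basis_elt (self_alg K) x \<one>[K]) = \<one>[K] .[V] \<phi> x"
   unfolding \<Phi>_def using that by (intro F.flift_bas V l) (simp_all add: tup_carrier)
  then show ?thesis using mlinD(1)[OF \<phi> that] V by (simp add: basis_elt_self)
 qed
 show "tens_lift K V \<phi> = (%t. the_elem (\<Phi> ` t))"
  by (intro ext) (simp add: tens_lift_def \<Phi>_def F.flift_def[abs_def] supp_self)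
 let ?N = "{r : cr tfree. \<Phi> r = \<zero>[V]}"
 have "LinearCombinations.submodule K ?N tfree"
  by (rule LinearCombinations.submodule.intro[OF W.module_axioms])
   (use V in \<open>auto simp: lin_add[OF lin] lin_smult[OF lin] lin_zero[OF lin tfree_kalg V] ka_closed[OF tfree_kalg]\<close>)
 moreover have "trels <= ?N"
 proof
  fix r assume r: "r : trels"
  note m = lin_minus[OF lin tfree_kalg V] lin_add[OF lin] lin_smult[OF lin]
  from r have "\<Phi> r = \<zero>[V]"
  proof (cases r rule: trels_cases)
   case x: (add x i a b)
   note u = upd_tuple[OF x(1,2,3)] upd_tuple[OF x(1,2,4)] upd_tuple[OF x(1,2) A.add.m_closed[OF x(3,4)]]
   note c = u[THEN tdel_closed]
   show ?thesis
    unfolding x(5) trel_add_def m(1)[OF c(3) ka_closed(2)[OF tfree_kalg c(1,2)]] m(2)[OF c(1,2)]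
     d[OF u(1)] d[OF u(2)] d[OF u(3)] mlinD(2)[OF \<phi> x(1-4)]
    using u[THEN mlinD(1)[OF \<phi>]] V by (simp add: ka_minus_eq_zero)
  next
   case x: (smult x i a c)
   note u = upd_tuple[OF x(1,2,3)] upd_tuple[OF x(1,2) ka_closed(4)[OF A x(4,3)]]
   note c = u[THEN tdel_closed]
   show ?thesis
    unfolding x(5) trel_smult_def m(1)[OF c(2) ka_closed(4)[OF tfree_kalg x(4) c(1)]] m(3)[OF x(4) c(1)]
     d[OF u(1)] d[OF u(2)] mlinD(3)[OF \<phi> x(1-4)]
    using u[THEN mlinD(1)[OF \<phi>]] V x(4) by (simp add: ka_minus_eq_zero)
  qed
  then show "r : ?N" using r trels_closed by auto
 qed
 ultimately have "trel <= ?N" by (intro trel_least)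
 then show "r : trel ==> \<Phi> r = \<zero>[V]" by auto
qed

lemma tens_lift_lin: "tens_lift K V \<phi> : module_hom K (tpow A n) V"
 unfolding tens_lift_aux(4) tensor_pow_def
 by (intro quot_lift tfree_kalg trel_ideal V tens_lift_aux)

lemma tens_lift_tens: "x : tup A n ==> tens_lift K V \<phi> (tens K A n x) = \<phi> x"
 unfolding tens_lift_aux(4) tens_def
 by (subst quot_lift(1)[OF tfree_kalg trel_ideal V tens_lift_aux(1) tens_lift_aux(3)])
  (auto simp: tens_lift_aux(2))

end

lemma lin_eq_tens:
 assumes "F : module_hom K (tpow A n) V" "G : module_hom K (tpow A n) V"
  "!!x. x : tup A n ==> F (tens K A n x) = G (tens K A n x)" "t : cr (tpow A n)"
 shows "F t = G t"
 using assms(4)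
 by (induction rule: tensor_induct)
  (simp_all add: assms(3) lin_add[OF assms(1)] lin_add[OF assms(2)] lin_smult[OF assms(1)] lin_smult[OF assms(2)])

lemma tens_lift_hom:
 assumes V: "kalg K V" and \<phi>: "mlin A n V \<phi>"
  and "!!x y. x : tup A n ==> y : tup A n ==> \<phi> (\<lambda>i\<in>{1..n}. x i *[A] y i) = \<phi> x *[V] \<phi> y"
  and "\<phi> (\<lambda>i\<in>{1..n}. \<one>[A]) = \<one>[V]"
 shows "tens_lift K V \<phi> : alg_hom K (tpow A n) V"
proof (rule alg_homI[OF tens_lift_lin[OF V \<phi>]])
 note L = tens_lift_lin[OF V \<phi>] and t = tens_lift_tens[OF V \<phi>]
 note LL = lin_closed[OF L] lin_add[OF L] lin_smult[OF L]
 show "tens_lift K V \<phi> \<one>[tpow A n] = \<one>[V]" using assms(4) by (subst tens_one, subst t) auto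
 show "tens_lift K V \<phi> (f *[tpow A n] g) = tens_lift K V \<phi> f *[V] tens_lift K V \<phi> g"
  if "f : cr (tpow A n)" "g : cr (tpow A n)" for f g
  using that(1)
 proof (induction f rule: tensor_induct)
  case (tens x)
  show ?case using that(2)
  proof (induction g rule: tensor_induct)
   case (tens y)
   then show ?case using \<open>x : tup A n\<close> tup_closed assms(3) by (simp add: tens_mult t)
  qed (use \<open>x : tup A n\<close> V in \<open>simp_all add: LL ka_simps(2,3) ka_smult(1,2)\<close>)
 qed (use that(2) V in \<open>simp_all add: LL ka_simps(2,3) ka_smult(1,2)\<close>)
qed

end

lemmas tensor_induct_rule = tensor_induct [consumes 2, case_names tens smult add]

end

declare upt_Suc [simp del]


section \<open>Bilinear and trilinear maps as linear maps on tensor powers\<close>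

context base_field
begin

lemma lin_const_left:
 assumes "kalg K T" "u : module_hom K A T" "b : cr T" shows "(%a. u a *[T] b) : module_hom K A T"
 using lin_comp[OF assms(2) lin_mult_right[OF assms(1,3)]] .

lemma lin_const_right:
 assumes "kalg K T" "u : module_hom K A T" "b : cr T" shows "(%a. b *[T] u a) : module_hom K A T"
 using lin_comp[OF assms(2) lin_mult_left[OF assms(1,3)]] .

lemma mlin2I:
 assumes "!!a. a : cr A ==> \<beta> a : module_hom K A V" "!!b. b : cr A ==> (%a. \<beta> a b) : module_hom K A V"
 shows "mlin A 2 V (%x. \<beta> (x 1) (x 2))"
proof (rule mlinI)
 fix x assume "x : tup A 2"
 then have x: "x 1 : cr A" "x 2 : cr A" by (auto simp: PiE_iff)
 then show "\<beta> (x 1) (x 2) : cr V" using assms(1) lin_closed by metis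
 fix i :: nat assume "i : {1..2}"
 then have i: "i = 1 \<or> i = 2" by auto
 show "\<beta> ((x(i := a +[A] b)) 1) ((x(i := a +[A] b)) 2) =
   \<beta> ((x(i := a)) 1) ((x(i := a)) 2) +[V] \<beta> ((x(i := b)) 1) ((x(i := b)) 2)"
  if "a : cr A" "b : cr A" for a b
  using i lin_add[OF assms(1)[OF x(1)] that] lin_add[OF assms(2)[OF x(2)] that] by auto
 show "\<beta> ((x(i := c .[A] a)) 1) ((x(i := c .[A] a)) 2) = c .[V] \<beta> ((x(i := a)) 1) ((x(i := a)) 2)"
  if "a : cr A" "c : cr K" for a c
  using i lin_smult[OF assms(1)[OF x(1)] that(2,1)] lin_smult[OF assms(2)[OF x(2)] that(2,1)] by auto
qed

lemma mlin3I:
 assumes "!!a b. a : cr A ==> b : cr A ==> \<beta> a b : module_hom K A V"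
  "!!a b. a : cr A ==> b : cr A ==> (%d. \<beta> a d b) : module_hom K A V"
  "!!a b. a : cr A ==> b : cr A ==> (%d. \<beta> d a b) : module_hom K A V"
 shows "mlin A 3 V (%x. \<beta> (x 1) (x 2) (x 3))"
proof (rule mlinI)
 fix x assume "x : tup A 3"
 then have x: "x 1 : cr A" "x 2 : cr A" "x 3 : cr A" by (auto simp: PiE_iff)
 then show "\<beta> (x 1) (x 2) (x 3) : cr V" using assms(1) lin_closed by metis
 fix i :: nat assume "i : {1..3}"
 then have i: "i = 1 \<or> i = 2 \<or> i = 3" by auto
 show "\<beta> ((x(i := a +[A] b)) 1) ((x(i := a +[A] b)) 2) ((x(i := a +[A] b)) 3) =
   \<beta> ((x(i := a)) 1) ((x(i := a)) 2) ((x(i := a)) 3) +[V] \<beta> ((x(i := b)) 1) ((x(i := b)) 2) ((x(i := b)) 3)"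
  if "a : cr A" "b : cr A" for a b
  using i lin_add[OF assms(1)[OF x(1,2)] that] lin_add[OF assms(2)[OF x(1,3)] that]
   lin_add[OF assms(3)[OF x(2,3)] that] by auto
 show "\<beta> ((x(i := c .[A] a)) 1) ((x(i := c .[A] a)) 2) ((x(i := c .[A] a)) 3) =
   c .[V] \<beta> ((x(i := a)) 1) ((x(i := a)) 2) ((x(i := a)) 3)"
  if "a : cr A" "c : cr K" for a c
  using i lin_smult[OF assms(1)[OF x(1,2)] that(2,1)] lin_smult[OF assms(2)[OF x(1,3)] that(2,1)]
   lin_smult[OF assms(3)[OF x(2,3)] that(2,1)] by auto
qed

lemma tup_list: "(\<lambda>i\<in>{1..length xs}. xs ! (i - 1)) : tup A (length xs)" if "set xs <= cr A"
 using that by (auto simp: PiE_iff subset_iff)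

lemma tens_list_closed: "kalg K A ==> set xs <= cr A ==> tens_list K A xs : cr (tpow A (length xs))"
 unfolding tens_list_def by (intro tens_closed tup_list)

lemma tens_list2_closed [simp]:
 "kalg K A ==> a : cr A ==> b : cr A ==> tens_list K A [a, b] : cr (tpow A 2)"
 using tens_list_closed[of A "[a, b]"] by (simp add: numeral_2_eq_2)

lemma tens_list3_closed [simp]:
 "kalg K A ==> a : cr A ==> b : cr A ==> c : cr A ==>
  tens_list K A [a, b, c] : cr (tpow A 3)"
 using tens_list_closed[of A "[a, b, c]"] by (simp add: numeral_3_eq_3)

lemma tens_list2:
 assumes "x : tup A 2" shows "tens K A 2 x = tens_list K A [x 1, x 2]"
proof -
 have "(\<lambda>i\<in>{1..length [x 1, x 2]}. [x 1, x 2] ! (i - 1)) = x"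
  using assms by (intro ext) (auto simp: PiE_iff extensional_def nth_Cons' numeral_2_eq_2 One_nat_def le_Suc_eq)
 then show ?thesis unfolding tens_list_def by (simp add: numeral_2_eq_2)
qed

lemma tens_list3:
 assumes "x : tup A 3" shows "tens K A 3 x = tens_list K A [x 1, x 2, x 3]"
proof -
 have "(\<lambda>i\<in>{1..length [x 1, x 2, x 3]}. [x 1, x 2, x 3] ! (i - 1)) = x"
  using assms by (intro ext) (auto simp: PiE_iff extensional_def nth_Cons' numeral_2_eq_2 numeral_3_eq_3 One_nat_def le_Suc_eq)
 then show ?thesis unfolding tens_list_def by (simp add: numeral_3_eq_3)
qed

lemma tens_lift2:
 assumes "kalg K A" "kalg K V" "mlin A 2 V \<phi>" "a : cr A" "b : cr A"
 shows "tens_lift K V \<phi> (tens_list K A [a, b]) = \<phi> (\<lambda>i\<in>{1..2}. [a, b] ! (i - 1))"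
 using tens_lift_tens[OF assms(1-3), of "\<lambda>i\<in>{1..2}. [a, b] ! (i - 1)"] tup_list[of "[a, b]" A] assms(4,5)
 by (simp add: tens_list_def numeral_2_eq_2)

lemma tens_lift3:
 assumes "kalg K A" "kalg K V" "mlin A 3 V \<phi>" "a : cr A" "b : cr A" "c : cr A"
 shows "tens_lift K V \<phi> (tens_list K A [a, b, c]) = \<phi> (\<lambda>i\<in>{1..3}. [a, b, c] ! (i - 1))"
 using tens_lift_tens[OF assms(1-3), of "\<lambda>i\<in>{1..3}. [a, b, c] ! (i - 1)"] tup_list[of "[a, b, c]" A] assms(4-6)
 by (simp add: tens_list_def numeral_3_eq_3)

lemma tensor2_induct [consumes 2, case_names tens smult add]:
 assumes "kalg K A" "t : cr (tpow A 2)"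
  "!!a b. a : cr A ==> b : cr A ==> P (tens_list K A [a, b])"
  "!!c t. c : cr K ==> t : cr (tpow A 2) ==> P t ==> P (c .[tpow A 2] t)"
  "!!t u. t : cr (tpow A 2) ==> u : cr (tpow A 2) ==> P t ==> P u ==> P (t +[tpow A 2] u)"
 shows "P t"
 using assms(1,2)
proof (induction rule: tensor_induct_rule)
 case (tens x)
 then show ?case unfolding tens_list2[OF tens] by (intro assms(3)) (auto simp: PiE_iff)
qed (use assms(4,5) in blast)+

lemma lin_eq_tens2:
 assumes "kalg K A" "F : module_hom K (tpow A 2) V" "G : module_hom K (tpow A 2) V"
  "!!a b. a : cr A ==> b : cr A ==> F (tens_list K A [a, b]) = G (tens_list K A [a, b])"
  "t : cr (tpow A 2)"
 shows "F t = G t"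
 using assms(1,5)
 by (induction rule: tensor2_induct)
  (simp_all add: assms(4) lin_add[OF assms(2)] lin_add[OF assms(3)] lin_smult[OF assms(2)] lin_smult[OF assms(3)])

text \<open>\<open>x\<^sub>1 \<otimes> \<dots> \<otimes> x\<^sub>n \<mapsto> f\<^sub>1(x\<^sub>1) \<cdots> f\<^sub>n(x\<^sub>n)\<close>\<close>

definition thom :: "nat => ('k, 't, 'w) module_scheme => (nat => 'a => 't) => ('k, 'a) tensor => 't" where
 "thom n T fs = tens_lift K T (%x. list_prod T (map (%i. fs i (x i)) [1..<Suc n]))"

subsection \<open>The embeddings into a tensor power\<close>

context
 fixes A :: "('k, 'a, 'z) module_scheme" and n :: nat
 assumes A: "kalg K A"
begin

lemma tens_emb_upd: "i : {1..n} ==> tens_emb K A n i a = tens K A n ((\<lambda>j\<in>{1..n}. \<one>[A])(i := a))"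
 unfolding tens_emb_def by (rule arg_cong[where f = "tens K A n"]) auto

lemma one_tup: "(\<lambda>j\<in>{1..n}. \<one>[A]) : tup A n"
 using A by auto

lemma emb_tup: "a : cr A ==> (\<lambda>j\<in>{1..n}. if j = i then a else \<one>[A]) : tup A n"
 using A by auto

lemma tens_emb_hom: "i : {1..n} ==> tens_emb K A n i : alg_hom K A (tpow A n)"
proof (rule alg_homI[OF module_homI])
 assume i: "i : {1..n}"
 show "tens_emb K A n i a : cr (tpow A n)" if "a : cr A" for a
  unfolding tens_emb_def by (rule tens_closed[OF A emb_tup[OF that]])
 show "tens_emb K A n i (a +[A] b) = tens_emb K A n i a +[tpow A n] tens_emb K A n i b"
  if "a : cr A" "b : cr A" for a b
  unfolding tens_emb_upd[OF i] by (rule mlinD(2)[OF tens_mlin[OF A] one_tup i that])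
 show "tens_emb K A n i (c .[A] a) = c .[tpow A n] tens_emb K A n i a"
  if "c : cr K" "a : cr A" for c a
  unfolding tens_emb_upd[OF i] by (rule mlinD(3)[OF tens_mlin[OF A] one_tup i that(2,1)])
 show "tens_emb K A n i (a *[A] b) = tens_emb K A n i a *[tpow A n] tens_emb K A n i b"
  if "a : cr A" "b : cr A" for a b
  unfolding tens_emb_def tens_mult[OF A emb_tup[OF that(1)] emb_tup[OF that(2)]]
  using A by (intro arg_cong[where f = "tens K A n"]) auto
 show "tens_emb K A n i \<one>[A] = \<one>[tpow A n]"
  unfolding tens_emb_def tens_one[OF A] by (intro arg_cong[where f = "tens K A n"]) auto
qed

lemma tens_emb_closed: "i : {1..n} ==> a : cr A ==> tens_emb K A n i a : cr (tpow A n)"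
 by (rule ah_closed[OF tens_emb_hom])

lemma tens_emb_comm:
 assumes "i ~= j" "a : cr A" "b : cr A"
 shows "tens_emb K A n i a *[tpow A n] tens_emb K A n j b = tens_emb K A n j b *[tpow A n] tens_emb K A n i a"
 unfolding tens_emb_def tens_mult[OF A emb_tup[OF assms(2)] emb_tup[OF assms(3)]]
  tens_mult[OF A emb_tup[OF assms(3)] emb_tup[OF assms(2)]]
 using A assms by (intro arg_cong[where f = "tens K A n"]) auto

text \<open>Multiplying by the embedding at position k + 1 fills that position and leaves the
  earlier ones alone. The factors are therefore inserted from left to right, with 1 in all positions
  not yet reached.\<close>

lemma tens_prod:
 assumes "x : tup A n"
 shows "tens K A n x = list_prod (tpow A n) (map (%i. tens_emb K A n i (x i)) [1..<Suc n])"
proof -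
 note m = kalg_monoid[OF tensor_kalg[OF A]]
 have x: "x i : cr A" if "i : {1..n}" for i using that assms by auto
 have "list_prod (tpow A n) (map (%i. tens_emb K A n i (x i)) [1..<Suc k]) =
   tens K A n (\<lambda>i\<in>{1..n}. if i <= k then x i else \<one>[A])" if "k <= n" for k
  using that
 proof (induction k)
  case 0
  then show ?case using A by (auto simp: tens_one One_nat_def intro!: arg_cong[where f = "tens K A n"])
 next
  case (Suc k)
  let ?y = "\<lambda>i\<in>{1..n}. if i <= k then x i else \<one>[A]"
  have y: "?y : tup A n" using x A by auto
  have k: "Suc k : {1..n}" using Suc by auto
  have z: "(\<lambda>j\<in>{1..n}. if j = Suc k then x (Suc k) else \<one>[A]) : tup A n" by (rule emb_tup[OF x[OF k]])
  have c: "set (map (%i. tens_emb K A n i (x i)) [1..<Suc k]) <= cr (tpow A n)"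
   using Suc.prems x by (auto intro!: tens_emb_closed)
  have "[1..<Suc (Suc k)] = [1..<Suc k] @ [Suc k]" by (simp add: One_nat_def upt_Suc)
  then have "list_prod (tpow A n) (map (%i. tens_emb K A n i (x i)) [1..<Suc (Suc k)]) =
    list_prod (tpow A n) (map (%i. tens_emb K A n i (x i)) [1..<Suc k]) *[tpow A n]
    list_prod (tpow A n) [tens_emb K A n (Suc k) (x (Suc k))]"
   using list_prod_append[OF m c, of "[tens_emb K A n (Suc k) (x (Suc k))]"] tens_emb_closed[OF k x[OF k]] by simp
  also have "... = tens K A n ?y *[tpow A n] tens_emb K A n (Suc k) (x (Suc k))"
   by (simp only: Suc.IH[OF Suc_leD[OF Suc.prems]] list_prod_Cons list_prod_Nil
     ka_basic(1)[OF tensor_kalg[OF A]] tens_emb_closed[OF k x[OF k]])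
  also have "... = tens K A n (\<lambda>i\<in>{1..n}. if i <= Suc k then x i else \<one>[A])"
   unfolding tens_emb_def tens_mult[OF A y z]
   using A x by (intro arg_cong[where f = "tens K A n"]) (auto simp: fun_eq_iff le_Suc_eq)
  finally show ?case .
 qed
 from this[of n] have "list_prod (tpow A n) (map (%i. tens_emb K A n i (x i)) [1..<Suc n]) =
   tens K A n (\<lambda>i\<in>{1..n}. if i <= n then x i else \<one>[A])" by simp
 also have "(\<lambda>i\<in>{1..n}. if i <= n then x i else \<one>[A]) = x"
  using assms by (auto simp: fun_eq_iff PiE_iff extensional_def)
 finally show ?thesis by simp
qed

text \<open>By \<open>tens_prod\<close> every elementary tensor is a product of embedded elements.
  Comparisons of algebra maps on tensor powers rest on this.\<close>

lemma tensor_gens: "gens K (tpow A n) {tens_emb K A n i a | i a. i : {1..n} & a : cr A}" (is "gens K _ ?X")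
proof (rule gensI)
 show "?X <= cr (tpow A n)" using tens_emb_closed by auto
 fix Y t assume Y: "?X <= Y" "Y <= cr (tpow A n)" "\<one>[tpow A n] : Y"
  "!!a b. a : Y ==> b : Y ==> a +[tpow A n] b : Y" "!!a b. a : Y ==> b : Y ==> a *[tpow A n] b : Y"
  "!!c a. c : cr K ==> a : Y ==> c .[tpow A n] a : Y" and "t : cr (tpow A n)"
 from A this(7) show "t : Y"
 proof (induction rule: tensor_induct_rule)
  case (tens x)
  have lp: "list_prod (tpow A n) xs : Y" if "set xs <= Y" for xs using that by (induction xs) (auto simp: Y(3,5))
  have "tens_emb K A n i (x i) : Y" if "i : {1..n}" for i
   using that tens by (intro subsetD[OF Y(1)]) blast
  then show ?case unfolding tens_prod[OF tens] by (intro lp) auto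
 qed (simp_all add: Y)
qed

lemma tensor_hom_eqI:
 assumes "F : alg_hom K (tpow A n) T" "G : alg_hom K (tpow A n) T"
  "!!i a. i : {1..n} ==> a : cr A ==> F (tens_emb K A n i a) = G (tens_emb K A n i a)" "t : cr (tpow A n)"
 shows "F t = G t"
 by (rule alg_hom_eq_gens[OF assms(1,2) tensor_kalg[OF A] tensor_gens _ assms(4)]) (use assms(3) in auto)

context
 fixes T :: "('k, 't, 'w) module_scheme" and fs :: "nat => 'a => 't"
 assumes T: "kalg K T"
begin

lemma thom_mlin:
 assumes fs: "!!i. i : {1..n} ==> fs i : module_hom K A T"
 shows "mlin A n T (%x. list_prod T (map (%i. fs i (x i)) [1..<Suc n]))"
proof (rule mlinI)
 note m = kalg_monoid[OF T]
 have c: "list_prod T (map (%i. fs i (x i)) [k..<l]) : cr T"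
  if "x : tup A n" "1 <= k" "l <= Suc n" for x k l
  using that by (intro list_prod_closed[OF m]) (auto intro!: lin_closed[OF fs])
 show "list_prod T (map (%i. fs i (x i)) [1..<Suc n]) : cr T" if "x : tup A n" for x
  by (intro c that) auto
 fix x i assume x: "x : tup A n" and i: "i : {1..n}"
 \<comment> \<open>The factors before and after position i do not involve the coordinate that
   varies.\<close>
 define P Q where "P = list_prod T (map (%i. fs i (x i)) [1..<i])" and "Q = list_prod T (map (%i. fs i (x i)) [Suc i..<Suc n])"
 have PQ: "P : cr T" "Q : cr T" unfolding P_def Q_def using i by (auto intro!: c x)
 have "list_prod T (map (%j. fs j ((x(i := a)) j)) [1..<Suc n]) = P *[T] (fs i a *[T] Q)" if a: "a : cr A" for a
 proof -
  have "[1..<Suc n] = [1..<i] @ [i..<Suc n]" "[i..<Suc n] = i # [Suc i..<Suc n]"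
   using i upt_add_eq_append[of 1 i "Suc n - i"] upt_conv_Cons[of i "Suc n"] by auto
  then have "map (%j. fs j ((x(i := a)) j)) [1..<Suc n] =
    map (%j. fs j ((x(i := a)) j)) [1..<i] @ fs i a # map (%j. fs j ((x(i := a)) j)) [Suc i..<Suc n]"
   by simp
  also have "map (%j. fs j ((x(i := a)) j)) [1..<i] = map (%j. fs j (x j)) [1..<i]" by simp
  also have "map (%j. fs j ((x(i := a)) j)) [Suc i..<Suc n] = map (%j. fs j (x j)) [Suc i..<Suc n]" by simp
  finally show ?thesis
   using i x a by (simp only: P_def Q_def list_prod_Cons, subst list_prod_append[OF m])
    (auto intro!: lin_closed[OF fs] simp: One_nat_def)
 qed
 moreover note f = lin_const_right[OF T lin_const_left[OF T fs[OF i] PQ(2)] PQ(1)]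
 ultimately show
  "list_prod T (map (%j. fs j ((x(i := a +[A] b)) j)) [1..<Suc n]) =
   list_prod T (map (%j. fs j ((x(i := a)) j)) [1..<Suc n]) +[T] list_prod T (map (%j. fs j ((x(i := b)) j)) [1..<Suc n])"
  if "a : cr A" "b : cr A" for a b
  using lin_add[OF f that] that A by (simp only: ka_closed)
 show "list_prod T (map (%j. fs j ((x(i := d .[A] a)) j)) [1..<Suc n]) =
   d .[T] list_prod T (map (%j. fs j ((x(i := a)) j)) [1..<Suc n])"
  if "a : cr A" "d : cr K" for a d
  using lin_smult[OF f that(2,1)] that A \<open>!!a. a : cr A ==> _ = P *[T] (fs i a *[T] Q)\<close>
  by (simp only: ka_closed)
qed

text \<open>Commuting images let the factors be regrouped, so algebra maps on the single positions
  combine to one on the tensor power. This is the universal property of a tensor power of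
  algebras.\<close>

lemma thom_hom:
 assumes fs: "!!i. i : {1..n} ==> fs i : alg_hom K A T"
  and com: "!!i j a b. i : {1..n} ==> j : {1..n} ==> i ~= j ==> a : cr A ==> b : cr A ==>
   fs i a *[T] fs j b = fs j b *[T] fs i a"
 shows "thom n T fs : alg_hom K (tpow A n) T"
  "i : {1..n} ==> a : cr A ==> thom n T fs (tens_emb K A n i a) = fs i a"
proof -
 note ml = thom_mlin[OF ah_lin[OF fs]]
 show "thom n T fs : alg_hom K (tpow A n) T"
  unfolding thom_def
 proof (rule tens_lift_hom[OF A T ml])
  fix x y assume xy: "x : tup A n" "y : tup A n"
  then have c: "x i : cr A" "y i : cr A" if "i : {1..n}" for i using that by auto
  have "map (%i. fs i ((\<lambda>i\<in>{1..n}. x i *[A] y i) i)) [1..<Suc n] =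
    map (%i. fs i (x i) *[T] fs i (y i)) [1..<Suc n]"
   using c by (auto simp: ah_mult[OF fs])
  also have "list_prod T ... = list_prod T (map (%i. fs i (x i)) [1..<Suc n]) *[T]
    list_prod T (map (%i. fs i (y i)) [1..<Suc n])"
  proof (rule list_prod_mult[OF kalg_monoid[OF T] distinct_upt])
   fix i j assume ij: "i : set [1..<Suc n]" "j : set [1..<Suc n]" "i ~= j"
   then have "i : {1..n}" "j : {1..n}" by auto
   then show "fs i (x i) *[T] fs j (y j) = fs j (y j) *[T] fs i (x i)"
    using c by (intro com ij(3)) auto
  next
   fix i assume "i : set [1..<Suc n]"
   then have "i : {1..n}" by auto
   then show "fs i (x i) : cr T & fs i (y i) : cr T" using c ah_closed[OF fs] by blast
  qed
  finally show "list_prod T (map (%i. fs i ((\<lambda>i\<in>{1..n}. x i *[A] y i) i)) [1..<Suc n]) =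
   list_prod T (map (%i. fs i (x i)) [1..<Suc n]) *[T] list_prod T (map (%i. fs i (y i)) [1..<Suc n])" .
 next
  show "list_prod T (map (%i. fs i ((\<lambda>i\<in>{1..n}. \<one>[A]) i)) [1..<Suc n]) = \<one>[T]"
   by (rule list_prod_one[OF kalg_monoid[OF T]]) (auto simp: ah_one[OF fs])
 qed
 show "thom n T fs (tens_emb K A n i a) = fs i a" if i: "i : {1..n}" and a: "a : cr A"
 proof -
  have "thom n T fs (tens_emb K A n i a) =
    list_prod T (map (%j. fs j ((\<lambda>j\<in>{1..n}. if j = i then a else \<one>[A]) j)) [1..<Suc n])"
   unfolding thom_def tens_emb_def by (rule tens_lift_tens[OF A T ml emb_tup[OF a]])
  also have "... = fs i ((\<lambda>j\<in>{1..n}. if j = i then a else \<one>[A]) i)"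
   using i a by (intro list_prod_single[OF kalg_monoid[OF T]])
    (auto simp: ah_one[OF fs] intro!: ah_closed[OF fs])
  finally show ?thesis using i by simp
 qed
qed

end

lemma tens_perm_hom:
 assumes w: "w permutes {1..n}"
 shows "tens_perm K A n w : alg_hom K (tpow A n) (tpow A n)"
  "i : {1..n} ==> a : cr A ==> tens_perm K A n w (tens_emb K A n i a) = tens_emb K A n (w i) a"
  "x : tup A n ==> tens_perm K A n w (tens K A n x) = tens K A n (\<lambda>i\<in>{1..n}. x (inv' w i))"
proof -
 have iw: "inv' w i : {1..n} \<longleftrightarrow> i : {1..n}" "w i : {1..n} \<longleftrightarrow> i : {1..n}" "inv' w i = j \<longleftrightarrow> i = w j" for i j
  using w permutes_inv[OF w] by (auto simp: permutes_in_image permutes_inv_eq simp del: atLeastAtMost_iff)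
 define p where "p x = (\<lambda>i\<in>{1..n}. x (inv' w i))" for x :: "nat => 'a"
 have p: "p x : tup A n" if "x : tup A n" for x
  using that iw(1) by (auto simp: p_def PiE_iff simp del: atLeastAtMost_iff)
 \<comment> \<open>Varying coordinate i before permuting means varying coordinate w(i) afterwards,
   so the permuted tensor is again multilinear.\<close>
 have pu: "p (x(i := a)) = (p x)(w i := a)" if "i : {1..n}" for x i a
  using that iw by (auto simp: p_def fun_eq_iff simp del: atLeastAtMost_iff)
 have ml: "mlin A n (tpow A n) (%x. tens K A n (p x))"
 proof (rule mlinI)
  fix x i assume x: "x : tup A n" "i : {1..n}"
  then have wi: "w i : {1..n}" using iw by blast
  show "tens K A n (p (x(i := a +[A] b))) = tens K A n (p (x(i := a))) +[tpow A n] tens K A n (p (x(i := b)))"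
   if "a : cr A" "b : cr A" for a b
   unfolding pu[OF x(2)] by (rule mlinD(2)[OF tens_mlin[OF A] p[OF x(1)] wi that])
  show "tens K A n (p (x(i := c .[A] a))) = c .[tpow A n] tens K A n (p (x(i := a)))"
   if "a : cr A" "c : cr K" for a c
   unfolding pu[OF x(2)] by (rule mlinD(3)[OF tens_mlin[OF A] p[OF x(1)] wi that])
 qed (rule tens_closed[OF A p])
 have e: "tens_perm K A n w = tens_lift K (tpow A n) (%x. tens K A n (p x))"
  by (simp add: tens_perm_def p_def)
 show "tens_perm K A n w : alg_hom K (tpow A n) (tpow A n)"
  unfolding e
 proof (rule tens_lift_hom[OF A tensor_kalg[OF A] ml])
  fix x y assume xy: "x : tup A n" "y : tup A n"
  have "p (\<lambda>i\<in>{1..n}. x i *[A] y i) = (\<lambda>i\<in>{1..n}. p x i *[A] p y i)"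
   using iw by (auto simp: p_def fun_eq_iff simp del: atLeastAtMost_iff)
  then show "tens K A n (p (\<lambda>i\<in>{1..n}. x i *[A] y i)) = tens K A n (p x) *[tpow A n] tens K A n (p y)"
   by (simp add: tens_mult[OF A p[OF xy(1)] p[OF xy(2)]])
 next
  have "p (\<lambda>i\<in>{1..n}. \<one>[A]) = (\<lambda>i\<in>{1..n}. \<one>[A])"
   using iw by (auto simp: p_def fun_eq_iff simp del: atLeastAtMost_iff)
  then show "tens K A n (p (\<lambda>i\<in>{1..n}. \<one>[A])) = \<one>[tpow A n]" by (simp add: tens_one[OF A])
 qed
 show t: "tens_perm K A n w (tens K A n x) = tens K A n (\<lambda>i\<in>{1..n}. x (inv' w i))" if "x : tup A n" for x
  unfolding e p_def[symmetric] by (rule tens_lift_tens[OF A tensor_kalg[OF A] ml that])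
 show "tens_perm K A n w (tens_emb K A n i a) = tens_emb K A n (w i) a" if "i : {1..n}" "a : cr A"
  unfolding tens_emb_def t[OF emb_tup[OF that(2)]]
  using iw that by (intro arg_cong[where f = "tens K A n"]) (auto simp: fun_eq_iff simp del: atLeastAtMost_iff)
qed

end

lemma tens_list_emb2:
 assumes A: "kalg K A" "a : cr A" "b : cr A"
 shows "tens_list K A [a, b] = tens_emb K A 2 1 a *[tpow A 2] tens_emb K A 2 2 b"
proof -
 have u: "[1..<3] = [1, 2::nat]" by (simp add: upt_conv_Cons)
 have "(\<lambda>i\<in>{1..2}. if i = 1 then a else b) : tup A 2" using A by auto
 from tens_list2[OF this] tens_prod[OF A(1) this] show ?thesis
  using A tens_emb_closed[OF A(1), of 2 2 b] by (simp add: u)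
qed

lemma tens_list_emb3:
 assumes A: "kalg K A" "a : cr A" "b : cr A" "c : cr A"
 shows "tens_list K A [a, b, c] = tens_emb K A 3 1 a *[tpow A 3] tens_emb K A 3 2 b *[tpow A 3] tens_emb K A 3 3 c"
proof -
 have u: "[1..<4] = [1, 2, 3::nat]" by (simp add: upt_conv_Cons)
 have "(\<lambda>i\<in>{1..3}. if i = 1 then a else if i = 2 then b else c) : tup A 3" using A by auto
 from tens_list3[OF this] tens_prod[OF A(1) this] show ?thesis
  using A tens_emb_closed[OF A(1), of 3 3 c] tens_emb_closed[OF A(1), of 2 3 b] tens_emb_closed[OF A(1), of 1 3 a]
  by (simp add: u ka_assoc)
qed

subsection \<open>Products of linear maps\<close>

text \<open>The linear map x \<otimes> y \<mapsto> u(x) v(y). Applied to \<Delta>(a) it is the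
  convolution of u and v at a; applied to J it evaluates the twist along u and v.\<close>

definition cv :: "('k, 't, 'w) module_scheme => ('a => 't) => ('a => 't) => ('k, 'a) tensor => 't" where
 "cv T u v = tens_lift K T (%x. u (x 1) *[T] v (x 2))"

text \<open>Elementwise commuting images: the condition under which \<open>cv T u v\<close> inherits
  multiplicativity from u and v.\<close>

definition com :: "('k, 'a, 'z) module_scheme => ('k, 't, 'w) module_scheme => ('a => 't) => ('a => 't) => bool" where
 "com A T u v \<longleftrightarrow> (ALL a:cr A. ALL b:cr A. u a *[T] v b = v b *[T] u a)"

lemma comI: "(!!a b. a : cr A ==> b : cr A ==> u a *[T] v b = v b *[T] u a) ==> com A T u v"
 and comD: "com A T u v ==> a : cr A ==> b : cr A ==> u a *[T] v b = v b *[T] u a"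
 by (simp_all add: com_def)

lemma com_sym: "com A T u v ==> com A T v u"
 by (simp add: com_def)

context
 fixes A :: "('k, 'a, 'z) module_scheme" and T :: "('k, 't, 'w) module_scheme"
 assumes A: "kalg K A" and T: "kalg K T"
begin

lemma cv_mlin:
 assumes "u : module_hom K A T" "v : module_hom K A T"
 shows "mlin A 2 T (%x. u (x 1) *[T] v (x 2))"
proof (rule mlin2I[where \<beta> = "%a b. u a *[T] v b"])
 show "(%b. u a *[T] v b) : module_hom K A T" if "a : cr A" for a
  by (rule lin_const_right[OF T assms(2) lin_closed[OF assms(1) that]])
 show "(%a. u a *[T] v b) : module_hom K A T" if "b : cr A" for b
  by (rule lin_const_left[OF T assms(1) lin_closed[OF assms(2) that]])
qed

lemma cv_lin: "u : module_hom K A T ==> v : module_hom K A T ==> cv T u v : module_hom K (tpow A 2) T"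
 unfolding cv_def by (intro tens_lift_lin A T cv_mlin)

lemma cv_closed: "u : module_hom K A T ==> v : module_hom K A T ==> X : cr (tpow A 2) ==> cv T u v X : cr T"
 by (rule lin_closed[OF cv_lin])

lemma cv_tens:
 "u : module_hom K A T ==> v : module_hom K A T ==> a : cr A ==> b : cr A ==>
  cv T u v (tens_list K A [a, b]) = u a *[T] v b"
 unfolding cv_def by (subst tens_lift2[OF A T cv_mlin]) (auto simp: nth_Cons')

lemma cv_eqI:
 assumes "u : module_hom K A T" "v : module_hom K A T" "F : module_hom K (tpow A 2) T"
  "!!a b. a : cr A ==> b : cr A ==> F (tens_list K A [a, b]) = u a *[T] v b" "X : cr (tpow A 2)"
 shows "F X = cv T u v X"
 by (rule lin_eq_tens2[OF A assms(3) cv_lin[OF assms(1,2)] _ assms(5)])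
  (simp add: assms(4) cv_tens[OF assms(1,2)])

lemma cv_cong:
 assumes "u : module_hom K A T" "v : module_hom K A T" "X : cr (tpow A 2)"
  "!!a. a : cr A ==> u a = u' a" "!!a. a : cr A ==> v a = v' a"
 shows "cv T u v X = cv T u' v' X"
proof (rule cv_eqI[OF _ _ cv_lin[OF assms(1,2)] _ assms(3)])
 show "u' : module_hom K A T" "v' : module_hom K A T"
  using lin_cong[OF assms(1,4) kalg_ring[OF A] kalg_module[OF A]]
   lin_cong[OF assms(2,5) kalg_ring[OF A] kalg_module[OF A]] by auto
qed (simp add: cv_tens[OF assms(1,2)] assms(4,5))

lemma cv_commute:
 assumes "u : module_hom K A T" "v : module_hom K A T" "X : cr (tpow A 2)" "z : cr T"
  "!!a. a : cr A ==> z *[T] u a = u a *[T] z" "!!a. a : cr A ==> z *[T] v a = v a *[T] z"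
 shows "z *[T] cv T u v X = cv T u v X *[T] z"
proof (rule lin_eq_tens2[OF A lin_const_right[OF T cv_lin[OF assms(1,2)] assms(4)]
  lin_const_left[OF T cv_lin[OF assms(1,2)] assms(4)] _ assms(3)])
 fix a b assume ab: "a : cr A" "b : cr A"
 note c = lin_closed[OF assms(1) ab(1)] lin_closed[OF assms(2) ab(2)] assms(4)
 have "z *[T] (u a *[T] v b) = u a *[T] (z *[T] v b)"
  using c T assms(5)[OF ab(1)] by (simp flip: ka_assoc[OF T])
 then show "z *[T] cv T u v (tens_list K A [a, b]) = cv T u v (tens_list K A [a, b]) *[T] z"
  using c T ab assms(6)[OF ab(2)] by (simp add: cv_tens[OF assms(1,2)] ka_assoc[OF T])
qed

lemma cv_hom:
 assumes u: "u : alg_hom K A T" and v: "v : alg_hom K A T" and com: "com A T u v"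
 shows "cv T u v : alg_hom K (tpow A 2) T"
  "a : cr A ==> cv T u v (tens_emb K A 2 1 a) = u a"
  "a : cr A ==> cv T u v (tens_emb K A 2 2 a) = v a"
proof -
 note l = ah_lin[OF u] ah_lin[OF v] and c = ah_closed[OF u] ah_closed[OF v]
 show "cv T u v : alg_hom K (tpow A 2) T"
  unfolding cv_def
 proof (rule tens_lift_hom[OF A T cv_mlin[OF l]])
  fix x y assume "x : tup A 2" "y : tup A 2"
  then have xy: "x 1 : cr A" "x 2 : cr A" "y 1 : cr A" "y 2 : cr A"
   by (auto simp: PiE_iff)
  have "u (x 1) *[T] u (y 1) *[T] (v (x 2) *[T] v (y 2)) =
    u (x 1) *[T] (u (y 1) *[T] v (x 2)) *[T] v (y 2)"
   using T c xy by (simp add: ka_assoc)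
  also have "... = u (x 1) *[T] v (x 2) *[T] (u (y 1) *[T] v (y 2))"
   unfolding comD[OF com xy(3,2)] using T c xy by (simp add: ka_assoc)
  finally show "u ((\<lambda>i\<in>{1..2}. x i *[A] y i) 1) *[T] v ((\<lambda>i\<in>{1..2}. x i *[A] y i) 2) =
   u (x 1) *[T] v (x 2) *[T] (u (y 1) *[T] v (y 2))"
   using xy by (simp add: ah_mult[OF u] ah_mult[OF v])
 qed (use T in \<open>simp add: ah_one[OF u] ah_one[OF v]\<close>)
 have e: "tens_emb K A 2 1 a = tens_list K A [a, \<one>[A]]" "tens_emb K A 2 2 a = tens_list K A [\<one>[A], a]"
  if "a : cr A" for a
  using that A tens_emb_closed[OF A, of 1 2 a] tens_emb_closed[OF A, of 2 2 a]
   ah_one[OF tens_emb_hom[OF A], of 1 2] ah_one[OF tens_emb_hom[OF A], of 2 2]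
  by (simp_all add: tens_list_emb2)
 show "cv T u v (tens_emb K A 2 1 a) = u a" "cv T u v (tens_emb K A 2 2 a) = v a" if "a : cr A"
  using that A T c by (simp_all add: e cv_tens[OF l] ah_one[OF u] ah_one[OF v])
qed

end

lemma tens_lift_cong:
 assumes "kalg K A" "kalg K V" "mlin A n V \<phi>" "!!x. x : tup A n ==> \<phi> x = \<psi> x"
 shows "mlin A n V \<psi>" "t : cr (tpow A n) ==> tens_lift K V \<phi> t = tens_lift K V \<psi> t"
proof -
 show m: "mlin A n V \<psi>"
 proof (rule mlinI)
  show "\<psi> x : cr V" if "x : tup A n" for x
   using mlinD(1)[OF assms(3) that] assms(4)[OF that] by simp
  fix x i a assume x: "x : tup A n" and i: "i : {1..n}" and a: "a : cr A"
  note u = upd_tuple[OF x i, THEN assms(4), symmetric]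
  show "\<psi> (x(i := a +[A] b)) = \<psi> (x(i := a)) +[V] \<psi> (x(i := b))" if b: "b : cr A" for b
   using mlinD(2)[OF assms(3) x i a b] u[OF a] u[OF b] u[OF ka_closed(2)[OF assms(1) a b]] by simp
  show "\<psi> (x(i := c .[A] a)) = c .[V] \<psi> (x(i := a))" if c: "c : cr K" for c
   using mlinD(3)[OF assms(3) x i a c] u[OF a] u[OF ka_closed(4)[OF assms(1) c a]] by simp
 qed
 show "tens_lift K V \<phi> t = tens_lift K V \<psi> t" if "t : cr (tpow A n)"
  by (rule lin_eq_tens[OF assms(1) tens_lift_lin[OF assms(1-3)] tens_lift_lin[OF assms(1,2) m] _ that])
   (simp add: assms(4) tens_lift_tens[OF assms(1-3)] tens_lift_tens[OF assms(1,2) m])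
qed

lemma lin_cv:
 assumes "kalg K A" "kalg K T" "kalg K T'" "h : alg_hom K T T'" "u : module_hom K A T" "v : module_hom K A T"
  "X : cr (tpow A 2)"
 shows "h (cv T u v X) = cv T' (%a. h (u a)) (%a. h (v a)) X"
proof (rule cv_eqI[OF assms(1,3) _ _ lin_comp[OF cv_lin[OF assms(1,2,5,6)] ah_lin[OF assms(4)]] _ assms(7)])
 show "(%a. h (u a)) : module_hom K A T'" "(%a. h (v a)) : module_hom K A T'"
  by (intro lin_comp[OF _ ah_lin[OF assms(4)]] assms)+
qed (simp add: cv_tens[OF assms(1,2,5,6)] ah_mult[OF assms(4)] lin_closed[OF assms(5)] lin_closed[OF assms(6)])

context
 fixes A :: "('k, 'a, 'z) module_scheme" and C :: "('k, 'c, 'y) module_scheme" and f g :: "'a => 'c"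
 assumes A: "kalg K A" and C: "kalg K C" and f: "f : module_hom K A C" and g: "g : module_hom K A C"
begin

lemma emb_lin:
 "(%a. tens_emb K C 2 1 (f a)) : module_hom K A (tpow C 2)" "(%a. tens_emb K C 2 2 (g a)) : module_hom K A (tpow C 2)"
 by (rule lin_comp[OF f ah_lin[OF tens_emb_hom[OF C]]] lin_comp[OF g ah_lin[OF tens_emb_hom[OF C]]], simp)+

lemma map2_cv:
 assumes "X : cr (tpow A 2)"
 shows "tens_map2 K C f g X = cv (tpow C 2) (%a. tens_emb K C 2 1 (f a)) (%a. tens_emb K C 2 2 (g a)) X"
 unfolding tens_map2_def cv_def
proof (rule tens_lift_cong(2)[OF A tensor_kalg[OF C] cv_mlin[OF A tensor_kalg[OF C] emb_lin] _ assms, symmetric])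
 fix x assume "x : tup A 2"
 then have "f (x 1) : cr C" "g (x 2) : cr C"
  by (auto intro!: lin_closed[OF f] lin_closed[OF g] simp: PiE_iff)
 then show "tens_emb K C 2 1 (f (x 1)) *[tpow C 2] tens_emb K C 2 2 (g (x 2)) = tens_list K C [f (x 1), g (x 2)]"
  by (rule tens_list_emb2[OF C, symmetric])
qed

lemma map2_lin: "tens_map2 K C f g : module_hom K (tpow A 2) (tpow C 2)"
 by (rule lin_cong[OF cv_lin[OF A tensor_kalg[OF C] emb_lin] map2_cv[symmetric]])
  (auto intro: kalg_ring kalg_module tensor_kalg A)

lemma map2_tens: "a : cr A ==> b : cr A ==> tens_map2 K C f g (tens_list K A [a, b]) = tens_list K C [f a, g b]"
 using A lin_closed[OF f] lin_closed[OF g]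
 by (simp add: map2_cv cv_tens[OF A tensor_kalg[OF C] emb_lin] tens_list_emb2[OF C])

lemma cv_map2:
 assumes "kalg K T" "u : module_hom K C T" "v : module_hom K C T" "X : cr (tpow A 2)"
 shows "cv T u v (tens_map2 K C f g X) = cv T (%a. u (f a)) (%a. v (g a)) X"
 by (rule cv_eqI[OF A assms(1) _ _ lin_comp[OF map2_lin cv_lin[OF C assms(1-3)]] _ assms(4)])
  (simp_all add: lin_comp[OF f assms(2)] lin_comp[OF g assms(3)] lin_closed[OF f] lin_closed[OF g]
   map2_tens cv_tens[OF C assms(1-3)])

end

lemma map2_hom:
 assumes "kalg K A" "kalg K C" "f : alg_hom K A C" "g : alg_hom K A C"
 shows "tens_map2 K C f g : alg_hom K (tpow A 2) (tpow C 2)"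
  "a : cr A ==> tens_map2 K C f g (tens_emb K A 2 1 a) = tens_emb K C 2 1 (f a)"
  "a : cr A ==> tens_map2 K C f g (tens_emb K A 2 2 a) = tens_emb K C 2 2 (g a)"
proof -
 have h: "(%a. tens_emb K C 2 1 (f a)) : alg_hom K A (tpow C 2)" "(%a. tens_emb K C 2 2 (g a)) : alg_hom K A (tpow C 2)"
  by (rule ah_comp[OF assms(3) tens_emb_hom[OF assms(2)]] ah_comp[OF assms(4) tens_emb_hom[OF assms(2)]], simp)+
 have c: "com A (tpow C 2) (%a. tens_emb K C 2 1 (f a)) (%a. tens_emb K C 2 2 (g a))"
  by (rule comI, rule tens_emb_comm[OF assms(2)])
   (simp_all add: ah_closed[OF assms(3)] ah_closed[OF assms(4)])
 note m = map2_cv[OF assms(1,2) ah_lin[OF assms(3)] ah_lin[OF assms(4)]]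
 note cv = cv_hom[OF assms(1) tensor_kalg[OF assms(2)] h c]
 show "tens_map2 K C f g : alg_hom K (tpow A 2) (tpow C 2)"
 proof (rule alg_homI[OF map2_lin[OF assms(1,2) ah_lin[OF assms(3)] ah_lin[OF assms(4)]]])
  show "tens_map2 K C f g \<one>[tpow A 2] = \<one>[tpow C 2]"
   by (simp add: m ka_closed(6)[OF tensor_kalg[OF assms(1)]] ah_one[OF cv(1)])
 qed (simp add: m ka_closed(1)[OF tensor_kalg[OF assms(1)]] ah_mult[OF cv(1)])
 show "tens_map2 K C f g (tens_emb K A 2 1 a) = tens_emb K C 2 1 (f a)"
  "tens_map2 K C f g (tens_emb K A 2 2 a) = tens_emb K C 2 2 (g a)" if "a : cr A"
  using that by (simp_all add: m tens_emb_closed[OF assms(1)] cv(2,3))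
qed

abbreviation E3 :: "('k, 'a, 'z) module_scheme => nat => 'a => ('k, 'a) tensor" where
 "E3 A i == tens_emb K A 3 i"

context
 fixes A :: "('k, 'a, 'z) module_scheme"
 assumes A: "kalg K A"
begin

lemma E3_hom: "E3 A 1 : alg_hom K A (tpow A 3)" "E3 A 2 : alg_hom K A (tpow A 3)" "E3 A 3 : alg_hom K A (tpow A 3)"
 by (auto intro!: tens_emb_hom A)

lemmas E3_lin = E3_hom[THEN ah_lin]

lemma E3_com: "i ~= j ==> com A (tpow A 3) (E3 A i) (E3 A j)"
 by (rule comI) (rule tens_emb_comm[OF A])

text \<open>\<Delta> \<otimes> id and id \<otimes> \<Delta> are defined by a lift inside a lift. For
  trilinear \<theta> the inner lift is identified with the value at a product of embedded tensors in
  the threefold power, where the algebra structure is available.\<close>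

lemma lift3_cv:
 assumes V: "kalg K V" and \<theta>: "mlin A 3 V (%x. \<theta> (x 1) (x 2) (x 3))" and Y: "Y : cr (tpow A 2)"
  and b: "b : cr A"
 defines "\<Theta> == tens_lift K V (%x. \<theta> (x 1) (x 2) (x 3))"
 shows "\<Theta> (cv (tpow A 3) (E3 A 1) (E3 A 2) Y *[tpow A 3] E3 A 3 b) = tens_lift K V (%y. \<theta> (y 1) (y 2) b) Y"
  "\<Theta> (E3 A 1 b *[tpow A 3] cv (tpow A 3) (E3 A 2) (E3 A 3) Y) = tens_lift K V (%y. \<theta> b (y 1) (y 2)) Y"
proof -
 note A3 = tensor_kalg[OF A, of 3]
 have t3: "(\<lambda>i\<in>{1..3}. if i = 1 then c else if i = 2 then d else e) : tup A 3"
  if "c : cr A" "d : cr A" "e : cr A" for c d e using that by auto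
 note md = mlinD[OF \<theta> t3]
 have "mlin A 2 V (%y. \<theta> (y 1) (y 2) b)"
 proof (rule mlin2I[where \<beta> = "%c d. \<theta> c d b"])
  show "(%d. \<theta> c d b) : module_hom K A V" if c: "c : cr A" for c
   using md(1)[OF c _ b] md(2)[OF c b b, of 2] md(3)[OF c b b, of 2] by (intro module_homI) auto
  show "(%c. \<theta> c d b) : module_hom K A V" if d: "d : cr A" for d
   using md(1)[OF _ d b] md(2)[OF b d b, of 1] md(3)[OF b d b, of 1] by (intro module_homI) auto
 qed
 note l1 = tens_lift_lin[OF A V this] and t1 = tens_lift2[OF A V this]
 have "mlin A 2 V (%y. \<theta> b (y 1) (y 2))"
 proof (rule mlin2I[where \<beta> = "%c d. \<theta> b c d"])
  show "(%d. \<theta> b c d) : module_hom K A V" if c: "c : cr A" for c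
   using md(1)[OF b c] md(2)[OF b c b, of 3] md(3)[OF b c b, of 3] by (intro module_homI) auto
  show "(%c. \<theta> b c d) : module_hom K A V" if d: "d : cr A" for d
   using md(1)[OF b _ d] md(2)[OF b b d, of 2] md(3)[OF b b d, of 2] by (intro module_homI) auto
 qed
 note l2 = tens_lift_lin[OF A V this] and t2 = tens_lift2[OF A V this]
 have L: "\<Theta> : module_hom K (tpow A 3) V" unfolding \<Theta>_def by (rule tens_lift_lin[OF A V \<theta>])
 have T: "\<Theta> (tens_list K A [c, d, e]) = \<theta> c d e" if "c : cr A" "d : cr A" "e : cr A" for c d e
  unfolding \<Theta>_def using tens_lift3[OF A V \<theta> that] by (simp add: nth_Cons')
 have Ec: "E3 A i c : cr (tpow A 3)" if "c : cr A" "i : {1..3}" for c i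
  using tens_emb_closed[OF A that(2,1)] .
 show "\<Theta> (cv (tpow A 3) (E3 A 1) (E3 A 2) Y *[tpow A 3] E3 A 3 b) = tens_lift K V (%y. \<theta> (y 1) (y 2) b) Y"
 proof (rule lin_eq_tens2[OF A lin_comp[OF lin_const_left[OF A3 cv_lin[OF A A3 E3_lin(1,2)]] L] l1 _ Y])
  show "E3 A 3 b : cr (tpow A 3)" using Ec b by auto
  fix c d assume cd: "c : cr A" "d : cr A"
  show "\<Theta> (cv (tpow A 3) (E3 A 1) (E3 A 2) (tens_list K A [c, d]) *[tpow A 3] E3 A 3 b) =
    tens_lift K V (%y. \<theta> (y 1) (y 2) b) (tens_list K A [c, d])"
   using T[OF cd b] tens_list_emb3[OF A cd b] t1[OF cd] cv_tens[OF A A3 E3_lin(1,2) cd] by (simp add: nth_Cons')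
 qed
 show "\<Theta> (E3 A 1 b *[tpow A 3] cv (tpow A 3) (E3 A 2) (E3 A 3) Y) = tens_lift K V (%y. \<theta> b (y 1) (y 2)) Y"
 proof (rule lin_eq_tens2[OF A lin_comp[OF lin_const_right[OF A3 cv_lin[OF A A3 E3_lin(2,3)]] L] l2 _ Y])
  show "E3 A 1 b : cr (tpow A 3)" using Ec b by auto
  fix c d assume cd: "c : cr A" "d : cr A"
  show "\<Theta> (E3 A 1 b *[tpow A 3] cv (tpow A 3) (E3 A 2) (E3 A 3) (tens_list K A [c, d])) =
    tens_lift K V (%y. \<theta> b (y 1) (y 2)) (tens_list K A [c, d])"
   using T[OF b cd] tens_list_emb3[OF A b cd] t2[OF cd] cv_tens[OF A A3 E3_lin(2,3) cd]
    ka_assoc[OF A3 Ec[OF b, of 1] Ec[OF cd(1), of 2] Ec[OF cd(2), of 3]] by (simp add: nth_Cons')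
 qed
qed

end

end

section \<open>Bialgebras and antipodes\<close>

context base_field
begin

lemma make_bialg_simps [simp]:
 "cr (make_bialg A d e) = cr A" "monoid.mult (make_bialg A d e) = monoid.mult A"
 "one (make_bialg A d e) = one A" "zero (make_bialg A d e) = zero A" "add (make_bialg A d e) = add A"
 "smult (make_bialg A d e) = smult A" "comult (make_bialg A d e) = d" "counit (make_bialg A d e) = e"
 by (simp_all add: make_bialg_def)

lemma make_bialg_finsum [simp]: "finsum (make_bialg A d e) f I = finsum A f I"
 by (simp add: finsum_def finprod_def)

lemma make_bialg_minus [simp]: "x \<ominus>\<^bsub>make_bialg A d e\<^esub> y = x \<ominus>\<^bsub>A\<^esub> y"
 by (simp add: a_minus_def a_inv_def m_inv_def)

lemma make_bialg_kalg: assumes "kalg K A" shows "kalg K (make_bialg A d e)"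
proof -
 interpret ring A by (rule kalg_ring[OF assms])
 show ?thesis
 proof (rule kalgI)
  show "ring (make_bialg A d e)"
   by (rule ring_criteria[where n = "%x. \<ominus>\<^bsub>A\<^esub> x"]) (simp_all add: ring_simprules)
 qed (simp_all add: assms ka_smult)
qed

lemma make_bialg_tens_lift [simp]: "tens_lift K (make_bialg A d e) = tens_lift K A"
 by (intro ext) (simp add: tens_lift_def)

lemma make_bialg_tensor [simp]:
 "tensor_free K (make_bialg A d e) n = tensor_free K A n" "tensor_rel K (make_bialg A d e) n = tensor_rel K A n"
 "tensor_pow K (make_bialg A d e) n = tensor_pow K A n" "tens K (make_bialg A d e) n = tens K A n"
 "tens_list K (make_bialg A d e) = tens_list K A" "tens_emb K (make_bialg A d e) n = tens_emb K A n"
 "tens_map2 K (make_bialg A d e) = tens_map2 K A"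
 "mult_map K (make_bialg A d e) = mult_map K A"
proof -
 have "tuple_monoid (make_bialg A d e) n = tuple_monoid A n" for n
  by (simp add: tuple_monoid_def)
 then show f: "tensor_free K (make_bialg A d e) n = tensor_free K A n" for n
  by (simp add: tensor_free_def)
 show r: "tensor_rel K (make_bialg A d e) n = tensor_rel K A n" for n
  by (simp add: tensor_rel_def f)
 show p: "tensor_pow K (make_bialg A d e) n = tensor_pow K A n" for n
  by (simp add: tensor_pow_def f r)
 show t: "tens K (make_bialg A d e) n = tens K A n" for n
  by (intro ext) (simp add: tens_def f r)
 show l: "tens_list K (make_bialg A d e) = tens_list K A"
  by (intro ext) (simp add: tens_list_def t)
 show "tens_emb K (make_bialg A d e) n = tens_emb K A n"
  by (intro ext) (simp add: tens_emb_def t cong del: if_weak_cong)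
 show "tens_map2 K (make_bialg A d e) = tens_map2 K A"
  by (intro ext) (simp add: tens_map2_def p l)
 show "mult_map K (make_bialg A d e) = mult_map K A"
  by (intro ext) (simp add: mult_map_def)
qed

lemma make_bialg_cv [simp]: "cv (make_bialg A d e) = cv A"
 by (intro ext) (simp add: cv_def)

lemma make_bialg_hom [simp]:
 "module_hom K (make_bialg A d e) C = module_hom K A C" "module_hom K C (make_bialg A d e) = module_hom K C A"
 "alg_hom K (make_bialg A d e) C = alg_hom K A C" "alg_hom K C (make_bialg A d e) = alg_hom K C A"
 by (auto simp: alg_hom_def module_hom_def ring_hom_def)

lemma make_bialg_gens [simp]: "gens K (make_bialg A d e) X = gens K A X"
 by (simp add: gens_def)

lemma opp_lin: "module_hom K A (opp C) = module_hom K A C" "module_hom K (opp A) C = module_hom K A C"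
 by (auto simp: module_hom_def)

text \<open>\<Delta>(a) \<otimes> 1 and, below, 1 \<otimes> \<Delta>(a) in the threefold tensor
  power.\<close>

abbreviation D12 :: "('k, 'a) bialg => 'a => ('k, 'a) tensor" where
 "D12 A a == cv (tpow A 3) (E3 A 1) (E3 A 2) (comult A a)"

abbreviation D23 :: "('k, 'a) bialg => 'a => ('k, 'a) tensor" where
 "D23 A a == cv (tpow A 3) (E3 A 2) (E3 A 3) (comult A a)"

context
 fixes A :: "('k, 'a) bialg"
 assumes A: "kalg K A" and \<Delta>: "comult A : alg_hom K A (tpow A 2)" and \<epsilon>: "counit A : alg_hom K A (self_alg K)"
begin

lemma D_hom: "(D12 A) : alg_hom K A (tpow A 3)" "(D23 A) : alg_hom K A (tpow A 3)"
 by (rule ah_comp[OF \<Delta> cv_hom(1)[OF A tensor_kalg[OF A] E3_hom(1,2)[OF A] E3_com[OF A]]], simp)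
  (rule ah_comp[OF \<Delta> cv_hom(1)[OF A tensor_kalg[OF A] E3_hom(2,3)[OF A] E3_com[OF A]]], simp)

lemma D_com: "com A (tpow A 3) (D12 A) (E3 A 3)" "com A (tpow A 3) (E3 A 1) (D23 A)"
proof -
 note c = cv_commute[OF A tensor_kalg[OF A]] and e = E3_lin[OF A] and d = ah_closed[OF \<Delta>]
  and t = comD[OF E3_com[OF A]] and h = E3_hom[OF A, THEN ah_closed]
 show "com A (tpow A 3) (D12 A) (E3 A 3)"
  by (rule comI, rule sym, rule c[OF e(1,2) d h(3)], simp_all, (rule t, simp_all)+)
 show "com A (tpow A 3) (E3 A 1) (D23 A)"
  by (rule comI, rule c[OF e(2,3) d h(1)], simp_all, (rule t, simp_all)+)
qed

text \<open>The identity of the threefold power is itself a lift. With it \<open>lift3_cv\<close>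
  becomes a statement about elements of that power.\<close>

lemma tens3_lift_id:
 assumes "Z : cr (tpow A 3)"
 shows "mlin A 3 (tpow A 3) (%x. tens_list K A [x 1, x 2, x 3])"
  "tens_lift K (tpow A 3) (%x. tens_list K A [x 1, x 2, x 3]) Z = Z"
proof -
 note c = tens_lift_cong[OF A tensor_kalg[OF A] tens_mlin[OF A, of 3] tens_list3]
 show "mlin A 3 (tpow A 3) (%x. tens_list K A [x 1, x 2, x 3])" by (rule c(1))
 have "tens_lift K (tpow A 3) (tens K A 3) Z = tens_lift K (tpow A 3) (%x. tens_list K A [x 1, x 2, x 3]) Z"
  by (rule c(2)[OF _ assms])
 moreover have "tens_lift K (tpow A 3) (tens K A 3) Z = Z"
  by (rule lin_eq_tens[OF A tens_lift_lin[OF A tensor_kalg[OF A] tens_mlin[OF A]] lin_id _ assms])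
   (rule tens_lift_tens[OF A tensor_kalg[OF A] tens_mlin[OF A]])
 ultimately show "tens_lift K (tpow A 3) (%x. tens_list K A [x 1, x 2, x 3]) Z = Z" by simp
qed

text \<open>Writing \<Delta> \<otimes> id as the product of the commuting algebra maps a \<mapsto>
  \<Delta>(a) \<otimes> 1 and b \<mapsto> 1 \<otimes> 1 \<otimes> b shows that it is multiplicative,
  which the nested definition hides. Likewise for id \<otimes> \<Delta>.\<close>

lemma comult_id_cv:
 assumes X: "X : cr (tpow A 2)"
 shows "comult_id K A X = cv (tpow A 3) (D12 A) (E3 A 3) X" "id_comult K A X = cv (tpow A 3) (E3 A 1) (D23 A) X"
proof -
 note A3 = tensor_kalg[OF A, of 3] and e = E3_lin[OF A] and ec = E3_hom[OF A, THEN ah_closed]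
  and l = D_hom[THEN ah_lin] and dc = D_hom[THEN ah_closed]
 have x: "x 1 : cr A" "x 2 : cr A" if "x : tup A 2" for x using that by (auto simp: PiE_iff)
 note d = ah_closed[OF \<Delta>]
 show "comult_id K A X = cv (tpow A 3) (D12 A) (E3 A 3) X"
  unfolding comult_id_def cv_def[of "tpow A 3" "(D12 A)" "E3 A 3"]
 proof (rule tens_lift_cong(2)[OF A A3 cv_mlin[OF A A3 l(1) e(3)] _ X, symmetric])
  fix x assume t: "x : tup A 2"
  note lc = lift3_cv(1)[OF A A3 tens3_lift_id(1)[OF ka_closed(6)[OF A3]] d[OF x(1)[OF t]] x(2)[OF t]]
  show "D12 A (x 1) *[tpow A 3] E3 A 3 (x 2) =
    tens_lift K (tpow A 3) (%y. tens_list K A [y 1, y 2, x 2]) (comult A (x 1))"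
   unfolding lc[symmetric] by (rule tens3_lift_id(2)[symmetric])
    (rule ka_closed(1)[OF A3 dc(1)[OF x(1)[OF t]] ec(3)[OF x(2)[OF t]]])
 qed
 show "id_comult K A X = cv (tpow A 3) (E3 A 1) (D23 A) X"
  unfolding id_comult_def cv_def[of "tpow A 3" "E3 A 1" "(D23 A)"]
 proof (rule tens_lift_cong(2)[OF A A3 cv_mlin[OF A A3 e(1) l(2)] _ X, symmetric])
  fix x assume t: "x : tup A 2"
  note lc = lift3_cv(2)[OF A A3 tens3_lift_id(1)[OF ka_closed(6)[OF A3]] d[OF x(2)[OF t]] x(1)[OF t]]
  show "E3 A 1 (x 1) *[tpow A 3] D23 A (x 2) =
    tens_lift K (tpow A 3) (%y. tens_list K A [x 1, y 1, y 2]) (comult A (x 2))"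
   unfolding lc[symmetric] by (rule tens3_lift_id(2)[symmetric])
    (rule ka_closed(1)[OF A3 ec(1)[OF x(1)[OF t]] dc(2)[OF x(2)[OF t]]])
 qed
qed

lemma \<epsilon>_closed: "a : cr A ==> counit A a : cr K"
 using ah_closed[OF \<epsilon>] by simp

lemma counit_id_cv:
 assumes X: "X : cr (tpow A 2)"
 shows "counit_id K A X = cv A (triv (counit A) A) (%a. a) X" "id_counit K A X = cv A (%a. a) (triv (counit A) A) X"
proof -
 note l = ah_lin[OF triv_hom[OF \<epsilon> A]]
 have x: "x 1 : cr A" "x 2 : cr A" if "x : tup A 2" for x using that by (auto simp: PiE_iff)
 show "counit_id K A X = cv A (triv (counit A) A) (%a. a) X"
  unfolding counit_id_def cv_def
  by (rule tens_lift_cong(2)[OF A A cv_mlin[OF A A l lin_id] _ X, symmetric])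
   (use A x in \<open>simp add: triv_def ka_smult \<epsilon>_closed\<close>)
 show "id_counit K A X = cv A (%a. a) (triv (counit A) A) X"
  unfolding id_counit_def cv_def
  by (rule tens_lift_cong(2)[OF A A cv_mlin[OF A A lin_id l] _ X, symmetric])
   (use A x in \<open>simp add: triv_def ka_smult \<epsilon>_closed\<close>)
qed

lemma triv_com: "com A A (triv (counit A) A) (%a. a)" "com A A (%a. a) (triv (counit A) A)"
 using A by (auto intro!: comI simp: triv_def ka_smult \<epsilon>_closed)

text \<open>By \<open>comult_id_cv\<close> and \<open>counit_id_cv\<close> both sides of each
  coalgebra axiom are algebra maps in the argument, so generators decide.\<close>

lemma bialgebraI_gens:
 assumes X: "gens K A X"
  and "!!x. x : X ==> comult_id K A (comult A x) = id_comult K A (comult A x)"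
  "!!x. x : X ==> counit_id K A (comult A x) = x" "!!x. x : X ==> id_counit K A (comult A x) = x"
 shows "bialgebra K A"
proof -
 note A3 = tensor_kalg[OF A, of 3]
 have XA: "x : cr A" if "x : X" for x using X that by (auto simp: gens_def)
 note d = ah_closed[OF \<Delta>]
 note h1 = ah_comp[OF \<Delta> cv_hom(1)[OF A A3 D_hom(1) E3_hom(3)[OF A] D_com(1)]]
  and h2 = ah_comp[OF \<Delta> cv_hom(1)[OF A A3 E3_hom(1)[OF A] D_hom(2) D_com(2)]]
 have 1: "comult_id K A (comult A a) = id_comult K A (comult A a)" if "a : cr A" for a
  unfolding comult_id_cv(1)[OF d[OF that]] comult_id_cv(2)[OF d[OF that]]
  by (rule alg_hom_eq_gens[OF h1 h2 A X _ that]) (simp add: assms(2) XA d flip: comult_id_cv)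
 note t = triv_hom[OF \<epsilon> A]
 note h3 = ah_comp[OF \<Delta> cv_hom(1)[OF A A t ah_id triv_com(1)]]
  and h4 = ah_comp[OF \<Delta> cv_hom(1)[OF A A ah_id t triv_com(2)]]
 have 2: "counit_id K A (comult A a) = a" if "a : cr A" for a
  unfolding counit_id_cv(1)[OF d[OF that]]
  by (rule alg_hom_eq_gens[OF h3 ah_id A X _ that]) (simp add: assms(3) XA d flip: counit_id_cv)
 have 3: "id_counit K A (comult A a) = a" if "a : cr A" for a
  unfolding counit_id_cv(2)[OF d[OF that]]
  by (rule alg_hom_eq_gens[OF h4 ah_id A X _ that]) (simp add: assms(4) XA d flip: counit_id_cv)
 show ?thesis unfolding bialgebra_def using A \<Delta> \<epsilon> 1 2 3 by blast
qed

end

lemma bialgebraD: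
 assumes "bialgebra K A"
 shows "kalg K A" "comult A : alg_hom K A (tpow A 2)" "counit A : alg_hom K A (self_alg K)"
  "a : cr A ==> comult_id K A (comult A a) = id_comult K A (comult A a)"
  "a : cr A ==> counit_id K A (comult A a) = a" "a : cr A ==> id_counit K A (comult A a) = a"
 using assms unfolding bialgebra_def by blast+

lemmas bialg_closed = bialgebraD(2)[THEN ah_closed]

lemma counit_closed: "bialgebra K A ==> a : cr A ==> counit A a : cr K"
 using ah_closed[OF bialgebraD(3)] by force

lemma bialg_coassoc:
 assumes A: "bialgebra K A" and a: "a : cr A"
 shows "cv (tpow A 3) (%a. cv (tpow A 3) (E3 A 1) (E3 A 2) (comult A a)) (E3 A 3) (comult A a) =
   cv (tpow A 3) (E3 A 1) (%a. cv (tpow A 3) (E3 A 2) (E3 A 3) (comult A a)) (comult A a)"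
  "cv A (triv (counit A) A) (%a. a) (comult A a) = a" "cv A (%a. a) (triv (counit A) A) (comult A a) = a"
 using bialgebraD(4-6)[OF A a] comult_id_cv[OF bialgebraD(1-3)[OF A] bialg_closed[OF A a]]
  counit_id_cv[OF bialgebraD(1-3)[OF A] bialg_closed[OF A a]] by simp_all

text \<open>The axioms of A are carried over by f \<otimes> f \<otimes> f. Here C is only an algebra
  with candidate structure maps; the lemma serves to prove that C is a bialgebra, on those
  generators that come from A.\<close>

lemma coassoc_image:
 fixes A :: "('k, 'a) bialg" and C :: "('k, 'c) bialg"
 assumes bA: "bialgebra K A" and C: "kalg K C" and \<Delta>: "comult C : alg_hom K C (tpow C 2)"
  and \<epsilon>: "counit C : alg_hom K C (self_alg K)" and f: "f : alg_hom K A C" and a: "a : cr A"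
  and f\<Delta>: "!!a. a : cr A ==> comult C (f a) = tens_map2 K C f f (comult A a)"
  and f\<epsilon>: "!!a. a : cr A ==> counit C (f a) = counit A a"
 shows "comult_id K C (comult C (f a)) = id_comult K C (comult C (f a))"
  "counit_id K C (comult C (f a)) = f a" "id_counit K C (comult C (f a)) = f a"
proof -
 note A = bialgebraD(1)[OF bA] and dA = bialg_closed[OF bA] and fl = ah_lin[OF f]
 note C3 = tensor_kalg[OF C, of 3] and A3 = tensor_kalg[OF A, of 3]
 have dC: "comult C (f b) : cr (tpow C 2)" if "b : cr A" for b
  using ah_closed[OF \<Delta> ah_closed[OF f that]] .
 \<comment> \<open>This is f \<otimes> f \<otimes> f.\<close>
 let ?F = "thom 3 (tpow C 3) (%i b. E3 C i (f b))"
 have F: "?F : alg_hom K (tpow A 3) (tpow C 3)"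
  "!!i b. i : {1..3} ==> b : cr A ==> ?F (E3 A i b) = E3 C i (f b)"
  by (rule thom_hom[OF A C3]; auto intro!: ah_comp[OF f tens_emb_hom[OF C]]
    simp: tens_emb_comm[OF C] ah_closed[OF f])+
 have D: "cv (tpow C 3) (E3 C i) (E3 C j) (comult C (f b)) = ?F (cv (tpow A 3) (E3 A i) (E3 A j) (comult A b))"
  if b: "b : cr A" and ij: "i : {1..3}" "j : {1..3}" for i j b
 proof -
  note e = ah_lin[OF tens_emb_hom[OF C ij(1)]] ah_lin[OF tens_emb_hom[OF C ij(2)]]
  note e' = ah_lin[OF tens_emb_hom[OF A ij(1)]] ah_lin[OF tens_emb_hom[OF A ij(2)]]
  have "cv (tpow C 3) (E3 C i) (E3 C j) (comult C (f b)) =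
    cv (tpow C 3) (%b. E3 C i (f b)) (%b. E3 C j (f b)) (comult A b)"
   unfolding f\<Delta>[OF b] by (rule cv_map2[OF A C fl fl C3 e dA[OF b]])
  also have "... = cv (tpow C 3) (%b. ?F (E3 A i b)) (%b. ?F (E3 A j b)) (comult A b)"
   using F(2) ij by (intro cv_cong[OF A C3 lin_comp[OF fl e(1)] lin_comp[OF fl e(2)] dA[OF b]]) simp_all
  also have "... = ?F (cv (tpow A 3) (E3 A i) (E3 A j) (comult A b))"
   by (rule lin_cv[OF A A3 C3 F(1) e' dA[OF b], symmetric])
  finally show ?thesis .
 qed
 note DA = D_hom[OF bialgebraD(1-3)[OF bA], THEN ah_lin] and DC = D_hom[OF C \<Delta> \<epsilon>, THEN ah_lin]
 have "comult_id K C (comult C (f a)) =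
   cv (tpow C 3) (%a. cv (tpow C 3) (E3 C 1) (E3 C 2) (comult C (f a))) (%a. E3 C 3 (f a)) (comult A a)"
  unfolding comult_id_cv(1)[OF C \<Delta> \<epsilon> dC[OF a]] unfolding f\<Delta>[OF a]
  by (rule cv_map2[OF A C fl fl C3 DC(1) E3_lin(3)[OF C] dA[OF a]])
 also have "... = cv (tpow C 3) (%a. ?F (cv (tpow A 3) (E3 A 1) (E3 A 2) (comult A a))) (%a. ?F (E3 A 3 a)) (comult A a)"
  by (rule cv_cong[OF A C3 lin_comp[OF fl DC(1)] lin_comp[OF fl E3_lin(3)[OF C]] dA[OF a]])
   (simp_all add: D F(2))
 also have "... = ?F (cv (tpow A 3) (%a. cv (tpow A 3) (E3 A 1) (E3 A 2) (comult A a)) (E3 A 3) (comult A a))"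
  by (rule lin_cv[OF A A3 C3 F(1) DA(1) E3_lin(3)[OF A] dA[OF a], symmetric])
 also have "... = ?F (cv (tpow A 3) (E3 A 1) (%a. cv (tpow A 3) (E3 A 2) (E3 A 3) (comult A a)) (comult A a))"
  by (simp only: bialg_coassoc(1)[OF bA a])
 also have "... = cv (tpow C 3) (%a. ?F (E3 A 1 a)) (%a. ?F (cv (tpow A 3) (E3 A 2) (E3 A 3) (comult A a))) (comult A a)"
  by (rule lin_cv[OF A A3 C3 F(1) E3_lin(1)[OF A] DA(2) dA[OF a]])
 also have "... = cv (tpow C 3) (%a. E3 C 1 (f a)) (%a. cv (tpow C 3) (E3 C 2) (E3 C 3) (comult C (f a))) (comult A a)"
  by (rule cv_cong[OF A C3 lin_comp[OF fl E3_lin(1)[OF C]] lin_comp[OF fl DC(2)] dA[OF a], symmetric])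
   (simp_all add: D F(2))
 also have "... = id_comult K C (comult C (f a))"
  unfolding comult_id_cv(2)[OF C \<Delta> \<epsilon> dC[OF a]] unfolding f\<Delta>[OF a]
  by (rule cv_map2[OF A C fl fl C3 E3_lin(1)[OF C] DC(2) dA[OF a], symmetric])
 finally show "comult_id K C (comult C (f a)) = id_comult K C (comult C (f a))" .
 note tC = ah_lin[OF triv_hom[OF \<epsilon> C]] and tA = ah_lin[OF triv_hom[OF bialgebraD(3)[OF bA] A]]
 have t: "triv (counit C) C (f b) = f (triv (counit A) A b)" if "b : cr A" for b
  using A that counit_closed[OF bA that] by (simp add: triv_def f\<epsilon> ah_smult[OF f] ah_one[OF f])
 show "counit_id K C (comult C (f a)) = f a"
  unfolding counit_id_cv(1)[OF C \<Delta> \<epsilon> dC[OF a]] unfolding f\<Delta>[OF a] cv_map2[OF A C fl fl C tC lin_id dA[OF a]]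
  using lin_cv[OF A A C f tA lin_id dA[OF a]] cv_cong[OF A C lin_comp[OF fl tC] fl dA[OF a] t refl]
  by (simp add: bialg_coassoc(2)[OF bA a])
 show "id_counit K C (comult C (f a)) = f a"
  unfolding counit_id_cv(2)[OF C \<Delta> \<epsilon> dC[OF a]] unfolding f\<Delta>[OF a] cv_map2[OF A C fl fl C lin_id tC dA[OF a]]
  using lin_cv[OF A A C f lin_id tA dA[OF a]] cv_cong[OF A C fl lin_comp[OF fl tC] dA[OF a] refl t]
  by (simp add: bialg_coassoc(3)[OF bA a])
qed

lemma bialg_homI:
 assumes A: "bialgebra K A" and C: "bialgebra K C" and f: "f : alg_hom K A C" and X: "gens K A X"
  and c: "!!x. x : X ==> comult C (f x) = tens_map2 K C f f (comult A x)" "!!x. x : X ==> counit C (f x) = counit A x"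
 shows "bialg_hom K A C f"
proof -
 note a = alg_hom_eq_gens[OF _ _ bialgebraD(1)[OF A] X]
 have "comult C (f x) = tens_map2 K C f f (comult A x)" if "x : cr A" for x
  by (rule a[OF ah_comp[OF f bialgebraD(2)[OF C]] ah_comp[OF bialgebraD(2)[OF A]
      map2_hom(1)[OF bialgebraD(1)[OF A] bialgebraD(1)[OF C] f f]] c(1) that])
 moreover have "counit C (f x) = counit A x" if "x : cr A" for x
  by (rule a[OF ah_comp[OF f bialgebraD(3)[OF C]] bialgebraD(3)[OF A] c(2) that])
 ultimately show ?thesis unfolding bialg_hom_def using A C f by blast
qed

lemma bialg_homD:
 assumes "bialg_hom K A C f"
 shows "bialgebra K A" "bialgebra K C" "f : alg_hom K A C"
  "a : cr A ==> comult C (f a) = tens_map2 K C f f (comult A a)" "a : cr A ==> counit C (f a) = counit A a"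
 using assms unfolding bialg_hom_def by blast+

text \<open>Coassociativity is an equation in the threefold tensor power; applying the linear map x
  \<otimes> y \<otimes> z \<mapsto> u(x) v(y) w(z), called \<Theta> below, turns it into
  associativity of convolution.\<close>

lemma convolution_assoc:
 fixes A :: "('k, 'a) bialg" and T :: "('k, 't, 'z) module_scheme"
 assumes bA: "bialgebra K A" and T: "kalg K T"
  and u: "u : module_hom K A T" and v: "v : module_hom K A T" and w: "w : module_hom K A T"
  and a: "a : cr A"
 shows "cv T (%a. cv T u v (comult A a)) w (comult A a) = cv T u (%a. cv T v w (comult A a)) (comult A a)"
proof -
 note A = bialgebraD(1)[OF bA] and dA = bialg_closed[OF bA] and \<Delta>l = ah_lin[OF bialgebraD(2)[OF bA]]
 note A3 = tensor_kalg[OF A, of 3]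
 have c: "u x : cr T" "v x : cr T" "w x : cr T" if "x : cr A" for x
  using that u v w by (simp_all add: lin_closed)
 have ml: "mlin A 3 T (%x. u (x 1) *[T] v (x 2) *[T] w (x 3))"
  by (rule mlin3I[where \<beta> = "%a b d. u a *[T] v b *[T] w d"])
   (rule lin_const_right[OF T w] lin_const_left[OF T lin_const_right[OF T v]]
    lin_const_left[OF T lin_const_left[OF T u]], simp_all add: c T)+
 define \<Theta> where "\<Theta> = tens_lift K T (%x. u (x 1) *[T] v (x 2) *[T] w (x 3))"
 have L: "\<Theta> : module_hom K (tpow A 3) T" unfolding \<Theta>_def by (rule tens_lift_lin[OF A T ml])
 have \<Theta>3: "\<Theta> (tens_list K A [x, y, z]) = u x *[T] v y *[T] w z"
  if "x : cr A" "y : cr A" "z : cr A" for x y z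
  unfolding \<Theta>_def using tens_lift3[OF A T ml that] by (simp add: nth_Cons')
 note e = E3_lin[OF A] and ec = E3_hom[OF A, THEN ah_closed]
 note e12 = cv_lin[OF A A3 e(1,2)] and e23 = cv_lin[OF A A3 e(2,3)]
 have 1: "\<Theta> (cv (tpow A 3) (E3 A 1) (E3 A 2) Y *[tpow A 3] E3 A 3 b) = cv T u v Y *[T] w b"
  if Y: "Y : cr (tpow A 2)" and b: "b : cr A" for Y b
  by (rule lin_eq_tens2[OF A lin_comp[OF lin_const_left[OF A3 e12 ec(3)[OF b]] L]
     lin_const_left[OF T cv_lin[OF A T u v] c(3)[OF b]] _ Y])
   (simp add: cv_tens[OF A A3 e(1,2)] cv_tens[OF A T u v] \<Theta>3 b flip: tens_list_emb3[OF A])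
 have 2: "\<Theta> (E3 A 1 b *[tpow A 3] cv (tpow A 3) (E3 A 2) (E3 A 3) Y) = u b *[T] cv T v w Y"
  if Y: "Y : cr (tpow A 2)" and b: "b : cr A" for Y b
 proof (rule lin_eq_tens2[OF A lin_comp[OF lin_const_right[OF A3 e23 ec(1)[OF b]] L]
     lin_const_right[OF T cv_lin[OF A T v w] c(1)[OF b]] _ Y])
  fix x y assume xy: "x : cr A" "y : cr A"
  have "E3 A 1 b *[tpow A 3] cv (tpow A 3) (E3 A 2) (E3 A 3) (tens_list K A [x, y]) = tens_list K A [b, x, y]"
   unfolding cv_tens[OF A A3 e(2,3) xy] tens_list_emb3[OF A b xy]
   by (rule ka_assoc[OF A3 ec(1)[OF b] ec(2)[OF xy(1)] ec(3)[OF xy(2)], symmetric])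
  then show "\<Theta> (E3 A 1 b *[tpow A 3] cv (tpow A 3) (E3 A 2) (E3 A 3) (tens_list K A [x, y])) =
    u b *[T] cv T v w (tens_list K A [x, y])"
   using xy b T c by (simp add: \<Theta>3 cv_tens[OF A T v w] ka_assoc)
 qed
 note D = D_hom[OF bialgebraD(1-3)[OF bA], THEN ah_lin]
 note cu = lin_comp[OF \<Delta>l cv_lin[OF A T u v]] and cw = lin_comp[OF \<Delta>l cv_lin[OF A T v w]]
 have "\<Theta> (cv (tpow A 3) (%a. cv (tpow A 3) (E3 A 1) (E3 A 2) (comult A a)) (E3 A 3) (comult A a)) =
   cv T (%a. cv T u v (comult A a)) w (comult A a)"
  by (rule cv_eqI[OF A T cu w lin_comp[OF cv_lin[OF A A3 D(1) e(3)] L] _ dA[OF a]])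
   (simp add: cv_tens[OF A A3 D(1) e(3)] 1 dA)
 moreover have "\<Theta> (cv (tpow A 3) (E3 A 1) (%a. cv (tpow A 3) (E3 A 2) (E3 A 3) (comult A a)) (comult A a)) =
   cv T u (%a. cv T v w (comult A a)) (comult A a)"
  by (rule cv_eqI[OF A T u cw lin_comp[OF cv_lin[OF A A3 e(1) D(2)] L] _ dA[OF a]])
   (simp add: cv_tens[OF A A3 e(1) D(2)] 2 dA)
 ultimately show ?thesis using bialg_coassoc(1)[OF bA a] by simp
qed

lemma convolution_counit:
 fixes A :: "('k, 'a) bialg" and T :: "('k, 't, 'z) module_scheme"
 assumes bA: "bialgebra K A" and T: "kalg K T" and u: "u : module_hom K A T" and a: "a : cr A"
 shows "cv T (triv (counit A) T) u (comult A a) = u a" "cv T u (triv (counit A) T) (comult A a) = u a"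
proof -
 note A = bialgebraD(1)[OF bA] and dA = bialg_closed[OF bA]
 note t = ah_lin[OF triv_hom[OF bialgebraD(3)[OF bA] T]] and tA = ah_lin[OF triv_hom[OF bialgebraD(3)[OF bA] A]]
 have c: "u x : cr T" if "x : cr A" for x by (rule lin_closed[OF u that])
 have tr: "triv (counit A) A x = counit A x .[A] \<one>[A]" "triv (counit A) T x = counit A x .[T] \<one>[T]" for x
  by (simp_all add: triv_def)
 have "cv T (triv (counit A) T) u (comult A a) = u (cv A (triv (counit A) A) (%a. a) (comult A a))"
  by (rule cv_eqI[OF A T t u lin_comp[OF cv_lin[OF A A tA lin_id] u] _ dA[OF a], symmetric])
   (simp add: cv_tens[OF A A tA lin_id] tr A T c ka_smult counit_closed[OF bA] lin_smult[OF u])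
 then show "cv T (triv (counit A) T) u (comult A a) = u a" by (simp only: bialg_coassoc(2)[OF bA a])
 have "cv T u (triv (counit A) T) (comult A a) = u (cv A (%a. a) (triv (counit A) A) (comult A a))"
  by (rule cv_eqI[OF A T u t lin_comp[OF cv_lin[OF A A lin_id tA] u] _ dA[OF a], symmetric])
   (simp add: cv_tens[OF A A lin_id tA] tr A T c ka_smult counit_closed[OF bA] lin_smult[OF u])
 then show "cv T u (triv (counit A) T) (comult A a) = u a" by (simp only: bialg_coassoc(3)[OF bA a])
qed

text \<open>A left inverse u and a right inverse w of v agree: both equal the convolution of u, v
  and w, bracketed in the two possible ways.\<close>

lemma convolution_inverse_unique:
 fixes A :: "('k, 'a) bialg" and T :: "('k, 't, 'z) module_scheme"
 assumes bA: "bialgebra K A" and T: "kalg K T"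
  and u: "u : module_hom K A T" and v: "v : module_hom K A T" and w: "w : module_hom K A T"
  and uv: "!!a. a : cr A ==> cv T u v (comult A a) = triv (counit A) T a"
  and vw: "!!a. a : cr A ==> cv T v w (comult A a) = triv (counit A) T a"
  and a: "a : cr A"
 shows "u a = w a"
proof -
 note A = bialgebraD(1)[OF bA] and dA = bialg_closed[OF bA] and \<Delta>l = ah_lin[OF bialgebraD(2)[OF bA]]
 note cu = lin_comp[OF \<Delta>l cv_lin[OF A T u v]] and cw = lin_comp[OF \<Delta>l cv_lin[OF A T v w]]
 have "w a = cv T (triv (counit A) T) w (comult A a)" by (rule convolution_counit(1)[OF bA T w a, symmetric])
 also have "... = cv T (%a. cv T u v (comult A a)) w (comult A a)"
  by (rule cv_cong[OF A T cu w dA[OF a] uv refl, symmetric])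
 also have "... = cv T u (%a. cv T v w (comult A a)) (comult A a)" by (rule convolution_assoc[OF bA T u v w a])
 also have "... = cv T u (triv (counit A) T) (comult A a)" by (rule cv_cong[OF A T u cw dA[OF a] refl vw])
 also have "... = u a" by (rule convolution_counit(2)[OF bA T u a])
 finally show ?thesis by (rule sym)
qed

lemma antipode_iff:
 "antipode K A S \<longleftrightarrow> S : module_hom K A A & (ALL a:cr A. cv A S (%x. x) (comult A a) = triv (counit A) A a &
  cv A (%x. x) S (comult A a) = triv (counit A) A a)"
 by (simp add: antipode_def cv_def triv_def)

lemma antipodeD:
 assumes "antipode K A S"
 shows "S : module_hom K A A" "a : cr A ==> cv A S (%x. x) (comult A a) = triv (counit A) A a"
  "a : cr A ==> cv A (%x. x) S (comult A a) = triv (counit A) A a"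
 using assms by (simp_all add: antipode_iff)

text \<open>S followed by f is a left inverse of f under convolution, and f followed by S' is a
  right inverse.\<close>

lemma bialg_hom_antipode:
 assumes f: "bialg_hom K A C f" and S: "antipode K A S" and S': "antipode K C S'" and a: "a : cr A"
 shows "f (S a) = S' (f a)"
proof -
 note bA = bialg_homD(1)[OF f] and bC = bialg_homD(2)[OF f] and fh = bialg_homD(3)[OF f]
 note A = bialgebraD(1)[OF bA] and C = bialgebraD(1)[OF bC] and fl = ah_lin[OF fh]
 note l = antipodeD(1)[OF S] antipodeD(1)[OF S'] and dA = bialg_closed[OF bA]
 show ?thesis
 proof (rule convolution_inverse_unique[OF bA C lin_comp[OF l(1) fl] fl lin_comp[OF fl l(2)] _ _ a])
  fix x assume x: "x : cr A"
  have "cv C (%x. f (S x)) f (comult A x) = f (cv A S (%x. x) (comult A x))"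
   by (rule lin_cv[OF A A C fh l(1) lin_id dA[OF x], symmetric])
  also have "... = triv (counit A) C x"
   using A counit_closed[OF bA x]
   by (simp add: antipodeD(2)[OF S x] triv_def ah_smult[OF fh] ah_one[OF fh])
  finally show "cv C (%x. f (S x)) f (comult A x) = triv (counit A) C x" .
  have "cv C f (%x. S' (f x)) (comult A x) = cv C (%x. x) S' (tens_map2 K C f f (comult A x))"
   by (rule cv_map2[OF A C fl fl C lin_id l(2) dA[OF x], symmetric])
  also have "... = triv (counit A) C x"
   using antipodeD(3)[OF S' ah_closed[OF fh x]] bialg_homD(4,5)[OF f x] by (simp add: triv_def)
  finally show "cv C f (%x. S' (f x)) (comult A x) = triv (counit A) C x" .
 qed
qed

lemma hopf_homI: "bialg_hom K A C f ==> hopf_algebra K A ==> hopf_algebra K C ==> hopf_hom K A C f"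
 unfolding hopf_hom_def by (blast intro: bialg_hom_antipode)

text \<open>For an antihomomorphism the axiom is inherited by products: in S(y_1) S(x_1) x_2 y_2 the
  inner part collapses to the scalar \<epsilon>(x), and the rest to \<epsilon>(y).\<close>

lemma antipodeI_gens:
 assumes bA: "bialgebra K A" and S: "S : alg_hom K A (opp A)" and X: "gens K A X"
  and SX: "!!x. x : X ==> cv A S (%x. x) (comult A x) = triv (counit A) A x"
   "!!x. x : X ==> cv A (%x. x) S (comult A x) = triv (counit A) A x"
 shows "antipode K A S"
proof -
 note A = bialgebraD(1)[OF bA] and \<Delta> = bialgebraD(2)[OF bA] and dA = bialg_closed[OF bA]
 interpret A: ring A by (rule kalg_ring[OF A])
 note A2 = tensor_kalg[OF A, of 2]
 have Sl: "S : module_hom K A A" using ah_lin[OF S] by (simp add: opp_lin)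
 have Sm: "S (x *[A] y) = S y *[A] S x" if "x : cr A" "y : cr A" for x y
  using ah_mult[OF S that] by simp
 have S1: "S \<one>[A] = \<one>[A]" using ah_one[OF S] by simp
 note Sc = lin_closed[OF Sl] and l1 = cv_lin[OF A A Sl lin_id] and l2 = cv_lin[OF A A lin_id Sl]
 note c1 = cv_tens[OF A A Sl lin_id] and c2 = cv_tens[OF A A lin_id Sl]
 have \<epsilon>: "counit A x : cr K" if "x : cr A" for x by (rule counit_closed[OF bA that])
 have mt: "tens_list K A [x, y] *[tpow A 2] tens_list K A [x', y'] = tens_list K A [x *[A] x', y *[A] y']"
  if xy: "x : cr A" "y : cr A" "x' : cr A" "y' : cr A" for x y x' y'
 proof -
  note e = tens_emb_hom[OF A, of 1 2] tens_emb_hom[OF A, of 2 2]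
  have e': "tens_emb K A 2 1 : alg_hom K A (tpow A 2)" "tens_emb K A 2 2 : alg_hom K A (tpow A 2)" using e by auto
  note ec = ah_closed[OF e'(1)] ah_closed[OF e'(2)]
  have "tens_emb K A 2 2 y *[tpow A 2] (tens_emb K A 2 1 x' *[tpow A 2] tens_emb K A 2 2 y') =
    tens_emb K A 2 1 x' *[tpow A 2] (tens_emb K A 2 2 y *[tpow A 2] tens_emb K A 2 2 y')"
   using ec xy tens_emb_comm[OF A, of 2 1 y x' 2] A2 by (simp flip: ka_assoc[OF A2])
  then show ?thesis using xy A A2 ec
   by (simp add: tens_list_emb2[OF A] ah_mult[OF e'(1)] ah_mult[OF e'(2)] ka_assoc[OF A2])
 qed
 \<comment> \<open>Z stands for \<Delta>(x) and Y for \<Delta>(y). Only the collapsed value c of Z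
   enters, so the identity can be checked on elementary tensors Y.\<close>
 have p1: "cv A S (%x. x) (Z *[tpow A 2] Y) = c .[A] cv A S (%x. x) Y"
  if Z: "Z : cr (tpow A 2)" "cv A S (%x. x) Z = c .[A] \<one>[A]" and c: "c : cr K" and Y: "Y : cr (tpow A 2)" for Z Y c
 proof (rule lin_eq_tens2[OF A lin_comp[OF lin_mult_left[OF A2 Z(1)] l1] _ _ Y])
  show "(%Y. c .[A] cv A S (%x. x) Y) : module_hom K (tpow A 2) A"
   using c A by (intro lin_comp[OF l1] module_homI) (auto simp: ka_smult K.m_comm)
  fix x y assume xy: "x : cr A" "y : cr A"
  have "cv A S (%x. x) (Z *[tpow A 2] tens_list K A [x, y]) = S x *[A] (cv A S (%x. x) Z *[A] y)"
   using xy A by (intro lin_eq_tens2[OF A lin_comp[OF lin_mult_right[OF A2] l1] lin_const_right[OF A lin_const_left[OF A l1]] _ Z(1)])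
    (simp_all add: mt c1 Sm Sc A.m_assoc)
  then show "cv A S (%x. x) (Z *[tpow A 2] tens_list K A [x, y]) = c .[A] cv A S (%x. x) (tens_list K A [x, y])"
   using xy A c Sc by (simp add: Z(2) c1 ka_smult)
 qed
 have p2: "cv A (%x. x) S (Y *[tpow A 2] Z) = c .[A] cv A (%x. x) S Y"
  if Z: "Z : cr (tpow A 2)" "cv A (%x. x) S Z = c .[A] \<one>[A]" and c: "c : cr K" and Y: "Y : cr (tpow A 2)" for Z Y c
 proof (rule lin_eq_tens2[OF A lin_comp[OF lin_mult_right[OF A2 Z(1)] l2] _ _ Y])
  show "(%Y. c .[A] cv A (%x. x) S Y) : module_hom K (tpow A 2) A"
   using c A by (intro lin_comp[OF l2] module_homI) (auto simp: ka_smult K.m_comm)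
  fix x y assume xy: "x : cr A" "y : cr A"
  have "cv A (%x. x) S (tens_list K A [x, y] *[tpow A 2] Z) = x *[A] (cv A (%x. x) S Z *[A] S y)"
   using xy A Sc by (intro lin_eq_tens2[OF A lin_comp[OF lin_mult_left[OF A2] l2] lin_const_right[OF A lin_const_left[OF A l2]] _ Z(1)])
    (simp_all add: mt c2 Sm A.m_assoc)
  then show "cv A (%x. x) S (tens_list K A [x, y] *[tpow A 2] Z) = c .[A] cv A (%x. x) S (tens_list K A [x, y])"
   using xy A c Sc by (simp add: Z(2) c2 ka_smult)
 qed
 have one: "\<one>[tpow A 2] = tens_list K A [\<one>[A], \<one>[A]]"
  using A2 A ah_one[OF tens_emb_hom[OF A, of 1 2]] ah_one[OF tens_emb_hom[OF A, of 2 2]]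
  by (simp add: tens_list_emb2[OF A])
 note eps = bialgebraD(3)[OF bA]
 have "cv A S (%x. x) (comult A a) = triv (counit A) A a & cv A (%x. x) S (comult A a) = triv (counit A) A a"
  if "a : cr A" for a
  using X that
 proof (induction rule: gens_induct)
  case one
  show ?case using A by (simp add: ah_one[OF \<Delta>] \<open>\<one>[tpow A 2] = _\<close> c1 c2 S1 triv_def ah_one[OF eps])
 next
  case (add a b)
  then show ?case
   using A by (simp add: ah_add[OF \<Delta>] dA lin_add[OF l1] lin_add[OF l2] triv_def ah_add[OF eps] ka_smult \<epsilon>)
 next
  case (smult c a)
  then show ?case
   using A by (simp add: ah_smult[OF \<Delta>] dA lin_smult[OF l1] lin_smult[OF l2] triv_def ah_smult[OF eps] ka_smult \<epsilon>)
 next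
  case (mult a b)
  then show ?case
   using A p1[OF dA[OF mult(1)] _ \<epsilon>[OF mult(1)] dA[OF mult(2)]] p2[OF dA[OF mult(2)] _ \<epsilon>[OF mult(2)] dA[OF mult(1)]]
   by (simp add: ah_mult[OF \<Delta>] triv_def ah_mult[OF eps] ka_smult \<epsilon> K.m_comm)
 qed (use SX A in auto)
 then show ?thesis using Sl by (simp add: antipode_iff)
qed

end

section \<open>Tensor powers of Hopf algebras\<close>

context base_field
begin

abbreviation E2 :: "('k, 'a, 'z) module_scheme => nat => 'a => ('k, 'a) tensor" where
 "E2 A i == tens_emb K A 2 i"

lemma E2_hom: "kalg K A ==> E2 A 1 : alg_hom K A (tpow A 2)" "kalg K A ==> E2 A 2 : alg_hom K A (tpow A 2)"
 by (auto intro!: tens_emb_hom)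

lemmas E2_lin = E2_hom[THEN ah_lin]
lemmas E2_closed = E2_hom[THEN ah_closed]

lemma tens_list2_mult:
 assumes A: "kalg K A" and xy: "x : cr A" "y : cr A" "x' : cr A" "y' : cr A"
 shows "tens_list K A [x, y] *[tpow A 2] tens_list K A [x', y'] = tens_list K A [x *[A] x', y *[A] y']"
proof -
 note A2 = tensor_kalg[OF A, of 2]
 note ec = E2_closed[OF A]
 have "E2 A 2 y *[tpow A 2] (E2 A 1 x' *[tpow A 2] E2 A 2 y') =
   E2 A 1 x' *[tpow A 2] (E2 A 2 y *[tpow A 2] E2 A 2 y')"
  using ec xy tens_emb_comm[OF A, of 2 1 y x' 2] A2 by (simp flip: ka_assoc[OF A2])
 then show ?thesis using xy A A2 ec
  by (simp add: tens_list_emb2[OF A] ah_mult[OF E2_hom(1)[OF A]] ah_mult[OF E2_hom(2)[OF A]] ka_assoc[OF A2])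
qed

lemma tens_list2_one: "kalg K A ==> \<one>[tpow A 2] = tens_list K A [\<one>[A], \<one>[A]]"
 by (simp add: tens_list_emb2 ah_one[OF E2_hom(1)] ah_one[OF E2_hom(2)])

definition tcomult :: "('k, 'b) bialg => nat => ('k, 'b) tensor => ('k, ('k, 'b) tensor) tensor" where
 "tcomult B m = thom m (tpow (tpow B m) 2) (%i b. tens_map2 K (tpow B m) (tens_emb K B m i) (tens_emb K B m i) (comult B b))"

definition tcounit :: "('k, 'b) bialg => nat => ('k, 'b) tensor => 'k" where
 "tcounit B m = thom m (self_alg K) (%i. counit B)"

lemma list_prod_self [simp]: "list_prod (self_alg K) = list_prod K"
 by (intro ext) (simp add: list_prod_def self_alg_def)

lemma tensor_bialg_eq [simp]: "tensor_bialg K B m = make_bialg (tpow B m) (tcomult B m) (tcounit B m)"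
 by (simp add: tensor_bialg_def tcomult_def tcounit_def thom_def Let_def)

context
 fixes B :: "('k, 'b) bialg" and m :: nat
 assumes bB: "bialgebra K B"
begin

lemma B_kalg: "kalg K B" by (rule bialgebraD[OF bB])

lemma tcomult_hom: "tcomult B m : alg_hom K (tpow B m) (tpow (tpow B m) 2)"
 "i : {1..m} ==> b : cr B ==>
  tcomult B m (tens_emb K B m i b) = tens_map2 K (tpow B m) (tens_emb K B m i) (tens_emb K B m i) (comult B b)"
proof -
 note B = B_kalg
 note R = tensor_kalg[OF B, of m] and RR = tensor_kalg[OF tensor_kalg[OF B], of m 2]
 let ?e = "tens_emb K B m"
 note eh = tens_emb_hom[OF B] and ec = tens_emb_closed[OF B]
 note m2 = map2_hom(1)[OF B R eh eh] and dB = bialg_closed[OF bB]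
 have comm: "tens_map2 K (tpow B m) (?e i) (?e i) X *[tpow (tpow B m) 2] tens_map2 K (tpow B m) (?e j) (?e j) Y =
   tens_map2 K (tpow B m) (?e j) (?e j) Y *[tpow (tpow B m) 2] tens_map2 K (tpow B m) (?e i) (?e i) X"
  if ij: "i : {1..m}" "j : {1..m}" "i ~= j" and X: "X : cr (tpow B 2)" and Y: "Y : cr (tpow B 2)" for i j X Y
 proof -
  note l = ah_lin[OF eh]
  let ?u = "%p i a. E2 (tpow B m) p (?e i a)"
  have ul: "?u 1 i : module_hom K B (tpow (tpow B m) 2)" "?u 2 i : module_hom K B (tpow (tpow B m) 2)" if "i : {1..m}" for i
   by (rule lin_comp[OF l[OF that] E2_lin(1)[OF R]] lin_comp[OF l[OF that] E2_lin(2)[OF R]])+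
  \<comment> \<open>Different legs commute in the outer tensor square, equal legs because the
    positions i and j in the inner power differ.\<close>
  have uc: "?u p i a *[tpow (tpow B m) 2] ?u q j b = ?u q j b *[tpow (tpow B m) 2] ?u p i a"
   if "p : {1,2}" "q : {1,2}" "a : cr B" "b : cr B" for p q a b
  proof (cases "p = q")
   case True
   have p: "p : {1..2}" using that(1) by auto
   show ?thesis unfolding True[symmetric] using ah_mult[OF tens_emb_hom[OF R p]] tens_emb_comm[OF B ij(3) that(3,4)]
     ec[OF ij(1) that(3)] ec[OF ij(2) that(4)] by metis
  next
   case False
   then show ?thesis by (rule tens_emb_comm[OF R _ ec[OF ij(1) that(3)] ec[OF ij(2) that(4)]])
  qed
  note mc = map2_cv[OF B R l l]
  have Xc: "cv (tpow (tpow B m) 2) (?u 1 i) (?u 2 i) X : cr (tpow (tpow B m) 2)"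
   by (rule cv_closed[OF B RR ul[OF ij(1)] X])
  have "cv (tpow (tpow B m) 2) (?u 1 i) (?u 2 i) X *[tpow (tpow B m) 2] ?u q j b =
    ?u q j b *[tpow (tpow B m) 2] cv (tpow (tpow B m) 2) (?u 1 i) (?u 2 i) X" if "q : {1,2}" "b : cr B" for q b
   by (rule cv_commute[OF B RR ul[OF ij(1)] X, symmetric])
    (use that uc lin_closed[OF ul(1)[OF ij(2)]] lin_closed[OF ul(2)[OF ij(2)]] in auto)
  then show ?thesis unfolding mc[OF ij(1,1) X] mc[OF ij(2,2) Y]
   by (intro cv_commute[OF B RR ul[OF ij(2)] Y Xc]) auto
 qed
 show "tcomult B m : alg_hom K (tpow B m) (tpow (tpow B m) 2)"
  "i : {1..m} ==> b : cr B ==>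
   tcomult B m (tens_emb K B m i b) = tens_map2 K (tpow B m) (tens_emb K B m i) (tens_emb K B m i) (comult B b)"
  unfolding tcomult_def
  by (rule thom_hom[OF B RR ah_comp[OF bialgebraD(2)[OF bB] m2] comm]; simp add: dB)+
qed

lemma tcounit_hom: "tcounit B m : alg_hom K (tpow B m) (self_alg K)"
 "i : {1..m} ==> b : cr B ==> tcounit B m (tens_emb K B m i b) = counit B b"
 unfolding tcounit_def
 by (rule thom_hom[OF B_kalg self_kalg bialgebraD(3)[OF bB]];
   simp add: K.m_comm counit_closed[OF bB])+

text \<open>Every generator of the power is the image of an element of B under an embedding that
  respects the structure maps, so the axioms come from B.\<close>

lemma tensor_bialgebra: "bialgebra K (tensor_bialg K B m)"
proof -
 note R = make_bialg_kalg[OF tensor_kalg[OF B_kalg], of m "tcomult B m" "tcounit B m"]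
 have h: "comult (tensor_bialg K B m) : alg_hom K (tensor_bialg K B m) (tpow (tensor_bialg K B m) 2)"
  "counit (tensor_bialg K B m) : alg_hom K (tensor_bialg K B m) (self_alg K)"
  by (simp_all add: tcomult_hom tcounit_hom)
 note I = bialgebraI_gens[OF R[folded tensor_bialg_eq] h]
 have e: "tens_emb K B m i : alg_hom K B (tensor_bialg K B m)" if "i : {1..m}" for i
  using tens_emb_hom[OF B_kalg that] by simp
 note im = coassoc_image[OF bB R[folded tensor_bialg_eq] h e]
 show ?thesis
 proof (rule I[of "{tens_emb K B m i a | i a. i : {1..m} & a : cr B}"])
  show "gens K (tensor_bialg K B m) {tens_emb K B m i a | i a. i : {1..m} & a : cr B}"
   using tensor_gens[OF B_kalg] by simp
  fix x assume "x : {tens_emb K B m i a | i a. i : {1..m} & a : cr B}"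
  then obtain i b where x: "x = tens_emb K B m i b" and i: "i : {1..m}" and b: "b : cr B" by blast
  have c: "comult (tensor_bialg K B m) (tens_emb K B m i b) =
    tens_map2 K (tensor_bialg K B m) (tens_emb K B m i) (tens_emb K B m i) (comult B b)"
   "counit (tensor_bialg K B m) (tens_emb K B m i b) = counit B b" if "b : cr B" for b
   using tcomult_hom(2)[OF i that] tcounit_hom(2)[OF i that] by simp_all
  show "comult_id K (tensor_bialg K B m) (comult (tensor_bialg K B m) x) =
    id_comult K (tensor_bialg K B m) (comult (tensor_bialg K B m) x)"
   unfolding x by (rule im(1)[OF i b c])
  show "counit_id K (tensor_bialg K B m) (comult (tensor_bialg K B m) x) = x"
   unfolding x by (rule im(2)[OF i b c])
  show "id_counit K (tensor_bialg K B m) (comult (tensor_bialg K B m) x) = x"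
   unfolding x by (rule im(3)[OF i b c])
 qed
qed

end

text \<open>Both \<open>S \<circ> \<mu>\<close> and \<open>x \<otimes> y \<mapsto> S(y)S(x)\<close> are convolution inverse to the multiplication \<open>\<mu>\<close> of \<open>B\<close>.\<close>

lemma antipode_opp:
 assumes bB: "bialgebra K B" and S: "antipode K B S"
 shows "S : alg_hom K B (opp B)"
proof -
 note B = bialgebraD(1)[OF bB] and dB = bialg_closed[OF bB]
 interpret B: ring B by (rule kalg_ring[OF B])
 note BB = tensor_kalg[OF B, of 2] and BBB = tensor_kalg[OF tensor_kalg[OF B], of 2 2] and o = opp_kalg[OF B]
 note Sl = antipodeD(1)[OF S] and Sc = lin_closed[OF antipodeD(1)[OF S]]
 let ?m = "cv B (%x. x) (%x. x)" and ?n = "cv (opp B) S S" and ?p = "%i. tens_map2 K (tpow B 2) (E2 B i) (E2 B i)"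
 have Sl': "S : module_hom K B (opp B)" using Sl by (simp add: opp_lin)
 have v: "?m : module_hom K (tpow B 2) B" by (rule cv_lin[OF B B lin_id lin_id])
 have u: "(%t. S (?m t)) : module_hom K (tpow B 2) B" by (rule lin_comp[OF v Sl])
 have w: "?n : module_hom K (tpow B 2) B" using cv_lin[OF B o Sl' Sl'] by (simp add: opp_lin)
 have vt: "?m (tens_list K B [x, y]) = x *[B] y" if "x : cr B" "y : cr B" for x y
  using cv_tens[OF B B lin_id lin_id that] .
 have wt: "?n (tens_list K B [x, y]) = S y *[B] S x" if "x : cr B" "y : cr B" for x y
  using cv_tens[OF B o Sl' Sl' that] by simp
 have ph: "?p 1 : alg_hom K (tpow B 2) (tpow (tpow B 2) 2)" "?p 2 : alg_hom K (tpow B 2) (tpow (tpow B 2) 2)"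
  by (rule map2_hom(1)[OF B BB E2_hom(1)[OF B] E2_hom(1)[OF B]] map2_hom(1)[OF B BB E2_hom(2)[OF B] E2_hom(2)[OF B]])+
 note pl = ph[THEN ah_lin] and pc = ph[THEN ah_closed]
 have pt: "?p 1 (tens_list K B [a, b]) *[tpow (tpow B 2) 2] ?p 2 (tens_list K B [c, d]) =
   tens_list K (tpow B 2) [tens_list K B [a, c], tens_list K B [b, d]]"
  if "a : cr B" "b : cr B" "c : cr B" "d : cr B" for a b c d
 proof -
  note e = E2_closed[OF B]
  have "?p 1 (tens_list K B [a, b]) = tens_list K (tpow B 2) [E2 B 1 a, E2 B 1 b]"
   "?p 2 (tens_list K B [c, d]) = tens_list K (tpow B 2) [E2 B 2 c, E2 B 2 d]"
   by (rule map2_tens[OF B BB E2_lin(1)[OF B] E2_lin(1)[OF B] that(1,2)]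
     map2_tens[OF B BB E2_lin(2)[OF B] E2_lin(2)[OF B] that(3,4)])+
  then show ?thesis
   by (simp only: tens_list2_mult[OF BB e(1)[OF that(1)] e(1)[OF that(2)] e(2)[OF that(3)] e(2)[OF that(4)]]
     tens_list_emb2[OF B that(1,3)] tens_list_emb2[OF B that(2,4)])
 qed
 \<comment> \<open>With X = \<Delta>(x) and Y = \<Delta>(y) this is the convolution of u and v on B
   \<otimes> B at x \<otimes> y. For independent X and Y it is bilinear and can be computed on
   elementary tensors.\<close>
 let ?F = "%u v X Y. cv B u v (?p 1 X *[tpow (tpow B 2) 2] ?p 2 Y)"
 have Fl: "(%X. ?F u v X Y) : module_hom K (tpow B 2) B" if "Y : cr (tpow B 2)"
  "u : module_hom K (tpow B 2) B" "v : module_hom K (tpow B 2) B" for u v Y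
  by (rule lin_comp[OF lin_const_left[OF BBB pl(1) pc(2)[OF that(1)]] cv_lin[OF BB B that(2,3)]])
 have Fr: "(%Y. ?F u v X Y) : module_hom K (tpow B 2) B" if "X : cr (tpow B 2)"
  "u : module_hom K (tpow B 2) B" "v : module_hom K (tpow B 2) B" for u v X
  by (rule lin_comp[OF lin_const_right[OF BBB pl(2) pc(1)[OF that(1)]] cv_lin[OF BB B that(2,3)]])
 have Ft: "?F u v (tens_list K B [a, b]) (tens_list K B [c, d]) = u (tens_list K B [a, c]) *[B] v (tens_list K B [b, d])"
  if "a : cr B" "b : cr B" "c : cr B" "d : cr B"
  "u : module_hom K (tpow B 2) B" "v : module_hom K (tpow B 2) B" for a b c d u v
  unfolding pt[OF that(1-4)] by (rule cv_tens[OF BB B that(5,6)]) (use that B in simp_all)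
 \<comment> \<open>S(x_1 y_1) x_2 y_2 is one side of the antipode axiom at the product x y.\<close>
 have conv: "?F (%t. S (?m t)) ?m X Y = cv B S (%x. x) (X *[tpow B 2] Y)"
  if X: "X : cr (tpow B 2)" and Y: "Y : cr (tpow B 2)" for X Y
 proof (rule lin_eq_tens2[OF B Fl[OF Y u v] lin_comp[OF lin_mult_right[OF BB Y] cv_lin[OF B B Sl lin_id]] _ X])
  fix a b assume ab: "a : cr B" "b : cr B"
  note tl = tens_list2_closed[OF B ab]
  show "?F (%t. S (?m t)) ?m (tens_list K B [a, b]) Y = cv B S (%x. x) (tens_list K B [a, b] *[tpow B 2] Y)"
   by (rule lin_eq_tens2[OF B Fr[OF tl u v] lin_comp[OF lin_mult_left[OF BB tl] cv_lin[OF B B Sl lin_id]] _ Y])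
    (use ab B in \<open>simp add: Ft[OF _ _ _ _ u v] vt tens_list2_mult cv_tens[OF B B Sl lin_id]\<close>)
 qed
 \<comment> \<open>In x_1 y_1 S(y_2) S(x_2) the inner part is the scalar c by the antipode axiom at
   y.\<close>
 have conv': "?F ?m ?n X Y = c .[B] cv B (%x. x) S X"
  if X: "X : cr (tpow B 2)" and Y: "Y : cr (tpow B 2)" and c: "c : cr K"
   and cY: "cv B (%x. x) S Y = c .[B] \<one>[B]" for X Y c
 proof (rule lin_eq_tens2[OF B Fl[OF Y v w] _ _ X])
  show "(%X. c .[B] cv B (%x. x) S X) : module_hom K (tpow B 2) B"
   using c B by (intro lin_comp[OF cv_lin[OF B B lin_id Sl]] module_homI) (auto simp: ka_smult K.m_comm)
  fix a b assume ab: "a : cr B" "b : cr B"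
  note tl = tens_list2_closed[OF B ab]
  have "?F ?m ?n (tens_list K B [a, b]) Y = a *[B] (cv B (%x. x) S Y *[B] S b)"
   by (rule lin_eq_tens2[OF B Fr[OF tl v w] lin_const_right[OF B lin_const_left[OF B cv_lin[OF B B lin_id Sl] Sc[OF ab(2)]] ab(1)] _ Y])
    (use ab B Sc in \<open>simp add: Ft[OF _ _ _ _ v w] vt wt cv_tens[OF B B lin_id Sl] B.m_assoc\<close>)
  then show "?F ?m ?n (tens_list K B [a, b]) Y = c .[B] cv B (%x. x) S (tens_list K B [a, b])"
   using ab c B Sc by (simp add: cY cv_tens[OF B B lin_id Sl] ka_smult)
 qed
 note tb = tensor_bialgebra[OF bB, of 2]
 note tc = tcomult_hom[OF bB, where m = 2] and te = tcounit_hom[OF bB, where m = 2]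
 have ct: "tcomult B 2 (tens_list K B [x, y]) = ?p 1 (comult B x) *[tpow (tpow B 2) 2] ?p 2 (comult B y)"
  "tcounit B 2 (tens_list K B [x, y]) = counit B x *[K] counit B y" if "x : cr B" "y : cr B" for x y
  using that E2_closed[OF B] te
  by (simp_all add: tens_list_emb2[OF B] ah_mult[OF tc(1)] tc(2) ah_mult[OF te(1)])
 note \<epsilon> = counit_closed[OF bB]
 have mult: "S (x *[B] y) = S y *[B] S x" if xy: "x : cr B" "y : cr B" for x y
 proof -
  have "(%t. S (?m t)) (tens_list K B [x, y]) = ?n (tens_list K B [x, y])"
  proof (rule convolution_inverse_unique[OF tb B, where v = ?m])
   have trv: "triv (tcounit B 2) B : module_hom K (tpow B 2) B" by (rule ah_lin[OF triv_hom[OF te(1) B]])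
   fix t assume "t : cr (tensor_bialg K B 2)"
   then have t: "t : cr (tpow B 2)" by simp
   have "cv B (%t. S (?m t)) ?m (tcomult B 2 t) = triv (tcounit B 2) B t"
   proof (rule lin_eq_tens2[OF B lin_comp[OF ah_lin[OF tc(1)] cv_lin[OF BB B u v]] trv _ t])
    fix a b assume ab: "a : cr B" "b : cr B"
    show "cv B (%t. S (?m t)) ?m (tcomult B 2 (tens_list K B [a, b])) = triv (tcounit B 2) B (tens_list K B [a, b])"
     using antipodeD(2)[OF S B.m_closed[OF ab]]
     unfolding ct(1)[OF ab] conv[OF dB[OF ab(1)] dB[OF ab(2)]] ah_mult[OF bialgebraD(2)[OF bB] ab, symmetric] triv_def
      ct(2)[OF ab] by (simp add: ah_mult[OF bialgebraD(3)[OF bB] ab])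
   qed
   then show "cv B (%t. S (?m t)) ?m (comult (tensor_bialg K B 2) t) = triv (counit (tensor_bialg K B 2)) B t" by simp
   have "cv B ?m ?n (tcomult B 2 t) = triv (tcounit B 2) B t"
   proof (rule lin_eq_tens2[OF B lin_comp[OF ah_lin[OF tc(1)] cv_lin[OF BB B v w]] trv _ t])
    fix a b assume ab: "a : cr B" "b : cr B"
    have c: "cv B (%x. x) S (comult B b) = counit B b .[B] \<one>[B]" "cv B (%x. x) S (comult B a) = counit B a .[B] \<one>[B]"
     using antipodeD(3)[OF S ab(2)] antipodeD(3)[OF S ab(1)] by (simp_all add: triv_def)
    show "cv B ?m ?n (tcomult B 2 (tens_list K B [a, b])) = triv (tcounit B 2) B (tens_list K B [a, b])"
     unfolding ct(1)[OF ab] conv'[OF dB[OF ab(1)] dB[OF ab(2)] \<epsilon>[OF ab(2)] c(1)] c(2) triv_def ct(2)[OF ab]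
     using B \<epsilon> ab by (simp add: ka_smult K.m_comm)
   qed
   then show "cv B ?m ?n (comult (tensor_bialg K B 2) t) = triv (counit (tensor_bialg K B 2)) B t" by simp
  qed (use u v w xy B in simp_all)
  then show ?thesis using xy by (simp add: vt wt)
 qed
 have "cv B S (%x. x) (comult B \<one>[B]) = S \<one>[B]"
  using B Sc by (simp add: ah_one[OF bialgebraD(2)[OF bB]] tens_list2_one cv_tens[OF B B Sl lin_id])
 then have "S \<one>[B] = \<one>[B]"
  using antipodeD(2)[OF S B.one_closed] B ah_one[OF bialgebraD(3)[OF bB]] by (simp add: triv_def)
 then show ?thesis using mult Sl' by (intro alg_homI) simp_all
qed

definition tantipode :: "('k, 'b) bialg => nat => ('b => 'b) => ('k, 'b) tensor => ('k, 'b) tensor" where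
 "tantipode B m S = thom m (opp (tpow B m)) (%i b. tens_emb K B m i (S b))"

lemma opp_alg_hom: "f : alg_hom K A C ==> f : alg_hom K (opp A) (opp C)"
 by (rule alg_homI) (simp_all add: opp_lin ah_lin ah_mult ah_one)

lemma tantipode_hom:
 assumes bB: "bialgebra K B" and S: "antipode K B S"
 shows "tantipode B m S : alg_hom K (tpow B m) (opp (tpow B m))"
  "i : {1..m} ==> b : cr B ==> tantipode B m S (tens_emb K B m i b) = tens_emb K B m i (S b)"
  "antipode K (tensor_bialg K B m) (tantipode B m S)"
proof -
 note B = bialgebraD(1)[OF bB] and dB = bialg_closed[OF bB] and So = antipode_opp[OF bB S] and Sl = antipodeD(1)[OF S]
 have Sc: "S b : cr B" if "b : cr B" for b using lin_closed[OF Sl that] .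
 note R = tensor_kalg[OF B, of m]
 note th = thom_hom[OF B opp_kalg[OF R] ah_comp[OF So opp_alg_hom[OF tens_emb_hom[OF B]]]]
 have h: "tantipode B m S : alg_hom K (tpow B m) (opp (tpow B m))"
  "i : {1..m} ==> b : cr B ==> tantipode B m S (tens_emb K B m i b) = tens_emb K B m i (S b)" for i b
  unfolding tantipode_def by (rule th; simp add: tens_emb_comm[OF B] Sc)+
 show "tantipode B m S : alg_hom K (tpow B m) (opp (tpow B m))"
  "i : {1..m} ==> b : cr B ==> tantipode B m S (tens_emb K B m i b) = tens_emb K B m i (S b)"
  by (rule h)+
 have hl: "tantipode B m S : module_hom K (tpow B m) (tpow B m)" using ah_lin[OF h(1)] by (simp add: opp_lin)
 note X = tensor_gens[OF B, of m]
 have c1: "cv (tpow B m) (tantipode B m S) (%x. x) (tcomult B m (tens_emb K B m i b)) = triv (counit B) (tpow B m) b"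
  and c2: "cv (tpow B m) (%x. x) (tantipode B m S) (tcomult B m (tens_emb K B m i b)) = triv (counit B) (tpow B m) b"
  if i: "i : {1..m}" and b: "b : cr B" for i b
 proof -
  note e = tens_emb_hom[OF B i] and el = ah_lin[OF tens_emb_hom[OF B i]]
  have t: "tens_emb K B m i (triv (counit B) B b) = triv (counit B) (tpow B m) b"
   using B counit_closed[OF bB b] by (simp add: triv_def ah_smult[OF e] ah_one[OF e])
  have "cv (tpow B m) (tantipode B m S) (%x. x) (tcomult B m (tens_emb K B m i b)) =
    cv (tpow B m) (%b. tantipode B m S (tens_emb K B m i b)) (tens_emb K B m i) (comult B b)"
   unfolding tcomult_hom(2)[OF bB i b] by (rule cv_map2[OF B R el el R hl lin_id dB[OF b]])
  also have "... = cv (tpow B m) (%b. tens_emb K B m i (S b)) (tens_emb K B m i) (comult B b)"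
   by (rule cv_cong[OF B R lin_comp[OF el hl] el dB[OF b]]) (simp_all add: h(2)[OF i])
  also have "... = tens_emb K B m i (cv B S (%x. x) (comult B b))"
   by (rule lin_cv[OF B B R e Sl lin_id dB[OF b], symmetric])
  finally show "cv (tpow B m) (tantipode B m S) (%x. x) (tcomult B m (tens_emb K B m i b)) = triv (counit B) (tpow B m) b"
   by (simp add: antipodeD(2)[OF S b] t)
  have "cv (tpow B m) (%x. x) (tantipode B m S) (tcomult B m (tens_emb K B m i b)) =
    cv (tpow B m) (tens_emb K B m i) (%b. tantipode B m S (tens_emb K B m i b)) (comult B b)"
   unfolding tcomult_hom(2)[OF bB i b] by (rule cv_map2[OF B R el el R lin_id hl dB[OF b]])
  also have "... = cv (tpow B m) (tens_emb K B m i) (%b. tens_emb K B m i (S b)) (comult B b)"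
   by (rule cv_cong[OF B R el lin_comp[OF el hl] dB[OF b]]) (simp_all add: h(2)[OF i])
  also have "... = tens_emb K B m i (cv B (%x. x) S (comult B b))"
   by (rule lin_cv[OF B B R e lin_id Sl dB[OF b], symmetric])
  finally show "cv (tpow B m) (%x. x) (tantipode B m S) (tcomult B m (tens_emb K B m i b)) = triv (counit B) (tpow B m) b"
   by (simp add: antipodeD(3)[OF S b] t)
 qed
 have o: "opp (tensor_bialg K B m) = opp (tpow B m)" by (simp add: opp_def)
 have tr: "triv e (make_bialg A d e') = triv e A" for e' d and A :: "('k, ('k, 'b) tensor) module" and e :: "('k, 'b) tensor => 'k"
  by (intro ext) (simp add: triv_def)
 show "antipode K (tensor_bialg K B m) (tantipode B m S)"
 proof (rule antipodeI_gens[OF tensor_bialgebra[OF bB]])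
  show "tantipode B m S : alg_hom K (tensor_bialg K B m) (opp (tensor_bialg K B m))"
   unfolding o using h(1) by simp
  show "gens K (tensor_bialg K B m) {tens_emb K B m i a | i a. i : {1..m} & a : cr B}"
   using X by simp
  fix x assume "x : {tens_emb K B m i a | i a. i : {1..m} & a : cr B}"
  then obtain i b where x: "x = tens_emb K B m i b" "i : {1..m}" "b : cr B" by blast
  show "cv (tensor_bialg K B m) (tantipode B m S) (%x. x) (comult (tensor_bialg K B m) x) =
    triv (counit (tensor_bialg K B m)) (tensor_bialg K B m) x"
   "cv (tensor_bialg K B m) (%x. x) (tantipode B m S) (comult (tensor_bialg K B m) x) =
    triv (counit (tensor_bialg K B m)) (tensor_bialg K B m) x"
   using c1[OF x(2,3)] c2[OF x(2,3)] tcounit_hom(2)[OF bB x(2,3)] by (simp_all add: x(1) tr triv_def)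
 qed
qed

end

section \<open>Central twists\<close>

locale central_twist = base_field K for K :: "'k ring" +
 fixes B :: "('k, 'b) bialg" and S :: "'b => 'b" and J :: "('k, 'b) tensor"
 assumes bB: "bialgebra K B" and antipode_S: "antipode K B S" and twist_J: "twist K B J"
  and central_J: "J : center (tpow B 2)"
  and comult_J: "comult (tensor_bialg K B 2) J =
   emb_twist K B 2 J 1 2 *[tpow (tpow B 2) 2] emb_twist K B 2 J 2 1
    *[tpow (tpow B 2) 2] tens_list K (tpow B 2) [J, J]"
  and S_J: "tens_map2 K B S S J = J" "tens_map2 K B (%x. x) S J = inv\<^bsub>tpow B 2\<^esub> J"
   "inv\<^bsub>tpow B 2\<^esub> J = tens_map2 K B S (%x. x) J"
begin

lemma B [simp]: "kalg K B" by (rule bialgebraD[OF bB])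

lemmas dB = bialg_closed[OF bB]
lemmas eB = counit_closed[OF bB]
lemmas BB = tensor_kalg[OF B, where n = 2]
lemmas Sl = antipodeD(1)[OF antipode_S]

lemma J [simp]: "J : cr (tpow B 2)" by (rule center_closed[OF central_J])

abbreviation triv\<epsilon> :: "('k, 't, 'z) module_scheme => 'b => 't" where
 "triv\<epsilon> T == triv (counit B) T"

lemma triv\<epsilon>_hom: "kalg K T ==> triv\<epsilon> T : alg_hom K B T"
 by (rule triv_hom[OF bialgebraD(3)[OF bB]])

lemma J_unit: "J : Units (tpow B 2)" using twist_J by (simp add: twist_def Let_def)

definition J' where "J' = inv\<^bsub>tpow B 2\<^esub> J"

lemma J' [simp]: "J' : cr (tpow B 2)" "J *[tpow B 2] J' = \<one>[tpow B 2]" "J' *[tpow B 2] J = \<one>[tpow B 2]"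
 unfolding J'_def
 using monoid.Units_inv_closed[OF kalg_monoid[OF BB] J_unit] monoid.Units_r_inv[OF kalg_monoid[OF BB] J_unit]
  monoid.Units_l_inv[OF kalg_monoid[OF BB] J_unit] by auto

lemma com_triv:
 assumes T: "kalg K T" and f: "f : module_hom K B T"
 shows "com B T (triv\<epsilon> T) f" "com B T f (triv\<epsilon> T)"
 by (rule comI; use T lin_closed[OF f] eB in \<open>simp add: triv_def ka_smult\<close>)+

lemma com_cv:
 assumes T: "kalg K T" and l: "u : module_hom K B T" "v : module_hom K B T" "z : module_hom K B T"
  and c: "com B T z u" "com B T z v"
 shows "b : cr B ==> X : cr (tpow B 2) ==> z b *[T] cv T u v X = cv T u v X *[T] z b"
 by (rule cv_commute[OF B T l(1,2)]) (simp_all add: lin_closed[OF l(3)] comD[OF c(1)] comD[OF c(2)])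

lemma cvl_hom:
 assumes "kalg K T" "f : alg_hom K B T" "g : alg_hom K B T" "com B T f g"
 shows "(%b. cv T f g (comult B b)) : alg_hom K B T"
 by (rule ah_comp[OF bialgebraD(2)[OF bB] cv_hom(1)[OF B assms]])

lemma cvl_triv:
 assumes T: "kalg K T" and f: "f : alg_hom K B T" and b: "b : cr B"
 shows "cv T (triv\<epsilon> T) f (comult B b) = f b" "cv T f (triv\<epsilon> T) (comult B b) = f b"
proof -
 note t = ah_lin[OF triv\<epsilon>_hom[OF B]] and fl = ah_lin[OF f]
 have ft: "f (triv\<epsilon> B a) = triv\<epsilon> T a" if "a : cr B" for a
  using that eB by (simp add: triv_def ah_smult[OF f] ah_one[OF f])
 have "cv T (%a. f (triv\<epsilon> B a)) (%a. f a) (comult B b) = f b"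
  using lin_cv[OF B B T f t lin_id dB[OF b]] bialg_coassoc(2)[OF bB b] by simp
 then show "cv T (triv\<epsilon> T) f (comult B b) = f b"
  using cv_cong[OF B T lin_comp[OF t fl] fl dB[OF b] ft refl] by simp
 have "cv T (%a. f a) (%a. f (triv\<epsilon> B a)) (comult B b) = f b"
  using lin_cv[OF B B T f lin_id t dB[OF b]] bialg_coassoc(3)[OF bB b] by simp
 then show "cv T f (triv\<epsilon> T) (comult B b) = f b"
  using cv_cong[OF B T fl lin_comp[OF t fl] dB[OF b] refl ft] by simp
qed

text \<open>
  Write \<open>J\<langle>f,g\<rangle> = (f \<cdot> g)(J)\<close> for algebra maps \<open>f, g : B \<rightarrow> T\<close> with commuting images.  Hypothesis (ii)
  reads \<open>J\<langle>f\<^sub>1*g\<^sub>1, f\<^sub>2*g\<^sub>2\<rangle> = J\<langle>f\<^sub>1,g\<^sub>2\<rangle> J\<langle>f\<^sub>2,g\<^sub>1\<rangle> J\<langle>f\<^sub>1,f\<^sub>2\<rangle> J\<langle>g\<^sub>1,g\<^sub>2\<rangle>\<close>; inserting trivial maps shows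
  that \<open>J\<close> is a symmetric bicharacter.
\<close>

lemma J_four:
 assumes T: "kalg K T"
  and h: "f1 : alg_hom K B T" "f2 : alg_hom K B T" "g1 : alg_hom K B T" "g2 : alg_hom K B T"
  and c: "com B T f1 f2" "com B T f1 g1" "com B T f1 g2" "com B T f2 g1" "com B T f2 g2" "com B T g1 g2"
 shows "cv T (%b. cv T f1 g1 (comult B b)) (%b. cv T f2 g2 (comult B b)) J =
  cv T f1 g2 J *[T] cv T f2 g1 J *[T] (cv T f1 f2 J *[T] cv T g1 g2 J)"
proof -
 note l = h[THEN ah_lin] and hc = h[THEN ah_closed]
 note BBB = tensor_kalg[OF BB, of 2]
 let ?f = "cv T f1 f2" and ?g = "cv T g1 g2"
 note fh = cv_hom[OF B T h(1,2) c(1)] and gh = cv_hom[OF B T h(3,4) c(6)]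
 note fl = ah_lin[OF fh(1)] and gl = ah_lin[OF gh(1)]
 note C = com_cv[OF T]
 have fg: "com (tpow B 2) T ?f ?g"
 proof (rule comI)
  fix X Y assume X: "X : cr (tpow B 2)" and Y: "Y : cr (tpow B 2)"
  show "?f X *[T] ?g Y = ?g Y *[T] ?f X"
   by (rule cv_commute[OF B T l(3,4) Y lin_closed[OF fl X]])
    (rule sym, rule C[OF l(1,2)], simp_all add: l c com_sym X)+
 qed
 \<comment> \<open>Hypothesis (ii) is an equation in (B \<otimes> B) \<otimes> (B \<otimes> B). It
   is evaluated along \<open>f1\<close> and \<open>f2\<close> on the first pair of factors and along
   \<open>g1\<close> and \<open>g2\<close> on the second.\<close>
 let ?\<Phi> = "cv T ?f ?g"
 note \<Phi> = cv_hom[OF BB T fh(1) gh(1) fg]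
 note tc = tcomult_hom[OF bB, where m = 2]
 have com4: "com B T (%b. cv T f1 g1 (comult B b)) (%b. cv T f2 g2 (comult B b))"
 proof (rule comI)
  fix a b assume a: "a : cr B" and b: "b : cr B"
  show "cv T f1 g1 (comult B a) *[T] cv T f2 g2 (comult B b) = cv T f2 g2 (comult B b) *[T] cv T f1 g1 (comult B a)"
   by (rule cv_commute[OF B T l(2,4) dB[OF b] cv_closed[OF B T l(1,3) dB[OF a]]])
    (rule sym, rule C[OF l(1,3)], simp_all add: l c com_sym dB[OF a])+
 qed
 note r = cv_hom[OF B T cvl_hom[OF T h(1,3) c(2)] cvl_hom[OF T h(2,4) c(5)] com4]
 have e: "E2 B i : module_hom K B (tpow B 2)" if "i : {1,2}" for i
  using that E2_lin[OF B] by auto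
 have m2: "?\<Phi> (tens_map2 K (tpow B 2) (E2 B i) (E2 B j) X) = cv T (%b. ?f (E2 B i b)) (%b. ?g (E2 B j b)) X"
  if "i : {1,2}" "j : {1,2}" "X : cr (tpow B 2)" for i j X
  by (rule cv_map2[OF B BB e[OF that(1)] e[OF that(2)] T fl gl that(3)])
 have cc: "cv T (%b. ?f (E2 B i b)) (%b. ?g (E2 B j b)) X = cv T (if i = 1 then f1 else f2) (if j = 1 then g1 else g2) X"
  if "i : {1,2}" "j : {1,2}" "X : cr (tpow B 2)" for i j X
  by (rule cv_cong[OF B T lin_comp[OF e[OF that(1)] fl] lin_comp[OF e[OF that(2)] gl] that(3)])
   (use that fh gh in auto)
 \<comment> \<open>As functions of J both sides are algebra maps on B \<otimes> B, so they are
   compared on b \<otimes> 1 and 1 \<otimes> b.\<close>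
 have "?\<Phi> (tcomult B 2 J) = cv T (%b. cv T f1 g1 (comult B b)) (%b. cv T f2 g2 (comult B b)) J"
 proof (rule tensor_hom_eqI[OF B ah_comp[OF tc(1) \<Phi>(1)] r(1) _ J])
  fix i b assume i: "i : {1..2::nat}" and b: "b : cr B"
  then have i': "i = 1 \<or> i = 2" by auto
  show "?\<Phi> (tcomult B 2 (E2 B i b)) = cv T (%b. cv T f1 g1 (comult B b)) (%b. cv T f2 g2 (comult B b)) (E2 B i b)"
   using i' r(2,3)[OF b] m2[of i i, OF _ _ dB[OF b]] cc[of i i, OF _ _ dB[OF b]] tc(2)[OF i b] by auto
 qed
 moreover have "?\<Phi> (tcomult B 2 J) = ?\<Phi> (emb_twist K B 2 J 1 2) *[T] ?\<Phi> (emb_twist K B 2 J 2 1) *[T] ?\<Phi> (tens_list K (tpow B 2) [J, J])"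
 proof -
  have et: "emb_twist K B 2 J i j : cr (tpow (tpow B 2) 2)" if "i : {1,2}" "j : {1,2}" for i j
   unfolding emb_twist_def by (rule lin_closed[OF map2_lin[OF B BB e[OF that(1)] e[OF that(2)]] J])
  show ?thesis
   using comult_J et[of 1 2] et[of 2 1] BBB
   by (simp add: ah_mult[OF \<Phi>(1)] tens_list2_closed[OF BB J J])
 qed
 moreover have "?\<Phi> (emb_twist K B 2 J i j) = cv T (if i = 1 then f1 else f2) (if j = 1 then g1 else g2) J"
  if "i : {1,2}" "j : {1,2}" for i j
  unfolding emb_twist_def m2[OF that J] by (rule cc[OF that J])
 moreover have "?\<Phi> (tens_list K (tpow B 2) [J, J]) = ?f J *[T] ?g J"
  by (rule cv_tens[OF BB T fl gl J J])
 ultimately show ?thesis by simp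
qed

text \<open>The counit conditions on the twist are the case of the identity map of B; f carries them
  to T.\<close>

lemma J_triv:
 assumes T: "kalg K T" and f: "f : alg_hom K B T"
 shows "cv T (triv\<epsilon> T) f J = \<one>[T]" "cv T f (triv\<epsilon> T) J = \<one>[T]"
proof -
 note t = ah_lin[OF triv\<epsilon>_hom[OF B]] and fl = ah_lin[OF f]
 have ft: "f (triv\<epsilon> B a) = triv\<epsilon> T a" if "a : cr B" for a
  using that eB by (simp add: triv_def ah_smult[OF f] ah_one[OF f])
 have J1: "cv B (triv\<epsilon> B) (%a. a) J = \<one>[B]" "cv B (%a. a) (triv\<epsilon> B) J = \<one>[B]"
  using twist_J counit_id_cv[OF bialgebraD(1-3)[OF bB] J] by (simp_all add: twist_def Let_def)
 have "cv T (%a. f (triv\<epsilon> B a)) (%a. f a) J = \<one>[T]"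
  using lin_cv[OF B B T f t lin_id J] by (simp add: J1 ah_one[OF f])
 then show "cv T (triv\<epsilon> T) f J = \<one>[T]" using cv_cong[OF B T lin_comp[OF t fl] fl J ft refl] by simp
 have "cv T (%a. f a) (%a. f (triv\<epsilon> B a)) J = \<one>[T]"
  using lin_cv[OF B B T f lin_id t J] by (simp add: J1 ah_one[OF f])
 then show "cv T f (triv\<epsilon> T) J = \<one>[T]" using cv_cong[OF B T fl lin_comp[OF t fl] J refl ft] by simp
qed

context
 fixes T :: "('k, 't, 'z) module_scheme"
 assumes T [simp]: "kalg K T"
begin

lemma jc: "f : alg_hom K B T ==> g : alg_hom K B T ==> X : cr (tpow B 2) ==> cv T f g X : cr T"
 by (rule cv_closed[OF B T ah_lin ah_lin])

text \<open>In \<open>J_four\<close> let \<open>f1\<close> and \<open>g2\<close> be trivial: the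
  left side becomes the twist along g and f, and on the right only the factor along f and g is
  left.\<close>

lemma J_sym:
 assumes f: "f : alg_hom K B T" and g: "g : alg_hom K B T" and c: "com B T f g"
 shows "cv T f g J = cv T g f J"
proof -
 note t = triv\<epsilon>_hom[OF T] and ct = com_triv[OF T]
 note fl = ah_lin[OF f] and gl = ah_lin[OF g] and tl = ah_lin[OF t]
 note cl = ah_lin[OF cvl_hom[OF T t g ct(1)[OF gl]]] ah_lin[OF cvl_hom[OF T f t ct(2)[OF fl]]]
 have "cv T g f J = cv T (%b. cv T (triv\<epsilon> T) g (comult B b)) (%b. cv T f (triv\<epsilon> T) (comult B b)) J"
  by (rule cv_cong[OF B T gl fl J]) (simp_all add: cvl_triv[OF T f] cvl_triv[OF T g])
 also have "... = cv T f g J"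
  using J_four[OF T t f g t ct(1)[OF fl] ct(1)[OF gl] ct(1)[OF tl] c ct(2)[OF fl] ct(2)[OF gl]] jc[OF f g J]
  by (simp add: J_triv[OF T] t f g)
 finally show ?thesis ..
qed

text \<open>\<open>J_four\<close> with a trivial \<open>g2\<close> for the first part and a trivial
  \<open>f1\<close> for the second. Symmetry restores the order of the arguments.\<close>

lemma J_bichar:
 assumes f: "f : alg_hom K B T" and f': "f' : alg_hom K B T" and g: "g : alg_hom K B T"
  and c: "com B T f f'" "com B T f g" "com B T f' g"
 shows "cv T (%b. cv T f f' (comult B b)) g J = cv T f' g J *[T] cv T f g J"
  "cv T g (%b. cv T f f' (comult B b)) J = cv T g f J *[T] cv T g f' J"
proof -
 note t = triv\<epsilon>_hom[OF T] and ct = com_triv[OF T]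
 note fl = ah_lin[OF f] and fl' = ah_lin[OF f'] and gl = ah_lin[OF g] and tl = ah_lin[OF t]
 note cl = ah_lin[OF cvl_hom[OF T f f' c(1)]]
 have "cv T (%b. cv T f f' (comult B b)) g J = cv T (%b. cv T f f' (comult B b)) (%b. cv T g (triv\<epsilon> T) (comult B b)) J"
  by (rule cv_cong[OF B T cl gl J]) (simp_all add: cvl_triv[OF T g])
 also have "... = cv T g f' J *[T] cv T f g J"
  using J_four[OF T f g f' t c(2) c(1) ct(2)[OF fl] com_sym[OF c(3)] ct(2)[OF gl] ct(2)[OF fl']]
   jc[OF g f' J] jc[OF f g J]
  by (simp add: J_triv[OF T] f f' g)
 finally show "cv T (%b. cv T f f' (comult B b)) g J = cv T f' g J *[T] cv T f g J"
  by (simp add: J_sym[OF f' g c(3)])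
 have "cv T g (%b. cv T f f' (comult B b)) J = cv T (%b. cv T (triv\<epsilon> T) g (comult B b)) (%b. cv T f f' (comult B b)) J"
  by (rule cv_cong[OF B T gl cl J]) (simp_all add: cvl_triv[OF T g])
 also have "... = cv T f g J *[T] cv T g f' J"
  using J_four[OF T t f g f' ct(1)[OF fl] ct(1)[OF gl] ct(1)[OF fl'] c(2) c(1) com_sym[OF c(3)]]
   jc[OF g f' J] jc[OF f g J]
  by (simp add: J_triv[OF T] f f' g)
 finally show "cv T g (%b. cv T f f' (comult B b)) J = cv T g f J *[T] cv T g f' J"
  by (simp add: J_sym[OF f g c(2)])
qed

lemma J_inverse:
 assumes f: "f : alg_hom K B T" and g: "g : alg_hom K B T" and c: "com B T f g"
 shows "cv T f g J *[T] cv T f g J' = \<one>[T]" "cv T f g J' *[T] cv T f g J = \<one>[T]"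
 using ah_mult[OF cv_hom(1)[OF B T f g c], of J J'] ah_mult[OF cv_hom(1)[OF B T f g c], of J' J]
  ah_one[OF cv_hom(1)[OF B T f g c]] by simp_all

text \<open>Centrality of J against b \<otimes> 1 and 1 \<otimes> b, seen through the algebra map
  induced by f and g.\<close>

lemma J_commute:
 assumes f: "f : alg_hom K B T" and g: "g : alg_hom K B T" and c: "com B T f g" and b: "b : cr B"
 shows "f b *[T] cv T f g J = cv T f g J *[T] f b" "g b *[T] cv T f g J = cv T f g J *[T] g b"
proof -
 note h = cv_hom[OF B T f g c]
 note e = E2_closed[OF B b]
 have "cv T f g (E2 B i b *[tpow B 2] J) = cv T f g (J *[tpow B 2] E2 B i b)" if "i : {1,2}" for i
  using that e center_comm[OF central_J] by auto
 from this[of 1] this[of 2] show "f b *[T] cv T f g J = cv T f g J *[T] f b" "g b *[T] cv T f g J = cv T f g J *[T] g b"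
  using e by (simp_all add: ah_mult[OF h(1)] h(2,3)[OF b])
qed

end

subsection \<open>The elements \<open>t\<^sub>i\<^sub>j\<close> and \<open>J\<^sub>i\<^sub>j\<close>\<close>

lemma hom_com:
 assumes "h : alg_hom K A T" "f : alg_hom K B A" "g : alg_hom K B A" "com B A f g"
 shows "com B T (%b. h (f b)) (%b. h (g b))"
 by (rule comI) (simp add: comD[OF assms(4)] ah_closed[OF assms(2)] ah_closed[OF assms(3)] flip: ah_mult[OF assms(1)])

context
 fixes m :: nat
begin

abbreviation (input) "RT == tpow B m"
abbreviation (input) "RRT == tpow (tpow B m) 2"
abbreviation (input) "eT i == tens_emb K B m i"
abbreviation (input) "ET p i == %b. E2 (tpow B m) p (tens_emb K B m i b)"

lemma Rk [simp]: "kalg K (tpow B m)" and RRk [simp]: "kalg K (tpow (tpow B m) n)"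
 by simp_all

lemma e_hom: "i : {1..m} ==> eT i : alg_hom K B RT" by (rule tens_emb_hom[OF B])
lemma e_closed: "i : {1..m} ==> b : cr B ==> eT i b : cr RT" by (rule tens_emb_closed[OF B])
lemma e_com: "i ~= j ==> com B RT (eT i) (eT j)" by (rule comI) (rule tens_emb_comm[OF B])

lemma E_hom: "p : {1..2} ==> i : {1..m} ==> ET p i : alg_hom K B RRT"
 by (rule ah_comp[OF e_hom tens_emb_hom[OF Rk]])

lemma E_com:
 assumes "p : {1..2}" "i : {1..m}" "j : {1..m}" "p ~= q \<or> i ~= j"
 shows "com B RRT (ET p i) (ET q j)"
proof (cases "p = q")
 case True
 then show ?thesis
  using hom_com[OF tens_emb_hom[OF Rk assms(1)] e_hom[OF assms(2)] e_hom[OF assms(3)] e_com] assms(4) by auto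
next
 case False
 show ?thesis by (rule comI) (rule tens_emb_comm[OF Rk False e_closed[OF assms(2)] e_closed[OF assms(3)]])
qed

definition t :: "nat => nat => ('k, 'b) tensor" where "t i j = cv RT (eT i) (eT j) J"
definition t' :: "nat => nat => ('k, 'b) tensor" where "t' i j = cv RT (eT i) (eT j) J'"
definition JJ :: "nat => nat => ('k, ('k, 'b) tensor) tensor" where "JJ i j = cv RRT (ET 1 i) (ET 2 j) J"

context
 fixes i j :: nat
 assumes i: "i : {1..m}" and j: "j : {1..m}"
begin

lemma emb_twist_eq: "emb_twist K B m J i j = JJ i j"
 unfolding emb_twist_def JJ_def
 by (rule map2_cv[OF B Rk ah_lin[OF e_hom[OF i]] ah_lin[OF e_hom[OF j]] J])

lemma emb_twist_mult_eq: "emb_twist_mult K B m J i j = t i j"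
proof -
 have "mult_map K RT X = cv RT (%x. x) (%x. x) X" for X by (simp add: mult_map_def cv_def)
 then show ?thesis
  unfolding emb_twist_mult_def emb_twist_def t_def
  using cv_map2[OF B Rk ah_lin[OF e_hom[OF i]] ah_lin[OF e_hom[OF j]] Rk lin_id lin_id J] by simp
qed

lemma t_closed: "t i j : cr RT" "t' i j : cr RT"
 unfolding t_def t'_def by (rule jc[OF Rk e_hom[OF i] e_hom[OF j]]; simp)+

lemma JJ_closed: "JJ i j : cr RRT"
 unfolding JJ_def by (rule jc[OF RRk E_hom[OF _ i] E_hom[OF _ j]]) auto

text \<open>Elements in the two places occupied by J commute with it because J is central, all
  others because they sit in a different leg or position.\<close>

lemma JJ_commute_gen:
 assumes "p : {1..2}" "k : {1..m}" "b : cr B" and ij: "i ~= j"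
 shows "ET p k b *[RRT] JJ i j = JJ i j *[RRT] ET p k b"
proof -
 have h: "ET 1 i : alg_hom K B RRT" "ET 2 j : alg_hom K B RRT" by (rule E_hom[OF _ i] E_hom[OF _ j], simp)+
 have c: "com B RRT (ET 1 i) (ET 2 j)" by (rule E_com[OF _ i j]) auto
 consider "p = 1 & k = i" | "p = 2 & k = j" | "(p ~= 1 \<or> k ~= i) & (p ~= 2 \<or> k ~= j)" by blast
 then show ?thesis
 proof cases
  case 1
  then show ?thesis using J_commute(1)[OF RRk h c assms(3)] by (simp add: JJ_def)
 next
  case 2
  then show ?thesis using J_commute(2)[OF RRk h c assms(3)] by (simp add: JJ_def)
 next
  case 3
  show ?thesis unfolding JJ_def
   by (rule com_cv[OF RRk h(1)[THEN ah_lin] h(2)[THEN ah_lin] E_hom[OF assms(1,2), THEN ah_lin] _ _ assms(3) J])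
    (rule E_com[OF assms(1,2)], use i j 3 in auto)+
 qed
qed

text \<open>R \<otimes> R is generated by its two legs, and each leg by the embedded copies of B, so
  commuting is tested in two stages.\<close>

lemma RR_gens_commute:
 assumes z: "z : cr RRT" and "!!p k b. p : {1..2} ==> k : {1..m} ==> b : cr B ==> ET p k b *[RRT] z = z *[RRT] ET p k b"
  and x: "x : cr RRT"
 shows "z *[RRT] x = x *[RRT] z"
proof -
 have "z *[RRT] E2 RT p r = E2 RT p r *[RRT] z" if p: "p : {1..2}" and r: "r : cr RT" for p r
  by (rule commute_gens[OF Rk RRk tens_emb_hom[OF Rk p] tensor_gens[OF B] z _ r]) (use assms(2)[OF p] in force)
 then show ?thesis
  by (intro commute_gens[OF RRk RRk ah_id tensor_gens[OF Rk] z _ x]) auto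
qed

lemma JJ_central: "i ~= j ==> JJ i j : center RRT"
 by (rule centerI[OF JJ_closed RR_gens_commute[OF JJ_closed JJ_commute_gen]])

lemma t_central: "i ~= j ==> t i j : center RT"
proof (rule centerI[OF t_closed(1)])
 fix x assume ij: "i ~= j" and x: "x : cr RT"
 note h = e_hom[OF i] e_hom[OF j] and c = e_com[OF ij]
 have "t i j *[RT] eT k b = eT k b *[RT] t i j" if k: "k : {1..m}" and b: "b : cr B" for k b
 proof -
  consider "k = i" | "k = j" | "k ~= i & k ~= j" by blast
  then show ?thesis
  proof cases
   case 3
   then show ?thesis unfolding t_def
    by (intro com_cv[OF Rk h[THEN ah_lin] e_hom[OF k, THEN ah_lin] _ _ b J, symmetric] e_com) auto
  qed (use J_commute[OF Rk h c b] in \<open>simp_all add: t_def\<close>)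
 qed
 then show "t i j *[RT] x = x *[RT] t i j"
  by (intro commute_gens[OF Rk Rk ah_id tensor_gens[OF B] t_closed(1) _ x]) auto
qed

lemma t_sym: "i ~= j ==> t i j = t j i"
 unfolding t_def by (rule J_sym[OF Rk e_hom[OF i] e_hom[OF j] e_com])

lemma t_inverse: "i ~= j ==> t i j *[RT] t' i j = \<one>[RT]" "i ~= j ==> t' i j *[RT] t i j = \<one>[RT]"
 unfolding t_def t'_def by (rule J_inverse[OF Rk e_hom[OF i] e_hom[OF j] e_com], assumption)+

text \<open>On embedded elements the counit of R is the counit of B, so J is evaluated along two
  trivial maps.\<close>

lemma t_counit: "i ~= j ==> tcounit B m (t i j) = \<one>[K]"
proof -
 assume ij: "i ~= j"
 note l = e_hom[OF i, THEN ah_lin] e_hom[OF j, THEN ah_lin] and \<epsilon> = tcounit_hom[OF bB, where m = m]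
 have "tcounit B m (t i j) = cv (self_alg K) (%b. tcounit B m (eT i b)) (%b. tcounit B m (eT j b)) J"
  unfolding t_def by (rule lin_cv[OF B Rk self_kalg \<epsilon>(1) l J])
 also have "... = cv (self_alg K) (triv\<epsilon> (self_alg K)) (counit B) J"
  by (rule cv_cong[OF B self_kalg lin_comp[OF l(1) ah_lin[OF \<epsilon>(1)]] lin_comp[OF l(2) ah_lin[OF \<epsilon>(1)]] J])
   (simp_all add: \<epsilon>(2)[OF i] \<epsilon>(2)[OF j] triv_def eB)
 also have "... = \<one>[K]" using J_triv(1)[OF self_kalg bialgebraD(3)[OF bB]] by simp
 finally show ?thesis .
qed

text \<open>The order reversed by the antipode is restored because positions i and j commute; what
  remains is (S \<otimes> S)(J) = J.\<close>

lemma t_antipode: "tantipode B m S (t i j) = t i j" if ij: "i ~= j"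
proof -
 note l = e_hom[OF i, THEN ah_lin] e_hom[OF j, THEN ah_lin]
 note SR = tantipode_hom[OF bB antipode_S, where m = m]
 have Sc: "S b : cr B" if "b : cr B" for b by (rule lin_closed[OF Sl that])
 have SRl: "tantipode B m S : module_hom K RT RT" using ah_lin[OF SR(1)] by (simp add: opp_lin)
 have "tantipode B m S (cv RT (eT i) (eT j) J) = cv RT (%b. eT i (S b)) (%b. eT j (S b)) J"
  by (rule cv_eqI[OF B Rk lin_comp[OF Sl l(1)] lin_comp[OF Sl l(2)] lin_comp[OF cv_lin[OF B Rk l] SRl] _ J])
   (use ah_mult[OF SR(1)] i j ij in \<open>simp add: cv_tens[OF B Rk l] SR(2) e_closed Sc comD[OF e_com]\<close>)
 also have "... = cv RT (eT i) (eT j) (tens_map2 K B S S J)"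
  by (rule cv_map2[OF B B Sl Sl Rk l J, symmetric])
 finally show ?thesis by (simp add: S_J t_def)
qed

text \<open>The one-sided conditions in (iii), read in R. They express the inverse of
  \<open>t i j\<close> through S, which is the form in which it occurs in the antipode axiom at a
  generator of H.\<close>

lemma t'_eq: "cv RT (%b. eT i (S b)) (eT j) J = t' i j" "cv RT (eT i) (%b. eT j (S b)) J = t' i j"
proof -
 note l = e_hom[OF i, THEN ah_lin] e_hom[OF j, THEN ah_lin]
 show "cv RT (%b. eT i (S b)) (eT j) J = t' i j"
  using cv_map2[OF B B Sl lin_id Rk l J] S_J by (simp add: t'_def J'_def)
 show "cv RT (eT i) (%b. eT j (S b)) J = t' i j"
  using cv_map2[OF B B lin_id Sl Rk l J] S_J by (simp add: t'_def J'_def)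
qed

text \<open>\<open>J_four\<close> for the two embeddings into the two legs of R \<otimes> R: the
  mixed terms are \<open>JJ i j\<close> and \<open>JJ j i\<close>, the terms inside one leg give
  \<open>t i j\<close> in that leg. This is the shape of the square of J_s (s \<otimes> s).\<close>

lemma t_comult:
 assumes ij: "i ~= j"
 shows "tcomult B m (t i j) = JJ i j *[RRT] JJ j i *[RRT] tens_list K RT [t i j, t i j]"
proof -
 note l = e_hom[OF i, THEN ah_lin] e_hom[OF j, THEN ah_lin] and \<Delta> = tcomult_hom[OF bB, where m = m]
 have h: "ET p k : alg_hom K B RRT" if "p : {1,2}" "k : {i, j}" for p k
  using that i j by (intro E_hom) auto
 have c: "com B RRT (ET p k) (ET q k')" if "p : {1,2}" "k : {i, j}" "k' : {i, j}" "p ~= q \<or> k ~= k'" for p q k k'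
  using that i j by (intro E_com) auto
 have "tcomult B m (t i j) = cv RRT (%b. tcomult B m (eT i b)) (%b. tcomult B m (eT j b)) J"
  unfolding t_def by (rule lin_cv[OF B Rk RRk \<Delta>(1) l J])
 also have "... = cv RRT (%b. cv RRT (ET 1 i) (ET 2 i) (comult B b)) (%b. cv RRT (ET 1 j) (ET 2 j) (comult B b)) J"
  by (rule cv_cong[OF B RRk lin_comp[OF l(1) ah_lin[OF \<Delta>(1)]] lin_comp[OF l(2) ah_lin[OF \<Delta>(1)]] J])
   (simp_all add: \<Delta>(2)[OF i] \<Delta>(2)[OF j] map2_cv[OF B Rk l(1) l(1)] map2_cv[OF B Rk l(2) l(2)] dB)
 also have "... = cv RRT (ET 1 i) (ET 2 j) J *[RRT] cv RRT (ET 1 j) (ET 2 i) J *[RRT]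
   (cv RRT (ET 1 i) (ET 1 j) J *[RRT] cv RRT (ET 2 i) (ET 2 j) J)"
  by (rule J_four[OF RRk]) (use ij in \<open>auto intro!: h c\<close>)
 also have "cv RRT (ET 1 i) (ET 1 j) J = E2 RT 1 (t i j)"
  unfolding t_def by (rule lin_cv[OF B Rk RRk E2_hom(1)[OF Rk] l J, symmetric])
 also have "cv RRT (ET 2 i) (ET 2 j) J = E2 RT 2 (t i j)"
  unfolding t_def by (rule lin_cv[OF B Rk RRk E2_hom(2)[OF Rk] l J, symmetric])
 finally show ?thesis using t_closed(1) by (simp add: JJ_def tens_list_emb2[OF Rk])
qed

lemma t_perm:
 assumes w: "w permutes {1..m}"
 shows "tens_perm K B m w (t i j) = t (w i) (w j)" "tens_map2 K RT (tens_perm K B m w) (tens_perm K B m w) (JJ i j) = JJ (w i) (w j)"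
proof -
 note s = tens_perm_hom[OF B w]
 note l = e_hom[OF i, THEN ah_lin] e_hom[OF j, THEN ah_lin]
 note sl = ah_lin[OF s(1)]
 show "tens_perm K B m w (t i j) = t (w i) (w j)"
  unfolding t_def lin_cv[OF B Rk Rk s(1) l J]
  by (rule cv_cong[OF B Rk lin_comp[OF l(1) sl] lin_comp[OF l(2) sl] J]) (simp_all add: s(2)[OF i] s(2)[OF j])
 note ss = map2_hom[OF Rk Rk s(1) s(1)]
 have El: "ET 1 i : module_hom K B RRT" "ET 2 j : module_hom K B RRT"
  by (rule ah_lin, rule E_hom[OF _ i] E_hom[OF _ j], simp)+
 show "tens_map2 K RT (tens_perm K B m w) (tens_perm K B m w) (JJ i j) = JJ (w i) (w j)"
  unfolding JJ_def lin_cv[OF B RRk RRk ss(1) El J]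
  by (rule cv_cong[OF B RRk lin_comp[OF El(1) ah_lin[OF ss(1)]] lin_comp[OF El(2) ah_lin[OF ss(1)]] J])
   (simp_all add: ss(2,3) s(2)[OF i] s(2)[OF j] e_closed[OF i] e_closed[OF j])
qed

end

text \<open>All structure maps are determined on the embedded copies of B, and a permutation only
  relabels these.\<close>

lemma perm_comult:
 assumes w: "w permutes {1..m}" and a: "a : cr RT"
 shows "tcomult B m (tens_perm K B m w a) = tens_map2 K RT (tens_perm K B m w) (tens_perm K B m w) (tcomult B m a)"
  "tcounit B m (tens_perm K B m w a) = tcounit B m a"
  "tantipode B m S (tens_perm K B m w a) = tens_perm K B m w (tantipode B m S a)"
proof -
 note s = tens_perm_hom[OF B w] and ss = map2_hom[OF Rk Rk tens_perm_hom(1)[OF B w] tens_perm_hom(1)[OF B w]]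
 note \<Delta> = tcomult_hom[OF bB, where m = m] and \<epsilon> = tcounit_hom[OF bB, where m = m]
 note SR = tantipode_hom[OF bB antipode_S, where m = m]
 have wi: "w i : {1..m}" if "i : {1..m}" for i using that w permutes_in_image[OF w] by blast
 show "tcomult B m (tens_perm K B m w a) = tens_map2 K RT (tens_perm K B m w) (tens_perm K B m w) (tcomult B m a)"
 proof (rule tensor_hom_eqI[OF B ah_comp[OF s(1) \<Delta>(1)] ah_comp[OF \<Delta>(1) ss(1)] _ a])
  fix i b assume i: "i : {1..m}" and b: "b : cr B"
  note l = e_hom[OF i, THEN ah_lin] and l' = e_hom[OF wi[OF i], THEN ah_lin]
  note sl = ah_lin[OF s(1)]
  have "tens_map2 K RT (tens_perm K B m w) (tens_perm K B m w) (tens_map2 K RT (eT i) (eT i) (comult B b)) =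
    tens_map2 K RT (eT (w i)) (eT (w i)) (comult B b)"
   by (rule lin_eq_tens2[OF B lin_comp[OF map2_lin[OF B Rk l l] ah_lin[OF ss(1)]] map2_lin[OF B Rk l' l'] _ dB[OF b]])
    (simp add: map2_tens[OF B Rk l l] map2_tens[OF B Rk l' l'] map2_tens[OF Rk Rk sl sl] e_closed[OF i] s(2)[OF i])
  then show "tcomult B m (tens_perm K B m w (eT i b)) = tens_map2 K RT (tens_perm K B m w) (tens_perm K B m w) (tcomult B m (eT i b))"
   by (simp only: s(2)[OF i b] \<Delta>(2)[OF i b] \<Delta>(2)[OF wi[OF i] b])
 qed
 show "tcounit B m (tens_perm K B m w a) = tcounit B m a"
  by (rule tensor_hom_eqI[OF B ah_comp[OF s(1) \<epsilon>(1)] \<epsilon>(1) _ a]) (simp add: s(2) \<epsilon>(2) wi del: atLeastAtMost_iff)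
 show "tantipode B m S (tens_perm K B m w a) = tens_perm K B m w (tantipode B m S a)"
  by (rule tensor_hom_eqI[OF B ah_comp[OF s(1) SR(1)] ah_comp[OF SR(1) opp_alg_hom[OF s(1)]] _ a])
   (simp add: s(2) SR(2) wi lin_closed[OF Sl] del: atLeastAtMost_iff)
qed

end

end

section \<open>Quotients of bialgebras\<close>

context base_field
begin

lemma make_bialg_crossed [simp]:
 "crossed_alg (make_bialg A d e) G act \<gamma> = crossed_alg A G act \<gamma>" "basis_elt (make_bialg A d e) = basis_elt A"
 "supp (make_bialg A d e) = supp A"
proof -
 show b: "basis_elt (make_bialg A d e) = basis_elt A" by (intro ext) (simp add: basis_elt_def)
 show s: "supp (make_bialg A d e) = supp A" by (intro ext) (simp add: supp_def)
 show "crossed_alg (make_bialg A d e) G act \<gamma> = crossed_alg A G act \<gamma>" by (simp add: crossed_alg_def b s)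
qed

lemma make_bialg_triv [simp]: "triv e (make_bialg A d e') = triv e A"
 by (intro ext) (simp add: triv_def)

lemma opp_make_bialg [simp]: "opp (make_bialg A d e) = opp A"
 by (simp add: opp_def)

lemma ideal_genideal:
 assumes "kalg K A" "X <= cr A" shows "ideal (genideal A X) A" "X <= genideal A X"
 using ring.genideal_ideal[OF kalg_ring[OF assms(1)] assms(2)] ring.genideal_self[OF kalg_ring[OF assms(1)] assms(2)] .

lemma genideal_vanish:
 assumes A: "kalg K A" and T: "kalg K T" and F: "F : alg_hom K A T" and X: "X <= cr A"
  and z: "!!x. x : X ==> F x = \<zero>[T]" and x: "x : genideal A X"
 shows "F x = \<zero>[T]"
 using ring.genideal_minimal[OF kalg_ring[OF A] kernel_ideal[OF A T F], of X] X z x by auto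

lemma quot_bialg_eq:
 "quot_bialg K A I = make_bialg (quot_alg A I)
   (%X. the_elem ((%x. tens_map2 K (quot_alg A I) (%a. I +>\<^bsub>A\<^esub> a) (%a. I +>\<^bsub>A\<^esub> a) (comult A x)) ` X))
   (%X. the_elem (counit A ` X))"
 by (simp add: quot_bialg_def Let_def)

text \<open>Vanishing on I lets the structure maps descend. Every element of the quotient is the
  image of one of A, so \<open>coassoc_image\<close> gives the coalgebra axioms with the whole
  carrier as generating set.\<close>

lemma quot_bialgebra:
 assumes bA: "bialgebra K A" and I: "ideal I A"
 defines "Q == quot_alg A I" and "\<pi> == %a. I +>\<^bsub>A\<^esub> a"
 assumes \<Delta>I: "!!x. x : I ==> tens_map2 K Q \<pi> \<pi> (comult A x) = \<zero>[tpow Q 2]"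
  and \<epsilon>I: "!!x. x : I ==> counit A x = \<zero>[K]"
 shows "bialg_hom K A (quot_bialg K A I) \<pi>"
proof -
 note A = bialgebraD(1)[OF bA] and \<Delta> = bialgebraD(2)[OF bA] and \<epsilon> = bialgebraD(3)[OF bA]
 have Q: "kalg K Q" unfolding Q_def by (rule quot_kalg[OF A I])
 have \<pi>: "\<pi> : alg_hom K A Q" unfolding \<pi>_def Q_def by (rule proj_hom[OF A I])
 have carr: "cr Q = \<pi> ` cr A" unfolding \<pi>_def Q_def by (rule quot_carrier[OF A I])
 let ?H = "quot_bialg K A I" and ?D = "%x. tens_map2 K Q \<pi> \<pi> (comult A x)"
 have H: "?H = make_bialg Q (%X. the_elem (?D ` X)) (%X. the_elem (counit A ` X))"
  by (simp add: quot_bialg_eq Q_def \<pi>_def)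
 have Dh: "?D : alg_hom K A (tpow Q 2)" by (rule ah_comp[OF \<Delta> map2_hom(1)[OF A Q \<pi> \<pi>]])
 note d = quot_lift_hom[OF A I tensor_kalg[OF Q] Dh \<Delta>I] quot_lift(1)[OF A I tensor_kalg[OF Q] ah_lin[OF Dh] \<Delta>I]
 have \<epsilon>I': "counit A x = \<zero>[self_alg K]" if "x : I" for x using \<epsilon>I[OF that] by simp
 note ee = quot_lift_hom[OF A I self_kalg \<epsilon> \<epsilon>I'] quot_lift(1)[OF A I self_kalg ah_lin[OF \<epsilon>] \<epsilon>I']
 have Hk: "kalg K ?H" unfolding H by (rule make_bialg_kalg[OF Q])
 have h: "comult ?H : alg_hom K ?H (tpow ?H 2)" "counit ?H : alg_hom K ?H (self_alg K)"
  unfolding H using d(1) ee(1) by (simp_all add: Q_def)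
 have c: "comult ?H (\<pi> a) = tens_map2 K ?H \<pi> \<pi> (comult A a)" "counit ?H (\<pi> a) = counit A a" if "a : cr A" for a
  unfolding H using d(2)[OF _ that] ee(2)[OF _ that] by (simp_all add: \<pi>_def)
 have \<pi>': "\<pi> : alg_hom K A ?H" using \<pi> by (simp add: H)
 note im = coassoc_image[OF bA Hk h \<pi>' _ c]
 have "bialgebra K ?H"
 proof (rule bialgebraI_gens[OF Hk h])
  show "gens K ?H (cr ?H)" by (rule gensI) auto
  fix x assume "x : cr ?H"
  then obtain a where a: "a : cr A" "x = \<pi> a" by (auto simp: H carr)
  show "comult_id K ?H (comult ?H x) = id_comult K ?H (comult ?H x)" unfolding a(2) by (rule im(1)[OF a(1)])
  show "counit_id K ?H (comult ?H x) = x" unfolding a(2) by (rule im(2)[OF a(1)])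
  show "id_counit K ?H (comult ?H x) = x" unfolding a(2) by (rule im(3)[OF a(1)])
 qed
 then show ?thesis unfolding bialg_hom_def using bA \<pi>' c by blast
qed

end

section \<open>The skew monoid bialgebra\<close>

text \<open>The twist along f and g commutes with f and g by centrality and with every map that
  commutes with both; hence with any second twist built from such maps.\<close>

lemma (in central_twist) J_comm:
 assumes T: "kalg K T" and f: "f : alg_hom K B T" and g: "g : alg_hom K B T" and c: "com B T f g"
  and f': "f' : alg_hom K B T" and g': "g' : alg_hom K B T"
  and "f' = f \<or> f' = g \<or> com B T f f' & com B T g f'" "g' = f \<or> g' = g \<or> com B T f g' & com B T g g'"
 shows "cv T f g J *[T] cv T f' g' J = cv T f' g' J *[T] cv T f g J"
proof -
 note l = f[THEN ah_lin] g[THEN ah_lin]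
 have z: "cv T f g J *[T] h b = h b *[T] cv T f g J"
  if "h : alg_hom K B T" "h = f \<or> h = g \<or> com B T f h & com B T g h" "b : cr B" for h b
  using that(2)
 proof (elim disjE conjE)
  assume "com B T f h" "com B T g h"
  then show ?thesis using com_cv[OF T l that(1)[THEN ah_lin] com_sym com_sym that(3) J] by simp
 qed (use J_commute[OF T f g c that(3)] in simp_all)
 show ?thesis
  by (rule cv_commute[OF B T f'[THEN ah_lin] g'[THEN ah_lin] J jc[OF T f g J]])
   (rule z[OF f' assms(7)], assumption, rule z[OF g' assms(8)])
qed

locale twisted = central_twist K B S J for K :: "'k ring" and B :: "('k, 'b) bialg" and S J + fixes m :: nat
begin

abbreviation "R == tpow B m"
abbreviation "RR == tpow (tpow B m) 2"
abbreviation "e i == tens_emb K B m i"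
abbreviation "\<sigma> i == tens_perm K B m (transpose i (Suc i))"
abbreviation "act == word_act K B m"
abbreviation "\<Delta>R == tcomult B m"
abbreviation "\<epsilon>R == tcounit B m"
abbreviation "SR == tantipode B m S"
abbreviation "tt i == t m i (Suc i)"

lemma transpose_permutes: "i : {1..<m} ==> transpose i (Suc i) permutes {1..m}"
 by (rule permutes_swap_id) auto

lemmas \<sigma>_hom = tens_perm_hom(1)[OF B transpose_permutes]

lemma \<sigma>_closed [simp]: "i : {1..<m} ==> a : cr R ==> \<sigma> i a : cr R"
 by (rule ah_closed[OF \<sigma>_hom])

lemma perm_compose:
 assumes "v permutes {1..m}" "w permutes {1..m}" "a : cr R"
 shows "tens_perm K B m (v \<circ> w) a = tens_perm K B m v (tens_perm K B m w a)"
 by (rule tensor_hom_eqI[OF B tens_perm_hom(1)[OF B permutes_compose[OF assms(2,1)]]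
    ah_comp[OF tens_perm_hom(1)[OF B assms(2)] tens_perm_hom(1)[OF B assms(1)]] _ assms(3)])
  (use permutes_in_image[OF assms(2)] in \<open>simp add: tens_perm_hom(2)[OF B] assms permutes_compose del: atLeastAtMost_iff\<close>)

lemma perm_id: "a : cr R ==> tens_perm K B m id a = a"
 by (rule tensor_hom_eqI[OF B tens_perm_hom(1)[OF B permutes_id] ah_id])
  (simp_all add: tens_perm_hom(2)[OF B permutes_id])

lemma \<sigma>_\<sigma>: "i : {1..<m} ==> a : cr R ==> \<sigma> i (\<sigma> i a) = a"
 using perm_compose[OF transpose_permutes transpose_permutes, of i i a] by (simp add: perm_id)

lemma act_simps: "act [] = id" "act (i # ws) = \<sigma> i \<circ> act ws"
 by (simp_all add: word_act_def)

lemma act_hom: "ws : lists {1..<m} ==> act ws : alg_hom K R R"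
proof (induction ws)
 case Nil
 show ?case by (simp add: act_simps id_def ah_id)
next
 case (Cons i ws)
 then have "i : {1..<m}" "act ws : alg_hom K R R" by auto
 then show ?case using ah_comp[OF _ \<sigma>_hom] by (simp add: act_simps comp_def del: atLeastLessThan_iff)
qed

lemma act_append: "act (xs @ ys) a = act xs (act ys a)"
 by (induction xs) (simp_all add: act_simps)

abbreviation "FM == free_monoid {1..<m}"

lemma FM_simps: "cr FM = lists {1..<m}" "x *[FM] y = x @ y" "\<one>[FM] = []"
 by (simp_all add: free_monoid_def)

sublocale W: crossed K R FM act "%_ _. \<one>[R]"
proof (rule crossed.intro[OF base_field_axioms crossed_axioms.intro])
 show "monoid FM" by (rule monoidI) (auto simp: FM_simps)
 show "act x : alg_hom K R R" if "x : cr FM" for x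
  using that by (auto simp: FM_simps intro: act_hom)
 show "\<one>[R] *[R] \<one>[R] = act x \<one>[R] *[R] \<one>[R]" if "x : cr FM" for x
  using that ah_one[OF act_hom] by (simp add: FM_simps)
qed (simp_all add: FM_simps act_simps act_append centerI)

abbreviation "A == crossed_alg R FM act (%_ _. \<one>[R])"
abbreviation "AA == tpow A 2"
abbreviation "\<iota> == basis_elt R []"
abbreviation "s i == basis_elt R [i] \<one>[R]"

lemma A [simp]: "kalg K A" by (rule W.crossed_kalg)

lemma \<iota>_hom: "\<iota> : alg_hom K R A" using W.emb_hom by (simp add: FM_simps)

lemmas \<iota>_closed = ah_closed[OF \<iota>_hom]

lemma s_closed [simp]: "i : {1..<m} ==> s i : cr A"
 using W.bas_closed[of "[i]" "\<one>[R]"] by (simp add: FM_simps)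

lemma bas_word: "ws : lists {1..<m} ==> basis_elt R ws \<one>[R] = list_prod A (map s ws)"
proof (induction ws)
 case Nil
 then show ?case using W.crossed_simps(5) by (simp add: FM_simps)
next
 case (Cons i ws)
 then have "basis_elt R (i # ws) \<one>[R] = s i *[A] basis_elt R ws \<one>[R]"
  using W.bas_mult[of "[i]" ws "\<one>[R]" "\<one>[R]"] ah_one[OF act_hom, of "[i]"] by (simp add: FM_simps)
 with Cons show ?case by simp
qed

lemma s_\<iota>: "i : {1..<m} ==> a : cr R ==> s i *[A] \<iota> a = \<iota> (\<sigma> i a) *[A] s i"
 using W.bas_comm[of "[i]" a] by (simp add: FM_simps act_simps)

text \<open>The words form a free monoid, so conditions on single letters suffice; commutation with
  R is extended to words by induction.\<close>

lemma A_universal: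
 assumes T: "kalg K T" and h: "h : alg_hom K R T" and y: "!!i. i : {1..<m} ==> y i : cr T"
  and yh: "!!i a. i : {1..<m} ==> a : cr R ==> y i *[T] h a = h (\<sigma> i a) *[T] y i"
 defines "F == W.flift T (%ws a. h a *[T] list_prod T (map y ws))"
 shows "F : alg_hom K A T" "!!a. a : cr R ==> F (\<iota> a) = h a" "!!i. i : {1..<m} ==> F (s i) = y i"
proof -
 note mT = kalg_monoid[OF T]
 have lc: "list_prod T (map y ws) : cr T" if "ws : lists {1..<m}" for ws
  using that y by (intro list_prod_closed[OF mT]) auto
 have u: "list_prod T (map y ws) *[T] h a = h (act ws a) *[T] list_prod T (map y ws)"
  if "ws : lists {1..<m}" "a : cr R" for ws a
  using that(1)
 proof (induction ws)
  case Nil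
  then show ?case using T ah_closed[OF h that(2)] by (simp add: act_simps)
 next
  case (Cons i ws)
  then have i: "i : {1..<m}" and ws: "ws : lists {1..<m}" by auto
  note c = y[OF i] lc[OF ws] ah_closed[OF h that(2)]
   ah_closed[OF act_hom[OF ws] that(2)]
   ah_closed[OF h ah_closed[OF act_hom[OF ws] that(2)]]
  have "y i *[T] list_prod T (map y ws) *[T] h a = y i *[T] (h (act ws a) *[T] list_prod T (map y ws))"
   using c T Cons.IH by (simp add: ka_assoc[OF T])
  also have "... = h (\<sigma> i (act ws a)) *[T] (y i *[T] list_prod T (map y ws))"
   using c T yh[OF i c(4)] ah_closed[OF h \<sigma>_closed[OF i c(4)]] by (simp flip: ka_assoc[OF T])
  finally show ?case by (simp add: act_simps)
 qed
 note L = W.lift_hom[OF T h, of "%ws. list_prod T (map y ws)", folded F_def]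
 have prem: "!!x. x : cr FM ==> list_prod T (map y x) : cr T" "list_prod T (map y \<one>[FM]) = \<one>[T]"
  "!!x a. x : cr FM ==> a : cr R ==> list_prod T (map y x) *[T] h a = h (act x a) *[T] list_prod T (map y x)"
  "!!v w. v : cr FM ==> w : cr FM ==> list_prod T (map y v) *[T] list_prod T (map y w) =
   h \<one>[R] *[T] list_prod T (map y (v *[FM] w))"
 proof -
  fix v w assume vw: "v : cr FM" "w : cr FM"
  then have s: "set (map y v) <= cr T" "set (map y w) <= cr T" using y by (auto simp: FM_simps)
  show "list_prod T (map y v) *[T] list_prod T (map y w) = h \<one>[R] *[T] list_prod T (map y (v *[FM] w))"
   using list_prod_append[OF mT s] T list_prod_closed[OF mT s(1)] list_prod_closed[OF mT s(2)]
   by (simp add: FM_simps ah_one[OF h])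
 qed (use lc u in \<open>simp_all add: FM_simps\<close>)
 note F = L[OF prem]
 show "F : alg_hom K A T" by (rule F(1))
 show "F (\<iota> a) = h a" if "a : cr R" for a
  using F(2)[of "[]" a] that T ah_closed[OF h that] by (simp add: FM_simps)
 show "F (s i) = y i" if "i : {1..<m}" for i
  using F(2)[of "[i]" "\<one>[R]"] that T y[OF that] by (simp add: FM_simps ah_one[OF h])
qed

lemma A_gens: "gens K A (\<iota> ` cr R \<union> s ` {1..<m})"
proof (rule gensI)
 show "\<iota> ` cr R \<union> s ` {1..<m} <= cr A" using \<iota>_closed s_closed by auto
 fix Y f assume Y: "\<iota> ` cr R \<union> s ` {1..<m} <= Y" "Y <= cr A" "\<one>[A] : Y"
  "!!a b. a : Y ==> b : Y ==> a +[A] b : Y" "!!a b. a : Y ==> b : Y ==> a *[A] b : Y"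
  "!!c a. c : cr K ==> a : Y ==> c .[A] a : Y" and f: "f : cr A"
 have w: "basis_elt R ws \<one>[R] : Y" if "ws : lists {1..<m}" for ws
  unfolding bas_word[OF that] using that
 proof (induction ws)
  case (Cons i ws)
  then have "s i : Y" using Y(1) by auto
  with Cons show ?case using Y(5) by auto
 qed (use Y(3) in simp)
 show "f : Y" using f
 proof (induction f rule: W.crossed_induct)
  case zero
  have "\<zero>[A] = \<zero>[K] .[A] \<one>[A]" by simp
  then show ?case using Y(6)[OF K.zero_closed Y(3)] by simp
 next
  case (bas x a)
  have "basis_elt R x a = \<iota> a *[A] basis_elt R x \<one>[R]" using W.bas_emb[OF bas] by (simp only: FM_simps)
  moreover have "\<iota> a : Y" using Y(1) bas by blast
  moreover have "basis_elt R x \<one>[R] : Y" using w bas by (simp only: FM_simps)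
  ultimately show ?case using Y(5) by (simp only:)
 qed (rule Y(4))
qed

abbreviation "\<iota>2 == tens_map2 K A \<iota> \<iota>"
abbreviation "ss i == tens_list K A [s i, s i]"

text \<open>The prescribed value of the comultiplication at \<open>s i\<close>.\<close>

definition "X i = \<iota>2 (JJ m i (Suc i)) *[AA] ss i"

lemmas \<iota>2_hom = map2_hom[OF Rk A \<iota>_hom \<iota>_hom]

text \<open>The relation \<open>(s\<^sub>i \<otimes> s\<^sub>i) x = (\<sigma>\<^sub>i \<otimes> \<sigma>\<^sub>i)(x) (s\<^sub>i \<otimes> s\<^sub>i)\<close> for any algebra in which \<open>s\<^sub>i a = \<sigma>\<^sub>i(a) s\<^sub>i\<close>.\<close>

lemma ss_comm:
 assumes T: "kalg K T" and h: "h : alg_hom K R T" and y: "y : cr T" and i: "i : {1..<m}"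
  and yh: "!!a. a : cr R ==> y *[T] h a = h (\<sigma> i a) *[T] y" and x: "x : cr RR"
 shows "tens_list K T [y, y] *[tpow T 2] tens_map2 K T h h x =
  tens_map2 K T h h (tens_map2 K R (\<sigma> i) (\<sigma> i) x) *[tpow T 2] tens_list K T [y, y]"
proof -
 note T2 = tensor_kalg[OF T, of 2] and hl = ah_lin[OF h] and \<sigma>l = ah_lin[OF \<sigma>_hom[OF i]]
 note yy = tens_list2_closed[OF T y y]
 note m2 = map2_lin[OF Rk T hl hl] and ms = map2_lin[OF Rk Rk \<sigma>l \<sigma>l]
 show ?thesis
  by (rule lin_eq_tens2[OF Rk lin_const_right[OF T2 m2 yy] lin_const_left[OF T2 lin_comp[OF ms m2] yy] _ x])
   (use i in \<open>simp add: map2_tens[OF Rk T hl hl] map2_tens[OF Rk Rk \<sigma>l \<sigma>l] tens_list2_mult[OF T] ah_closed[OF h] y yh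
    del: atLeastLessThan_iff\<close>)
qed

lemma ij: "i : {1..<m} ==> i : {1..m} & Suc i : {1..m} & i ~= Suc i" by auto

lemma JJ_c: "i : {1..<m} ==> JJ m i (Suc i) : cr RR"
 using JJ_closed ij by blast

lemma X_closed [simp]: "i : {1..<m} ==> X i : cr AA"
 unfolding X_def by (intro ka_closed(1) tensor_kalg A ah_closed[OF \<iota>2_hom(1)] JJ_c tens_list2_closed s_closed)

text \<open>\<open>JJ\<close> central turns conjugation by \<open>J\<^sub>i(s\<^sub>i \<otimes> s\<^sub>i)\<close> into conjugation by \<open>s\<^sub>i \<otimes> s\<^sub>i\<close>.\<close>

lemma twisted_comm:
 assumes T: "kalg K T" and h: "h : alg_hom K R T" and y: "y : cr T" and i: "i : {1..<m}"
  and yh: "!!a. a : cr R ==> y *[T] h a = h (\<sigma> i a) *[T] y" and a: "a : cr R"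
 defines "h2 == tens_map2 K T h h" and "Y == tens_map2 K T h h (JJ m i (Suc i)) *[tpow T 2] tens_list K T [y, y]"
 shows "Y *[tpow T 2] h2 (\<Delta>R a) = h2 (\<Delta>R (\<sigma> i a)) *[tpow T 2] Y"
proof -
 note T2 = tensor_kalg[OF T, of 2] and tc = tcomult_hom(1)[OF bB, where m = m]
 have h2: "h2 : alg_hom K RR (tpow T 2)" unfolding h2_def by (rule map2_hom(1)[OF Rk T h h])
 note c = ah_closed[OF tc] ah_closed[OF h2]
 note yy = tens_list2_closed[OF T y y]
 note cen = center_comm[OF JJ_central[OF _ _ _], of i m "Suc i"]
 have "Y *[tpow T 2] h2 (\<Delta>R a) = h2 (JJ m i (Suc i)) *[tpow T 2] (tens_list K T [y, y] *[tpow T 2] h2 (\<Delta>R a))"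
  unfolding Y_def h2_def[symmetric] by (rule ka_assoc[OF T2 c(2)[OF JJ_c[OF i]] yy c(2)[OF c(1)[OF a]]])
 also have "tens_list K T [y, y] *[tpow T 2] h2 (\<Delta>R a) = h2 (\<Delta>R (\<sigma> i a)) *[tpow T 2] tens_list K T [y, y]"
  unfolding h2_def perm_comult(1)[OF transpose_permutes[OF i] a]
  by (rule ss_comm[OF T h y i yh c(1)[OF a]])
 also have "h2 (JJ m i (Suc i)) *[tpow T 2] (h2 (\<Delta>R (\<sigma> i a)) *[tpow T 2] tens_list K T [y, y]) =
   h2 (JJ m i (Suc i)) *[tpow T 2] h2 (\<Delta>R (\<sigma> i a)) *[tpow T 2] tens_list K T [y, y]"
  using c(2)[OF JJ_c[OF i]] yy c(2)[OF c(1)[OF \<sigma>_closed[OF i a]]] by (simp only: ka_assoc[OF T2])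
 also have "h2 (JJ m i (Suc i)) *[tpow T 2] h2 (\<Delta>R (\<sigma> i a)) = h2 (\<Delta>R (\<sigma> i a)) *[tpow T 2] h2 (JJ m i (Suc i))"
  using cen[OF _ _ _ c(1)[OF \<sigma>_closed[OF i a]]] ij[OF i] JJ_c[OF i] c(1)[OF \<sigma>_closed[OF i a]]
  by (simp flip: ah_mult[OF h2])
 finally show ?thesis
  unfolding Y_def h2_def[symmetric] using c(2)[OF JJ_c[OF i]] yy c(2)[OF c(1)[OF \<sigma>_closed[OF i a]]]
  by (simp only: ka_assoc[OF T2])
qed

text \<open>The structure maps as supplied by the universal property. They are shown to agree with
  the fields of \<open>skew_bialg\<close> on the carrier, where all letters are in range, and
  multiplicativity is transferred along this agreement.\<close>

definition "\<Delta>A = W.flift AA (%ws a. \<iota>2 (\<Delta>R a) *[AA] list_prod AA (map X ws))"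
definition "\<epsilon>A = W.flift (self_alg K) (%ws a. \<epsilon>R a *[self_alg K] list_prod (self_alg K) (map (%_. \<one>[K]) ws))"

lemma \<Delta>A: "\<Delta>A : alg_hom K A AA" "a : cr R ==> \<Delta>A (\<iota> a) = \<iota>2 (\<Delta>R a)" "i : {1..<m} ==> \<Delta>A (s i) = X i"
proof -
 note tc = tcomult_hom(1)[OF bB, where m = m]
 have "X i *[AA] \<iota>2 (\<Delta>R a) = \<iota>2 (\<Delta>R (\<sigma> i a)) *[AA] X i" if "i : {1..<m}" "a : cr R" for i a
  unfolding X_def by (rule twisted_comm[OF A \<iota>_hom s_closed[OF that(1)] that(1) s_\<iota>[OF that(1)] that(2)])
 note U = A_universal[OF tensor_kalg[OF A] ah_comp[OF tc \<iota>2_hom(1)] X_closed this, folded \<Delta>A_def]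
 show "\<Delta>A : alg_hom K A AA" "a : cr R ==> \<Delta>A (\<iota> a) = \<iota>2 (\<Delta>R a)" "i : {1..<m} ==> \<Delta>A (s i) = X i"
  by (simp_all add: U del: atLeastLessThan_iff)
qed

lemma \<epsilon>A: "\<epsilon>A : alg_hom K A (self_alg K)" "a : cr R ==> \<epsilon>A (\<iota> a) = \<epsilon>R a" "i : {1..<m} ==> \<epsilon>A (s i) = \<one>[K]"
proof -
 note tc = tcounit_hom(1)[OF bB, where m = m]
 have cl: "\<epsilon>R a : cr K" if "a : cr R" for a using ah_closed[OF tc that] by simp
 have "\<one>[K] *[self_alg K] \<epsilon>R a = \<epsilon>R (\<sigma> i a) *[self_alg K] \<one>[K]" if "i : {1..<m}" "a : cr R" for i a
  using cl[OF that(2)] by (simp add: perm_comult(2)[OF transpose_permutes[OF that(1)] that(2)])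
 note U = A_universal[OF self_kalg tc _ this, folded \<epsilon>A_def]
 show "\<epsilon>A : alg_hom K A (self_alg K)" "a : cr R ==> \<epsilon>A (\<iota> a) = \<epsilon>R a" "i : {1..<m} ==> \<epsilon>A (s i) = \<one>[K]"
  using U by simp_all
qed

lemma skew_bialg_on:
 assumes f: "f : cr A"
 shows "comult (skew_bialg K B J m) f = \<Delta>A f" "counit (skew_bialg K B J m) f = \<epsilon>A f"
proof -
 have S: "ws : lists {1..<m}" if "ws : supp R f" for ws using f that by (auto simp: W.crossed_simps FM_simps)
 have fc: "f ws : cr R" for ws using f by (auto simp: W.crossed_simps)
 interpret AA: ring AA by (rule kalg_ring[OF tensor_kalg[OF A]])
 have Xc: "list_prod AA (map X ws) : cr AA" if "ws : lists {1..<m}" for ws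
  using that by (intro list_prod_closed[OF kalg_monoid[OF tensor_kalg[OF A]]]) auto
 have "comult (skew_bialg K B J m) f = (\<Oplus>\<^bsub>AA\<^esub>ws\<in>supp R f. \<iota>2 (\<Delta>R (f ws)) *[AA]
   list_prod AA (map (%i. \<iota>2 (emb_twist K B m J i (Suc i)) *[AA] ss i) ws))"
  by (simp add: skew_bialg_def Let_def)
 also have "... = (\<Oplus>\<^bsub>AA\<^esub>ws\<in>supp R f. \<iota>2 (\<Delta>R (f ws)) *[AA] list_prod AA (map X ws))"
 proof (rule AA.finsum_cong')
  show "\<iota>2 (\<Delta>R (f ws)) *[AA] list_prod AA (map (%i. \<iota>2 (emb_twist K B m J i (Suc i)) *[AA] ss i) ws) =
    \<iota>2 (\<Delta>R (f ws)) *[AA] list_prod AA (map X ws)" if "ws : supp R f" for ws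
  proof -
   have "map (%i. \<iota>2 (emb_twist K B m J i (Suc i)) *[AA] ss i) ws = map X ws"
    using S[OF that] ij by (auto simp: X_def emb_twist_eq)
   then show ?thesis by (simp only:)
  qed
  show "(%ws. \<iota>2 (\<Delta>R (f ws)) *[AA] list_prod AA (map X ws)) : supp R f \<rightarrow> cr AA"
   using S fc ah_closed[OF \<iota>2_hom(1) ah_closed[OF tcomult_hom(1)[OF bB]]] by (intro Pi_I AA.m_closed Xc) auto
 qed simp
 also have "... = \<Delta>A f" by (simp add: \<Delta>A_def W.flift_def)
 finally show "comult (skew_bialg K B J m) f = \<Delta>A f" .
 have "list_prod K (map (%_. \<one>[K]) ws) = \<one>[K]" for ws :: "nat list" by (induction ws) simp_all
 moreover have "\<epsilon>R (f ws) : cr K" for ws using ah_closed[OF tcounit_hom(1)[OF bB] fc] by simp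
 ultimately show "counit (skew_bialg K B J m) f = \<epsilon>A f"
  by (simp add: skew_bialg_def Let_def \<epsilon>A_def W.flift_def finsum_self)
qed

lemma skew_bialg_make: "skew_bialg K B J m = make_bialg A (comult (skew_bialg K B J m)) (counit (skew_bialg K B J m))"
 by (simp add: skew_bialg_def Let_def)

lemma skew_kalg: "kalg K (skew_bialg K B J m)"
 by (subst skew_bialg_make) (rule make_bialg_kalg[OF A])

end

context base_field
begin

lemma alg_hom_cong:
 assumes "f : alg_hom K A C" "!!x. x : cr A ==> f x = g x" "kalg K A"
 shows "g : alg_hom K A C"
proof (rule alg_homI[OF lin_cong[OF ah_lin[OF assms(1)] assms(2) kalg_ring[OF assms(3)] kalg_module[OF assms(3)]]])
 show "g (x *[A] y) = g x *[C] g y" if "x : cr A" "y : cr A" for x y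
  using that ah_mult[OF assms(1) that] assms(2)[of x] assms(2)[of y] assms(2)[of "x *[A] y"] assms(3) by simp
 show "g \<one>[A] = \<one>[C]" using ah_one[OF assms(1)] assms(2)[of "\<one>[A]"] assms(3) by simp
qed

lemma gens_image:
 assumes X: "gens K A X" and f: "f : alg_hom K A C" and s: "cr C = f ` cr A" and A: "kalg K A"
 shows "gens K C (f ` X)"
proof (rule gensI)
 show "f ` X <= cr C" using X s by (auto simp: gens_def)
 fix Y c assume Y: "f ` X <= Y" "Y <= cr C" "\<one>[C] : Y"
  "!!a b. a : Y ==> b : Y ==> a +[C] b : Y" "!!a b. a : Y ==> b : Y ==> a *[C] b : Y"
  "!!c a. c : cr K ==> a : Y ==> c .[C] a : Y" and c: "c : cr C"
 obtain a where a: "a : cr A" "c = f a" using c s by auto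
 have "f a : Y" using X a(1)
  by (induction rule: gens_induct)
   (use Y A in \<open>auto simp: ah_one[OF f] ah_add[OF f] ah_mult[OF f] ah_smult[OF f]\<close>)
 then show "c : Y" using a by simp
qed

lemma map2_comp:
 assumes A: "kalg K A" and C: "kalg K C" and D: "kalg K D" and f: "f : module_hom K A C" and g: "g : module_hom K C D"
  and x: "x : cr (tpow A 2)"
 shows "tens_map2 K D g g (tens_map2 K C f f x) = tens_map2 K D (%a. g (f a)) (%a. g (f a)) x"
 by (rule lin_eq_tens2[OF A lin_comp[OF map2_lin[OF A C f f] map2_lin[OF C D g g]]
    map2_lin[OF A D lin_comp[OF f g] lin_comp[OF f g]] _ x])
  (simp add: map2_tens[OF A C f f] map2_tens[OF C D g g] map2_tens[OF A D lin_comp[OF f g] lin_comp[OF f g]]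
   lin_closed[OF f])

end

context twisted
begin

abbreviation "sk == skew_bialg K B J m"

lemma sk_simps [simp]:
 "cr sk = cr A" "monoid.mult sk = monoid.mult A" "one sk = one A" "zero sk = zero A" "add sk = add A"
 "smult sk = smult A" "tensor_pow K sk n = tpow A n" "tens_emb K sk n = tens_emb K A n" "tens_list K sk = tens_list K A"
 "tens_map2 K sk = tens_map2 K A" "cv sk = cv A" "triv e' sk = triv e' A" "module_hom K sk T = module_hom K A T"
 "module_hom K T sk = module_hom K T A" "alg_hom K sk T = alg_hom K A T" "alg_hom K T sk = alg_hom K T A"
 "gens K sk Y = gens K A Y" "x \<ominus>\<^bsub>sk\<^esub> y = x \<ominus>\<^bsub>A\<^esub> y"
 by (subst skew_bialg_make, simp)+

lemma sk_com_left [simp]: "com sk T f g = com A T f g"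
 and sk_com_right [simp]: "com C sk f' g' = com C A f' g'"
 by (simp_all add: com_def)

lemma \<Delta>sk: "comult sk : alg_hom K A AA" and \<epsilon>sk: "counit sk : alg_hom K A (self_alg K)"
 by (rule alg_hom_cong[OF \<Delta>A(1) _ A] alg_hom_cong[OF \<epsilon>A(1) _ A], simp add: skew_bialg_on)+

lemma sk_values:
 "a : cr R ==> comult sk (\<iota> a) = \<iota>2 (\<Delta>R a)" "i : {1..<m} ==> comult sk (s i) = X i"
 "a : cr R ==> counit sk (\<iota> a) = \<epsilon>R a" "i : {1..<m} ==> counit sk (s i) = \<one>[K]"
 by (simp_all add: skew_bialg_on \<iota>_closed \<Delta>A \<epsilon>A del: atLeastLessThan_iff)

text \<open>On R the axioms are those of R. At \<open>s i\<close> both sides of coassociativity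
  equal the product of the twists in the three pairs of legs times s_i \<otimes> s_i \<otimes> s_i,
  because bimultiplicativity splits \<Delta> applied to one argument of J.\<close>

lemma sk_bialgebra: "bialgebra K sk"
proof -
 have h: "comult sk : alg_hom K sk (tpow sk 2)" "counit sk : alg_hom K sk (self_alg K)"
  by (simp_all add: \<Delta>sk \<epsilon>sk)
 note I = bialgebraI_gens[OF skew_kalg h, simplified, OF A_gens]
 have im: "comult_id K sk (comult sk (\<iota> a)) = id_comult K sk (comult sk (\<iota> a))"
  "counit_id K sk (comult sk (\<iota> a)) = \<iota> a" "id_counit K sk (comult sk (\<iota> a)) = \<iota> a" if "a : cr R" for a
  by (rule coassoc_image[OF tensor_bialgebra[OF bB, of m] skew_kalg h];
   simp add: \<iota>_hom that sk_values)+
 note A3 = tensor_kalg[OF A, of 3] and e3 = E3_hom[OF A] and e3l = E3_lin[OF A]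
 have sX: "comult_id K sk (X i) = id_comult K sk (X i)" "counit_id K sk (X i) = s i" "id_counit K sk (X i) = s i"
  if i: "i : {1..<m}" for i
 proof -
  let ?j = "Suc i" and ?T = "tpow A 3"
  have ii: "i : {1..m}" and jj: "?j : {1..m}" using i by auto
  \<comment> \<open>\<open>q p k\<close> puts B at position k of leg p in the threefold power of
    A.\<close>
  define q where "q p k b = E3 A p (\<iota> (e k b))" for p k b
  have \<iota>e: "(%b. \<iota> (e k b)) : alg_hom K B A" if "k : {1..m}" for k by (rule ah_comp[OF tens_emb_hom[OF B that] \<iota>_hom])
  have q: "q p k : alg_hom K B ?T" if "p : {1..3}" "k : {1..m}" for p k
   unfolding q_def by (rule ah_comp[OF \<iota>e[OF that(2)] tens_emb_hom[OF A that(1)]])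
  have qc: "com B ?T (q p k) (q p' l)" if "p : {1..3}" "k : {1..m}" "l : {1..m}" "p ~= p' \<or> k ~= l" for p k p' l
  proof (cases "p = p'")
   case True
   with that have "k ~= l" by simp
   then show ?thesis unfolding True[symmetric] q_def
    by (intro hom_com[OF ah_comp[OF \<iota>_hom tens_emb_hom[OF A that(1)]] tens_emb_hom[OF B that(2)] tens_emb_hom[OF B that(3)]])
     (rule e_com)
  next
   case False
   show ?thesis unfolding q_def
    by (rule comI) (rule tens_emb_comm[OF A False ah_closed[OF \<iota>e[OF that(2)]] ah_closed[OF \<iota>e[OF that(3)]]])
  qed
  have \<iota>J: "\<iota>2 (JJ m i ?j) = cv AA (%b. E2 A 1 (\<iota> (e i b))) (%b. E2 A 2 (\<iota> (e ?j b))) J"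
  proof -
   have l: "(%b. E2 R 1 (e i b)) : module_hom K B RR" "(%b. E2 R 2 (e ?j b)) : module_hom K B RR"
    by (rule ah_lin, rule E_hom[OF _ ii] E_hom[OF _ jj], simp)+
   show ?thesis unfolding JJ_def lin_cv[OF B RRk tensor_kalg[OF A] \<iota>2_hom(1) l J]
    by (rule cv_cong[OF B tensor_kalg[OF A] lin_comp[OF l(1) ah_lin[OF \<iota>2_hom(1)]] lin_comp[OF l(2) ah_lin[OF \<iota>2_hom(1)]] J])
     (simp_all add: \<iota>2_hom(2,3) e_closed[OF ii] e_closed[OF jj])
  qed
  have El: "(%b. E2 A 1 (\<iota> (e i b))) : module_hom K B AA" "(%b. E2 A 2 (\<iota> (e ?j b))) : module_hom K B AA"
   by (rule lin_comp[OF \<iota>e[OF ii, THEN ah_lin] E2_lin(1)[OF A]] lin_comp[OF \<iota>e[OF jj, THEN ah_lin] E2_lin(2)[OF A]])+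
  \<comment> \<open>Every axiom at \<open>s i\<close> evaluates a pair of commuting algebra maps f,
    g on A at \<open>X i\<close>; this formula covers all of them.\<close>
  have hX: "cv T f g (X i) = cv T (%b. f (\<iota> (e i b))) (%b. g (\<iota> (e ?j b))) J *[T] (f (s i) *[T] g (s i))"
   if T: "kalg K T" and f: "f : alg_hom K A T" and g: "g : alg_hom K A T" and c: "com A T f g"
   for f g and T :: "('k, 'tt, 'zz) module_scheme"
  proof -
   note F = cv_hom[OF A T f g c]
   have "cv T f g (\<iota>2 (JJ m i ?j)) = cv T (%b. f (\<iota> (e i b))) (%b. g (\<iota> (e ?j b))) J"
    unfolding \<iota>J lin_cv[OF B tensor_kalg[OF A] T F(1) El J]
    by (rule cv_cong[OF B T lin_comp[OF El(1) ah_lin[OF F(1)]] lin_comp[OF El(2) ah_lin[OF F(1)]] J])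
     (simp_all add: F(2,3) ah_closed[OF \<iota>e[OF ii]] ah_closed[OF \<iota>e[OF jj]])
   then show ?thesis
    unfolding X_def using i cv_tens[OF A T ah_lin[OF f] ah_lin[OF g] s_closed[OF i] s_closed[OF i]]
     ah_closed[OF \<iota>2_hom(1) JJ_c[OF i]] tens_list2_closed[OF A s_closed[OF i] s_closed[OF i]]
    by (simp add: ah_mult[OF F(1)])
  qed
  have hX3: "cv ?T (E3 A p) (E3 A p') (X i) = cv ?T (q p i) (q p' ?j) J *[?T] (E3 A p (s i) *[?T] E3 A p' (s i))"
   if "p : {1..3}" "p' : {1..3}" "p ~= p'" for p p'
   using hX[OF A3 tens_emb_hom[OF A that(1)] tens_emb_hom[OF A that(2)] E3_com[OF A that(3)]] by (simp only: q_def[abs_def])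
  have D: "cv ?T (E3 A p) (E3 A p') (comult sk (\<iota> (e k b))) = cv ?T (q p k) (q p' k) (comult B b)"
   if "p : {1..3}" "p' : {1..3}" and k: "k : {1..m}" and b: "b : cr B" for p p' k b
  proof -
   note el = ah_lin[OF tens_emb_hom[OF B k]] and \<iota>l = ah_lin[OF \<iota>_hom]
   note el3 = ah_lin[OF tens_emb_hom[OF A that(1)]] ah_lin[OF tens_emb_hom[OF A that(2)]]
   have "cv ?T (E3 A p) (E3 A p') (\<iota>2 (tens_map2 K R (e k) (e k) (comult B b))) = cv ?T (%a. E3 A p (\<iota> a)) (%a. E3 A p' (\<iota> a)) (tens_map2 K R (e k) (e k) (comult B b))"
    by (rule cv_map2[OF Rk A \<iota>l \<iota>l A3 el3 lin_closed[OF map2_lin[OF B Rk el el] dB[OF b]]])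
   also have "... = cv ?T (q p k) (q p' k) (comult B b)"
    unfolding q_def by (rule cv_map2[OF B Rk el el A3 lin_comp[OF \<iota>l el3(1)] lin_comp[OF \<iota>l el3(2)] dB[OF b]])
   finally show ?thesis using k b by (simp add: sk_values e_closed tcomult_hom(2)[OF bB] del: atLeastAtMost_iff)
  qed
  note Dh = D_hom[OF skew_kalg h, simplified] and Dc = D_com[OF skew_kalg h, simplified]
  note dq = cvl_hom[OF A3 q q qc]
  let ?J = "%p k p' l. cv ?T (q p k) (q p' l) J"
  have Jc: "?J p k p' l : cr ?T" if "p : {1..3}" "p' : {1..3}" "k : {1..m}" "l : {1..m}" for p k p' l
   by (rule jc[OF A3 q[OF that(1,3)] q[OF that(2,4)] J])
  define P Q W where "P = ?J 2 i 3 ?j" and "Q = ?J 1 i 3 ?j" and "W = ?J 1 i 2 ?j"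
  have PQW: "P : cr ?T" "Q : cr ?T" "W : cr ?T"
   unfolding P_def Q_def W_def by (rule Jc; use ii jj in simp)+
  have comm: "P *[?T] Q = Q *[?T] P" "P *[?T] W = W *[?T] P" "Q *[?T] W = W *[?T] Q"
   unfolding P_def Q_def W_def
   by (rule J_comm[OF A3 q q qc q q]; (use ii jj in simp); (use ii jj in \<open>auto intro!: qc\<close>)?)+
  define x y z where "x = E3 A 1 (s i)" and "y = E3 A 2 (s i)" and "z = E3 A 3 (s i)"
  have xyz: "x : cr ?T" "y : cr ?T" "z : cr ?T"
   unfolding x_def y_def z_def by (rule tens_emb_closed[OF A]; use i in simp)+
  \<comment> \<open>P lives in legs 2 and 3, hence passes the letter in leg 1.\<close>
  have xP: "x *[?T] P = P *[?T] x"
   unfolding P_def x_def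
   by (rule cv_commute[OF B A3 q[THEN ah_lin] q[THEN ah_lin] J];
    use ii jj i xyz in \<open>simp add: q_def x_def tens_emb_comm[OF A] ah_closed[OF \<iota>e]\<close>)
  have "comult_id K sk (X i) = cv ?T (%a. cv ?T (E3 A 1) (E3 A 2) (comult sk a)) (E3 A 3) (X i)"
   using comult_id_cv(1)[OF skew_kalg h, of "X i"] i by simp
  also have "... = cv ?T (%b. cv ?T (E3 A 1) (E3 A 2) (comult sk (\<iota> (e i b)))) (%b. E3 A 3 (\<iota> (e ?j b))) J *[?T]
    (cv ?T (E3 A 1) (E3 A 2) (comult sk (s i)) *[?T] z)"
   unfolding z_def by (rule hX[OF A3 Dh(1) e3(3) Dc(1)])
  also have "cv ?T (%b. cv ?T (E3 A 1) (E3 A 2) (comult sk (\<iota> (e i b)))) (%b. E3 A 3 (\<iota> (e ?j b))) J =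
    cv ?T (%b. cv ?T (q 1 i) (q 2 i) (comult B b)) (q 3 ?j) J"
   by (rule cv_cong[OF B A3 lin_comp[OF \<iota>e[OF ii, THEN ah_lin] ah_lin[OF Dh(1)]] _ J])
    (use ii jj D in \<open>simp_all add: q_def lin_comp[OF \<iota>e[OF jj, THEN ah_lin] e3l(3)]\<close>)
  \<comment> \<open>\<Delta> in the first argument of J doubles the leg; the twist along the
    convolution is the product of the twists along the two legs.\<close>
  also have "... = P *[?T] Q" unfolding P_def Q_def
   by (rule J_bichar(1)[OF A3 q q q qc qc qc]) (use ii jj in simp_all)
  also have "cv ?T (E3 A 1) (E3 A 2) (comult sk (s i)) = W *[?T] (x *[?T] y)"
   unfolding W_def x_def y_def using hX3[of 1 2] i by (simp add: sk_values)
  finally have 1: "comult_id K sk (X i) = P *[?T] Q *[?T] (W *[?T] (x *[?T] y) *[?T] z)" .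
  have "id_comult K sk (X i) = cv ?T (E3 A 1) (%a. cv ?T (E3 A 2) (E3 A 3) (comult sk a)) (X i)"
   using comult_id_cv(2)[OF skew_kalg h, of "X i"] i by simp
  also have "... = cv ?T (%b. E3 A 1 (\<iota> (e i b))) (%b. cv ?T (E3 A 2) (E3 A 3) (comult sk (\<iota> (e ?j b)))) J *[?T]
    (x *[?T] cv ?T (E3 A 2) (E3 A 3) (comult sk (s i)))"
   unfolding x_def by (rule hX[OF A3 e3(1) Dh(2) Dc(2)])
  also have "cv ?T (%b. E3 A 1 (\<iota> (e i b))) (%b. cv ?T (E3 A 2) (E3 A 3) (comult sk (\<iota> (e ?j b)))) J =
    cv ?T (q 1 i) (%b. cv ?T (q 2 ?j) (q 3 ?j) (comult B b)) J"
   by (rule cv_cong[OF B A3 _ lin_comp[OF \<iota>e[OF jj, THEN ah_lin] ah_lin[OF Dh(2)]] J])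
    (use ii jj D in \<open>simp_all add: q_def lin_comp[OF \<iota>e[OF ii, THEN ah_lin] e3l(1)]\<close>)
  also have "... = W *[?T] Q" unfolding W_def Q_def
   by (rule J_bichar(2)[OF A3 q q q qc qc qc]) (use ii jj in simp_all)
  also have "cv ?T (E3 A 2) (E3 A 3) (comult sk (s i)) = P *[?T] (y *[?T] z)"
   unfolding P_def y_def z_def using hX3[of 2 3] i by (simp add: sk_values)
  finally have 2: "id_comult K sk (X i) = W *[?T] Q *[?T] (x *[?T] (P *[?T] (y *[?T] z)))" .
  have "x *[?T] (P *[?T] (y *[?T] z)) = P *[?T] (x *[?T] (y *[?T] z))"
   using xP xyz PQW A3 by (simp flip: ka_assoc[OF A3])
  moreover have "P *[?T] (Q *[?T] W) = W *[?T] (Q *[?T] P)"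
   using comm PQW A3 by (metis ka_assoc[OF A3])
  ultimately show "comult_id K sk (X i) = id_comult K sk (X i)"
   unfolding 1 2 using xyz PQW A3 by (simp add: ka_assoc[OF A3]) (simp flip: ka_assoc[OF A3])
  note tc = triv_com[OF skew_kalg h, simplified] and th = triv_hom[OF \<epsilon>sk A]
  have tr: "triv (counit sk) A (\<iota> (e k b)) = triv\<epsilon> A b" if "k : {1..m}" "b : cr B" for k b
   using that by (simp add: triv_def sk_values e_closed tcounit_hom(2)[OF bB] del: atLeastAtMost_iff)
  have ts: "triv (counit sk) A (s i) = \<one>[A]" using i by (simp add: triv_def sk_values)
  have "counit_id K sk (X i) = cv A (triv (counit sk) A) (%a. a) (X i)"
   using counit_id_cv(1)[OF skew_kalg h, of "X i"] i by simp
  also have "... = cv A (%b. triv (counit sk) A (\<iota> (e i b))) (%b. \<iota> (e ?j b)) J *[A] (triv (counit sk) A (s i) *[A] s i)"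
   by (rule hX[OF A th ah_id tc(1)])
  also have "cv A (%b. triv (counit sk) A (\<iota> (e i b))) (%b. \<iota> (e ?j b)) J = cv A (triv\<epsilon> A) (%b. \<iota> (e ?j b)) J"
   by (rule cv_cong[OF B A lin_comp[OF \<iota>e[OF ii, THEN ah_lin] ah_lin[OF th]] \<iota>e[OF jj, THEN ah_lin] J])
    (simp_all add: tr[OF ii])
  finally show "counit_id K sk (X i) = s i" using i by (simp add: J_triv[OF A \<iota>e[OF jj]] ts)
  have "id_counit K sk (X i) = cv A (%a. a) (triv (counit sk) A) (X i)"
   using counit_id_cv(2)[OF skew_kalg h, of "X i"] i by simp
  also have "... = cv A (%b. \<iota> (e i b)) (%b. triv (counit sk) A (\<iota> (e ?j b))) J *[A] (s i *[A] triv (counit sk) A (s i))"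
   by (rule hX[OF A ah_id th tc(2)])
  also have "cv A (%b. \<iota> (e i b)) (%b. triv (counit sk) A (\<iota> (e ?j b))) J = cv A (%b. \<iota> (e i b)) (triv\<epsilon> A) J"
   by (rule cv_cong[OF B A \<iota>e[OF ii, THEN ah_lin] lin_comp[OF \<iota>e[OF jj, THEN ah_lin] ah_lin[OF th]] J])
    (simp_all add: tr[OF jj])
  finally show "id_counit K sk (X i) = s i" using i by (simp add: J_triv[OF A \<iota>e[OF ii]] ts)
 qed
 show ?thesis
 proof (rule I)
  fix x assume x: "x : \<iota> ` cr R \<union> s ` {1..<m}"
  then show "comult_id K sk (comult sk x) = id_comult K sk (comult sk x)"
  proof (elim UnE imageE)
   show "comult_id K sk (comult sk x) = id_comult K sk (comult sk x)" if "x = \<iota> a" "a : cr R" for a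
    unfolding that(1) by (rule im(1)[OF that(2)])
   show "comult_id K sk (comult sk x) = id_comult K sk (comult sk x)" if "x = s i" "i : {1..<m}" for i
    unfolding that(1) sk_values(2)[OF that(2)] by (rule sX(1)[OF that(2)])
  qed
  from x show "counit_id K sk (comult sk x) = x"
  proof (elim UnE imageE)
   show "counit_id K sk (comult sk x) = x" if "x = \<iota> a" "a : cr R" for a
    unfolding that(1) by (rule im(2)[OF that(2)])
   show "counit_id K sk (comult sk x) = x" if "x = s i" "i : {1..<m}" for i
    unfolding that(1) sk_values(2)[OF that(2)] by (rule sX(2)[OF that(2)])
  qed
  from x show "id_counit K sk (comult sk x) = x"
  proof (elim UnE imageE)
   show "id_counit K sk (comult sk x) = x" if "x = \<iota> a" "a : cr R" for a
    unfolding that(1) by (rule im(3)[OF that(2)])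
   show "id_counit K sk (comult sk x) = x" if "x = s i" "i : {1..<m}" for i
    unfolding that(1) sk_values(2)[OF that(2)] by (rule sX(3)[OF that(2)])
  qed
 qed
qed

section \<open>The quotient by the twisted relations\<close>

abbreviation "I == twisted_ideal K B J m"
abbreviation "Q == quot_alg sk I"
abbreviation "H == twisted_hopf K B J m"
abbreviation "\<pi> == twisted_proj K B J m"
abbreviation "\<kappa> == twisted_incl K B J m"
abbreviation "S' i == twisted_proj K B J m (basis_elt (tpow B m) [i] \<one>[tpow B m])"

lemma rels_eq: "twisted_relations K B J m =
 {s i *[A] s i \<ominus>\<^bsub>A\<^esub> \<iota> (tt i) | i. i : {1..<m}} \<union>
 {s i *[A] s (Suc i) *[A] s i \<ominus>\<^bsub>A\<^esub> s (Suc i) *[A] s i *[A] s (Suc i) | i. i : {1..<m} & Suc i : {1..<m}} \<union>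
 {s i *[A] s j \<ominus>\<^bsub>A\<^esub> s j *[A] s i | i j. i : {1..<m} & j : {1..<m} & (Suc i < j \<or> Suc j < i)}"
proof -
 have "{s i *[A] s i \<ominus>\<^bsub>A\<^esub> \<iota> (emb_twist_mult K B m J i (Suc i)) | i. 1 <= i & i < m} =
   {s i *[A] s i \<ominus>\<^bsub>A\<^esub> \<iota> (tt i) | i. i : {1..<m}}"
 proof (rule Collect_cong, rule ex_cong1)
  fix x i
  have "emb_twist_mult K B m J i (Suc i) = tt i" if "i : {1..<m}"
   using ij[OF that] emb_twist_mult_eq by blast
  then show "(x = s i *[A] s i \<ominus>\<^bsub>A\<^esub> \<iota> (emb_twist_mult K B m J i (Suc i)) & 1 <= i & i < m) =
    (x = s i *[A] s i \<ominus>\<^bsub>A\<^esub> \<iota> (tt i) & i : {1..<m})" by auto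
 qed
 moreover have "(1 <= i & Suc i < m) = (i : {1..<m} & Suc i : {1..<m})" for i by auto
 ultimately show ?thesis
  by (simp add: twisted_relations_def Let_def conj_assoc)
qed

lemma tt_closed [simp]: "i : {1..<m} ==> tt i : cr R"
 using t_closed(1) ij by blast

lemma rels_closed: "twisted_relations K B J m <= cr A"
 unfolding rels_eq by (auto simp: \<iota>_closed simp del: atLeastLessThan_iff)

lemma I_ideal: "ideal I sk" and rels_I: "twisted_relations K B J m <= I"
 unfolding twisted_ideal_def using ideal_genideal[OF skew_kalg] rels_closed by simp_all

lemma Q [simp]: "kalg K Q" by (rule quot_kalg[OF skew_kalg I_ideal])

lemma \<pi>_eq: "\<pi> = (%a. I +>\<^bsub>sk\<^esub> a)" by (intro ext) (simp add: twisted_proj_def)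

lemma \<pi>_hom: "\<pi> : alg_hom K A Q" unfolding \<pi>_eq using proj_hom[OF skew_kalg I_ideal] by simp

lemma Q_carrier: "cr Q = \<pi> ` cr A"
 unfolding \<pi>_eq using quot_carrier[OF skew_kalg I_ideal] by simp

lemmas \<pi>_closed = ah_closed[OF \<pi>_hom]

lemma \<kappa>_eq: "\<kappa> = (%a. \<pi> (\<iota> a))" by (intro ext) (simp add: twisted_incl_def)

lemma \<kappa>_hom: "\<kappa> : alg_hom K R Q" unfolding \<kappa>_eq by (rule ah_comp[OF \<iota>_hom \<pi>_hom])

lemmas \<kappa>_closed = ah_closed[OF \<kappa>_hom]

lemma S'_closed [simp]: "i : {1..<m} ==> S' i : cr Q" by (simp add: \<pi>_closed)

lemma S'_\<kappa>: "i : {1..<m} ==> a : cr R ==> S' i *[Q] \<kappa> a = \<kappa> (\<sigma> i a) *[Q] S' i"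
 unfolding \<kappa>_eq by (simp add: s_\<iota> \<iota>_closed flip: ah_mult[OF \<pi>_hom] del: atLeastLessThan_iff)

lemma \<pi>_rel:
 assumes "x : cr A" "y : cr A" "x \<ominus>\<^bsub>A\<^esub> y : twisted_relations K B J m"
 shows "\<pi> x = \<pi> y"
 unfolding \<pi>_eq using coset_eq_iff[OF skew_kalg I_ideal, of x y] assms rels_I by auto

text \<open>h plays the restriction to R and y i the image of the i-th generator. Commutation is
  asked for one order of the indices, the other being the same equation read backwards.\<close>

definition satisfies_rels :: "('k, 't, 'z) module_scheme => (('k, 'b) tensor => 't) => (nat => 't) => bool" where
 "satisfies_rels T h y \<longleftrightarrow> (ALL i:{1..<m}. y i *[T] y i = h (tt i)) &
  (ALL i:{1..<m}. Suc i : {1..<m} --> y i *[T] y (Suc i) *[T] y i = y (Suc i) *[T] y i *[T] y (Suc i)) &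
  (ALL i:{1..<m}. ALL j:{1..<m}. Suc i < j --> y i *[T] y j = y j *[T] y i)"

lemma satisfies_relsI:
 assumes "!!i. i : {1..<m} ==> y i *[T] y i = h (tt i)"
  "!!i. i : {1..<m} ==> Suc i : {1..<m} ==> y i *[T] y (Suc i) *[T] y i = y (Suc i) *[T] y i *[T] y (Suc i)"
  "!!i j. i : {1..<m} ==> j : {1..<m} ==> Suc i < j ==> y i *[T] y j = y j *[T] y i"
 shows "satisfies_rels T h y"
 unfolding satisfies_rels_def using assms by blast

lemma satisfies_relsD:
 assumes "satisfies_rels T h y"
 shows "i : {1..<m} ==> y i *[T] y i = h (tt i)"
  "i : {1..<m} ==> Suc i : {1..<m} ==> y i *[T] y (Suc i) *[T] y i = y (Suc i) *[T] y i *[T] y (Suc i)"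
  "i : {1..<m} ==> j : {1..<m} ==> Suc i < j \<or> Suc j < i ==> y i *[T] y j = y j *[T] y i"
proof -
 note r = assms[unfolded satisfies_rels_def]
 show "i : {1..<m} ==> y i *[T] y i = h (tt i)"
  "i : {1..<m} ==> Suc i : {1..<m} ==> y i *[T] y (Suc i) *[T] y i = y (Suc i) *[T] y i *[T] y (Suc i)"
  using r by blast+
 have c: "y i *[T] y j = y j *[T] y i" if "i : {1..<m}" "j : {1..<m}" "Suc i < j" for i j
  using r that by blast
 show "y i *[T] y j = y j *[T] y i" if a: "i : {1..<m}" "j : {1..<m}" "Suc i < j \<or> Suc j < i"
  using a(3)
 proof
  assume "Suc i < j" then show ?thesis by (rule c[OF a(1,2)])
 next
  assume "Suc j < i" then show ?thesis by (rule c[OF a(2,1), symmetric])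
 qed
qed

lemma Q_rels: "satisfies_rels Q \<kappa> S'"
proof (rule satisfies_relsI)
 note m = ah_mult[OF \<pi>_hom, symmetric]
 show "S' i *[Q] S' i = \<kappa> (tt i)" if i: "i : {1..<m}" for i
  unfolding \<kappa>_eq m[OF s_closed[OF i] s_closed[OF i]]
  by (rule \<pi>_rel) (use i in \<open>auto simp: rels_eq \<iota>_closed simp del: atLeastLessThan_iff\<close>)
 show "S' i *[Q] S' (Suc i) *[Q] S' i = S' (Suc i) *[Q] S' i *[Q] S' (Suc i)"
  if i: "i : {1..<m}" "Suc i : {1..<m}" for i
 proof -
  have "\<pi> (s i *[A] s (Suc i) *[A] s i) = \<pi> (s (Suc i) *[A] s i *[A] s (Suc i))"
   by (rule \<pi>_rel) (use i in \<open>auto simp: rels_eq simp del: atLeastLessThan_iff\<close>)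
  then show ?thesis using i by (simp add: ah_mult[OF \<pi>_hom] del: atLeastLessThan_iff)
 qed
 show "S' i *[Q] S' j = S' j *[Q] S' i" if i: "i : {1..<m}" "j : {1..<m}" "Suc i < j" for i j
  unfolding m[OF s_closed[OF i(1)] s_closed[OF i(2)]] m[OF s_closed[OF i(2)] s_closed[OF i(1)]]
  by (rule \<pi>_rel) (use i in \<open>auto simp: rels_eq simp del: atLeastLessThan_iff\<close>)
qed

lemma rels_vanish:
 assumes T: "kalg K T" and G: "G : alg_hom K A T" and r: "satisfies_rels T (%a. G (\<iota> a)) (%i. G (s i))" and x: "x : I"
 shows "G x = \<zero>[T]"
proof (rule genideal_vanish[OF skew_kalg T _ _ _ x[unfolded twisted_ideal_def]])
 show "G : alg_hom K sk T" "twisted_relations K B J m <= cr sk" using G rels_closed by simp_all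
 fix x assume "x : twisted_relations K B J m"
 note m = lin_minus[OF ah_lin[OF G] A T] ah_mult[OF G]
 note c = ah_closed[OF G]
 note z = ka_minus_eq_zero[OF T]
 from \<open>x : twisted_relations K B J m\<close> show "G x = \<zero>[T]"
  unfolding rels_eq
  by (auto simp: m z c T satisfies_relsD[OF r] \<iota>_closed simp del: atLeastLessThan_iff)
qed

text \<open>The relations lie in the kernel of the map on the skew monoid algebra, hence so does the
  ideal they generate. This yields the antipode, the map to the crossed product and the map to the
  group algebra.\<close>

lemma Q_universal:
 assumes T: "kalg K T" and h: "h : alg_hom K R T" and y: "!!i. i : {1..<m} ==> y i : cr T"
  and yh: "!!i a. i : {1..<m} ==> a : cr R ==> y i *[T] h a = h (\<sigma> i a) *[T] y i"
  and r: "satisfies_rels T h y"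
 obtains F where "F : alg_hom K Q T" "!!a. a : cr R ==> F (\<kappa> a) = h a" "!!i. i : {1..<m} ==> F (S' i) = y i"
proof -
 note U = A_universal[OF T h y yh]
 let ?G = "W.flift T (%ws a. h a *[T] list_prod T (map y ws))"
 have r': "satisfies_rels T (%a. ?G (\<iota> a)) (%i. ?G (s i))"
  by (rule satisfies_relsI) (simp_all add: U(2,3) satisfies_relsD[OF r] del: atLeastLessThan_iff)
 have G: "?G : alg_hom K sk T" using U(1) by simp
 have v: "?G x = \<zero>[T]" if "x : I" for x by (rule rels_vanish[OF T U(1) r' that])
 have e: "the_elem (?G ` \<pi> x) = ?G x" if "x : cr A" for x
  unfolding \<pi>_eq using quot_lift(1)[OF skew_kalg I_ideal T ah_lin[OF G] v] that by simp
 show thesis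
  by (rule that[OF quot_lift_hom[OF skew_kalg I_ideal T G v]])
   (simp_all add: \<kappa>_eq e \<iota>_closed U(2,3) del: atLeastLessThan_iff)
qed

lemma Q_gens: "gens K Q (\<kappa> ` cr R \<union> S' ` {1..<m})"
proof -
 have "\<pi> ` (\<iota> ` cr R \<union> s ` {1..<m}) = \<kappa> ` cr R \<union> S' ` {1..<m}"
  unfolding \<kappa>_eq by (simp add: image_Un image_image)
 then show ?thesis using gens_image[OF A_gens \<pi>_hom Q_carrier A] by simp
qed

end

section \<open>Bialgebra structure and antipode of the quotient\<close>

context twisted
begin

lemma transpose_JJ:
 assumes k: "k : {1..<m}" and i: "i : {1..m}" and j: "j : {1..m}"
 shows "tens_map2 K R (\<sigma> k) (\<sigma> k) (JJ m i j) = JJ m (transpose k (Suc k) i) (transpose k (Suc k) j)"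
 by (rule t_perm(2)[OF i j transpose_permutes[OF k]])

text \<open>The reason why \<Delta> descends, stated for any algebra T in which the relations hold.
  The square relation is matched by the formula for \<Delta>(t_i); in the braid and commutation
  relations the central coefficients on the two sides are the same products of twists.\<close>

lemma twisted_rels:
 assumes T: "kalg K T" and h: "h : alg_hom K R T" and y: "!!i. i : {1..<m} ==> y i : cr T"
  and yh: "!!i a. i : {1..<m} ==> a : cr R ==> y i *[T] h a = h (\<sigma> i a) *[T] y i"
  and r: "satisfies_rels T h y"
 shows "satisfies_rels (tpow T 2) (%a. tens_map2 K T h h (\<Delta>R a))
  (%i. tens_map2 K T h h (JJ m i (Suc i)) *[tpow T 2] tens_list K T [y i, y i])"
proof -
 note T2 = tensor_kalg[OF T, of 2]
 define h2 where "h2 = tens_map2 K T h h"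
 define q where "q i = tens_list K T [y i, y i]" for i
 define \<tau> where "\<tau> i = tens_map2 K R (\<sigma> i) (\<sigma> i)" for i
 have h2: "h2 : alg_hom K RR (tpow T 2)" unfolding h2_def by (rule map2_hom(1)[OF Rk T h h])
 note hc = ah_closed[OF h2]
 have q [simp]: "q i : cr (tpow T 2)" if "i : {1..<m}" for i unfolding q_def using y[OF that] T by simp
 have qh: "q i *[tpow T 2] h2 x = h2 (\<tau> i x) *[tpow T 2] q i" if "i : {1..<m}" "x : cr RR" for i x
  unfolding q_def h2_def \<tau>_def by (rule ss_comm[OF T h y[OF that(1)] that(1) yh[OF that(1)] that(2)])
 have \<tau>c: "\<tau> i x : cr RR" if "i : {1..<m}" "x : cr RR" for i x
  unfolding \<tau>_def by (rule ah_closed[OF map2_hom(1)[OF Rk Rk \<sigma>_hom[OF that(1)] \<sigma>_hom[OF that(1)]] that(2)])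
 have qq: "q i *[tpow T 2] q j = tens_list K T [y i *[T] y j, y i *[T] y j]" if "i : {1..<m}" "j : {1..<m}" for i j
  unfolding q_def by (rule tens_list2_mult[OF T y[OF that(1)] y[OF that(1)] y[OF that(2)] y[OF that(2)]])
 \<comment> \<open>Products are brought to the form coefficient times letters; \<open>e\<close> says
   how the coefficient z changes when the letters p are moved past it.\<close>
 have P: "(h2 x *[tpow T 2] p) *[tpow T 2] (h2 z *[tpow T 2] p') = h2 (x *[RR] z') *[tpow T 2] (p *[tpow T 2] p')"
  if "x : cr RR" "z : cr RR" "z' : cr RR" "p : cr (tpow T 2)" "p' : cr (tpow T 2)"
   and e: "p *[tpow T 2] h2 z = h2 z' *[tpow T 2] p" for x z z' p p'
 proof -
  have "(h2 x *[tpow T 2] p) *[tpow T 2] (h2 z *[tpow T 2] p') = h2 x *[tpow T 2] (p *[tpow T 2] h2 z) *[tpow T 2] p'"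
   using that(1-5) hc T2 by (simp add: ka_assoc[OF T2])
  also have "... = h2 x *[tpow T 2] (h2 z' *[tpow T 2] p) *[tpow T 2] p'" by (simp only: e)
  also have "... = h2 (x *[RR] z') *[tpow T 2] (p *[tpow T 2] p')"
   using that(1-5) hc T2 by (simp add: ka_assoc[OF T2] ah_mult[OF h2])
  finally show ?thesis .
 qed
 note Jc = JJ_closed
 have "satisfies_rels (tpow T 2) (%a. h2 (\<Delta>R a)) (%i. h2 (JJ m i (Suc i)) *[tpow T 2] q i)"
 proof (rule satisfies_relsI)
  fix i assume i: "i : {1..<m}"
  then have ii: "i : {1..m}" "Suc i : {1..m}" by auto
  have t: "tt i : cr R" using i by simp
  \<comment> \<open>Conjugation by s_i exchanges the two indices; this produces the factor
    \<open>JJ m (Suc i) i\<close> of \<Delta>(t_i).\<close>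
  have \<tau>J: "\<tau> i (JJ m i (Suc i)) = JJ m (Suc i) i" unfolding \<tau>_def transpose_JJ[OF i ii] by simp
  have "h2 (JJ m i (Suc i)) *[tpow T 2] q i *[tpow T 2] (h2 (JJ m i (Suc i)) *[tpow T 2] q i) =
    h2 (JJ m i (Suc i) *[RR] JJ m (Suc i) i) *[tpow T 2] (q i *[tpow T 2] q i)"
   by (rule P[OF Jc[OF ii] Jc[OF ii] Jc[OF ii(2,1)] q[OF i] q[OF i]]) (simp add: qh[OF i Jc[OF ii]] \<tau>J)
  also have "q i *[tpow T 2] q i = h2 (tens_list K R [tt i, tt i])"
   unfolding qq[OF i i] satisfies_relsD(1)[OF r i] h2_def
   by (rule map2_tens[OF Rk T ah_lin[OF h] ah_lin[OF h] t t, symmetric])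
  also have "h2 (JJ m i (Suc i) *[RR] JJ m (Suc i) i) *[tpow T 2] h2 (tens_list K R [tt i, tt i]) = h2 (\<Delta>R (tt i))"
   unfolding t_comult[OF ii n_not_Suc_n]
   using Jc[OF ii] Jc[OF ii(2,1)] t by (simp add: ah_mult[OF h2] ka_closed(1)[OF RRk] tens_list2_closed[OF Rk t t])
  finally show "h2 (JJ m i (Suc i)) *[tpow T 2] q i *[tpow T 2] (h2 (JJ m i (Suc i)) *[tpow T 2] q i) = h2 (\<Delta>R (tt i))" .
 next
  fix i assume i: "i : {1..<m}" and j: "Suc i : {1..<m}"
  let ?j = "Suc i" and ?k = "Suc (Suc i)"
  have k: "i : {1..m}" "?j : {1..m}" "?k : {1..m}" using i j by auto
  note J3 = Jc[OF k(1,2)] Jc[OF k(1,3)] Jc[OF k(2,3)]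
  \<comment> \<open>The transpositions permute the three pairs from i, i + 1, i + 2, so either side
    of the braid relation collects each of the three twists once.\<close>
  have \<tau>: "\<tau> i (JJ m ?j ?k) = JJ m i ?k" "\<tau> ?j (JJ m i ?j) = JJ m i ?k" "\<tau> i (JJ m i ?k) = JJ m ?j ?k" "\<tau> ?j (JJ m i ?k) = JJ m i ?j"
   unfolding \<tau>_def transpose_JJ[OF i k(2,3)] transpose_JJ[OF j k(1,2)] transpose_JJ[OF i k(1,3)] transpose_JJ[OF j k(1,3)]
   by (simp_all add: transpose_def)
  note qi = q[OF i] q[OF j]
  have qqc: "q i *[tpow T 2] q ?j : cr (tpow T 2)" "q ?j *[tpow T 2] q i : cr (tpow T 2)"
   using qi T2 by simp_all
  have L: "h2 (JJ m i ?j) *[tpow T 2] q i *[tpow T 2] (h2 (JJ m ?j ?k) *[tpow T 2] q ?j) =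
    h2 (JJ m i ?j *[RR] JJ m i ?k) *[tpow T 2] (q i *[tpow T 2] q ?j)"
   by (rule P[OF J3(1) J3(3) J3(2) qi]) (simp add: qh[OF i J3(3)] \<tau>)
  have "q i *[tpow T 2] q ?j *[tpow T 2] h2 (JJ m i ?j) = q i *[tpow T 2] h2 (JJ m i ?k) *[tpow T 2] q ?j"
   using qi T2 hc[OF J3(1)] hc[OF J3(2)] qh[OF j J3(1)] \<tau> by (simp add: ka_assoc[OF T2])
  also have "... = h2 (JJ m ?j ?k) *[tpow T 2] (q i *[tpow T 2] q ?j)"
   using qi T2 hc[OF J3(3)] qh[OF i J3(2)] \<tau> by (simp add: ka_assoc[OF T2])
  finally have L2: "h2 (JJ m i ?j *[RR] JJ m i ?k) *[tpow T 2] (q i *[tpow T 2] q ?j) *[tpow T 2] (h2 (JJ m i ?j) *[tpow T 2] q i) =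
    h2 (JJ m i ?j *[RR] JJ m i ?k *[RR] JJ m ?j ?k) *[tpow T 2] (q i *[tpow T 2] q ?j *[tpow T 2] q i)"
   by (rule P[OF ka_closed(1)[OF RRk J3(1,2)] J3(1) J3(3) qqc(1) qi(1)])
  have M: "h2 (JJ m ?j ?k) *[tpow T 2] q ?j *[tpow T 2] (h2 (JJ m i ?j) *[tpow T 2] q i) =
    h2 (JJ m ?j ?k *[RR] JJ m i ?k) *[tpow T 2] (q ?j *[tpow T 2] q i)"
   by (rule P[OF J3(3) J3(1) J3(2) qi(2,1)]) (simp add: qh[OF j J3(1)] \<tau>)
  have "q ?j *[tpow T 2] q i *[tpow T 2] h2 (JJ m ?j ?k) = q ?j *[tpow T 2] h2 (JJ m i ?k) *[tpow T 2] q i"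
   using qi T2 hc[OF J3(3)] hc[OF J3(2)] qh[OF i J3(3)] \<tau> by (simp add: ka_assoc[OF T2])
  also have "... = h2 (JJ m i ?j) *[tpow T 2] (q ?j *[tpow T 2] q i)"
   using qi T2 hc[OF J3(1)] qh[OF j J3(2)] \<tau> by (simp add: ka_assoc[OF T2])
  finally have M2: "h2 (JJ m ?j ?k *[RR] JJ m i ?k) *[tpow T 2] (q ?j *[tpow T 2] q i) *[tpow T 2] (h2 (JJ m ?j ?k) *[tpow T 2] q ?j) =
    h2 (JJ m ?j ?k *[RR] JJ m i ?k *[RR] JJ m i ?j) *[tpow T 2] (q ?j *[tpow T 2] q i *[tpow T 2] q ?j)"
   by (rule P[OF ka_closed(1)[OF RRk J3(3,2)] J3(3) J3(1) qqc(2) qi(2)])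
  have cen: "JJ m i ?j : center RR" "JJ m ?j ?k : center RR" using JJ_central k by simp_all
  have "JJ m i ?j *[RR] JJ m i ?k *[RR] JJ m ?j ?k = JJ m ?j ?k *[RR] (JJ m i ?j *[RR] JJ m i ?k)"
   by (rule center_comm[OF cen(2) ka_closed(1)[OF RRk J3(1,2)], symmetric])
  also have "... = JJ m ?j ?k *[RR] JJ m i ?k *[RR] JJ m i ?j"
   using J3 center_comm[OF cen(1) J3(2)] by (simp add: ka_assoc[OF RRk])
  finally have JJJ: "JJ m i ?j *[RR] JJ m i ?k *[RR] JJ m ?j ?k = JJ m ?j ?k *[RR] JJ m i ?k *[RR] JJ m i ?j" .
  have yc: "y i *[T] y ?j : cr T" "y ?j *[T] y i : cr T" using y[OF i] y[OF j] T by simp_all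
  have "q i *[tpow T 2] q ?j *[tpow T 2] q i = q ?j *[tpow T 2] q i *[tpow T 2] q ?j"
   unfolding qq[OF i j] qq[OF j i] unfolding q_def
    tens_list2_mult[OF T yc(1) yc(1) y[OF i] y[OF i]] tens_list2_mult[OF T yc(2) yc(2) y[OF j] y[OF j]]
   by (simp only: satisfies_relsD(2)[OF r i j])
  then show "h2 (JJ m i ?j) *[tpow T 2] q i *[tpow T 2] (h2 (JJ m ?j ?k) *[tpow T 2] q ?j) *[tpow T 2]
    (h2 (JJ m i ?j) *[tpow T 2] q i) =
    h2 (JJ m ?j ?k) *[tpow T 2] q ?j *[tpow T 2] (h2 (JJ m i ?j) *[tpow T 2] q i) *[tpow T 2]
    (h2 (JJ m ?j ?k) *[tpow T 2] q ?j)"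
   unfolding L L2 M M2 JJJ by simp
 next
  fix i j assume i: "i : {1..<m}" and j: "j : {1..<m}" and ij: "Suc i < j"
  have k: "i : {1..m}" "Suc i : {1..m}" "j : {1..m}" "Suc j : {1..m}" using i j by auto
  note J2 = Jc[OF k(1,2)] Jc[OF k(3,4)]
  have \<tau>: "\<tau> i (JJ m j (Suc j)) = JJ m j (Suc j)" "\<tau> j (JJ m i (Suc i)) = JJ m i (Suc i)"
   unfolding \<tau>_def transpose_JJ[OF i k(3,4)] transpose_JJ[OF j k(1,2)] using ij by (simp_all add: transpose_def)
  have "h2 (JJ m i (Suc i)) *[tpow T 2] q i *[tpow T 2] (h2 (JJ m j (Suc j)) *[tpow T 2] q j) =
    h2 (JJ m i (Suc i) *[RR] JJ m j (Suc j)) *[tpow T 2] (q i *[tpow T 2] q j)"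
   by (rule P[OF J2 J2(2) q[OF i] q[OF j]]) (simp add: qh[OF i J2(2)] \<tau>)
  moreover have "h2 (JJ m j (Suc j)) *[tpow T 2] q j *[tpow T 2] (h2 (JJ m i (Suc i)) *[tpow T 2] q i) =
    h2 (JJ m j (Suc j) *[RR] JJ m i (Suc i)) *[tpow T 2] (q j *[tpow T 2] q i)"
   by (rule P[OF J2(2,1) J2(1) q[OF j] q[OF i]]) (simp add: qh[OF j J2(1)] \<tau>)
  moreover have "JJ m i (Suc i) *[RR] JJ m j (Suc j) = JJ m j (Suc j) *[RR] JJ m i (Suc i)"
   by (rule center_comm[OF JJ_central[OF k(1,2) n_not_Suc_n] J2(2)])
  moreover have "y i *[T] y j = y j *[T] y i" using satisfies_relsD(3)[OF r i j] ij by simp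
  then have "q i *[tpow T 2] q j = q j *[tpow T 2] q i"
   unfolding qq[OF i j] qq[OF j i] by (simp only:)
  ultimately show "h2 (JJ m i (Suc i)) *[tpow T 2] q i *[tpow T 2] (h2 (JJ m j (Suc j)) *[tpow T 2] q j) =
    h2 (JJ m j (Suc j)) *[tpow T 2] q j *[tpow T 2] (h2 (JJ m i (Suc i)) *[tpow T 2] q i)"
   by (simp only:)
 qed
 then show ?thesis by (simp only: h2_def q_def)
qed

abbreviation "QQ == tpow Q 2"
abbreviation "\<kappa>2 == tens_map2 K Q \<kappa> \<kappa>"
abbreviation "Y i == tens_map2 K Q \<kappa> \<kappa> (JJ m i (Suc i)) *[QQ] tens_list K Q [S' i, S' i]"

lemma \<pi>2:
 "x : cr RR ==> tens_map2 K Q \<pi> \<pi> (\<iota>2 x) = \<kappa>2 x"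
 "i : {1..<m} ==> tens_map2 K Q \<pi> \<pi> (X i) = Y i"
proof -
 show 1: "tens_map2 K Q \<pi> \<pi> (\<iota>2 x) = \<kappa>2 x" if "x : cr RR" for x
  unfolding \<kappa>_eq by (rule map2_comp[OF Rk A Q ah_lin[OF \<iota>_hom] ah_lin[OF \<pi>_hom] that])
 note p2 = map2_hom(1)[OF A Q \<pi>_hom \<pi>_hom] and pl = ah_lin[OF \<pi>_hom]
 show "tens_map2 K Q \<pi> \<pi> (X i) = Y i" if i: "i : {1..<m}"
  unfolding X_def
   ah_mult[OF p2 ah_closed[OF \<iota>2_hom(1) JJ_c[OF i]] tens_list2_closed[OF A s_closed[OF i] s_closed[OF i]]]
   1[OF JJ_c[OF i]] map2_tens[OF A Q pl pl s_closed[OF i] s_closed[OF i]] ..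
qed

text \<open>The values of \<Delta> modulo the ideal satisfy the relations by
  \<open>twisted_rels\<close>, those of \<epsilon> because \<epsilon>(t_i) = 1; so both maps vanish
  on the ideal.\<close>

lemma \<pi>_bialg_hom: "bialg_hom K sk H \<pi>"
proof -
 note p2 = map2_hom(1)[OF A Q \<pi>_hom \<pi>_hom] and tc = tcomult_hom(1)[OF bB, where m = m]
 have D: "(%x. tens_map2 K Q \<pi> \<pi> (comult sk x)) : alg_hom K A QQ" by (rule ah_comp[OF \<Delta>sk p2])
 note r = twisted_rels[OF Q \<kappa>_hom S'_closed S'_\<kappa> Q_rels]
 have 1: "satisfies_rels QQ (%a. tens_map2 K Q \<pi> \<pi> (comult sk (\<iota> a))) (%i. tens_map2 K Q \<pi> \<pi> (comult sk (s i)))"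
  by (rule satisfies_relsI)
   (simp_all add: sk_values \<pi>2 ah_closed[OF tc] satisfies_relsD[OF r] del: atLeastLessThan_iff)
 have 2: "satisfies_rels (self_alg K) (%a. counit sk (\<iota> a)) (%i. counit sk (s i))"
  by (rule satisfies_relsI)
   (use ij t_counit in \<open>simp_all add: sk_values del: atLeastLessThan_iff\<close>)
 note v1 = rels_vanish[OF tensor_kalg[OF Q] D 1] and v2 = rels_vanish[OF self_kalg \<epsilon>sk 2]
 show ?thesis
  unfolding twisted_hopf_def \<pi>_eq
  by (rule quot_bialgebra[OF sk_bialgebra I_ideal]) (use v1 v2 in \<open>simp_all add: \<pi>_eq\<close>)
qed

lemma H_bialgebra: "bialgebra K H" by (rule bialg_homD[OF \<pi>_bialg_hom])

lemma H_make: "H = make_bialg Q (comult H) (counit H)"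
 by (simp add: twisted_hopf_def quot_bialg_eq)

lemma H_simps [simp]:
 "cr H = cr Q" "monoid.mult H = monoid.mult Q" "one H = one Q" "zero H = zero Q" "add H = add Q"
 "smult H = smult Q" "tensor_pow K H n = tpow Q n" "tens_emb K H n = tens_emb K Q n" "tens_list K H = tens_list K Q"
 "tens_map2 K H = tens_map2 K Q" "cv H = cv Q" "triv e' H = triv e' Q" "module_hom K H T = module_hom K Q T"
 "module_hom K T H = module_hom K T Q" "alg_hom K H T = alg_hom K Q T" "alg_hom K T H = alg_hom K T Q"
 "gens K H Z = gens K Q Z" "opp H = opp Q" "finsum H = finsum Q"
 by (subst H_make, simp add: fun_eq_iff)+

lemma H_values:
 "a : cr R ==> comult H (\<kappa> a) = \<kappa>2 (\<Delta>R a)" "i : {1..<m} ==> comult H (S' i) = Y i"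
 "a : cr R ==> counit H (\<kappa> a) = \<epsilon>R a" "i : {1..<m} ==> counit H (S' i) = \<one>[K]"
 using bialg_homD(4,5)[OF \<pi>_bialg_hom] ah_closed[OF tcomult_hom(1)[OF bB, where m = m]]
 by (simp_all add: \<kappa>_eq \<iota>_closed sk_values \<pi>2[unfolded \<kappa>_eq] del: atLeastLessThan_iff)

text \<open>J is symmetric, so \<sigma>_i fixes t_i; applying \<sigma>_i to the equation for the
  inverse of t_i gives this.\<close>

lemma \<sigma>_t': "i : {1..<m} ==> \<sigma> i (t' m i (Suc i)) *[R] tt i = \<one>[R]"
proof -
 assume i: "i : {1..<m}"
 then have ii: "i : {1..m}" "Suc i : {1..m}" by auto
 have "\<sigma> i (tt i) = tt i"
  using t_perm(1)[OF ii transpose_permutes[OF i]] t_sym[OF ii] by simp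
 then show ?thesis
  using ah_mult[OF \<sigma>_hom[OF i] t_closed(2)[OF ii] t_closed(1)[OF ii]] t_inverse(2)[OF ii]
  by (simp add: ah_one[OF \<sigma>_hom[OF i]])
qed

text \<open>The antipode extends that of R and fixes every generator: reversing the words preserves
  the relations, and t_i is fixed by the antipode of R. At a generator, (iii) turns J into its
  inverse, whose image in R cancels s_i^2 = t_i.\<close>

lemma H_antipode:
 obtains SH where "antipode K H SH" "SH : alg_hom K Q (opp Q)"
proof -
 interpret Q: ring Q by (rule kalg_ring[OF Q])
 note SR = tantipode_hom[OF bB antipode_S, where m = m] and o = opp_kalg[OF Q]
 note SRc = ah_closed[OF SR(1), simplified]
 have h: "(%a. \<kappa> (SR a)) : alg_hom K R (opp Q)" by (rule ah_comp[OF SR(1) opp_alg_hom[OF \<kappa>_hom]])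
 \<comment> \<open>In the opposite algebra the commutation rule is reversed. The original rule at
   \<sigma>_i(a), with \<sigma>_i an involution, gives the reversed one.\<close>
 have yh: "S' i *[opp Q] \<kappa> (SR a) = \<kappa> (SR (\<sigma> i a)) *[opp Q] S' i" if "i : {1..<m}" "a : cr R" for i a
  using S'_\<kappa>[OF that(1) SRc[OF \<sigma>_closed[OF that]]] perm_comult(3)[OF transpose_permutes[OF that(1)] \<sigma>_closed[OF that]]
  by (simp add: \<sigma>_\<sigma>[OF that])
 have r: "satisfies_rels (opp Q) (%a. \<kappa> (SR a)) S'"
 proof (rule satisfies_relsI)
  show "S' i *[opp Q] S' i = \<kappa> (SR (tt i))" if "i : {1..<m}" for i
   using satisfies_relsD(1)[OF Q_rels that] t_antipode ij[OF that] by simp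
  show "S' i *[opp Q] S' (Suc i) *[opp Q] S' i = S' (Suc i) *[opp Q] S' i *[opp Q] S' (Suc i)"
   if "i : {1..<m}" "Suc i : {1..<m}" for i
   using satisfies_relsD(2)[OF Q_rels that] that
   by (simp add: Q.m_assoc[OF S'_closed S'_closed S'_closed] del: atLeastLessThan_iff)
  show "S' i *[opp Q] S' j = S' j *[opp Q] S' i" if "i : {1..<m}" "j : {1..<m}" "Suc i < j" for i j
   using satisfies_relsD(3)[OF Q_rels that(1,2)] that(3) by simp
 qed
 obtain F where F: "F : alg_hom K Q (opp Q)" "!!a. a : cr R ==> F (\<kappa> a) = \<kappa> (SR a)" "!!i. i : {1..<m} ==> F (S' i) = S' i"
  by (rule Q_universal[OF o h _ yh r]) auto
 have Fl: "F : module_hom K Q Q" using ah_lin[OF F(1)] by (simp add: opp_lin)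
 have \<kappa>l: "\<kappa> : module_hom K R Q" by (rule ah_lin[OF \<kappa>_hom])
 note tc = ah_closed[OF tcomult_hom(1)[OF bB, where m = m]]
 have SRl: "SR : module_hom K R R" using ah_lin[OF SR(1)] by (simp add: opp_lin)
 note SRa = SR(3)[simplified]
 have R1: "cv Q F (%x. x) (comult H (\<kappa> a)) = triv (counit H) Q (\<kappa> a)"
  "cv Q (%x. x) F (comult H (\<kappa> a)) = triv (counit H) Q (\<kappa> a)" if a: "a : cr R" for a
 proof -
  have tr: "\<kappa> (triv \<epsilon>R R a) = triv (counit H) Q (\<kappa> a)"
   using a ah_closed[OF tcounit_hom(1)[OF bB, where m = m] a]
   by (simp add: triv_def H_values ah_smult[OF \<kappa>_hom] ah_one[OF \<kappa>_hom])
  have "cv Q F (%x. x) (\<kappa>2 (\<Delta>R a)) = cv Q (%a. F (\<kappa> a)) \<kappa> (\<Delta>R a)"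
   by (rule cv_map2[OF Rk Q \<kappa>l \<kappa>l Q Fl lin_id tc[OF a]])
  also have "... = cv Q (%a. \<kappa> (SR a)) \<kappa> (\<Delta>R a)"
   by (rule cv_cong[OF Rk Q lin_comp[OF \<kappa>l Fl] \<kappa>l tc[OF a]]) (simp_all add: F(2))
  also have "... = \<kappa> (cv R SR (%x. x) (\<Delta>R a))"
   by (rule lin_cv[OF Rk Rk Q \<kappa>_hom SRl lin_id tc[OF a], symmetric])
  finally show "cv Q F (%x. x) (comult H (\<kappa> a)) = triv (counit H) Q (\<kappa> a)"
   using antipodeD(2)[OF SRa, of a] a tr by (simp add: H_values)
  have "cv Q (%x. x) F (\<kappa>2 (\<Delta>R a)) = cv Q \<kappa> (%a. F (\<kappa> a)) (\<Delta>R a)"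
   by (rule cv_map2[OF Rk Q \<kappa>l \<kappa>l Q lin_id Fl tc[OF a]])
  also have "... = cv Q \<kappa> (%a. \<kappa> (SR a)) (\<Delta>R a)"
   by (rule cv_cong[OF Rk Q \<kappa>l lin_comp[OF \<kappa>l Fl] tc[OF a]]) (simp_all add: F(2))
  also have "... = \<kappa> (cv R (%x. x) SR (\<Delta>R a))"
   by (rule lin_cv[OF Rk Rk Q \<kappa>_hom lin_id SRl tc[OF a], symmetric])
  finally show "cv Q (%x. x) F (comult H (\<kappa> a)) = triv (counit H) Q (\<kappa> a)"
   using antipodeD(3)[OF SRa, of a] a tr by (simp add: H_values)
 qed
 have R2: "cv Q F (%x. x) (Y i) = \<one>[Q]" "cv Q (%x. x) F (Y i) = \<one>[Q]" if i: "i : {1..<m}" for i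
 proof -
  let ?j = "Suc i"
  have ii: "i : {1..m}" and jj: "?j : {1..m}" using i by auto
  let ?E = "cv RR (%b. E2 R 1 (e i b)) (%b. E2 R 2 (e ?j b))" and ?q = "tens_list K Q [S' i, S' i]"
  note S = S'_closed[OF i] and qc = tens_list2_closed[OF Q S'_closed[OF i] S'_closed[OF i]]
  note QQk = tensor_kalg[OF Q, of 2]
  have el: "(%b. E2 R 1 (e i b)) : module_hom K B RR" "(%b. E2 R 2 (e ?j b)) : module_hom K B RR"
   by (rule ah_lin, rule E_hom[OF _ ii] E_hom[OF _ jj], simp)+
  note El = cv_lin[OF B RRk el]
  note k2l = map2_lin[OF Rk Q \<kappa>l \<kappa>l]
  note l = e_hom[OF ii, THEN ah_lin] e_hom[OF jj, THEN ah_lin]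
  have Sc: "S b : cr B" if "b : cr B" for b by (rule lin_closed[OF Sl that])
  \<comment> \<open>\<Delta>(s_i) is seen as the value at J of a linear map on B \<otimes> B, so
    that the antipode axiom can be computed on a \<otimes> b before J is put in.\<close>
  have YL: "(%Z. \<kappa>2 (?E Z) *[QQ] ?q) : module_hom K (tpow B 2) QQ"
   by (rule lin_const_left[OF QQk lin_comp[OF El k2l] qc])
  have Yt: "\<kappa>2 (?E (tens_list K B [a, b])) *[QQ] ?q = tens_list K Q [\<kappa> (e i a) *[Q] S' i, \<kappa> (e ?j b) *[Q] S' i]"
   if ab: "a : cr B" "b : cr B" for a b
  proof -
   note ec = e_closed[OF ii ab(1)] e_closed[OF jj ab(2)]
   have "?E (tens_list K B [a, b]) = tens_list K R [e i a, e ?j b]"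
    unfolding cv_tens[OF B RRk el ab] by (rule tens_list_emb2[OF Rk ec, symmetric])
   then show ?thesis
    by (simp only: map2_tens[OF Rk Q \<kappa>l \<kappa>l ec] tens_list2_mult[OF Q \<kappa>_closed[OF ec(1)] \<kappa>_closed[OF ec(2)] S S])
  qed
  have FS: "F (\<kappa> x *[Q] S' i) = S' i *[Q] \<kappa> (SR x)" if "x : cr R" for x
   using ah_mult[OF F(1) \<kappa>_closed[OF that] S] F(2)[OF that] F(3)[OF i] by simp
  have SSi: "S' i *[Q] S' i = \<kappa> (tt i)" by (rule satisfies_relsD(1)[OF Q_rels i])
  have tR: "tt i : cr R" using i by simp
  note t'c = t_closed(2)[OF ii jj]
  have "cv Q F (%x. x) (\<kappa>2 (?E Z) *[QQ] ?q) = S' i *[Q] (\<kappa> (cv R (%b. e i (S b)) (e ?j) Z) *[Q] S' i)"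
   if Z: "Z : cr (tpow B 2)" for Z
  proof (rule lin_eq_tens2[OF B lin_comp[OF YL cv_lin[OF Q Q Fl lin_id]]
    lin_const_right[OF Q lin_const_left[OF Q lin_comp[OF cv_lin[OF B Rk lin_comp[OF Sl l(1)] l(2)] \<kappa>l] S] S] _ Z])
   fix a b assume ab: "a : cr B" "b : cr B"
   note ec = e_closed[OF ii ab(1)] e_closed[OF jj ab(2)] e_closed[OF ii Sc[OF ab(1)]]
   show "cv Q F (%x. x) (\<kappa>2 (?E (tens_list K B [a, b])) *[QQ] ?q) =
     S' i *[Q] (\<kappa> (cv R (%b. e i (S b)) (e ?j) (tens_list K B [a, b])) *[Q] S' i)"
    unfolding Yt[OF ab] cv_tens[OF B Rk lin_comp[OF Sl l(1)] l(2) ab]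
    using ec \<kappa>_closed S
    by (simp add: cv_tens[OF Q Q Fl lin_id] FS SR(2)[OF ii ab(1)] ah_mult[OF \<kappa>_hom] Q.m_assoc)
  qed
  from this[OF J] have "cv Q F (%x. x) (Y i) = S' i *[Q] (\<kappa> (t' m i ?j) *[Q] S' i)"
   by (simp only: JJ_def t'_eq(1)[OF ii jj])
  also have "... = \<kappa> (\<sigma> i (t' m i ?j)) *[Q] (S' i *[Q] S' i)"
   using S \<kappa>_closed[OF t'c] \<kappa>_closed[OF \<sigma>_closed[OF i t'c]] S'_\<kappa>[OF i t'c] by (simp flip: Q.m_assoc)
  also have "... = \<one>[Q]"
   unfolding SSi ah_mult[OF \<kappa>_hom \<sigma>_closed[OF i t'c] tR, symmetric] \<sigma>_t'[OF i] by (rule ah_one[OF \<kappa>_hom])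
  finally show "cv Q F (%x. x) (Y i) = \<one>[Q]" .
  have "cv Q (%x. x) F (\<kappa>2 (?E Z) *[QQ] ?q) = \<kappa> (tt i *[R] cv R (e i) (%b. e ?j (S b)) Z)"
   if Z: "Z : cr (tpow B 2)" for Z
  proof (rule lin_eq_tens2[OF B lin_comp[OF YL cv_lin[OF Q Q lin_id Fl]]
    lin_comp[OF lin_const_right[OF Rk cv_lin[OF B Rk l(1) lin_comp[OF Sl l(2)]] tR] \<kappa>l] _ Z])
   fix a b assume ab: "a : cr B" "b : cr B"
   note ec = e_closed[OF ii ab(1)] e_closed[OF jj ab(2)] e_closed[OF jj Sc[OF ab(2)]]
   have "\<kappa> (e i a) *[Q] S' i *[Q] (S' i *[Q] \<kappa> (e ?j (S b))) = \<kappa> (e i a) *[Q] (S' i *[Q] S' i) *[Q] \<kappa> (e ?j (S b))"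
    using ec \<kappa>_closed S by (simp add: Q.m_assoc)
   also have "... = \<kappa> (e i a *[R] tt i *[R] e ?j (S b))"
    unfolding SSi using ec tR by (simp add: ah_mult[OF \<kappa>_hom] del: atLeastLessThan_iff)
   also have "e i a *[R] tt i *[R] e ?j (S b) = tt i *[R] (e i a *[R] e ?j (S b))"
    using center_comm[OF t_central[OF ii jj n_not_Suc_n] ec(1)] ec tR by (simp flip: ka_assoc[OF Rk])
   finally show "cv Q (%x. x) F (\<kappa>2 (?E (tens_list K B [a, b])) *[QQ] ?q) =
     \<kappa> (tt i *[R] cv R (e i) (%b. e ?j (S b)) (tens_list K B [a, b]))"
    unfolding Yt[OF ab] cv_tens[OF B Rk l(1) lin_comp[OF Sl l(2)] ab]
    using ec \<kappa>_closed S by (simp add: cv_tens[OF Q Q lin_id Fl] FS SR(2)[OF jj ab(2)])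
  qed
  from this[OF J] have "cv Q (%x. x) F (Y i) = \<kappa> (tt i *[R] t' m i ?j)"
   by (simp only: JJ_def t'_eq(2)[OF ii jj])
  also have "... = \<one>[Q]" unfolding t_inverse(1)[OF ii jj n_not_Suc_n] by (rule ah_one[OF \<kappa>_hom])
  finally show "cv Q (%x. x) F (Y i) = \<one>[Q]" .
 qed
 have "antipode K H F"
 proof (rule antipodeI_gens[OF H_bialgebra])
  show "F : alg_hom K H (opp H)" "gens K H (\<kappa> ` cr R \<union> S' ` {1..<m})" using F(1) Q_gens by simp_all
  fix x assume x: "x : \<kappa> ` cr R \<union> S' ` {1..<m}"
  have tS: "triv (counit H) Q (S' i) = \<one>[Q]" if "i : {1..<m}" for i using that by (simp add: triv_def H_values)
  from x show "cv H F (%x. x) (comult H x) = triv (counit H) H x"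
  proof (elim UnE imageE)
   show "cv H F (%x. x) (comult H x) = triv (counit H) H x" if "x = \<kappa> a" "a : cr R" for a
    using R1(1)[OF that(2)] that(1) by simp
   show "cv H F (%x. x) (comult H x) = triv (counit H) H x" if "x = S' i" "i : {1..<m}" for i
    using R2(1)[OF that(2)] H_values(2)[OF that(2)] tS[OF that(2)] that(1) by simp
  qed
  from x show "cv H (%x. x) F (comult H x) = triv (counit H) H x"
  proof (elim UnE imageE)
   show "cv H (%x. x) F (comult H x) = triv (counit H) H x" if "x = \<kappa> a" "a : cr R" for a
    using R1(2)[OF that(2)] that(1) by simp
   show "cv H (%x. x) F (comult H x) = triv (counit H) H x" if "x = S' i" "i : {1..<m}" for i
    using R2(2)[OF that(2)] H_values(2)[OF that(2)] tS[OF that(2)] that(1) by simp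
  qed
 qed
 then show thesis using that F(1) by blast
qed

lemma H_hopf: "hopf_algebra K H"
 using H_antipode H_bialgebra unfolding hopf_algebra_def by blast

lemma R_hopf: "hopf_algebra K (tensor_bialg K B m)"
 using tensor_bialgebra[OF bB] tantipode_hom(3)[OF bB antipode_S] unfolding hopf_algebra_def by blast

lemma \<kappa>_hopf_hom: "hopf_hom K (tensor_bialg K B m) H \<kappa>"
proof (rule hopf_homI[OF _ R_hopf H_hopf])
 show "bialg_hom K (tensor_bialg K B m) H \<kappa>"
  unfolding bialg_hom_def using tensor_bialgebra[OF bB, of m] H_bialgebra \<kappa>_hom by (simp add: H_values)
qed

end

section \<open>Words, inversions and normal forms in the symmetric group\<close>

lemma word_perm_simps [simp]:
 "word_perm [] = id" "word_perm (i # ws) = transpose i (Suc i) \<circ> word_perm ws"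
 "word_perm (us @ vs) = word_perm us \<circ> word_perm vs"
proof -
 show 1: "word_perm [] = id" "word_perm (i # ws) = transpose i (Suc i) \<circ> word_perm ws" for i ws
  by (simp_all add: word_perm_def)
 show "word_perm (us @ vs) = word_perm us \<circ> word_perm vs" by (induction us) (simp_all add: 1 comp_assoc)
qed

lemma transpose_Suc_permutes: "i : {1..<m} ==> transpose i (Suc i) permutes {1..m}"
 by (rule permutes_swap_id) auto

lemma word_perm_permutes: "ws : lists {1..<m} ==> word_perm ws permutes {1..m}"
 by (induction ws) (auto intro!: permutes_compose permutes_id transpose_Suc_permutes simp del: atLeastLessThan_iff)

definition pairs :: "nat => nat set set" where "pairs m = {p. p <= {1..m} & card p = 2}"

text \<open>Tested with the inverse, so that p is a pair of values of w. Pairs are unordered sets,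
  on which permutations act by taking images; \<open>Min\<close> and \<open>Max\<close> recover the
  order.\<close>

definition inverted :: "(nat => nat) => nat set => bool" where
 "inverted w p \<longleftrightarrow> inv' w (Max p) < inv' w (Min p)"

definition inversions :: "nat => (nat => nat) => nat set set" where "inversions m w = {p : pairs m. inverted w p}"

lemma finite_pairs [simp]: "finite (pairs m)" "finite (inversions m w)"
 by (simp_all add: pairs_def inversions_def)

lemma pairs_cases:
 assumes "p : pairs m"
 obtains a b where "a < b" "p = {a, b}" "a : {1..m}" "b : {1..m}"
proof -
 obtain a b where "p = {a, b}" "a ~= b" using assms by (auto simp: pairs_def card_2_iff)
 then show ?thesis using assms that[of a b] that[of b a] by (cases "a < b") (auto simp: pairs_def insert_commute)
qed

lemma pairsI: "a : {1..m} ==> b : {1..m} ==> a ~= b ==> {a, b} : pairs m"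
 by (simp add: pairs_def)

lemma inverted_pair:
 assumes "w permutes X" "a ~= b"
 shows "inverted w {a, b} \<longleftrightarrow> (a < b) ~= (inv' w a < inv' w b)"
proof -
 have "inv' w a ~= inv' w b" using assms inj_eq[OF permutes_inj[OF permutes_inv[OF assms(1)]]] by simp
 then show ?thesis using assms(2) by (auto simp: inverted_def min_def max_def)
qed

lemma image_pairs: "w permutes {1..m} ==> p : pairs m ==> w ` p : pairs m"
 using image_mono[of p "{1..m}" w]
 by (simp add: pairs_def permutes_image card_image permutes_inj_on del: image_mono)

lemma bij_pairs: assumes w: "w permutes {1..m}" shows "bij_betw ((`) w) (pairs m) (pairs m)"
proof (rule bij_betwI[where g = "(`) (inv' w)"])
 note b = permutes_inverses[OF w]
 show "(`) w : pairs m \<rightarrow> pairs m" using image_pairs[OF w] by auto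
 show "(`) (inv' w) : pairs m \<rightarrow> pairs m" using image_pairs[OF permutes_inv[OF w]] by auto
qed (simp_all add: image_image permutes_inverses[OF w])

text \<open>Two strands end up crossed in the composite exactly if they cross in one of the two
  factors and not in both.\<close>

lemma inverted_comp:
 assumes w: "w permutes {1..m}" and v: "v permutes {1..m}" and p: "p : pairs m"
 shows "inverted (w \<circ> v) p \<longleftrightarrow> inverted w p ~= inverted v (inv' w ` p)"
proof -
 from p obtain a b where ab: "a < b" "p = {a, b}" by (rule pairs_cases)
 have i: "inv' (w \<circ> v) = inv' v \<circ> inv' w" by (rule o_inv_distrib[OF permutes_bij[OF w] permutes_bij[OF v]])
 have ne: "inv' w a ~= inv' w b" using ab inj_eq[OF permutes_inj[OF permutes_inv[OF w]]] by simp
 show ?thesis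
  using ab ne inverted_pair[OF permutes_compose[OF v w], of a b] inverted_pair[OF w, of a b]
   inverted_pair[OF v ne] i by auto
qed

lemma inverted_id [simp]: "p : pairs m ==> ~ inverted id p"
 by (erule pairs_cases) (simp add: inverted_pair[OF permutes_id])

lemma inverted_transpose:
 assumes i: "i : {1..<m}" and p: "p : pairs m"
 shows "inverted (transpose i (Suc i)) p \<longleftrightarrow> p = {i, Suc i}"
proof -
 from p obtain a b where ab: "a < b" "p = {a, b}" by (rule pairs_cases)
 have "inverted (transpose i (Suc i)) p \<longleftrightarrow> ~ transpose i (Suc i) a < transpose i (Suc i) b"
  using inverted_pair[OF transpose_Suc_permutes[OF i], of a b] ab by simp
 also have "... \<longleftrightarrow> a = i & b = Suc i" using ab(1) by (auto simp: transpose_def)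
 also have "... \<longleftrightarrow> p = {i, Suc i}" using ab by (auto simp: doubleton_eq_iff)
 finally show ?thesis .
qed

text \<open>Multiplying by s_i on the left moves the inversion set along s_i and toggles the single
  pair {i, i + 1}, which s_i preserves.\<close>

lemma card_inversions_step:
 assumes i: "i : {1..<m}" and v: "v permutes {1..m}"
 shows "if inverted v {i, Suc i} then card (inversions m v) = Suc (card (inversions m (transpose i (Suc i) \<circ> v)))
  else card (inversions m (transpose i (Suc i) \<circ> v)) = Suc (card (inversions m v))"
proof -
 let ?s = "transpose i (Suc i)" and ?p = "{i, Suc i}"
 let ?N = "(`) ?s ` inversions m v"
 have s: "?s permutes {1..m}" by (rule transpose_Suc_permutes[OF i])
 have ss: "?s ` ?s ` q = q" for q by (simp add: image_image)
 have pp: "?p : pairs m" and sp: "?s ` ?p = ?p" using i by (auto intro: pairsI)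
 have memN: "q : ?N \<longleftrightarrow> q : pairs m & inverted v (?s ` q)" for q
 proof -
  have "q : ?N \<longleftrightarrow> ?s ` q : inversions m v" using ss by (metis image_iff)
  moreover have "?s ` q : pairs m \<longleftrightarrow> q : pairs m" using image_pairs[OF s, of q] image_pairs[OF s, of "?s ` q"] ss[of q] by argo
  ultimately show ?thesis by (simp add: inversions_def)
 qed
 have *: "q : inversions m (?s \<circ> v) \<longleftrightarrow> q : pairs m & (q = ?p) ~= inverted v (?s ` q)" for q
  using inverted_comp[OF s v] inverted_transpose[OF i] by (auto simp: inversions_def)
 have c: "card ?N = card (inversions m v)" by (rule card_image) (metis inj_onI ss)
 show ?thesis
 proof (cases "inverted v ?p")
  case True
  have "q : inversions m (?s \<circ> v) \<longleftrightarrow> q : ?N - {?p}" for q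
   unfolding * Diff_iff memN singleton_iff using True sp by metis
  then have "inversions m (?s \<circ> v) = ?N - {?p}" by blast
  moreover have "?p : ?N" using memN True sp pp by simp
  ultimately have "card ?N = Suc (card (inversions m (?s \<circ> v)))" by (metis card_Suc_Diff1 finite_pairs(2) finite_imageI)
  then show ?thesis using True c by simp
 next
  case False
  have "q : inversions m (?s \<circ> v) \<longleftrightarrow> q : insert ?p ?N" for q
   unfolding * insert_iff memN using False sp pp by metis
  then have "inversions m (?s \<circ> v) = insert ?p ?N" by blast
  moreover have "?p \<notin> ?N" using memN False sp by simp
  ultimately show ?thesis using False c by simp
 qed
qed

lemma card_inversions_le: "ws : lists {1..<m} ==> card (inversions m (word_perm ws)) <= length ws"
proof (induction ws)
 case Nil
 have "inversions m id = {}" using inverted_id by (auto simp: inversions_def)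
 then show ?case by (simp add: id_def)
next
 case (Cons i ws)
 then show ?case using card_inversions_step[of i m "word_perm ws"] word_perm_permutes[of ws m]
  by (cases "inverted (word_perm ws) {i, Suc i}") (auto simp: comp_def)
qed

text \<open>Without descents the inverse is increasing, so every i is at most its image under the
  inverse; a permutation with this property is the identity.\<close>

lemma no_descent_id:
 assumes w: "w permutes {1..m}" and d: "!!i. i : {1..<m} ==> ~ inverted w {i, Suc i}"
 shows "w = id"
proof -
 have lt: "inv' w i < inv' w (Suc i)" if "i : {1..<m}" for i
  using d[OF that] inverted_pair[OF w, of i "Suc i"] by simp
 have "i <= m ==> 1 <= i ==> i <= inv' w i" for i
 proof (induction i)
  case (Suc i)
  show ?case
  proof (cases "i = 0")
   case True
   then have "Suc i : {1..m}" using Suc by simp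
   then have "inv' w (Suc i) : {1..m}" using permutes_in_image[OF permutes_inv[OF w]] by blast
   then show ?thesis using True by simp
  next
   case False
   then show ?thesis using Suc lt[of i] by auto
  qed
 qed simp
 then have "inv' w = id" using permutes_natset_ge[OF permutes_inv[OF w]] by simp
 then show ?thesis using permutes_inv_inv[OF w] by simp
qed

text \<open>Sorting by adjacent swaps: a permutation other than the identity has a descent, and
  removing it lowers the number of inversions by one.\<close>

lemma ex_word:
 assumes "w permutes {1..m}"
 shows "EX ws:lists {1..<m}. word_perm ws = w & length ws = card (inversions m w)"
 using assms
proof (induction "card (inversions m w)" arbitrary: w)
 case 0
 then have "w = id" by (intro no_descent_id) (auto simp: inversions_def pairs_def)
 then show ?case using 0 by (intro bexI[of _ "[]"]) auto
next
 case (Suc n)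
 have "EX i:{1..<m}. inverted w {i, Suc i}"
 proof (rule ccontr)
  assume "~ ?thesis"
  then have "w = id" using no_descent_id[OF Suc(3)] by blast
  then have "inversions m w = {}" using inverted_id by (auto simp: inversions_def)
  then show False using Suc(2) by simp
 qed
 then obtain i where i: "i : {1..<m}" "inverted w {i, Suc i}" by blast
 let ?v = "transpose i (Suc i) \<circ> w"
 have "n = card (inversions m ?v)" using card_inversions_step[OF i(1) Suc(3)] i(2) Suc(2) by simp
 moreover have "?v permutes {1..m}" by (rule permutes_compose[OF Suc(3) transpose_Suc_permutes[OF i(1)]])
 ultimately obtain ws where ws: "ws : lists {1..<m}" "word_perm ws = ?v" "length ws = n" using Suc(1) by metis
 have "word_perm (i # ws) = w" using ws(2) by (simp add: fun_eq_iff)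
 then show ?case using ws i Suc(2) by (intro bexI[of _ "i # ws"]) auto
qed

text \<open>The word from \<open>ex_word\<close> attains the lower bound of
  \<open>card_inversions_le\<close>, so minimal words have exactly this length.\<close>

lemma reduced_length:
 assumes "reduced_word m w ws" shows "length ws = card (inversions m (word_perm ws))"
proof -
 have ws: "ws : lists {1..<m}" "word_perm ws = w" "!!vs. vs : lists {1..<m} ==> word_perm vs = w ==> length ws <= length vs"
  using assms by (auto simp: reduced_word_def)
 obtain vs where "vs : lists {1..<m}" "word_perm vs = w" "length vs = card (inversions m w)"
  using ex_word[OF word_perm_permutes[OF ws(1)]] ws(2) by auto
 then show ?thesis using ws(3)[of vs] card_inversions_le[OF ws(1)] ws(2) by simp
qed

text \<open>A letter changes the inversion number by one, so a word as long as its inversion number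
  gains one inversion with every letter.\<close>

lemma reduced_tail:
 assumes ws: "i # ws : lists {1..<m}" and l: "length (i # ws) = card (inversions m (word_perm (i # ws)))"
 shows "length ws = card (inversions m (word_perm ws))" "~ inverted (word_perm ws) {i, Suc i}"
proof -
 have i: "i : {1..<m}" and w: "ws : lists {1..<m}" using ws by auto
 show "length ws = card (inversions m (word_perm ws))" "~ inverted (word_perm ws) {i, Suc i}"
  using card_inversions_step[OF i word_perm_permutes[OF w]] card_inversions_le[OF w] l
  by (simp_all split: if_splits)
qed

text \<open>The moves that hold in H up to a unit of R. Squares may be cancelled but not created, so
  the relation is not symmetric and both directions of the braid move are listed.\<close>

inductive word_red :: "nat list => nat list => bool" where
 red_refl: "word_red us us"
| red_square: "word_red [i, i] []"
| red_braid: "word_red [i, Suc i, i] [Suc i, i, Suc i]"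
| red_braid': "word_red [Suc i, i, Suc i] [i, Suc i, i]"
| red_comm: "Suc i < j \<or> Suc j < i ==> word_red [i, j] [j, i]"
| red_append: "word_red us vs ==> word_red us' vs' ==> word_red (us @ us') (vs @ vs')"
| red_trans: "word_red us vs ==> word_red vs ws ==> word_red us ws"

lemma word_red_cong: "word_red us vs ==> word_red (xs @ us @ ys) (xs @ vs @ ys)"
 by (intro word_red.red_append word_red.red_refl)

lemma word_red_move: "(!!x. x : set xs ==> Suc i < x \<or> Suc x < i) ==> word_red (xs @ [i]) (i # xs)"
proof (induction xs)
 case (Cons x xs)
 have "word_red ([x] @ (xs @ [i]) @ []) ([x] @ (i # xs) @ [])" using Cons by (intro word_red_cong) auto
 moreover have "word_red ([] @ [x, i] @ xs) ([] @ [i, x] @ xs)"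
  using Cons.prems[of x] by (intro word_red_cong word_red.red_comm) auto
 ultimately show ?case using word_red.red_trans by fastforce
qed (simp add: word_red.red_refl)

lemma word_red_sound: "word_red us vs ==> word_perm us = word_perm vs"
proof (induction rule: word_red.induct)
 case (red_comm i j)
 then show ?case by (auto simp: fun_eq_iff transpose_def)
qed (auto simp: fun_eq_iff transpose_def)

lemma word_red_lists: "word_red us vs ==> us : lists X ==> vs : lists X"
 by (induction rule: word_red.induct) auto

text \<open>The word k, k - 1, ..., j, empty for j = k + 1. These words represent the cosets of the
  permutations of {1..k} among those of {1..k + 1}.\<close>

abbreviation down :: "nat => nat => nat list" where "down k j == rev [j..<Suc k]"

text \<open>A letter i appended to the descending word passes to the front as i - 1 if j < i,
  cancels the last letter if i = j, extends the word if i + 1 = j, and passes unchanged if i + 1 <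
  j.\<close>

lemma down_append:
 assumes i: "i : {1..k}" and j: "j : {1..Suc k}"
 shows "EX us j'. us : lists {1..<k} & j' : {1..Suc k} & word_red (down k j @ [i]) (us @ down k j')"
proof -
 consider "j < i" | "i = j" | "Suc i = j" | "Suc i < j" by linarith
 then show ?thesis
 proof cases
  case 1
  then obtain h where h: "i = Suc h" "j <= h" by (metis Suc_le_D Suc_le_mono less_eq_Suc_le)
  define X Y where "X = rev [Suc i..<Suc k]" and "Y = rev [j..<h]"
  have "[j..<Suc k] = [j..<h] @ h # i # [Suc i..<Suc k]"
   using upt_add_eq_append[OF h(2), of "Suc k - h"] i h by (simp add: upt_conv_Cons)
  then have D: "down k j = X @ [i, h] @ Y" by (simp add: X_def Y_def)
  \<comment> \<open>The letter i moves left past the letters below h, a braid move at i, h, i turns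
    it into h, and h then passes the letters above i.\<close>
  have "word_red ((X @ [i, h]) @ (Y @ [i]) @ []) ((X @ [i, h]) @ (i # Y) @ [])"
   using h by (intro word_red_cong word_red_move) (auto simp: Y_def)
  moreover have "word_red (X @ [Suc h, h, Suc h] @ Y) (X @ [h, Suc h, h] @ Y)" by (intro word_red_cong word_red.red_braid')
  moreover have "word_red ([] @ (X @ [h]) @ ([i, h] @ Y)) ([] @ (h # X) @ ([i, h] @ Y))"
   using h by (intro word_red_cong word_red_move) (auto simp: X_def)
  ultimately have "word_red (down k j @ [i]) ([h] @ down k j)"
   by (simp only: D h(1) append_assoc append_Cons append_Nil append_Nil2) (blast intro: word_red.red_trans)
  then show ?thesis using i j h by (intro exI[of _ "[h]"] exI[of _ j]) auto
 next
  case 2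
  have D: "down k j = down k (Suc j) @ [j]" using i 2 by (simp add: upt_conv_Cons)
  have "word_red (down k (Suc j) @ [j, j] @ []) (down k (Suc j) @ [] @ [])" by (intro word_red_cong word_red.red_square)
  then show ?thesis using 2 i D by (intro exI[of _ "[]"] exI[of _ "Suc j"]) auto
 next
  case 3
  have "down k i = down k j @ [i]" using i 3 by (simp add: upt_conv_Cons)
  then show ?thesis using i word_red.red_refl by (intro exI[of _ "[]"] exI[of _ i]) auto
 next
  case 4
  have "word_red (down k j @ [i]) (i # down k j)" using 4 by (intro word_red_move) auto
  then show ?thesis using 4 i j by (intro exI[of _ "[i]"] exI[of _ j]) auto
 qed
qed

text \<open>Normal forms along the chain of symmetric groups: for each letter one descending word
  that starts with it. \<open>canonical_words k\<close> describes the permutations of k + 1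
  points.\<close>

fun canonical_words :: "nat => nat list set" where
 "canonical_words 0 = {[]}"
| "canonical_words (Suc k) = {us @ down (Suc k) j | us j. us : canonical_words k & j : {1..Suc (Suc k)}}"

lemma canonical_letters: "c : canonical_words k ==> c : lists {1..<Suc k}"
 by (induction k arbitrary: c) fastforce+

lemma down_split:
 assumes "ws : lists {1..k}"
 shows "EX us j. us : lists {1..<k} & j : {1..Suc k} & word_red ws (us @ down k j)"
 using assms
proof (induction ws rule: rev_induct)
 case Nil
 then show ?case by (intro exI[of _ "[]"] exI[of _ "Suc k"]) (simp add: word_red.red_refl)
next
 case (snoc i ws)
 then obtain us j where u: "us : lists {1..<k}" "j : {1..Suc k}" "word_red ws (us @ down k j)" by auto
 obtain vs j' where v: "vs : lists {1..<k}" "j' : {1..Suc k}" "word_red (down k j @ [i]) (vs @ down k j')"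
  using down_append[of i k j] snoc u by auto
 have "word_red (ws @ [i]) ((us @ down k j) @ [i])" by (rule word_red.red_append[OF u(3) word_red.red_refl])
 moreover have "word_red (us @ (down k j @ [i]) @ []) (us @ (vs @ down k j') @ [])" by (rule word_red_cong[OF v(3)])
 ultimately have "word_red (ws @ [i]) ((us @ vs) @ down k j')" using word_red.red_trans by fastforce
 then show ?case using u v by (intro exI[of _ "us @ vs"] exI[of _ j']) auto
qed

lemma ex_canonical: "ws : lists {1..<Suc k} ==> EX c:canonical_words k. word_red ws c"
proof (induction k arbitrary: ws)
 case 0
 then show ?case by (auto intro: word_red.red_refl)
next
 case (Suc k)
 have "ws : lists {1..Suc k}" using Suc(2) by (simp add: atLeastLessThanSuc_atLeastAtMost)
 from down_split[OF this] obtain us j where u: "us : lists {1..<Suc k}" "j : {1..Suc (Suc k)}" "word_red ws (us @ down (Suc k) j)"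
  by blast
 obtain c where c: "c : canonical_words k" "word_red us c" using Suc(1)[OF u(1)] by blast
 have "word_red ws (c @ down (Suc k) j)" by (rule word_red.red_trans[OF u(3) word_red.red_append[OF c(2) word_red.red_refl]])
 then show ?case using c u(2) by auto
qed

lemma word_perm_down: "1 <= j ==> j <= Suc k ==> word_perm (down k j) j = Suc k"
proof (induction k)
 case (Suc k)
 then show ?case by (cases "j = Suc (Suc k)") (auto simp: upt_Suc)
qed (auto simp: One_nat_def)

text \<open>The final descending word sends j to the largest point, and the part in front of it
  fixes that point. So the permutation determines j, and the rest follows by cancelling.\<close>

lemma canonical_unique:
 "c : canonical_words k ==> c' : canonical_words k ==> word_perm c = word_perm c' ==> c = c'"
proof (induction k arbitrary: c c')
 case (Suc k)
 then obtain u j u' j' where u: "c = u @ down (Suc k) j" "u : canonical_words k" "j : {1..Suc (Suc k)}"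
  "c' = u' @ down (Suc k) j'" "u' : canonical_words k" "j' : {1..Suc (Suc k)}" by auto
 have fix1: "word_perm x (Suc (Suc k)) = Suc (Suc k)" if "x : canonical_words k" for x
  using permutes_not_in[OF word_perm_permutes[OF canonical_letters[OF that]]] by simp
 have "word_perm c j = Suc (Suc k)" "word_perm c' j' = Suc (Suc k)"
  using u(2,3,5,6) fix1 word_perm_down by (simp_all add: u(1,4))
 then have top: "word_perm c j = Suc (Suc k)" "word_perm c j' = Suc (Suc k)" using Suc(4) by simp_all
 have "c : lists {1..<Suc (Suc k)}" by (rule canonical_letters[OF Suc(2)])
 then have "j = j'" using top permutes_inj[OF word_perm_permutes] by (metis injD)
 have bij: "bij (word_perm (down (Suc k) j))"
  by (rule permutes_bij[OF word_perm_permutes[of _ "Suc (Suc k)"]]) (use u(3) in auto)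
 have "word_perm u \<circ> word_perm (down (Suc k) j) = word_perm u' \<circ> word_perm (down (Suc k) j)"
  using Suc(4) u \<open>j = j'\<close> by (simp add: comp_def)
 then have "word_perm u = word_perm u'"
  by (metis bij bij_is_surj comp_assoc comp_id surj_iff)
 then show ?case using Suc(1) u \<open>j = j'\<close> by blast
qed simp

section \<open>Central elements and the explicit cocycle\<close>

context base_field
begin

text \<open>Indexed products need a commutative monoid, which R is not in general. The factors of
  the cocycle are central, so its products are formed here.\<close>

lemma center_comm_monoid: assumes A: "kalg K A" shows "comm_monoid (A\<lparr>carrier := center A\<rparr>)"
proof (rule comm_monoidI)
 note c = center_closed
 show "x *[A\<lparr>carrier := center A\<rparr>] y : cr (A\<lparr>carrier := center A\<rparr>)"
  if "x : cr (A\<lparr>carrier := center A\<rparr>)" "y : cr (A\<lparr>carrier := center A\<rparr>)" for x y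
 proof -
  have "x *[A] y *[A] z = z *[A] (x *[A] y)" if z: "z : cr A" for z
   using that \<open>x : _\<close> \<open>y : _\<close> A c[of x A] c[of y A] center_comm[of x A z] center_comm[of y A z]
   by (simp add: ka_assoc[OF A]) (simp flip: ka_assoc[OF A])
  then show ?thesis using that A by (simp add: centerI c)
 qed
 show "\<one>[A\<lparr>carrier := center A\<rparr>] : cr (A\<lparr>carrier := center A\<rparr>)" using A by (simp add: centerI)
 show "x *[A\<lparr>carrier := center A\<rparr>] y = y *[A\<lparr>carrier := center A\<rparr>] x"
  if "x : cr (A\<lparr>carrier := center A\<rparr>)" "y : cr (A\<lparr>carrier := center A\<rparr>)" for x y
  using that center_comm[of x A y] c[of y A] by simp
qed (use A in \<open>simp_all add: ka_assoc[OF A] center_closed[of _ A]\<close>)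

lemma center_unit:
 assumes A: "kalg K A" and z: "z : center A" and y: "y : cr A" "z *[A] y = \<one>[A]" "y *[A] z = \<one>[A]"
 shows "z : Units (A\<lparr>carrier := center A\<rparr>)"
proof -
 note zc = center_closed[OF z]
 have "y : center A"
 proof (rule centerI[OF y(1)])
  fix x assume x: "x : cr A"
  have "y *[A] x = y *[A] x *[A] (z *[A] y)" using x y A by simp
  also have "... = y *[A] (z *[A] x) *[A] y" using x y(1) zc A center_comm[OF z x] by (simp add: ka_assoc[OF A])
  also have "... = x *[A] y" using x y zc A by (simp flip: ka_assoc[OF A])
  finally show "y *[A] x = x *[A] y" .
 qed
 then show ?thesis using z y by (auto simp: Units_def)
qed

lemma hom_finprod:
 assumes A: "kalg K A" and h: "h : alg_hom K A A" and S: "finite S"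
  and f: "!!p. p : S ==> f p : center A" "!!p. p : S ==> h (f p) : center A"
 shows "h (finprod (A\<lparr>carrier := center A\<rparr>) f S) = finprod (A\<lparr>carrier := center A\<rparr>) (%p. h (f p)) S"
proof -
 interpret Z: comm_monoid "A\<lparr>carrier := center A\<rparr>" by (rule center_comm_monoid[OF A])
 show ?thesis using S f
 proof (induction S)
  case empty
  then show ?case by (simp add: ah_one[OF h])
 next
  case (insert p S)
  have "finprod (A\<lparr>carrier := center A\<rparr>) f S : center A" using Z.finprod_closed[of f S] insert by auto
  then show ?case
   using insert ah_mult[OF h center_closed center_closed, of "f p" "finprod (A\<lparr>carrier := center A\<rparr>) f S"]
   by (simp add: Pi_def)
 qed
qed

text \<open>Trivial factors are left out, so that all entries of the list come from X; the list may
  be empty.\<close>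

lemma finprod_list:
 assumes "comm_monoid G" "finite S" "!!p. p : S ==> f p = \<one>[G] \<or> f p : X" "X <= cr G"
 shows "EX us. set us <= X & finprod G f S = list_prod G us"
proof -
 interpret comm_monoid G by fact
 show ?thesis using assms(2,3)
 proof (induction S)
  case empty
  show ?case by (intro exI[of _ "[]"]) simp
 next
  case (insert p S)
  have c: "f q : cr G" if "q : insert p S" for q using insert.prems[OF that] assms(4) by auto
  obtain us where us: "set us <= X" "finprod G f S = list_prod G us" using insert by auto
  have u: "list_prod G us : cr G" using list_prod_closed[OF monoid_axioms] us assms(4) by blast
  have "finprod G f (insert p S) = f p *[G] list_prod G us" using insert c us by (simp add: Pi_def)
  then show ?case
  proof (cases "f p = \<one>[G]")
   case False
   then show ?thesis using us insert.prems[of p] \<open>finprod G f (insert p S) = _\<close> by (intro exI[of _ "f p # us"]) simp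
  qed (use us u in \<open>auto intro: exI[of _ us]\<close>)
 qed
qed

end

context twisted
begin

abbreviation "\<Sigma> == sym_group m"
abbreviation "ZR == R\<lparr>carrier := center R\<rparr>"
abbreviation "tr i == transpose i (Suc i)"

text \<open>Ordering the pair is a mere choice, since t is symmetric in its two indices.\<close>

definition tp :: "nat set => ('k, 'b) tensor" where "tp p = t m (Min p) (Max p)"

sublocale ZR: comm_monoid ZR by (rule center_comm_monoid[OF Rk])

lemma tp_pair: "a : {1..m} ==> b : {1..m} ==> a ~= b ==> tp {a, b} = t m a b"
 using t_sym[of a m b] by (auto simp: tp_def min_def max_def)

lemma tp_props:
 assumes p: "p : pairs m"
 shows "tp p : Units ZR" "tp p : center R" "\<epsilon>R (tp p) = \<one>[K]"
  and "w permutes {1..m} ==> tens_perm K B m w (tp p) = tp (w ` p)"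
proof -
 from p obtain a b where ab: "a < b" "p = {a, b}" "a : {1..m}" "b : {1..m}" by (rule pairs_cases)
 have ne: "a ~= b" using ab by simp
 note e = tp_pair[OF ab(3,4) ne]
 show "tp p : Units ZR" unfolding ab(2) e
  by (rule center_unit[OF Rk t_central[OF ab(3,4) ne] t_closed(2)[OF ab(3,4)] t_inverse[OF ab(3,4) ne]])
 show "tp p : center R" "\<epsilon>R (tp p) = \<one>[K]"
  unfolding ab(2) e by (rule t_central[OF ab(3,4) ne] t_counit[OF ab(3,4) ne])+
 show "tens_perm K B m w (tp p) = tp (w ` p)" if w: "w permutes {1..m}"
  using t_perm(1)[OF ab(3,4) w] tp_pair[of "w a" "w b"] ne permutes_inj[OF w] permutes_in_image[OF w] ab(2-4) e
  by (simp add: inj_eq del: atLeastAtMost_iff)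
qed

definition \<gamma>f :: "(nat => nat) => (nat => nat) => nat set => ('k, 'b) tensor" where
 "\<gamma>f w v p = (if inverted w p & inverted v (inv' w ` p) then tp p else \<one>[R])"

definition \<gamma> :: "(nat => nat) => (nat => nat) => ('k, 'b) tensor" where
 "\<gamma> w v = finprod ZR (\<gamma>f w v) (pairs m)"

lemma one_center: "\<one>[R] : center R" using ZR.one_closed by simp

lemma \<gamma>f_center: "p : pairs m ==> \<gamma>f w v p : center R"
 using tp_props(2) one_center by (simp add: \<gamma>f_def)

lemma \<gamma>_list: "EX us. set us <= tp ` pairs m & \<gamma> w v = list_prod R us"
proof -
 have 1: "\<gamma>f w v p = \<one>[ZR] \<or> \<gamma>f w v p : tp ` pairs m" if "p : pairs m" for p using that by (simp add: \<gamma>f_def)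
 have "tp ` pairs m <= cr ZR" using tp_props(2) by auto
 from finprod_list[OF ZR.comm_monoid_axioms finite_pairs(1) 1 this] show ?thesis
  by (simp add: \<gamma>_def list_prod_def)
qed

lemma \<gamma>_unit: "\<gamma> w v : Units ZR"
proof -
 obtain us where us: "set us <= tp ` pairs m" "\<gamma> w v = list_prod R us" using \<gamma>_list by blast
 have "tp ` pairs m <= Units ZR" using tp_props(1) by blast
 with us(1) have "set us <= Units ZR" by (rule subset_trans)
 then have "list_prod ZR us : Units ZR"
 proof (induction us)
  case Nil
  then show ?case using ZR.Units_one_closed by (simp only: list_prod_Nil)
 next
  case (Cons u us)
  then show ?case using ZR.Units_m_closed[of u "list_prod ZR us"] by (simp only: list_prod_Cons set_simps insert_subset)
 qed
 then show ?thesis using us(2) by (simp add: list_prod_def)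
qed

lemma \<gamma>_center: "\<gamma> w v : center R"
 using ZR.Units_closed[OF \<gamma>_unit] by simp

lemma \<gamma>_counit: "\<epsilon>R (\<gamma> w v) = \<one>[K]"
proof -
 obtain us where us: "set us <= tp ` pairs m" "\<gamma> w v = list_prod R us" using \<gamma>_list by blast
 have "tp ` pairs m <= cr R" by (rule image_subsetI, rule center_closed, rule tp_props(2))
 with us(1) have "set us <= cr R" by (rule subset_trans)
 then have "\<epsilon>R (\<gamma> w v) = list_prod K (map \<epsilon>R us)"
  using alg_hom_list_prod[OF tcounit_hom(1)[OF bB] Rk] us(2) by simp
 also have "... = \<one>[K]"
 proof (rule list_prod_one[OF K.monoid_axioms])
  fix u assume "u : set us"
  with us(1) have "u : tp ` pairs m" by (rule subsetD)
  then show "\<epsilon>R u = \<one>[K]" using tp_props(3) by (elim imageE) simp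
 qed
 finally show ?thesis .
qed

lemma \<gamma>_list_simple:
 "EX us. set us <= {tens_perm K B m u (tt i) | u i. u : cr \<Sigma> & i : {1..<m}} & \<gamma> w v = list_prod R us"
proof -
 have "tp p : {tens_perm K B m u (tt i) | u i. u : cr \<Sigma> & i : {1..<m}}" if p: "p : pairs m" for p
 proof -
  from p obtain a b where ab: "a < b" "p = {a, b}" "a : {1..m}" "b : {1..m}" by (rule pairs_cases)
  have a: "a : {1..<m}" "Suc a : {1..m}" using ab by auto
  \<comment> \<open>This permutation moves a + 1 to b and fixes a, so it carries t_a to the element
    of the pair {a, b}; for b = a + 1 it is the identity.\<close>
  let ?u = "transpose (Suc a) b"
  have u: "?u permutes {1..m}" by (rule permutes_swap_id[OF a(2) ab(4)])
  have "tens_perm K B m ?u (tt a) = tp p"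
   using t_perm(1)[OF ab(3) a(2) u] tp_pair[OF ab(3,4)] ab(1,2) by (simp add: transpose_def)
  then show ?thesis using u a(1) by (auto simp: sym_group_carrier)
 qed
 then have "tp ` pairs m <= {tens_perm K B m u (tt i) | u i. u : cr \<Sigma> & i : {1..<m}}" by (rule image_subsetI)
 with \<gamma>_list[of w v] show ?thesis by (meson subset_trans)
qed

lemma \<gamma>_cocycle:
 assumes w: "w permutes {1..m}" and v: "v permutes {1..m}" and u: "u permutes {1..m}"
 shows "\<gamma> w v *[R] \<gamma> (w \<circ> v) u = tens_perm K B m w (\<gamma> v u) *[R] \<gamma> w (v \<circ> u)"
proof -
 \<comment> \<open>After reindexing the pairs by w, the factor \<sigma>_w(\<gamma>(v, u)) becomes a
   product over the same index set as the other three.\<close>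
 define g where "g p = (if inverted v (inv' w ` p) & inverted u (inv' v ` inv' w ` p) then tp p else \<one>[R])" for p
 have gc: "g p : center R" if "p : pairs m" for p using tp_props(2)[OF that] one_center by (simp add: g_def)
 have gw: "tens_perm K B m w (\<gamma>f v u p) = g (w ` p)" if p: "p : pairs m" for p
  using tp_props(4)[OF p w] ah_one[OF tens_perm_hom(1)[OF B w]]
  by (simp add: \<gamma>f_def g_def image_image permutes_inverses[OF w])
 have wp: "w ` p : pairs m" if "p : pairs m" for p by (rule image_pairs[OF w that])
 have "tens_perm K B m w (\<gamma> v u) = finprod ZR (%p. tens_perm K B m w (\<gamma>f v u p)) (pairs m)"
  unfolding \<gamma>_def by (rule hom_finprod[OF Rk tens_perm_hom(1)[OF B w]]) (use gw gc wp \<gamma>f_center in simp_all)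
 also have "... = finprod ZR (%p. g (w ` p)) (pairs m)"
  by (rule ZR.finprod_cong') (use gw gc wp in simp_all)
 also have "... = finprod ZR g ((`) w ` pairs m)"
  by (rule ZR.finprod_reindex[symmetric]) (use gc wp bij_pairs[OF w] in \<open>auto simp: bij_betw_def\<close>)
 also have "(`) w ` pairs m = pairs m" using bij_pairs[OF w] by (simp add: bij_betw_def)
 finally have 1: "tens_perm K B m w (\<gamma> v u) = finprod ZR g (pairs m)" .
 have i: "inv' (w \<circ> v) = inv' v \<circ> inv' w" by (rule o_inv_distrib[OF permutes_bij[OF w] permutes_bij[OF v]])
 \<comment> \<open>Let x, y, z be the truth values of the inversions of the pair in w, and of its
   preimages in v and u. On either side the factor is present exactly if at least two of x, y, z
   hold, and then once: xy + (x xor y)z = yz + x(y xor z).\<close>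
 have pw: "\<gamma>f w v p *[R] \<gamma>f (w \<circ> v) u p = g p *[R] \<gamma>f w (v \<circ> u) p" if p: "p : pairs m" for p
 proof -
  note wp = image_pairs[OF permutes_inv[OF w] p]
  note tc = center_closed[OF tp_props(2)[OF p]]
  show ?thesis
   unfolding \<gamma>f_def g_def inverted_comp[OF w v p] inverted_comp[OF v u wp] i image_comp[symmetric]
   using tc by auto
 qed
 have "\<gamma> w v *[ZR] \<gamma> (w \<circ> v) u = finprod ZR (%p. \<gamma>f w v p *[ZR] \<gamma>f (w \<circ> v) u p) (pairs m)"
  unfolding \<gamma>_def by (rule ZR.finprod_multf[symmetric]) (use \<gamma>f_center in auto)
 also have "... = finprod ZR (%p. g p *[ZR] \<gamma>f w (v \<circ> u) p) (pairs m)"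
  by (rule ZR.finprod_cong') (use pw ZR.m_closed gc \<gamma>f_center in auto)
 also have "... = finprod ZR g (pairs m) *[ZR] \<gamma> w (v \<circ> u)"
  unfolding \<gamma>_def by (rule ZR.finprod_multf) (use gc \<gamma>f_center in auto)
 finally show ?thesis using 1 by simp
qed

lemma \<gamma>_id: "\<gamma> id w = \<one>[R]" "w permutes {1..m} ==> \<gamma> w id = \<one>[R]"
proof -
 have "\<gamma> id w = finprod ZR (%_. \<one>[ZR]) (pairs m)"
  unfolding \<gamma>_def by (rule ZR.finprod_cong') (use one_center in \<open>simp_all add: \<gamma>f_def\<close>)
 then show "\<gamma> id w = \<one>[R]" by simp
 assume w: "w permutes {1..m}"
 have "\<gamma> w id = finprod ZR (%_. \<one>[ZR]) (pairs m)"
  unfolding \<gamma>_def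
  by (rule ZR.finprod_cong') (use one_center inverted_id[OF image_pairs[OF permutes_inv[OF w]]] in \<open>simp_all add: \<gamma>f_def\<close>)
 then show "\<gamma> w id = \<one>[R]" by simp
qed

text \<open>s_i inverts only the pair {i, i + 1}, so at most one factor of the product is
  left.\<close>

lemma \<gamma>_transpose:
 assumes i: "i : {1..<m}" and v: "v permutes {1..m}"
 shows "\<gamma> (tr i) v = (if inverted v {i, Suc i} then tt i else \<one>[R])"
proof -
 let ?p = "{i, Suc i}"
 have p: "?p : pairs m" and ii: "i : {1..m}" "Suc i : {1..m}" using i by (auto intro: pairsI)
 have im: "inv' (tr i) ` ?p = ?p" by auto
 define f where "f q = (if inverted v q then tp q else \<one>[R])" for q
 have "\<gamma>f (tr i) v ?p = f ?p" by (simp only: \<gamma>f_def f_def im inverted_transpose[OF i p]) simp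
 then have 1: "\<gamma>f (tr i) v q = (if ?p = q then f q else \<one>[R])" if "q : pairs m" for q
  using inverted_transpose[OF i that] by (cases "?p = q") (simp_all add: \<gamma>f_def)
 have "\<gamma> (tr i) v = finprod ZR (%q. if ?p = q then f q else \<one>[ZR]) (pairs m)"
  unfolding \<gamma>_def
  by (rule ZR.finprod_cong')
   (use one_center tp_props(2) 1 in \<open>simp_all add: f_def\<close>)
 also have "... = f ?p"
  by (rule ZR.finprod_singleton) (use p one_center tp_props(2) in \<open>simp_all add: f_def\<close>)
 finally show ?thesis using tp_pair[OF ii] by (simp add: f_def)
qed

sublocale C: crossed K R \<Sigma> "tens_perm K B m" \<gamma>
proof (rule crossed.intro[OF base_field_axioms], rule crossed_axioms.intro)
 show "monoid \<Sigma>" using sym_group_is_group group.is_monoid by blast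
qed (simp_all add: sym_group_carrier sym_group_mult sym_group_one tens_perm_hom(1) perm_id perm_compose
  \<gamma>_center \<gamma>_cocycle \<gamma>_id)

lemma tr_carrier: "i : {1..<m} ==> tr i : cr \<Sigma>"
 using transpose_permutes by (simp add: sym_group_carrier)

lemma C_tr_mult:
 assumes i: "i : {1..<m}" and v: "v : cr \<Sigma>"
 shows "C.bas (tr i) \<one>[R] *[C.C] C.bas v \<one>[R] =
  C.bas (tr i \<circ> v) (if inverted v {i, Suc i} then tt i else \<one>[R])"
proof -
 have v': "v permutes {1..m}" using v by (simp add: sym_group_carrier)
 have "tt i : cr R" using i by simp
 then show ?thesis
  unfolding C.bas_mult[OF tr_carrier[OF i] v ka_closed(6)[OF Rk] ka_closed(6)[OF Rk]] \<gamma>_transpose[OF i v']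
  using ah_one[OF \<sigma>_hom[OF i]] by (simp add: sym_group_mult)
qed

text \<open>In the model a simple transposition squares to t_i, while the braid and commutation
  words pick up no cocycle factor; so the universal property of the quotient applies.\<close>

lemma crossed_map:
 obtains \<Psi> where "\<Psi> : alg_hom K Q C.C" "!!a. a : cr R ==> \<Psi> (\<kappa> a) = C.bas id a"
  "!!i. i : {1..<m} ==> \<Psi> (S' i) = C.bas (tr i) \<one>[R]"
proof -
 have id: "C.bas id : alg_hom K R C.C" using C.emb_hom by (simp add: sym_group_one)
 let ?y = "%i. C.bas (tr i) \<one>[R]"
 have y: "?y i : cr C.C" if "i : {1..<m}" for i using C.bas_closed[OF tr_carrier[OF that]] by simp
 have inv: "inverted (tr j) {i, Suc i} \<longleftrightarrow> i = j" if "i : {1..<m}" "j : {1..<m}" for i j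
 proof -
  have "{i, Suc i} : pairs m" using that by (auto intro: pairsI)
  then show ?thesis using inverted_transpose[OF that(2)] by (auto simp: doubleton_eq_iff)
 qed
 have yy: "?y i *[C.C] ?y j = C.bas (tr i \<circ> tr j) (if i = j then tt i else \<one>[R])"
  if "i : {1..<m}" "j : {1..<m}" for i j
  unfolding C_tr_mult[OF that(1) tr_carrier[OF that(2)]] inv[OF that] by simp
 have rels: "satisfies_rels C.C (C.bas id) ?y"
 proof (rule satisfies_relsI)
  show "?y i *[C.C] ?y i = C.bas id (tt i)" if "i : {1..<m}" for i using yy[OF that that] by simp
  show "?y i *[C.C] ?y (Suc i) *[C.C] ?y i = ?y (Suc i) *[C.C] ?y i *[C.C] ?y (Suc i)"
   if i: "i : {1..<m}" and j: "Suc i : {1..<m}" for i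
  proof -
   let ?j = "Suc i"
   have pp: "{i, ?j} : pairs m" "{?j, Suc ?j} : pairs m" "{Suc ?j, i} : pairs m" "{i, Suc ?j} : pairs m" using i j by (auto intro!: pairsI)
   note P = transpose_permutes[OF i] transpose_permutes[OF j]
   \<comment> \<open>No pair is crossed twice in either word of length three, so the braid words
     carry no cocycle factor.\<close>
   have n: "~ inverted (tr ?j \<circ> tr i) {i, ?j}" "~ inverted (tr i \<circ> tr ?j) {?j, Suc ?j}"
    using inverted_comp[OF P(2,1) pp(1)] inverted_comp[OF P pp(2)] inverted_transpose[OF i] inverted_transpose[OF j] pp
    by (simp_all add: doubleton_eq_iff transpose_def)
   have c: "tr ?j \<circ> tr i : cr \<Sigma>" "tr i \<circ> tr ?j : cr \<Sigma>"
    using permutes_compose[OF P] permutes_compose[OF P(2,1)] by (simp_all add: sym_group_carrier)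
   have "?y i *[C.C] ?y ?j *[C.C] ?y i = C.bas (tr i \<circ> (tr ?j \<circ> tr i)) \<one>[R]"
    using C.C_assoc[OF y[OF i] y[OF j] y[OF i]] yy[OF j i] C_tr_mult[OF i c(1)] n(1) by simp
   moreover have "?y ?j *[C.C] ?y i *[C.C] ?y ?j = C.bas (tr ?j \<circ> (tr i \<circ> tr ?j)) \<one>[R]"
    using C.C_assoc[OF y[OF j] y[OF i] y[OF j]] yy[OF i j] C_tr_mult[OF j c(2)] n(2) by simp
   moreover have "tr i \<circ> (tr ?j \<circ> tr i) = tr ?j \<circ> (tr i \<circ> tr ?j)" by (auto simp: fun_eq_iff transpose_def)
   ultimately show ?thesis by simp
  qed
  show "?y i *[C.C] ?y j = ?y j *[C.C] ?y i" if "i : {1..<m}" "j : {1..<m}" "Suc i < j" for i j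
  proof -
   have "tr i \<circ> tr j = tr j \<circ> tr i" using that(3) by (auto simp: fun_eq_iff transpose_def)
   then show ?thesis using yy[OF that(1,2)] yy[OF that(2,1)] that(3) by simp
  qed
 qed
 have yh: "?y i *[C.C] C.bas id a = C.bas id (\<sigma> i a) *[C.C] ?y i" if "i : {1..<m}" "a : cr R" for i a
  using C.bas_comm[OF tr_carrier[OF that(1)] that(2)] by (simp add: sym_group_one)
 show thesis by (rule Q_universal[OF C.crossed_kalg id y yh rels that])
qed

end

section \<open>Words in H and their reduction\<close>

context twisted
begin

abbreviation "wd == twisted_word K B J m"

lemma wd_eq: "wd ws = \<pi> (basis_elt R ws \<one>[R])" and S'_eq: "S' i = wd [i]"
 by (simp_all add: twisted_word_def)

lemma wd_closed [simp]: "ws : lists {1..<m} ==> wd ws : cr Q"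
 unfolding wd_eq by (intro \<pi>_closed W.bas_closed) (simp_all add: FM_simps)

lemma wd_Nil: "wd [] = \<one>[Q]"
 using ah_one[OF \<pi>_hom] W.crossed_simps(5) by (simp add: wd_eq FM_simps)

lemma wd_append:
 assumes u: "us : lists {1..<m}" and v: "vs : lists {1..<m}"
 shows "wd (us @ vs) = wd us *[Q] wd vs"
proof -
 have "basis_elt R us \<one>[R] *[A] basis_elt R vs \<one>[R] = basis_elt R (us @ vs) \<one>[R]"
  using W.bas_mult[of us vs "\<one>[R]" "\<one>[R]"] u v ah_one[OF act_hom[OF u]] by (simp add: FM_simps)
 then show ?thesis
  unfolding wd_eq using ah_mult[OF \<pi>_hom, of "basis_elt R us \<one>[R]" "basis_elt R vs \<one>[R]"] u v
  by (simp add: W.bas_closed FM_simps)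
qed

lemma wd_Cons: "i # ws : lists {1..<m} ==> wd (i # ws) = S' i *[Q] wd ws"
 using wd_append[of "[i]" ws] by (simp add: S'_eq)

lemma wd_\<kappa>:
 assumes w: "ws : lists {1..<m}" and a: "a : cr R"
 shows "wd ws *[Q] \<kappa> a = \<kappa> (act ws a) *[Q] wd ws" "\<pi> (basis_elt R ws a) = \<kappa> a *[Q] wd ws"
proof -
 have b: "basis_elt R ws \<one>[R] : cr A" using w by (simp add: W.bas_closed FM_simps)
 have aa: "act ws a : cr R" by (rule ah_closed[OF act_hom[OF w] a])
 have "basis_elt R ws \<one>[R] *[A] \<iota> a = \<iota> (act ws a) *[A] basis_elt R ws \<one>[R]"
  using W.bas_comm[of ws a] w a by (simp add: FM_simps)
 then show "wd ws *[Q] \<kappa> a = \<kappa> (act ws a) *[Q] wd ws"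
  unfolding wd_eq \<kappa>_eq
  by (simp only: ah_mult[OF \<pi>_hom b \<iota>_closed[OF a], symmetric] ah_mult[OF \<pi>_hom \<iota>_closed[OF aa] b, symmetric])
 have "basis_elt R ws a = \<iota> a *[A] basis_elt R ws \<one>[R]"
  using W.bas_emb[of ws a] w a by (simp add: FM_simps)
 then show "\<pi> (basis_elt R ws a) = \<kappa> a *[Q] wd ws"
  unfolding wd_eq \<kappa>_eq by (simp only: ah_mult[OF \<pi>_hom \<iota>_closed[OF a] b])
qed

lemma R_units_mult: "r : Units R ==> r' : Units R ==> r *[R] r' : Units R"
 using monoid.Units_m_closed[OF kalg_monoid[OF Rk]] by blast

lemma alg_hom_units:
 assumes h: "h : alg_hom K R R" and r: "r : Units R" shows "h r : Units R"
proof -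
 obtain s where s: "r : cr R" "s : cr R" "s *[R] r = \<one>[R]" "r *[R] s = \<one>[R]"
  using r unfolding Units_def by blast
 then have "h s *[R] h r = \<one>[R]" "h r *[R] h s = \<one>[R]"
  using ah_mult[OF h s(2,1)] ah_mult[OF h s(1,2)] ah_one[OF h] by simp_all
 then show ?thesis using ah_closed[OF h] s unfolding Units_def by blast
qed

text \<open>Cancelling a square costs the unit t_i, braid and commutation moves are exact, and a
  unit moved to the left of a word is changed by an automorphism of R. Units are recorded because
  comparing two words later inverts one of them.\<close>

lemma wd_word_red:
 assumes "word_red us vs" "us : lists {1..<m}"
 shows "EX r:Units R. wd us = \<kappa> r *[Q] wd vs"
proof -
 have U1: "\<one>[R] : Units R" by (rule monoid.Units_one_closed[OF kalg_monoid[OF Rk]])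
 have k1: "EX r:Units R. wd us = \<kappa> r *[Q] wd vs" if "wd us = wd vs" "vs : lists {1..<m}" for us vs
  using U1 ah_one[OF \<kappa>_hom] that by (intro bexI[of _ "\<one>[R]"]) simp_all
 note sr = satisfies_relsD[OF Q_rels]
 have c2: "wd [i, j] = S' i *[Q] S' j" if "i : {1..<m}" "j : {1..<m}" for i j
  using wd_Cons[of i "[j]"] that by (simp only: S'_eq lists.Cons lists.Nil)
 have c3: "wd [i, j, k] = S' i *[Q] S' j *[Q] S' k" if "i : {1..<m}" "j : {1..<m}" "k : {1..<m}" for i j k
  using wd_append[of "[i, j]" "[k]"] c2[OF that(1,2)] that by (simp add: S'_eq del: atLeastLessThan_iff)
 show ?thesis using assms
 proof (induction rule: word_red.induct)
  case (red_refl us)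
  then show ?case by (intro k1) simp
 next
  case (red_square i)
  then have i: "i : {1..<m}" and ii: "i : {1..m}" "Suc i : {1..m}" by auto
  have "tt i : Units R"
   using t_inverse[OF ii n_not_Suc_n] t_closed[OF ii] unfolding Units_def by blast
  moreover have "wd [i, i] = \<kappa> (tt i) *[Q] wd []"
   using c2[OF i i] sr(1)[OF i] \<kappa>_closed[OF tt_closed[OF i]] by (simp add: wd_Nil)
  ultimately show ?case by blast
 next
  case (red_braid i)
  then have "i : {1..<m}" "Suc i : {1..<m}" by auto
  then show ?case using c3 sr(2) by (intro k1) (simp_all del: atLeastLessThan_iff)
 next
  case (red_braid' i)
  then have "i : {1..<m}" "Suc i : {1..<m}" by auto
  then show ?case using c3 sr(2) by (intro k1) (simp_all del: atLeastLessThan_iff)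
 next
  case (red_comm i j)
  then have "i : {1..<m}" "j : {1..<m}" by auto
  then show ?case using c2 sr(3) red_comm(1) by (intro k1) (simp_all del: atLeastLessThan_iff)
 next
  case (red_append us vs us' vs')
  then have u: "us : lists {1..<m}" "us' : lists {1..<m}" by auto
  note v = word_red_lists[OF red_append(1) u(1)] word_red_lists[OF red_append(2) u(2)]
  obtain r r' where r: "r : Units R" "wd us = \<kappa> r *[Q] wd vs" "r' : Units R" "wd us' = \<kappa> r' *[Q] wd vs'"
   using red_append u by blast
  have rc: "r : cr R" "r' : cr R" using r unfolding Units_def by blast+
  have ac: "act vs r' : cr R" by (rule ah_closed[OF act_hom[OF v(1)] rc(2)])
  note kc = \<kappa>_closed[OF rc(1)] \<kappa>_closed[OF rc(2)] \<kappa>_closed[OF ac] wd_closed[OF v(1)] wd_closed[OF v(2)]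
  have "wd (us @ us') = \<kappa> r *[Q] (wd vs *[Q] \<kappa> r') *[Q] wd vs'"
   unfolding wd_append[OF u] r(2,4) using kc by (simp add: ka_assoc[OF Q])
  also have "... = \<kappa> (r *[R] act vs r') *[Q] wd (vs @ vs')"
   unfolding wd_\<kappa>(1)[OF v(1) rc(2)] wd_append[OF v] ah_mult[OF \<kappa>_hom rc(1) ac] using kc by (simp add: ka_assoc[OF Q])
  finally show ?case
   using R_units_mult[OF r(1) alg_hom_units[OF act_hom[OF v(1)] r(3)]] by blast
 next
  case (red_trans us vs ws)
  note v = word_red_lists[OF red_trans(1) red_trans.prems] and w = word_red_lists[OF red_trans(2) word_red_lists[OF red_trans(1) red_trans.prems]]
  obtain r r' where r: "r : Units R" "wd us = \<kappa> r *[Q] wd vs" "r' : Units R" "wd vs = \<kappa> r' *[Q] wd ws"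
   using red_trans v by blast
  have rc: "r : cr R" "r' : cr R" using r unfolding Units_def by blast+
  have "wd us = \<kappa> (r *[R] r') *[Q] wd ws"
   unfolding r(2,4) ah_mult[OF \<kappa>_hom rc] using \<kappa>_closed rc wd_closed[OF w] by (simp add: ka_assoc[OF Q])
  then show ?case using R_units_mult[OF r(1,3)] by blast
 qed
qed

text \<open>Both words reduce to the same canonical word, and the unit belonging to the second one
  can be divided off.\<close>

lemma wd_same_perm:
 assumes u: "us : lists {1..<m}" and v: "vs : lists {1..<m}" and e: "word_perm us = word_perm vs"
 shows "EX r:cr R. wd us = \<kappa> r *[Q] wd vs"
proof -
 \<comment> \<open>\<open>canonical_words k\<close> has letters up to k, so it is used with k = m -
   1.\<close>
 have "{1..<m} <= {1..<Suc (m - 1)}" by auto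
 from lists_mono[OF this] have u': "us : lists {1..<Suc (m - 1)}" and v': "vs : lists {1..<Suc (m - 1)}" using u v by blast+
 obtain c where c: "c : canonical_words (m - 1)" "word_red us c" using ex_canonical[OF u'] by blast
 obtain c' where c': "c' : canonical_words (m - 1)" "word_red vs c'" using ex_canonical[OF v'] by blast
 have "c' = c" using canonical_unique[OF c'(1) c(1)] word_red_sound[OF c(2)] word_red_sound[OF c'(2)] e by simp
 obtain r where r: "r : Units R" "wd us = \<kappa> r *[Q] wd c" using wd_word_red[OF c(2) u] by blast
 obtain r' where r': "r' : Units R" "wd vs = \<kappa> r' *[Q] wd c" using wd_word_red[OF c'(2) v] \<open>c' = c\<close> by blast
 obtain q where q: "q : cr R" "q *[R] r' = \<one>[R]" using r'(1) unfolding Units_def by blast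
 have rc: "r : cr R" "r' : cr R" using r r' unfolding Units_def by blast+
 note cc = wd_closed[OF word_red_lists[OF c(2) u]]
 have "\<kappa> q *[Q] wd vs = \<kappa> (q *[R] r') *[Q] wd c"
  unfolding r'(2) ah_mult[OF \<kappa>_hom q(1) rc(2)] using \<kappa>_closed q rc cc by (simp add: ka_assoc[OF Q])
 then have "wd c = \<kappa> q *[Q] wd vs" using q(2) cc ah_one[OF \<kappa>_hom] by simp
 then have "wd us = \<kappa> (r *[R] q) *[Q] wd vs"
  unfolding r(2) ah_mult[OF \<kappa>_hom rc(1) q(1)] using \<kappa>_closed q(1) rc(1) wd_closed[OF v] by (simp add: ka_assoc[OF Q])
 then show ?thesis using rc(1) q(1) by (intro bexI[of _ "r *[R] q"]) simp_all
qed

end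

section \<open>Freeness of H over R\<close>

locale twisted_red = twisted K B S J m for K :: "'k ring" and B :: "('k, 'b) bialg" and S J m +
 fixes red :: "(nat => nat) => nat list"
 assumes red: "w : cr (sym_group m) ==> reduced_word m w (red w)"
begin

abbreviation "wbar w == wd (red w)"

lemma red_word: "w : cr \<Sigma> ==> red w : lists {1..<m} & word_perm (red w) = w"
 using red unfolding reduced_word_def by blast

lemma wbar_closed [simp]: "w : cr \<Sigma> ==> wbar w : cr Q"
 using red_word by simp

lemma finite_\<Sigma>: "finite (cr \<Sigma>)"
 using finite_permutations[of "{1..m}"] by (simp add: sym_group_def)

text \<open>The candidate for the inverse of the map to the model. As a linear map it needs no
  knowledge of the products of the \<open>wbar w\<close>; surjectivity comes from the reduction of
  words, injectivity from the algebra map in the other direction.\<close>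

definition \<Phi> :: "((nat => nat) => ('k, 'b) tensor) => _" where "\<Phi> = C.flift Q (%w a. \<kappa> a *[Q] wbar w)"

lemma \<Phi>_term_lin: "w : cr \<Sigma> ==> (%a. \<kappa> a *[Q] wbar w) : module_hom K R Q"
 by (rule lin_const_left[OF Q ah_lin[OF \<kappa>_hom] wbar_closed])

lemma \<Phi>_lin: "\<Phi> : module_hom K C.C Q"
 unfolding \<Phi>_def by (rule C.flift_lin[OF Q \<Phi>_term_lin])

lemma \<Phi>_bas: "w : cr \<Sigma> ==> a : cr R ==> \<Phi> (C.bas w a) = \<kappa> a *[Q] wbar w"
 unfolding \<Phi>_def by (rule C.flift_bas[OF Q \<Phi>_term_lin])

lemma \<Phi>_sum: "f : cr C.C ==> \<Phi> f = (\<Oplus>\<^bsub>Q\<^esub>w\<in>cr \<Sigma>. \<kappa> (f w) *[Q] wbar w)"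
 unfolding \<Phi>_def by (rule C.flift_eq[OF Q \<Phi>_term_lin _ finite_\<Sigma>]) (simp_all add: C.crossed_simps)

lemma \<Phi>_surj: assumes h: "h : cr Q" shows "EX f:cr C.C. h = \<Phi> f"
proof -
 obtain x where x: "x : cr A" "h = \<pi> x" using h Q_carrier by blast
 from x(1) have "EX f:cr C.C. \<pi> x = \<Phi> f"
 proof (induction x rule: W.crossed_induct)
  case zero
  show ?case
   using lin_zero[OF ah_lin[OF \<pi>_hom] A Q] lin_zero[OF \<Phi>_lin C.crossed_kalg Q]
   by (intro bexI[of _ "\<zero>[C.C]"]) simp_all
 next
  case (bas ws a)
  then have ws: "ws : lists {1..<m}" and a: "a : cr R" by (simp_all add: FM_simps)
  have w: "word_perm ws : cr \<Sigma>" using word_perm_permutes[OF ws] by (simp add: sym_group_carrier)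
  note rw = red_word[OF w]
  obtain r where r: "r : cr R" "wd ws = \<kappa> r *[Q] wbar (word_perm ws)"
   using wd_same_perm[OF ws, of "red (word_perm ws)"] rw by auto
  have "\<pi> (basis_elt R ws a) = \<Phi> (C.bas (word_perm ws) (a *[R] r))"
   unfolding wd_\<kappa>(2)[OF ws a] r(2) \<Phi>_bas[OF w ka_closed(1)[OF Rk a r(1)]] ah_mult[OF \<kappa>_hom a r(1)]
   using \<kappa>_closed a r(1) wbar_closed[OF w] by (simp add: ka_assoc[OF Q])
  then show ?case using w a r(1) by (intro bexI[of _ "C.bas (word_perm ws) (a *[R] r)"]) simp_all
 next
  case (add x y)
  then obtain f g where fg: "f : cr C.C" "g : cr C.C" "\<pi> x = \<Phi> f" "\<pi> y = \<Phi> g" by blast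
  then show ?case
   using ah_add[OF \<pi>_hom add(1,2)] lin_add[OF \<Phi>_lin fg(1,2)]
   by (intro bexI[of _ "f +[C.C] g"]) simp_all
 qed
 then show ?thesis using x(2) by simp
qed

lemma crossed_iso:
 obtains \<Psi> where "\<Psi> : alg_hom K Q C.C" "bij_betw \<Psi> (cr Q) (cr C.C)"
  "!!f. f : cr C.C ==> \<Psi> (\<Phi> f) = f"
proof -
 obtain \<Psi> where \<Psi>: "\<Psi> : alg_hom K Q C.C" "!!a. a : cr R ==> \<Psi> (\<kappa> a) = C.bas id a"
  "!!i. i : {1..<m} ==> \<Psi> (S' i) = C.bas (tr i) \<one>[R]" using crossed_map by blast
 \<comment> \<open>Along a reduced word each new letter adds an inversion, so every cocycle factor
   in the model is 1.\<close>
 have word: "\<Psi> (wd ws) = C.bas (word_perm ws) \<one>[R]"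
  if "ws : lists {1..<m}" "length ws = card (inversions m (word_perm ws))" for ws
  using that
 proof (induction ws rule: list.induct)
  case Nil
  show ?case using ah_one[OF \<Psi>(1)] C.crossed_simps(5) by (simp add: wd_Nil sym_group_one id_def)
 next
  case (Cons i ws)
  have t: "length ws = card (inversions m (word_perm ws))" "~ inverted (word_perm ws) {i, Suc i}"
   using reduced_tail[of i ws m] Cons.prems by blast+
  have i: "i : {1..<m}" and ws: "ws : lists {1..<m}" using Cons.prems by auto
  have "word_perm ws : cr \<Sigma>" using word_perm_permutes[OF ws] by (simp add: sym_group_carrier)
  then have "C.bas (tr i) \<one>[R] *[C.C] C.bas (word_perm ws) \<one>[R] = C.bas (word_perm (i # ws)) \<one>[R]"
   using C_tr_mult[OF i] t(2) by (simp only: word_perm_simps) simp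
  then show ?case
   unfolding wd_Cons[OF Cons.prems(1)] ah_mult[OF \<Psi>(1) S'_closed[OF i] wd_closed[OF ws]] \<Psi>(3)[OF i]
    Cons.IH[OF ws t(1)] .
 qed
 have wbar: "\<Psi> (wbar w) = C.bas w \<one>[R]" if "w : cr \<Sigma>" for w
  using word[of "red w"] reduced_length[OF red[OF that]] red_word[OF that] by simp
 have inv: "\<Psi> (\<Phi> f) = f" if "f : cr C.C" for f
 proof (rule C.lin_eq_bas[OF C.crossed_kalg lin_comp[OF \<Phi>_lin ah_lin[OF \<Psi>(1)]] lin_id _ that])
  fix w a assume w: "w : cr \<Sigma>" and a: "a : cr R"
  show "\<Psi> (\<Phi> (C.bas w a)) = C.bas w a"
   unfolding \<Phi>_bas[OF w a] ah_mult[OF \<Psi>(1) \<kappa>_closed[OF a] wbar_closed[OF w]] \<Psi>(2)[OF a] wbar[OF w]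
   using C.bas_emb[OF w a] by (simp add: sym_group_one)
 qed
 have "bij_betw \<Psi> (cr Q) (cr C.C)"
  using inv \<Phi>_surj ah_closed[OF \<Psi>(1)] lin_closed[OF \<Phi>_lin]
  by (intro bij_betw_byWitness[where f' = \<Phi>]) (metis, blast+)
 with \<Psi>(1) show thesis using inv by (rule that)
qed

lemma \<Phi>_inj: "f : cr C.C ==> g : cr C.C ==> \<Phi> f = \<Phi> g ==> f = g"
 using crossed_iso by metis

lemma wbar_basis:
 assumes h: "h : cr Q"
 shows "EX! a. a : cr \<Sigma> \<rightarrow>\<^sub>E cr R & h = (\<Oplus>\<^bsub>Q\<^esub>w\<in>cr \<Sigma>. \<kappa> (a w) *[Q] wbar w)"
proof -
 interpret Q: ring Q by (rule kalg_ring[OF Q])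
 have tc: "\<kappa> (a w) *[Q] wbar w : cr Q" if "a : cr \<Sigma> \<rightarrow> cr R" "w : cr \<Sigma>" for a w
  by (rule ka_closed(1)[OF Q \<kappa>_closed[OF funcset_mem[OF that]] wbar_closed[OF that(2)]])
 \<comment> \<open>Coefficient families are extensional, hence \<open>undefined\<close> outside the
   symmetric group, whereas elements of the crossed product vanish there.\<close>
 define ext where "ext a = (%w. if w : cr \<Sigma> then a w else \<zero>[R])" for a :: "(nat => nat) => ('k, 'b) tensor"
 have ext: "ext a : cr C.C" "\<Phi> (ext a) = (\<Oplus>\<^bsub>Q\<^esub>w\<in>cr \<Sigma>. \<kappa> (a w) *[Q] wbar w)"
  if a: "a : cr \<Sigma> \<rightarrow> cr R" for a
 proof -
  have sup: "supp R (ext a) <= cr \<Sigma>" by (auto simp: supp_def ext_def)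
  show c: "ext a : cr C.C"
   unfolding C.crossed_simps using sup finite_subset[OF sup finite_\<Sigma>] a by (auto simp: ext_def)
  show "\<Phi> (ext a) = (\<Oplus>\<^bsub>Q\<^esub>w\<in>cr \<Sigma>. \<kappa> (a w) *[Q] wbar w)"
   unfolding \<Phi>_sum[OF c] by (rule Q.finsum_cong') (use a tc in \<open>simp_all add: ext_def Pi_def\<close>)
 qed
 obtain f where f: "f : cr C.C" "h = \<Phi> f" using \<Phi>_surj[OF h] by blast
 have fc: "f w : cr R" for w using f(1) by (simp add: C.crossed_simps)
 show ?thesis
 proof (rule ex1I[of _ "restrict f (cr \<Sigma>)"], rule conjI)
  show 1: "restrict f (cr \<Sigma>) : cr \<Sigma> \<rightarrow>\<^sub>E cr R" using fc by auto
  show "h = (\<Oplus>\<^bsub>Q\<^esub>w\<in>cr \<Sigma>. \<kappa> (restrict f (cr \<Sigma>) w) *[Q] wbar w)"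
   unfolding f(2) \<Phi>_sum[OF f(1)] by (rule Q.finsum_cong') (use fc tc in \<open>simp_all add: Pi_def\<close>)
  fix a assume a: "a : cr \<Sigma> \<rightarrow>\<^sub>E cr R & h = (\<Oplus>\<^bsub>Q\<^esub>w\<in>cr \<Sigma>. \<kappa> (a w) *[Q] wbar w)"
  then have a': "a : cr \<Sigma> \<rightarrow> cr R" by auto
  have "f = ext a" by (rule \<Phi>_inj[OF f(1) ext(1)[OF a']]) (use a ext(2)[OF a'] f(2) in simp)
  show "a = restrict f (cr \<Sigma>)"
  proof
   fix w
   show "a w = restrict f (cr \<Sigma>) w"
    unfolding \<open>f = ext a\<close> using PiE_arb[OF conjunct1[OF a]] by (simp add: ext_def restrict_def)
  qed
 qed
qed

text \<open>The map to the model sends the image of a to a placed at the identity permutation, from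
  which a can be read off.\<close>

lemma \<kappa>_inj: "inj_on \<kappa> (cr R)"
proof (rule inj_onI)
 obtain \<Psi> where \<Psi>: "\<Psi> : alg_hom K Q C.C" "!!a. a : cr R ==> \<Psi> (\<kappa> a) = C.bas id a" using crossed_map by blast
 fix a b assume ab: "a : cr R" "b : cr R" "\<kappa> a = \<kappa> b"
 then have "C.bas (id :: nat => nat) a = C.bas id b" using \<Psi>(2) by metis
 from fun_cong[OF this, of id] show "a = b" by (simp add: basis_elt_def)
qed

end

section \<open>The group algebra as a Hopf algebra\<close>

context base_field
begin

lemma group_crossed: "monoid G ==> crossed K (self_alg K) G (%_ a. a) (%_ _. \<one>[K])"
proof (rule crossed.intro[OF base_field_axioms], rule crossed_axioms.intro)
 show "\<one>[K] : center (self_alg K)" by (rule centerI) simp_all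
qed (simp_all add: ah_id)

context
 fixes G :: "('g, 'y) monoid_scheme" assumes G: "group G"
begin

interpretation G: group G by (rule G)
interpretation M: crossed K "self_alg K" G "%_ a. a" "%_ _. \<one>[K]" by (rule group_crossed[OF G.monoid_axioms])

abbreviation (input) "KG == monoid_alg K G"
abbreviation (input) "\<delta> g == basis_elt K g \<one>[K]"

lemma KG_eq: "KG = M.C" by (simp add: monoid_alg_def)

lemma KG [simp]: "kalg K (monoid_alg K G)" unfolding KG_eq by (rule M.crossed_kalg)

lemma delta_closed [simp]: "g : cr G ==> \<delta> g : cr KG"
 using M.bas_closed[of g "\<one>[K]"] by (simp add: KG_eq basis_elt_self)

lemma delta_mult: "g : cr G ==> h : cr G ==> \<delta> g *[KG] \<delta> h = \<delta> (g *[G] h)"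
 using M.bas_mult[of g h "\<one>[K]" "\<one>[K]"] by (simp add: KG_eq basis_elt_self)

lemma delta_one: "\<one>[KG] = \<delta> \<one>[G]"
 using M.crossed_simps(5) by (simp add: KG_eq basis_elt_self)

lemma delta_smult: "c : cr K ==> c .[KG] \<delta> g = basis_elt K g c"
 using M.bas_smult[where c = c and x = g and a = "\<one>[K]"] by (simp add: KG_eq basis_elt_self)

lemma KG_induct [consumes 1, case_names zero delta add]:
 assumes "f : cr KG" "P \<zero>[KG]"
  "!!g c. g : cr G ==> c : cr K ==> P (c .[KG] \<delta> g)"
  "!!f f'. f : cr KG ==> f' : cr KG ==> P f ==> P f' ==> P (f +[KG] f')"
 shows "P f"
 using assms(1) unfolding KG_eq
proof (induction f rule: M.crossed_induct)
 case (bas g c)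
 then show ?case using assms(3)[of g c] delta_smult[of c g] by (simp add: basis_elt_self)
qed (use assms(2,4) in \<open>simp_all add: KG_eq\<close>)

lemma KG_gens: "gens K KG ((%g. \<delta> g) ` cr G)"
proof (rule gensI)
 show "(%g. \<delta> g) ` cr G <= cr KG" by (rule image_subsetI) simp
 fix Y f
 assume Y: "(%g. \<delta> g) ` cr G <= Y" "!!a b. a : Y ==> b : Y ==> a +[KG] b : Y"
  "!!c a. c : cr K ==> a : Y ==> c .[KG] a : Y" and f: "f : cr KG"
 from f show "f : Y"
 proof (induction f rule: KG_induct)
  case zero
  have "\<zero>[K] .[KG] \<delta> \<one>[G] : Y" using Y(1) by (intro Y(3)) auto
  then show ?case by simp
 qed (use Y in auto)
qed

text \<open>The linear extension is written as a sum over the support, the form used in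
  \<open>group_bialg\<close>, so that comultiplication, counit and antipode are obtained as
  instances.\<close>

lemma KG_lift:
 assumes T: "kalg K T" and u: "!!g. g : cr G ==> u g : cr T" and "u \<one>[G] = \<one>[T]"
  and uu: "!!g h. g : cr G ==> h : cr G ==> u g *[T] u h = u (g *[G] h)"
 defines "F == %f. \<Oplus>\<^bsub>T\<^esub>g\<in>supp K f. f g .[T] u g"
 shows "F : alg_hom K KG T" "!!g. g : cr G ==> F (\<delta> g) = u g"
proof -
 interpret T: ring T by (rule kalg_ring[OF T])
 let ?F = "M.flift T (%g a. triv (%x. x) T a *[T] u g)"
 have h: "triv (%x. x) T : alg_hom K (self_alg K) T" by (rule triv_hom[OF ah_id T])
 note hl = M.lift_hom[OF T h, of u]
 have F: "?F : alg_hom K M.C T" "!!g a. g : cr G ==> a : cr (self_alg K) ==> ?F (basis_elt (self_alg K) g a) = triv (%x. x) T a *[T] u g"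
  by (rule hl; use assms in \<open>simp add: triv_def smult_one_comm[OF T]\<close>)+
 have eq: "F f = ?F f" if "f : cr KG" for f
  unfolding F_def M.flift_def supp_self
 proof (rule T.finsum_cong'[OF refl, symmetric])
  have s: "g : cr G" "f g : cr K" if "g : supp K f" for g
   using that \<open>f : cr KG\<close> unfolding KG_eq M.crossed_simps supp_self by auto
  show "triv (%x. x) T (f g) *[T] u g = f g .[T] u g" if "g : supp K f" for g
   using s[OF that] u T by (simp add: triv_def ka_smult[OF T])
  show "(%g. f g .[T] u g) : supp K f \<rightarrow> cr T" using s u T by auto
 qed
 show "F : alg_hom K KG T"
  by (rule alg_hom_cong[OF F(1)[folded KG_eq] eq[symmetric] KG])
 show "F (\<delta> g) = u g" if g: "g : cr G" for g
  unfolding eq[OF delta_closed[OF g]] using F(2)[OF g, of "\<one>[K]"] u[OF g] T by (simp add: basis_elt_self triv_def)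
qed

lemma group_bialg_make: "group_bialg K G = make_bialg KG (comult (group_bialg K G)) (counit (group_bialg K G))"
 by (simp add: group_bialg_def Let_def)

lemma group_bialg_hom:
 "comult (group_bialg K G) : alg_hom K KG (tpow KG 2)" "counit (group_bialg K G) : alg_hom K KG (self_alg K)"
 "g : cr G ==> comult (group_bialg K G) (\<delta> g) = tens_list K KG [\<delta> g, \<delta> g]"
 "g : cr G ==> counit (group_bialg K G) (\<delta> g) = \<one>[K]"
proof -
 note T2 = tensor_kalg[OF KG, of 2]
 have c: "comult (group_bialg K G) = (%f. \<Oplus>\<^bsub>tpow KG 2\<^esub>g\<in>supp K f. f g .[tpow KG 2] tens_list K KG [\<delta> g, \<delta> g])"
  by (simp add: group_bialg_def Let_def)
 show "comult (group_bialg K G) : alg_hom K KG (tpow KG 2)"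
  "g : cr G ==> comult (group_bialg K G) (\<delta> g) = tens_list K KG [\<delta> g, \<delta> g]"
  unfolding c
  by (rule KG_lift[OF T2]; simp add: tens_list2_mult[OF KG] delta_mult tens_list2_one[OF KG] delta_one)+
 have e: "f : cr KG ==> (\<Oplus>\<^bsub>self_alg K\<^esub>g\<in>supp K f. f g .[self_alg K] \<one>[K]) = counit (group_bialg K G) f" for f
  unfolding finsum_self group_bialg_def Let_def make_bialg_simps
  by (rule K.finsum_cong') (auto simp: KG_eq M.crossed_simps)
 have l: "(%f. \<Oplus>\<^bsub>self_alg K\<^esub>g\<in>supp K f. f g .[self_alg K] \<one>[K]) : alg_hom K KG (self_alg K)"
  "g : cr G ==> (\<Oplus>\<^bsub>self_alg K\<^esub>g'\<in>supp K (\<delta> g). \<delta> g g' .[self_alg K] \<one>[K]) = \<one>[K]"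
  by (rule KG_lift[OF self_kalg, of "%_. \<one>[K]"]; simp)+
 show "counit (group_bialg K G) : alg_hom K KG (self_alg K)" by (rule alg_hom_cong[OF l(1) e KG])
 show "g : cr G ==> counit (group_bialg K G) (\<delta> g) = \<one>[K]" using l(2) e[OF delta_closed] by simp
qed

lemma group_bialg_simps [simp]:
 "cr (group_bialg K G) = cr KG" "monoid.mult (group_bialg K G) = monoid.mult KG" "one (group_bialg K G) = one KG"
 "smult (group_bialg K G) = smult KG" "tensor_pow K (group_bialg K G) n = tpow KG n"
 "tens_emb K (group_bialg K G) n = tens_emb K KG n" "tens_list K (group_bialg K G) = tens_list K KG"
 "tens_map2 K (group_bialg K G) = tens_map2 K KG" "cv (group_bialg K G) = cv KG"
 "triv e' (group_bialg K G) = triv e' KG" "alg_hom K (group_bialg K G) T = alg_hom K KG T"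
 "alg_hom K T' (group_bialg K G) = alg_hom K T' KG" "gens K (group_bialg K G) Z = gens K KG Z"
 "opp (group_bialg K G) = opp KG"
 by (subst group_bialg_make, simp add: fun_eq_iff)+

lemma group_bialgebra: "bialgebra K (group_bialg K G)"
proof (rule bialgebraI_gens[OF _ _ _ KG_gens[folded group_bialg_simps(13)]])
 let ?B = "group_bialg K G"
 show k: "kalg K ?B" by (subst group_bialg_make, rule make_bialg_kalg) simp
 show d: "comult ?B : alg_hom K ?B (tpow ?B 2)" and e: "counit ?B : alg_hom K ?B (self_alg K)"
  using group_bialg_hom(1,2) by simp_all
 fix x assume "x : (%g. \<delta> g) ` cr G"
 then obtain g where g: "g : cr G" "x = \<delta> g" by blast
 then have x: "x : cr ?B" and cx: "comult ?B x = tens_list K ?B [x, x]" and ex: "counit ?B x = \<one>[K]"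
  using group_bialg_hom(3,4) by simp_all
 have xx: "tens_list K ?B [x, x] : cr (tpow ?B 2)" by (rule tens_list2_closed[OF k x x])
 note cv2 = cv_tens[OF k _ _ _ x x]
 note Dl = D_hom[OF k d e, THEN ah_lin] and k3 = tensor_kalg[OF k, of 3] and El = E3_lin[OF k]
 note Ec = El[THEN lin_closed, OF x]
 show "comult_id K ?B (comult ?B x) = id_comult K ?B (comult ?B x)"
  unfolding cx comult_id_cv[OF k d e xx] cv2[OF k3 Dl(1) El(3)] cv2[OF k3 El(1) Dl(2)]
  unfolding cx cv2[OF k3 El(1,2)] cv2[OF k3 El(2,3)] by (rule ka_assoc[OF k3 Ec])
 note tl = triv_hom[OF e k, THEN ah_lin]
 show "counit_id K ?B (comult ?B x) = x" "id_counit K ?B (comult ?B x) = x"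
  unfolding cx counit_id_cv[OF k d e xx] cv2[OF k tl lin_id] cv2[OF k lin_id tl]
  unfolding triv_def ex using k x by (simp_all only: ka_basic ka_closed)
qed

lemma group_hopf: "hopf_algebra K (group_bialg K G)"
proof -
 let ?B = "group_bialg K G" and ?u = "%g. \<delta> (inv\<^bsub>G\<^esub> g)"
 let ?S = "%f. \<Oplus>\<^bsub>opp KG\<^esub>g\<in>supp K f. f g .[opp KG] ?u g"
 have S: "?S : alg_hom K KG (opp KG)" "!!g. g : cr G ==> ?S (\<delta> g) = ?u g"
  by (rule KG_lift[OF opp_kalg[OF KG]]; simp add: delta_one delta_mult G.inv_mult_group)+
 have Sl: "?S : module_hom K KG KG" using ah_lin[OF S(1)] by (simp only: opp_lin)
 have "antipode K ?B ?S"
 proof (rule antipodeI_gens[OF group_bialgebra _ KG_gens[folded group_bialg_simps(13)]])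
  show "?S : alg_hom K ?B (opp ?B)" using S(1) by simp
  fix x assume "x : (%g. \<delta> g) ` cr G"
  then obtain g where g: "g : cr G" "x = \<delta> g" by blast
  note x = delta_closed[OF g(1)]
  have tr: "triv (counit ?B) KG (\<delta> g) = \<one>[KG]" using group_bialg_hom(4)[OF g(1)] by (simp add: triv_def)
  have "?S (\<delta> g) *[KG] \<delta> g = \<one>[KG]" "\<delta> g *[KG] ?S (\<delta> g) = \<one>[KG]"
   unfolding S(2)[OF g(1)] using g(1) by (simp_all add: delta_mult delta_one)
  then show "cv ?B ?S (%x. x) (comult ?B x) = triv (counit ?B) ?B x"
   "cv ?B (%x. x) ?S (comult ?B x) = triv (counit ?B) ?B x"
   unfolding g(2) group_bialg_hom(3)[OF g(1)] group_bialg_simps tr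
    cv_tens[OF KG KG Sl lin_id x x] cv_tens[OF KG KG lin_id Sl x x] .
 qed
 then show ?thesis using group_bialgebra unfolding hopf_algebra_def by blast
qed

end

end

section \<open>The projection of H onto the group algebra\<close>

context twisted
begin

text \<open>R is mapped by its counit. Since \<epsilon>(t_i) = 1 the twisted relations become the
  Coxeter relations, and since J is then evaluated along trivial maps the twist in \<Delta>(s_i)
  becomes 1.\<close>

lemma ex_group_map:
 "EX p. hopf_hom K H (group_bialg K \<Sigma>) p & p ` cr H = cr (group_bialg K \<Sigma>) &
  (ALL a:cr R. p (\<kappa> a) = basis_elt K id (\<epsilon>R a)) &
  (ALL i:{1..<m}. p (S' i) = basis_elt K (tr i) \<one>[K])"
proof -
 let ?T = "monoid_alg K \<Sigma>" and ?B = "group_bialg K \<Sigma>" and ?\<delta> = "%w :: nat => nat. basis_elt K w \<one>[K]"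
 have G: "group \<Sigma>" by (rule sym_group_is_group)
 note T = KG[OF G] and \<delta>c = delta_closed[OF G] and gb = group_bialg_simps[OF G]
 have dm: "?\<delta> w *[?T] ?\<delta> v = ?\<delta> (w \<circ> v)" if "w : cr \<Sigma>" "v : cr \<Sigma>" for w v
  using delta_mult[OF G that] by (simp add: sym_group_mult)
 have d1: "\<one>[?T] = ?\<delta> id" using delta_one[OF G] by (simp add: sym_group_one)
 have comp: "w \<circ> v : cr \<Sigma>" if "w : cr \<Sigma>" "v : cr \<Sigma>" for w v
  using that permutes_compose by (auto simp: sym_group_carrier)
 let ?h = "triv \<epsilon>R ?T"
 have h: "?h : alg_hom K R ?T" by (rule triv_hom[OF tcounit_hom(1)[OF bB] T])
 have eR: "\<epsilon>R a : cr K" if "a : cr R" for a using ah_closed[OF tcounit_hom(1)[OF bB] that] by simp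
 have yh: "?\<delta> (tr i) *[?T] ?h a = ?h (\<sigma> i a) *[?T] ?\<delta> (tr i)" if i: "i : {1..<m}" and a: "a : cr R" for i a
  using smult_one_comm[OF T eR[OF a] \<delta>c[OF tr_carrier[OF i]]] perm_comult(2)[OF transpose_permutes[OF i] a]
  by (simp add: triv_def)
 have rels: "satisfies_rels ?T ?h (%i. ?\<delta> (tr i))"
 proof (rule satisfies_relsI)
  show "?\<delta> (tr i) *[?T] ?\<delta> (tr i) = ?h (tt i)" if i: "i : {1..<m}" for i
   using dm[OF tr_carrier[OF i] tr_carrier[OF i]] t_counit ij[OF i] T \<delta>c[of id] by (simp add: triv_def d1 sym_group_carrier permutes_id)
  show "?\<delta> (tr i) *[?T] ?\<delta> (tr (Suc i)) *[?T] ?\<delta> (tr i) = ?\<delta> (tr (Suc i)) *[?T] ?\<delta> (tr i) *[?T] ?\<delta> (tr (Suc i))"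
   if i: "i : {1..<m}" and j: "Suc i : {1..<m}" for i
  proof -
   have "tr i \<circ> tr (Suc i) \<circ> tr i = tr (Suc i) \<circ> tr i \<circ> tr (Suc i)" by (auto simp: fun_eq_iff transpose_def)
   then show ?thesis using dm comp tr_carrier[OF i] tr_carrier[OF j] by simp
  qed
  show "?\<delta> (tr i) *[?T] ?\<delta> (tr j) = ?\<delta> (tr j) *[?T] ?\<delta> (tr i)" if "i : {1..<m}" "j : {1..<m}" "Suc i < j" for i j
  proof -
   have "tr i \<circ> tr j = tr j \<circ> tr i" using that(3) by (auto simp: fun_eq_iff transpose_def)
   then show ?thesis using dm[OF tr_carrier tr_carrier] that(1,2) by simp
  qed
 qed
 obtain p where p: "p : alg_hom K Q ?T" "!!a. a : cr R ==> p (\<kappa> a) = ?h a" "!!i. i : {1..<m} ==> p (S' i) = ?\<delta> (tr i)"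
  by (rule Q_universal[OF T h \<delta>c[OF tr_carrier] yh rels]) auto
 note pl = ah_lin[OF p(1)]
 have word: "p (wd ws) = ?\<delta> (word_perm ws)" if "ws : lists {1..<m}" for ws
  using that
 proof (induction ws rule: list.induct)
  case Nil
  show ?case by (simp add: wd_Nil ah_one[OF p(1)] d1 id_def)
 next
  case (Cons i ws)
  then have i: "i : {1..<m}" and ws: "ws : lists {1..<m}" by auto
  have "word_perm ws : cr \<Sigma>" using word_perm_permutes[OF ws] by (simp add: sym_group_carrier)
  then show ?case
   unfolding wd_Cons[OF Cons.prems] ah_mult[OF p(1) S'_closed[OF i] wd_closed[OF ws]] p(3)[OF i] Cons.IH[OF ws]
   using dm[OF tr_carrier[OF i]] by (simp only: word_perm_simps)
 qed
 have surj: "f : p ` cr Q" if "f : cr ?T" for f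
  using that
 proof (induction f rule: KG_induct[OF G, consumes 1, case_names zero delta add])
  case zero
  then show ?case using lin_zero[OF pl Q T] Q by (intro image_eqI[of _ _ "\<zero>[Q]"]) simp_all
 next
  case (delta g c)
  obtain ws where ws: "ws : lists {1..<m}" "word_perm ws = g"
   using ex_word[of g m] delta(1) by (auto simp: sym_group_carrier)
  have "p (c .[Q] wd ws) = c .[?T] ?\<delta> g"
   using ah_smult[OF p(1) delta(2) wd_closed[OF ws(1)]] word[OF ws(1)] ws(2) by simp
  then show ?case using wd_closed[OF ws(1)] delta(2) by (intro image_eqI[of _ _ "c .[Q] wd ws"]) simp_all
 next
  case (add f f')
  then obtain x x' where x: "x : cr Q" "x' : cr Q" "f = p x" "f' = p x'" by blast
  then show ?case using ah_add[OF p(1) x(1,2)] by (intro image_eqI[of _ _ "x +[Q] x'"]) simp_all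
 qed
 note Th = group_bialg_hom[OF G]
 have bh: "bialg_hom K H ?B p"
 proof (rule bialg_homI[OF H_bialgebra group_bialgebra[OF G], where X = "\<kappa> ` cr R \<union> S' ` {1..<m}"])
  show "p : alg_hom K H ?B" "gens K H (\<kappa> ` cr R \<union> S' ` {1..<m})" using p(1) Q_gens by (simp_all add: gb)
  note p2 = map2_hom(1)[OF Q T p(1) p(1)] and k2 = map2_hom(1)[OF Rk Q \<kappa>_hom \<kappa>_hom]
  have p2k: "tens_map2 K ?T p p (\<kappa>2 x) = tens_map2 K ?T ?h ?h x" if "x : cr RR" for x
  proof (rule lin_eq_tens2[OF Rk lin_comp[OF ah_lin[OF k2] ah_lin[OF p2]] map2_lin[OF Rk T ah_lin[OF h] ah_lin[OF h]] _ that])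
   fix a b assume ab: "a : cr R" "b : cr R"
   note kl = ah_lin[OF \<kappa>_hom] and hl = ah_lin[OF h]
   show "tens_map2 K ?T p p (\<kappa>2 (tens_list K R [a, b])) = tens_map2 K ?T ?h ?h (tens_list K R [a, b])"
    unfolding map2_tens[OF Rk Q kl kl ab] map2_tens[OF Q T pl pl \<kappa>_closed[OF ab(1)] \<kappa>_closed[OF ab(2)]]
     map2_tens[OF Rk T hl hl ab] p(2)[OF ab(1)] p(2)[OF ab(2)] ..
  qed
  note T2 = tensor_kalg[OF T, of 2]
  have E1: "E2 ?T i (?h a) = triv \<epsilon>R (tpow ?T 2) a" if "i : {1..2}" "a : cr R" for i a
   using tens_emb_hom[OF T, of i 2] that(1) eR[OF that(2)] T
   by (simp add: triv_def ah_smult ah_one del: atLeastAtMost_iff)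
  have h2: "triv \<epsilon>R (tpow ?T 2) : alg_hom K R (tpow ?T 2)" by (rule triv_hom[OF tcounit_hom(1)[OF bB] T2])
  note h2l = ah_lin[OF h2] and El = E2_lin[OF T]
  have tl: "triv \<epsilon>R R : module_hom K R R" by (rule ah_lin[OF triv_hom[OF tcounit_hom(1)[OF bB] Rk]])
  have ht: "triv \<epsilon>R (tpow ?T 2) (triv \<epsilon>R R a) = triv \<epsilon>R (tpow ?T 2) a" if "a : cr R" for a
   using ah_smult[OF h2 eR[OF that], of "\<one>[R]"] ah_one[OF h2] by (simp add: triv_def[of \<epsilon>R R] triv_def[of _ _ a])
  \<comment> \<open>The counit is applied in both legs of \<Delta>(a): one leg disappears by the
    counit axiom of R, and the other leaves the scalar \<epsilon>(a).\<close>
  have hh: "tens_map2 K ?T ?h ?h (\<Delta>R a) = triv \<epsilon>R (tpow ?T 2) a" if a: "a : cr R" for a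
  proof -
   note D = ah_closed[OF tcomult_hom(1)[OF bB, where m = m] a]
   have "tens_map2 K ?T ?h ?h (\<Delta>R a) = cv (tpow ?T 2) (%a. E2 ?T 1 (?h a)) (%a. E2 ?T 2 (?h a)) (\<Delta>R a)"
    by (rule map2_cv[OF Rk T ah_lin[OF h] ah_lin[OF h] D])
   also have "... = cv (tpow ?T 2) (%a. triv \<epsilon>R (tpow ?T 2) (triv \<epsilon>R R a)) (triv \<epsilon>R (tpow ?T 2)) (\<Delta>R a)"
    by (rule cv_cong[OF Rk T2 lin_comp[OF ah_lin[OF h] El(1)] lin_comp[OF ah_lin[OF h] El(2)] D]) (simp_all add: E1 ht)
   also have "... = triv \<epsilon>R (tpow ?T 2) (cv R (triv \<epsilon>R R) (%a. a) (\<Delta>R a))"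
    by (rule lin_cv[OF Rk Rk T2 h2 tl lin_id D, symmetric])
   also have "cv R (triv \<epsilon>R R) (%a. a) (\<Delta>R a) = a"
    using bialg_coassoc(2)[OF tensor_bialgebra[OF bB, of m], of a] a by simp
   finally show ?thesis .
  qed
  have hJ: "tens_map2 K ?T ?h ?h (JJ m i (Suc i)) = \<one>[tpow ?T 2]" if i: "i : {1..<m}" for i
  proof -
   have ii: "i : {1..m}" "Suc i : {1..m}" using i by auto
   have pq: "1 : {1..2::nat}" "2 : {1..2::nat}" by simp_all
   note hm = map2_hom[OF Rk T h h]
   have e: "?h (e j b) = triv (counit B) ?T b" if "j : {1..m}" "b : cr B" for j b
    using tcounit_hom(2)[OF bB that] by (simp add: triv_def)
   have Et: "E2 ?T p (triv (counit B) ?T b) = triv (counit B) (tpow ?T 2) b" if "p : {1..2}" "b : cr B" for p b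
    using tens_emb_hom[OF T, of p 2] that(1) eB[OF that(2)] T
    by (simp add: triv_def ah_smult ah_one del: atLeastAtMost_iff)
   have "tens_map2 K ?T ?h ?h (JJ m i (Suc i)) =
     cv (tpow ?T 2) (%b. tens_map2 K ?T ?h ?h (E2 R 1 (e i b))) (%b. tens_map2 K ?T ?h ?h (E2 R 2 (e (Suc i) b))) J"
    unfolding JJ_def by (rule lin_cv[OF B RRk T2 hm(1) ah_lin[OF E_hom[OF pq(1) ii(1)]] ah_lin[OF E_hom[OF pq(2) ii(2)]] J])
   also have "... = cv (tpow ?T 2) (triv (counit B) (tpow ?T 2)) (triv (counit B) (tpow ?T 2)) J"
    by (rule cv_cong[OF B T2 lin_comp[OF ah_lin[OF E_hom[OF pq(1) ii(1)]] ah_lin[OF hm(1)]]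
       lin_comp[OF ah_lin[OF E_hom[OF pq(2) ii(2)]] ah_lin[OF hm(1)]] J])
     (simp_all add: hm(2,3) e_closed[OF ii(1)] e_closed[OF ii(2)] e[OF ii(1)] e[OF ii(2)] Et)
   also have "... = \<one>[tpow ?T 2]" by (rule J_triv(1)[OF T2 triv\<epsilon>_hom[OF T2]])
   finally show ?thesis .
  qed
  fix x assume "x : \<kappa> ` cr R \<union> S' ` {1..<m}"
  then consider a where "a : cr R" "x = \<kappa> a" | i where "i : {1..<m}" "x = S' i" by blast
  then show "comult ?B (p x) = tens_map2 K ?B p p (comult H x)" "counit ?B (p x) = counit H x"
  proof (atomize (full), cases)
   case 1
   note D = ah_closed[OF tcomult_hom(1)[OF bB, where m = m] 1(1)]
   show "comult ?B (p x) = tens_map2 K ?B p p (comult H x) & counit ?B (p x) = counit H x"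
    unfolding 1(2) p(2)[OF 1(1)] gb H_values(1)[OF 1(1)] H_values(3)[OF 1(1)] p2k[OF D] hh[OF 1(1)]
    unfolding triv_def ah_smult[OF Th(1) eR[OF 1(1)] ka_closed(6)[OF T]] ah_one[OF Th(1)]
     ah_smult[OF Th(2) eR[OF 1(1)] ka_closed(6)[OF T]] ah_one[OF Th(2)]
    using eR[OF 1(1)] by simp
  next
   case 2
   note i = 2(1)
   have "tens_map2 K ?T p p (Y i) = \<one>[tpow ?T 2] *[tpow ?T 2] tens_list K ?T [?\<delta> (tr i), ?\<delta> (tr i)]"
    unfolding ah_mult[OF p2 ah_closed[OF k2 JJ_c[OF i]] tens_list2_closed[OF Q S'_closed[OF i] S'_closed[OF i]]]
     p2k[OF JJ_c[OF i]] hJ[OF i] map2_tens[OF Q T pl pl S'_closed[OF i] S'_closed[OF i]] p(3)[OF i] ..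
   also have "... = tens_list K ?T [?\<delta> (tr i), ?\<delta> (tr i)]"
    by (rule ka_basic(2)[OF T2 tens_list2_closed[OF T \<delta>c[OF tr_carrier[OF i]] \<delta>c[OF tr_carrier[OF i]]]])
   finally show "comult ?B (p x) = tens_map2 K ?B p p (comult H x) & counit ?B (p x) = counit H x"
    unfolding 2(2) p(3)[OF i] gb H_values(2)[OF i] H_values(4)[OF i] Th(3)[OF tr_carrier[OF i]] Th(4)[OF tr_carrier[OF i]]
    by simp
  qed
 qed
 have "hopf_hom K H ?B p" by (rule hopf_homI[OF bh H_hopf group_hopf[OF G]])
 moreover have "p ` cr H = cr ?B"
  using surj ah_closed[OF p(1)] gb(1) by auto
 moreover have "ALL a:cr R. p (\<kappa> a) = basis_elt K id (\<epsilon>R a)"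
  using p(2) delta_smult[OF G eR] by (simp add: triv_def d1)
 ultimately show ?thesis using p(3) by blast
qed

end

section \<open>Bases and dual functionals\<close>

lemma (in abelian_group) add_eq_add_minus:
 assumes "x : cr G" "p : cr G" "y : cr G" "q : cr G" "x \<oplus> p = y \<oplus> q"
 shows "p \<ominus> q = y \<ominus> x"
proof -
 have "p = \<ominus> x \<oplus> (y \<oplus> q)" using assms r_neg1[of x p] by simp
 then have "p \<ominus> q = \<ominus> x \<oplus> (y \<oplus> (q \<ominus> q))" using assms by (simp add: a_minus_def a_assoc)
 then show ?thesis using assms by (simp add: a_minus_def r_neg a_comm)
qed

context base_field
begin

context
 fixes V :: "('k, 'v, 'z) module_scheme" assumes V: "kalg K V"
begin

interpretation V: vectorspace K V by (rule kalg_vectorspace[OF V])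

lemma span_closed:
 assumes S: "S <= cr V"
 shows "\<zero>[V] : V.span S" "x : V.span S ==> y : V.span S ==> x +[V] y : V.span S"
  "c : cr K ==> x : V.span S ==> c .[V] x : V.span S" "x : V.span S ==> x : cr V"
 using V.span_is_submodule[OF S] V.span_is_subset2[OF S] by (auto simp: LinearCombinations.submodule_def)

lemma span_least:
 assumes x: "x : V.span S" and S: "S <= cr V" "S <= N" and N: "\<zero>[V] : N"
  "!!x y. x : cr V ==> y : cr V ==> x : N ==> y : N ==> x +[V] y : N"
  "!!c x. c : cr K ==> x : cr V ==> x : N ==> c .[V] x : N"
 shows "x : N"
proof -
 have "LinearCombinations.submodule K (cr V \<inter> N) V"
  by (rule LinearCombinations.submodule.intro[OF V.module_axioms]) (use N V in auto)
 then have "V.span S <= cr V \<inter> N" by (rule V.span_is_subset[rotated]) (use S in blast)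
 then show ?thesis using x by blast
qed

text \<open>Applying a dual functional to a vanishing combination isolates one coefficient. The
  index set may be infinite, and spanning is phrased as minimality so that it can be proved by
  closure arguments.\<close>

lemma dual_family_basis:
 assumes v: "!!i. i : I ==> v i : cr V"
  and f: "!!i. i : I ==> f i : module_hom K V (self_alg K)"
  and fv: "!!i j. i : I ==> j : I ==> f i (v j) = (if i = j then \<one>[K] else \<zero>[K])"
  and gen: "!!N x. v ` I <= N ==> \<zero>[V] : N ==> (!!x y. x : N ==> y : N ==> x +[V] y : N) ==>
   (!!c x. c : cr K ==> x : N ==> c .[V] x : N) ==> x : cr V ==> x : N"
 shows "V.basis (v ` I) & inj_on v I"
proof -
 have inj: "inj_on v I" using fv by (metis K.one_not_zero inj_onI)
 have s: "v ` I <= cr V" using v by blast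
 have "V.lin_indpt (v ` I)"
 proof
  assume "V.lin_dep (v ` I)"
  then obtain A a w where A: "finite A" "A <= v ` I" "a : A \<rightarrow> cr K" "V.lincomb a A = \<zero>[V]" "w : A" "a w ~= \<zero>[K]"
   unfolding V.lin_dep_def by blast
  then obtain i where i: "i : I" "w = v i" by blast
  have Ac: "u : cr V" "a u : cr K" if "u : A" for u using that A s by auto
  have fu: "f i u = (if w = u then \<one>[K] else \<zero>[K])" if uA: "u : A" for u
  proof -
   obtain j where "j : I" "u = v j" using subsetD[OF A(2) uA] by blast
   then show ?thesis using fv[OF i(1)] inj i by (auto dest: inj_onD)
  qed
  have "\<zero>[K] = f i (V.lincomb a A)" using lin_zero[OF f[OF i(1)] V self_kalg] A(4) by simp
  also have "... = (\<Oplus>\<^bsub>self_alg K\<^esub>u\<in>A. f i (a u .[V] u))"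
   unfolding V.lincomb_def by (rule lin_finsum[OF f[OF i(1)] V self_kalg A(1)]) (use Ac V in auto)
  also have "... = (\<Oplus>\<^bsub>K\<^esub>u\<in>A. if w = u then a u else \<zero>[K])"
   unfolding finsum_self
   by (rule K.finsum_cong') (use Ac fu lin_smult[OF f[OF i(1)]] in \<open>auto split: if_splits\<close>)
  also have "... = a w" by (rule K.finsum_singleton[OF A(5,1)]) (use Ac in auto)
  finally show False using A(6) by simp
 qed
 moreover have "x : V.span (v ` I)" if "x : cr V" for x
  by (rule gen[OF V.in_own_span[OF s] span_closed(1)[OF s] span_closed(2)[OF s] span_closed(3)[OF s] that])
 ultimately show ?thesis
  unfolding V.basis_def using s span_closed(4)[OF s] inj by blast
qed

lemma basis_dual:
 assumes \<beta>: "V.basis \<beta>" and b: "b : \<beta>"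
 shows "EX f:module_hom K V (self_alg K). ALL b':\<beta>. f b' = (if b = b' then \<one>[K] else \<zero>[K])"
proof -
 have li: "V.lin_indpt \<beta>" and sp: "V.span \<beta> = cr V" and \<beta>c: "\<beta> <= cr V" using \<beta> by (auto simp: V.basis_def)
 let ?T = "\<beta> - {b}"
 have T: "?T <= cr V" and bc: "b : cr V" using \<beta>c b by auto
 note sc = span_closed[OF T]
 have nb: "b \<notin> V.span ?T"
 proof -
  have "?T \<union> {b} = \<beta>" using b by blast
  then show ?thesis using V.lin_dep_iff_in_span[OF T V.subset_li_is_li[OF li] bc] li by auto
 qed
 \<comment> \<open>The coordinate of x at b is the c for which x - c b lies in the span of the other
   basis vectors. This describes the functional without a finite expansion of x.\<close>
 define rel where "rel x c \<longleftrightarrow> c : cr K & (EX y:V.span ?T. x = y +[V] c .[V] b)" for x c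
 have uniq: "c = d" if c: "rel x c" and d: "rel x d" for x c d
 proof (rule ccontr)
  assume ne: "c ~= d"
  obtain y z where y: "c : cr K" "y : V.span ?T" "x = y +[V] c .[V] b"
   and z: "d : cr K" "z : V.span ?T" "x = z +[V] d .[V] b" using c d unfolding rel_def by blast
  let ?e = "c \<ominus>\<^bsub>K\<^esub> d"
  have e: "?e : cr K" "?e ~= \<zero>[K]" using y(1) z(1) ne by (simp_all add: a_minus_def K.add.inv_solve_right')
  then have eU: "inv\<^bsub>K\<^esub> ?e : cr K" "inv\<^bsub>K\<^esub> ?e *[K] ?e = \<one>[K]"
   using K.field_Units K.Units_l_inv K.Units_inv_closed by auto
  have cl: "y : cr V" "z : cr V" "c .[V] b : cr V" "d .[V] b : cr V"
   using y z bc sc(4) V by auto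
  have "?e .[V] b = c .[V] b \<ominus>\<^bsub>V\<^esub> d .[V] b"
   using V.smult_l_distr[of c "\<ominus>\<^bsub>K\<^esub> d" b] V.smult_l_minus[of d b] y(1) z(1) bc by (simp add: a_minus_def)
  also have "... = z \<ominus>\<^bsub>V\<^esub> y"
   by (rule abelian_group.add_eq_add_minus[OF kalg_abelian_group[OF V]]) (use cl y(3) z(3) in simp_all)
  also have "... = z +[V] (\<ominus>\<^bsub>K\<^esub> \<one>[K]) .[V] y" using ka_minus[OF V cl(1)] by (simp add: a_minus_def)
  also have "... : V.span ?T" using y(2) z(2) by (intro sc(2,3)) simp_all
  \<comment> \<open>Two different coordinates would put b itself into the span of the other basis
    vectors.\<close>
  finally have "inv\<^bsub>K\<^esub> ?e .[V] (?e .[V] b) : V.span ?T" by (rule sc(3)[OF eU(1)])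
  then show False using nb eU e(1) bc V by (simp add: ka_smult(5)[OF V])
 qed
 have rel0: "rel x \<zero>[K]" if "x : V.span ?T" for x
  unfolding rel_def using that sc(4)[OF that] bc V by (intro conjI bexI[of _ x]) simp_all
 have rel1: "rel b \<one>[K]" unfolding rel_def using sc(1) bc V by (intro conjI bexI[of _ "\<zero>[V]"]) simp_all
 have rel_add: "rel (x +[V] x') (c +[K] c')" if xc: "rel x c" "rel x' c'" for x x' c c'
 proof -
  obtain y y' where y: "c : cr K" "y : V.span ?T" "x = y +[V] c .[V] b" "c' : cr K" "y' : V.span ?T" "x' = y' +[V] c' .[V] b"
   using xc unfolding rel_def by blast
  then show ?thesis unfolding rel_def using sc(2)[of y y'] sc(4) bc V
   by (intro conjI bexI[of _ "y +[V] y'"]) (simp_all add: ka_smult(4)[OF V] ka_simps(4-6)[OF V])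
 qed
 have rel_smult: "rel (d .[V] x) (d *[K] c)" if xc: "rel x c" and d: "d : cr K" for x c d
 proof -
  obtain y where y: "c : cr K" "y : V.span ?T" "x = y +[V] c .[V] b" using xc unfolding rel_def by blast
  then show ?thesis unfolding rel_def using sc(3)[OF d y(2)] sc(4) bc V d
   by (intro conjI bexI[of _ "d .[V] y"]) (simp_all add: ka_smult(3,5)[OF V])
 qed
 have ex: "EX c. rel x c" if "x : cr V" for x
 proof -
  have "x : {x. EX c. rel x c}"
  proof (rule span_least[OF that[folded sp] \<beta>c])
   show "\<beta> <= {x. EX c. rel x c}" using rel1 rel0 V.in_own_span[OF T] by fast
  qed (use rel0[OF sc(1)] rel_add rel_smult in blast)+
  then show ?thesis by simp
 qed
 define f where "f x = (THE c. rel x c)" for x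
 have f: "f x = c" if "rel x c" for x c unfolding f_def using that uniq by (blast intro: the_equality)
 show ?thesis
 proof (rule bexI[of _ f], rule ballI)
  show "f b' = (if b = b' then \<one>[K] else \<zero>[K])" if "b' : \<beta>" for b'
   using that f[OF rel1] f[OF rel0] V.in_own_span[OF T] by auto
  show "f : module_hom K V (self_alg K)"
  proof (rule module_homI)
   show "f x : cr (self_alg K)" if "x : cr V" for x 
   proof -
    from ex[OF that] obtain c where "rel x c" by blast
    then show ?thesis using f[of x c] by (simp add: rel_def)
   qed
   show "f (x +[V] y) = f x +[self_alg K] f y" if "x : cr V" "y : cr V" for x y
    using ex[OF that(1)] ex[OF that(2)] f rel_add by (metis self_alg_simps(5))
   show "f (c .[V] x) = c .[self_alg K] f x" if "c : cr K" "x : cr V" for c x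
    using ex[OF that(2)] f rel_smult that(1) by (metis self_alg_simps(6))
  qed
 qed
qed

end

lemma mlin_basis_closed:
 assumes A: "kalg K A" and V: "kalg K V" and \<phi>: "mlin A n V \<phi>" and \<beta>: "vectorspace.basis K A \<beta>"
  and N: "\<zero>[V] : N" "!!x y. x : N ==> y : N ==> x +[V] y : N" "!!c x. c : cr K ==> x : N ==> c .[V] x : N"
   "!!x. x : {1..n} \<rightarrow>\<^sub>E \<beta> ==> \<phi> x : N"
  and x: "x : tup A n"
 shows "\<phi> x : N"
proof -
 interpret A: vectorspace K A by (rule kalg_vectorspace[OF A])
 have sp: "A.span \<beta> = cr A" and \<beta>c: "\<beta> <= cr A" using \<beta> by (auto simp: A.basis_def)
 \<comment> \<open>Positions up to k are arbitrary and those beyond k hold basis vectors; each step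
   frees one more position by linearity.\<close>
 have "x : tup A n ==> (!!i. i : {1..n} ==> k < i ==> x i : \<beta>) ==> \<phi> x : N" for k x
 proof (induction k arbitrary: x)
  case 0
  then show ?case by (intro N(4)) (auto simp: PiE_iff)
 next
  case (Suc k)
  show ?case
  proof (cases "Suc k : {1..n}")
   case False
   then show ?thesis using Suc by (metis not_less_eq less_antisym)
  next
   case True
   note l = mlinD[OF \<phi> Suc.prems(1)]
   have "x (Suc k) : {a. \<phi> (x(Suc k := a)) : N}"
   proof (rule span_least[OF A _ \<beta>c])
    show "x (Suc k) : A.span \<beta>" unfolding sp using Suc.prems(1) True by blast
    show "\<beta> <= {a. \<phi> (x(Suc k := a)) : N}"
    proof
     fix b assume b: "b : \<beta>"
     have "\<phi> (x(Suc k := b)) : N"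
      by (rule Suc.IH[OF upd_tuple[OF Suc.prems(1) True]]) (use b \<beta>c Suc.prems(2) in auto)
     then show "b : {a. \<phi> (x(Suc k := a)) : N}" by simp
    qed
    have z: "\<phi> (x(Suc k := \<zero>[A])) = \<zero>[V]"
     using l(3)[OF True, of "\<zero>[A]" "\<zero>[K]"] mlinD(1)[OF \<phi> upd_tuple[OF Suc.prems(1) True]] A V by simp
    show "\<zero>[A] : {a. \<phi> (x(Suc k := a)) : N}" using z N(1) by simp
   qed (use l True N in simp_all)
   then show ?thesis by simp
  qed
 qed
 from this[of x n] x show ?thesis by simp
qed

lemma list_prod_zero:
 assumes A: "kalg K A" and "set xs <= cr A" "\<zero>[A] : set xs" shows "list_prod A xs = \<zero>[A]"
 using assms(2,3) by (induction xs) (use list_prod_closed[OF kalg_monoid[OF A]] A in auto)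

end

section \<open>A basis of H over K and its dimension\<close>

context twisted_red
begin

text \<open>Independence is shown by functionals: the map to the crossed product reads off the
  R-coefficient at w, and products of coordinate functionals read off the coefficient of an
  elementary tensor of basis vectors. This works in any dimension, whence the equipollence.\<close>

lemma H_basis:
 assumes \<beta>: "vectorspace.basis K B \<beta>"
 shows "EX \<eta>. vectorspace.basis K H \<eta> & \<eta> \<approx> ({1..m} \<rightarrow>\<^sub>E \<beta>) \<times> cr \<Sigma>"
proof -
 interpret B: vectorspace K B by (rule kalg_vectorspace[OF B])
 have H: "kalg K H" by (rule bialgebraD(1)[OF H_bialgebra])
 obtain \<Psi> where \<Psi>: "\<Psi> : alg_hom K Q C.C" "!!f. f : cr C.C ==> \<Psi> (\<Phi> f) = f" using crossed_iso by metis
 have \<beta>c: "\<beta> <= cr B" using \<beta> by (auto simp: B.basis_def)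
 obtain d where d: "!!b. b : \<beta> ==> d b : module_hom K B (self_alg K)"
  "!!b b'. b : \<beta> ==> b' : \<beta> ==> d b b' = (if b = b' then \<one>[K] else \<zero>[K])"
  using bchoice[of \<beta> "%b f. f : module_hom K B (self_alg K) & (ALL b':\<beta>. f b' = (if b = b' then \<one>[K] else \<zero>[K]))"]
   basis_dual[OF B \<beta>] by blast
 let ?I = "({1..m} \<rightarrow>\<^sub>E \<beta>) \<times> cr \<Sigma>"
 define v where "v = (%(x, w). \<kappa> (tens K B m x) *[Q] wbar w)"
 \<comment> \<open>The product of the coordinate functionals at the entries of x; the functional
   \<open>f\<close> below applies it to the R-coefficient at w.\<close>
 define g where "g x = thom m (self_alg K) (%i. d (x i))" for x :: "nat => 'b"
 define f where "f = (%(x, w) h. g x (\<Psi> h w))"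
 have xt: "x : tup B m" if "x : {1..m} \<rightarrow>\<^sub>E \<beta>" for x using that \<beta>c by (auto simp: PiE_iff)
 have dx: "d (x i) : module_hom K B (self_alg K)" if "x : {1..m} \<rightarrow>\<^sub>E \<beta>" "i : {1..m}" for x i
  using that d(1) by (auto simp: PiE_iff)
 have gl: "g x : module_hom K R (self_alg K)" if "x : {1..m} \<rightarrow>\<^sub>E \<beta>" for x
  unfolding g_def thom_def by (rule tens_lift_lin[OF B self_kalg thom_mlin[OF B self_kalg dx[OF that]]])
 have gt: "g x (tens K B m y) = (if x = y then \<one>[K] else \<zero>[K])" if x: "x : {1..m} \<rightarrow>\<^sub>E \<beta>" and y: "y : {1..m} \<rightarrow>\<^sub>E \<beta>" for x y
 proof -
  let ?l = "map (%i. d (x i) (y i)) [1..<Suc m]"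
  have "g x (tens K B m y) = list_prod (self_alg K) ?l"
   unfolding g_def thom_def by (rule tens_lift_tens[OF B self_kalg thom_mlin[OF B self_kalg dx[OF x]] xt[OF y]])
  then have e: "g x (tens K B m y) = list_prod K ?l" by simp
  have dd: "d (x i) (y i) = (if x i = y i then \<one>[K] else \<zero>[K])" if "i : {1..m}" for i
   using d(2) x y that by (auto simp: PiE_iff)
  show ?thesis
  proof (cases "x = y")
   case True
   have "list_prod K ?l = \<one>[K]" by (rule list_prod_one[OF K.monoid_axioms]) (use dd True in auto)
   then show ?thesis using e True by simp
  next
   case False
   then obtain i where i: "i : {1..m}" "x i ~= y i" using PiE_ext[OF x y] by blast
   have "list_prod (self_alg K) ?l = \<zero>[self_alg K]"
   proof (rule list_prod_zero[OF self_kalg])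
    show "set ?l <= cr (self_alg K)" using dd by auto
    have "d (x i) (y i) : set ?l" using i(1) by auto
    then show "\<zero>[self_alg K] : set ?l" using dd[OF i(1)] i(2) by simp
   qed
   then show ?thesis using e False by simp
  qed
 qed
 have ev: "(%h. \<Psi> h w) : module_hom K Q R" for w
 proof (rule module_homI)
  show "\<Psi> h w : cr R" if "h : cr Q" for h
   using ah_closed[OF \<Psi>(1) that] by (simp only: C.crossed_simps)
 qed (simp_all add: ah_add[OF \<Psi>(1)] ah_smult[OF \<Psi>(1)] C.crossed_simps(2,3))
 have \<Psi>v: "\<Psi> (v (x, w)) = C.bas w (tens K B m x)" if "x : tup B m" "w : cr \<Sigma>" for x w
  using \<Psi>(2)[OF C.bas_closed[OF that(2) tens_closed[OF B that(1)]]] \<Phi>_bas[OF that(2) tens_closed[OF B that(1)]]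
  by (simp add: v_def)
 have vc: "v (x, w) : cr Q" if "x : tup B m" "w : cr \<Sigma>" for x w
  using \<kappa>_closed[OF tens_closed[OF B that(1)]] wbar_closed[OF that(2)] by (simp add: v_def ka_closed(1)[OF Q])
 have basis: "vectorspace.basis K H (v ` ?I) & inj_on v ?I"
 proof (rule dual_family_basis[OF H, where I = ?I and f = f and v = v])
  fix i assume i: "i : ?I"
  obtain x w where xw: "i = (x, w)" "x : {1..m} \<rightarrow>\<^sub>E \<beta>" "w : cr \<Sigma>" using i by blast
  show "v i : cr H" using vc[OF xt[OF xw(2)] xw(3)] xw(1) by simp
  show "f i : module_hom K H (self_alg K)"
   unfolding xw(1) f_def H_simps prod.case by (rule lin_comp[OF ev gl[OF xw(2)]])
  fix j assume j: "j : ?I"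
  obtain y u where yu: "j = (y, u)" "y : {1..m} \<rightarrow>\<^sub>E \<beta>" "u : cr \<Sigma>" using j by blast
  show "f i (v j) = (if i = j then \<one>[K] else \<zero>[K])"
   unfolding xw(1) yu(1) f_def prod.case \<Psi>v[OF xt[OF yu(2)] yu(3)] basis_elt_def
   using gt[OF xw(2) yu(2)] lin_zero[OF gl[OF xw(2)] Rk self_kalg]
   by (cases "w = u"; cases "x = y") simp_all
 next
  fix N h
  assume N: "v ` ?I <= N" "\<zero>[H] : N" "!!x y. x : N ==> y : N ==> x +[H] y : N"
   "!!c x. c : cr K ==> x : N ==> c .[H] x : N" and h: "h : cr H"
  note N' = N(2-4)[unfolded H_simps]
  have T: "\<kappa> a *[Q] wbar w : N" if a: "a : cr R" and w: "w : cr \<Sigma>" for a w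
  proof -
   note tl = \<Phi>_term_lin[OF w]
   have ml: "mlin B m Q (%x. \<kappa> (tens K B m x) *[Q] wbar w)"
   proof (rule mlinI)
    fix x assume x: "x : tup B m"
    show "\<kappa> (tens K B m x) *[Q] wbar w : cr Q" by (rule lin_closed[OF tl tens_closed[OF B x]])
    note l = mlinD[OF tens_mlin[OF B, of m] x] and u = upd_tuple[OF x]
    fix i a b c assume i: "i : {1..m}" and a: "a : cr B"
    show "\<kappa> (tens K B m (x(i := a +[B] b))) *[Q] wbar w = \<kappa> (tens K B m (x(i := a))) *[Q] wbar w +[Q] \<kappa> (tens K B m (x(i := b))) *[Q] wbar w"
     if "b : cr B"
     unfolding l(2)[OF i a that] by (rule lin_add[OF tl]; rule tens_closed[OF B]; rule u[OF i]; rule a that)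
    show "\<kappa> (tens K B m (x(i := c .[B] a))) *[Q] wbar w = c .[Q] (\<kappa> (tens K B m (x(i := a))) *[Q] wbar w)"
     if "c : cr K"
     unfolding l(3)[OF i a that] by (rule lin_smult[OF tl that tens_closed[OF B u[OF i a]]])
   qed
   have bas: "\<kappa> (tens K B m x) *[Q] wbar w : N" if "x : tup B m" for x
   proof (rule mlin_basis_closed[OF B Q ml \<beta> N' _ that])
    fix x assume "x : {1..m} \<rightarrow>\<^sub>E \<beta>"
    then have "v (x, w) : N" using N(1) w by blast
    then show "\<kappa> (tens K B m x) *[Q] wbar w : N" by (simp only: v_def prod.case)
   qed
   from B a show ?thesis
   proof (induction a rule: tensor_induct_rule)
    case (tens x)
    then show ?case by (rule bas)
   next
    case (smult c a)
    then show ?case using N'(3) by (simp only: lin_smult[OF tl])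
   next
    case (add a b)
    then show ?case using N'(2) by (simp only: lin_add[OF tl])
   qed
  qed
  obtain f' where f': "f' : cr C.C" "h = \<Phi> f'" using \<Phi>_surj h by (metis H_simps(1))
  from f'(1) have "\<Phi> f' : N"
  proof (induction f' rule: C.crossed_induct)
   case zero
   then show ?case using N'(1) by (simp only: lin_zero[OF \<Phi>_lin C.crossed_kalg Q])
  next
   case (bas w a)
   then show ?case using T by (simp only: \<Phi>_bas)
  next
   case (add f f')
   then show ?case using N'(2) by (simp only: lin_add[OF \<Phi>_lin])
  qed
  then show "h : N" using f'(2) by simp
 qed
 then show ?thesis using inj_on_image_eqpoll_self by blast
qed

lemma H_dim:
 assumes "vectorspace.fin_dim K B"
 shows "vectorspace.fin_dim K H" "vectorspace.dim K H = vectorspace.dim K B ^ m * fact m"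
proof -
 interpret B: vectorspace K B by (rule kalg_vectorspace[OF B])
 interpret H: vectorspace K H by (rule kalg_vectorspace[OF bialgebraD(1)[OF H_bialgebra]])
 obtain \<beta> where \<beta>: "finite \<beta>" "B.basis \<beta>" using B.finite_basis_exists[OF assms] by blast
 obtain \<eta> where \<eta>: "H.basis \<eta>" "\<eta> \<approx> ({1..m} \<rightarrow>\<^sub>E \<beta>) \<times> cr \<Sigma>" using H_basis[OF \<beta>(2)] by blast
 have fin: "finite (({1..m} \<rightarrow>\<^sub>E \<beta>) \<times> cr \<Sigma>)" using \<beta>(1) finite_\<Sigma> by (intro finite_SigmaI finite_PiE) auto
 then have f\<eta>: "finite \<eta>" using \<eta>(2) eqpoll_finite_iff by blast
 show "vectorspace.fin_dim K H" unfolding H.fin_dim_def using f\<eta> \<eta>(1) unfolding H.basis_def by blast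
 have "card \<eta> = card (({1..m} \<rightarrow>\<^sub>E \<beta>) \<times> cr \<Sigma>)" using \<eta>(2) fin f\<eta> eqpoll_iff_card by blast
 also have "... = card \<beta> ^ m * fact m"
  using sym_group_card_carrier[of m] by (simp add: card_cartesian_product card_PiE)
 finally show "vectorspace.dim K H = vectorspace.dim K B ^ m * fact m"
  using H.dim_basis[OF f\<eta> \<eta>(1)] B.dim_basis[OF \<beta>] by simp
qed

end

section \<open>Complements of subspaces and Maschke's theorem\<close>

context base_field
begin

definition subsp :: "('k, 'v, 'z) module_scheme => 'v set => bool" where
 "subsp V L \<longleftrightarrow> L <= cr V & \<zero>[V] : L & (ALL x:L. ALL y:L. x +[V] y : L) & (ALL c:cr K. ALL x:L. c .[V] x : L)"

lemma subspD:
 assumes "subsp V L"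
 shows "x : L ==> x : cr V" "\<zero>[V] : L" "x : L ==> y : L ==> x +[V] y : L"
  "c : cr K ==> x : L ==> c .[V] x : L"
 using assms by (auto simp: subsp_def)

context
 fixes V :: "('k, 'v, 'z) module_scheme" assumes V: "kalg K V"
begin

interpretation V: abelian_group V by (rule kalg_abelian_group[OF V])

lemma subsp_minus: "subsp V L ==> x : L ==> y : L ==> x \<ominus>\<^bsub>V\<^esub> y : L"
 using subspD[of V L] ka_minus[OF V, of y] by (simp add: a_minus_def)

text \<open>Zorn's lemma gives a maximal subspace M that meets L trivially. For x outside M the
  enlarged space M + K x meets L, and solving for x puts it into L + M.\<close>

lemma ex_complement:
 assumes L: "subsp V L"
 shows "EX M. subsp V M & L \<inter> M = {\<zero>[V]} & (ALL x:cr V. EX l:L. EX n:M. x = l +[V] n)"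
proof -
 let ?P = "{M. subsp V M & L \<inter> M = {\<zero>[V]}}"
 have "EX M:?P. ALL X:?P. M <= X --> X = M"
 proof (rule subset_Zorn_nonempty)
  have "{\<zero>[V]} : ?P" using L V by (auto simp: subsp_def)
  then show "?P ~= {}" by blast
  fix \<C> assume ne: "\<C> ~= {}" and ch: "subset.chain ?P \<C>"
  then have C: "!!M. M : \<C> ==> subsp V M & L \<inter> M = {\<zero>[V]}"
   and lin: "!!M N. M : \<C> ==> N : \<C> ==> M <= N \<or> N <= M" by (auto simp: subset.chain_def)
  have Cs: "subsp V M" if "M : \<C>" for M using C[OF that] by (rule conjunct1)
  have "subsp V (\<Union>\<C>)"
   unfolding subsp_def
  proof (intro conjI ballI)
   show "\<Union>\<C> <= cr V" by (rule Union_least, rule subsetI, rule subspD(1)[OF Cs])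
   show "\<zero>[V] : \<Union>\<C>" using ne subspD(2)[OF Cs] by blast
   show "x +[V] y : \<Union>\<C>" if xy: "x : \<Union>\<C>" "y : \<Union>\<C>" for x y
   proof -
    obtain M N where "M : \<C>" "x : M" "N : \<C>" "y : N" using xy by blast
    then obtain M' where M': "M' : \<C>" "x : M'" "y : M'" using lin[of M N] by blast
    show ?thesis by (rule UnionI[OF M'(1) subspD(3)[OF Cs[OF M'(1)] M'(2,3)]])
   qed
   show "c .[V] x : \<Union>\<C>" if "c : cr K" "x : \<Union>\<C>" for c x 
   proof -
    obtain M where M: "M : \<C>" "x : M" using \<open>x : \<Union>\<C>\<close> by blast
    show ?thesis by (rule UnionI[OF M(1) subspD(4)[OF Cs[OF M(1)] \<open>c : cr K\<close> M(2)]])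
   qed
  qed
  moreover have "L \<inter> \<Union>\<C> = {\<zero>[V]}"
  proof -
   have "L \<inter> M = {\<zero>[V]}" if "M : \<C>" for M using C[OF that] by (rule conjunct2)
   then show ?thesis using ne by blast
  qed
  ultimately show "\<Union>\<C> : ?P" by simp
 qed
 then obtain M where MP: "M : ?P" and max': "ALL X:?P. M <= X --> X = M" by (rule bexE)
 from MP have M: "subsp V M" "L \<inter> M = {\<zero>[V]}" by simp_all
 have max: "X = M" if "subsp V X" "L \<inter> X = {\<zero>[V]}" "M <= X" for X
  using bspec[OF max', of X] that by simp
 note l = subspD[OF L] and n = subspD[OF M(1)]
 have "EX l:L. EX n:M. x = l +[V] n" if x: "x : cr V" for x
 proof (cases "x : M")
  case True
  then show ?thesis using l(2) x V by (intro bexI[of _ "\<zero>[V]"] bexI[of _ x]) simp_all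
 next
  case False
  define X where "X = {y +[V] c .[V] x | y c. y : M & c : cr K}"
  have XI: "y +[V] c .[V] x : X" if "y : M" "c : cr K" for y c unfolding X_def using that by blast
  have XE: "EX y c. u = y +[V] c .[V] x & y : M & c : cr K" if "u : X" for u using that unfolding X_def by blast
  have MX: "M <= X"
  proof
   fix y assume y: "y : M"
   show "y : X" using XI[OF y K.zero_closed] n(1)[OF y] x V by simp
  qed
  have Xs: "subsp V X"
   unfolding subsp_def
  proof (intro conjI ballI)
   show "X <= cr V" unfolding X_def using n(1) x V by auto
   show "\<zero>[V] : X" by (rule subsetD[OF MX n(2)])
   fix u assume "u : X"
   then obtain y c where u: "u = y +[V] c .[V] x" "y : M" "c : cr K" using XE by blast
   show "u +[V] v : X" if v': "v : X" for v
   proof -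
    obtain z d where v: "v = z +[V] d .[V] x" "z : M" "d : cr K" using XE[OF v'] by blast
    have "u +[V] v = (y +[V] z) +[V] (c +[K] d) .[V] x"
     using u v n(1) x V by (simp add: ka_smult(4)[OF V] ka_simps(4-6)[OF V])
    then show ?thesis using XI[OF n(3)[OF u(2) v(2)] K.a_closed[OF u(3) v(3)]] by simp
   qed
   show "d .[V] u : X" if d: "d : cr K" for d
   proof -
    have "d .[V] u = d .[V] y +[V] (d *[K] c) .[V] x"
     using u d n(1) x V by (simp add: ka_smult(3,5)[OF V])
    then show ?thesis using XI[OF n(4)[OF d u(2)] K.m_closed[OF d u(3)]] by simp
   qed
  qed
  have "x : X" using XI[OF n(2) K.one_closed] x V by simp
  then have "L \<inter> X ~= {\<zero>[V]}" using max[OF Xs _ MX] False by blast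
  moreover have "\<zero>[V] : L \<inter> X" using subspD(2)[OF Xs] l(2) by simp
  ultimately obtain w where "w : L" "w ~= \<zero>[V]" "w : X" by blast
  then obtain y c where w: "w : L" "w ~= \<zero>[V]" "w = y +[V] c .[V] x" "y : M" "c : cr K"
   using XE[of w] by blast
  have "c ~= \<zero>[K]"
  proof
   assume "c = \<zero>[K]"
   then have "w = y" using w(3) n(1)[OF w(4)] x V by simp
   then have "w : L \<inter> M" using w by simp
   then show False unfolding M(2) using w(2) by simp
  qed
  then have c: "inv\<^bsub>K\<^esub> c : cr K" "inv\<^bsub>K\<^esub> c *[K] c = \<one>[K]"
   using w(5) K.field_Units K.Units_l_inv K.Units_inv_closed by auto
  have "c .[V] x = \<ominus>\<^bsub>V\<^esub> y +[V] w"
   unfolding w(3) using V.r_neg1[of y "c .[V] x"] n(1)[OF w(4)] w(5) x V by simp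
  also have "... = w +[V] (\<ominus>\<^bsub>V\<^esub> y)" using l(1)[OF w(1)] n(1)[OF w(4)] V by (simp add: ka_simps(5)[OF V])
  finally have "c .[V] x = w +[V] (\<ominus>\<^bsub>V\<^esub> y)" .
  moreover have "inv\<^bsub>K\<^esub> c .[V] (c .[V] x) = x" using c w(5) x V by (simp add: ka_smult(5)[OF V])
  ultimately have "x = inv\<^bsub>K\<^esub> c .[V] w +[V] inv\<^bsub>K\<^esub> c .[V] (\<ominus>\<^bsub>V\<^esub> y)"
   using c(1) l(1)[OF w(1)] n(1)[OF w(4)] V by (metis ka_smult(3) ka_closed(5))
  moreover have "\<ominus>\<^bsub>V\<^esub> y : M" using n(4)[of "\<ominus>\<^bsub>K\<^esub> \<one>[K]"] w(4) ka_minus[OF V n(1)[OF w(4)]] by simp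
  ultimately show ?thesis using l(4)[OF c(1) w(1)] n(4)[OF c(1)] by blast
 qed
 then show ?thesis using M by (intro exI[of _ M]) simp
qed

lemma ex_projection:
 assumes L: "subsp V L"
 shows "EX p:module_hom K V V. (ALL x:cr V. p x : L) & (ALL x:L. p x = x)"
proof -
 obtain M where M: "subsp V M" "L \<inter> M = {\<zero>[V]}" "!!x. x : cr V ==> EX l:L. EX n:M. x = l +[V] n"
  using ex_complement[OF L] by blast
 note l = subspD[OF L] and n = subspD[OF M(1)]
 define rel where "rel x u \<longleftrightarrow> u : L & (EX v:M. x = u +[V] v)" for x u
 have uniq: "u' = u" if r: "rel x u" "rel x u'" for x u u'
 proof -
  obtain v v' where v: "u : L" "v : M" "x = u +[V] v" "u' : L" "v' : M" "x = u' +[V] v'"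
   using r unfolding rel_def by blast
  have "v \<ominus>\<^bsub>V\<^esub> v' = u' \<ominus>\<^bsub>V\<^esub> u" by (rule V.add_eq_add_minus) (use v l(1) n(1) in simp_all)
  then have "u' \<ominus>\<^bsub>V\<^esub> u : L \<inter> M" using subsp_minus[OF L v(4,1)] subsp_minus[OF M(1) v(2,5)] by simp
  then show ?thesis using M(2) ka_minus_eq_zero[OF V l(1)[OF v(4)] l(1)[OF v(1)]] by blast
 qed
 define p where "p x = (THE u. rel x u)" for x
 have p: "p x = u" if "rel x u" for x u unfolding p_def using that uniq by (blast intro: the_equality)
 have ex: "EX u. rel x u" if "x : cr V" for x using M(3)[OF that] unfolding rel_def by blast
 have L0: "rel x x" if "x : L" for x
  unfolding rel_def using that l(1)[OF that] n(2) V by (intro conjI bexI[of _ "\<zero>[V]"]) simp_all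
 show ?thesis
 proof (rule bexI[of _ p], intro conjI ballI)
  show pL: "p x : L" if "x : cr V" for x
  proof -
   from ex[OF that] obtain u where "rel x u" by blast
   then show ?thesis using p[of x u] by (simp add: rel_def)
  qed
  show "p x = x" if "x : L" for x by (rule p[OF L0[OF that]])
  show "p : module_hom K V V"
  proof (rule module_homI)
   show "p x : cr V" if "x : cr V" for x by (rule l(1)[OF pL[OF that]])
   fix x assume "x : cr V"
   from ex[OF this] obtain u where xu: "rel x u" by blast
   then obtain v where v: "u : L" "v : M" "x = u +[V] v" unfolding rel_def by blast
   show "p (x +[V] y) = p x +[V] p y" if "y : cr V" for y
   proof -
    from ex[OF that] obtain u' where yu: "rel y u'" by blast
    then obtain v' where v': "u' : L" "v' : M" "y = u' +[V] v'" unfolding rel_def by blast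
    have "x +[V] y = (u +[V] u') +[V] (v +[V] v')"
     using v v' l(1) n(1) V by (simp add: V.a_ac)
    then have "rel (x +[V] y) (u +[V] u')" unfolding rel_def using l(3) n(3) v v' by blast
    then show ?thesis using p xu yu by simp
   qed
   show "p (c .[V] x) = c .[V] p x" if c: "c : cr K" for c
   proof -
    have "c .[V] x = c .[V] u +[V] c .[V] v" using v l(1) n(1) c by (simp add: ka_smult(3)[OF V])
    then have "rel (c .[V] x) (c .[V] u)" unfolding rel_def using l(4)[OF c] n(4)[OF c] v by blast
    then show ?thesis using p xu by simp
   qed
  qed
 qed
qed

lemma left_ideal_subsp: assumes L: "left_ideal L V" shows "subsp V L"
proof -
 have a: "additive_subgroup L V" "!!a x. a : cr V ==> x : L ==> a *[V] x : L" using L by (auto simp: left_ideal_def)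
 have c: "x : cr V" if "x : L" for x using additive_subgroup.a_Hcarr[OF a(1) that] .
 have "c .[V] x : L" if "c : cr K" "x : L" for c x
  using a(2)[of "c .[V] \<one>[V]" x] that c V by (simp add: ka_smult(1)[OF V])
 then show ?thesis
  unfolding subsp_def using c additive_subgroup.a_closed[OF a(1)] additive_subgroup.zero_closed[OF a(1)] by blast
qed

lemma left_idealI: assumes L: "subsp V L" and m: "!!a x. a : cr V ==> x : L ==> a *[V] x : L" shows "left_ideal L V"
proof -
 note l = subspD[OF L]
 have "subgroup L (add_monoid V)"
 proof (rule V.add.subgroupI)
  show "L <= cr V" "L ~= {}" using l by blast+
  show "\<ominus>\<^bsub>V\<^esub> x : L" if "x : L" for x using ka_minus[OF V l(1)[OF that]] l(4)[OF _ that] by simp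
 qed (use l in simp)
 then show ?thesis using m by (simp add: left_ideal_def additive_subgroup_def)
qed

end

text \<open>The element \<Lambda>_1 \<otimes> S(\<Lambda>_2), called \<open>e0\<close>, satisfies (a
  \<otimes> 1) e0 = e0 (1 \<otimes> a), and its legs multiply to 1. Averaging a linear projection
  onto a left ideal over it makes the projection A-linear, and the kernel is then a complementary
  left ideal.\<close>

lemma maschke:
 fixes A :: "('k, 'a) bialg"
 assumes bA: "bialgebra K A" and S: "antipode K A S" and \<Lambda>: "\<Lambda> : cr A" "counit A \<Lambda> = \<one>[K]"
  and int: "!!a. a : cr A ==> a *[A] \<Lambda> = counit A a .[A] \<Lambda>"
 shows "semisimple A"
proof -
 note A = bialgebraD(1)[OF bA] and dA = bialg_closed[OF bA] and \<Delta>h = bialgebraD(2)[OF bA] and eA = counit_closed[OF bA]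
 note T = tensor_kalg[OF A, of 2] and Sl = antipodeD(1)[OF S]
 note So = antipode_opp[OF bA S]
 note E = E2_hom[OF A] and El = E2_lin[OF A] and Ec = E2_closed[OF A]
 let ?T = "tpow A 2"
 define e where "e = tens_map2 K A (%x. x) S"
 have el: "e : module_hom K ?T ?T" unfolding e_def by (rule map2_lin[OF A A lin_id Sl])
 have et: "e (tens_list K A [u, v]) = tens_list K A [u, S v]" if "u : cr A" "v : cr A" for u v
  unfolding e_def by (rule map2_tens[OF A A lin_id Sl that])
 have Sc: "S u : cr A" if "u : cr A" for u by (rule lin_closed[OF Sl that])
 have ES: "(%v. E2 A 2 (S v)) : module_hom K A ?T" by (rule lin_comp[OF Sl El(2)])
 have f: "(%u. E2 A 1 u *[?T] Z) : module_hom K A ?T" if "Z : cr ?T" for Z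
  by (rule lin_const_left[OF T El(1) that])
 \<comment> \<open>S reverses products, so in the second leg the factor that comes from X ends up to
   the right of \<open>e Y\<close>.\<close>
 have eX: "e (X *[?T] Y) = cv ?T (%u. E2 A 1 u *[?T] e Y) (%v. E2 A 2 (S v)) X"
  if X: "X : cr ?T" and Y: "Y : cr ?T" for X Y
 proof (rule cv_eqI[OF A T f[OF lin_closed[OF el Y]] ES _ _ X])
  show "(%X. e (X *[?T] Y)) : module_hom K ?T ?T" by (rule lin_comp[OF lin_mult_right[OF T Y] el])
  fix u v assume uv: "u : cr A" "v : cr A"
  note uvc = tens_list2_closed[OF A uv]
  have Ev: "E2 A 2 (S v) : cr ?T" by (rule Ec(2)[OF Sc[OF uv(2)]])
  show "e (tens_list K A [u, v] *[?T] Y) = E2 A 1 u *[?T] e Y *[?T] E2 A 2 (S v)"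
  proof (rule lin_eq_tens2[OF A lin_comp[OF lin_mult_left[OF T uvc] el]
     lin_const_left[OF T lin_const_right[OF T el Ec(1)[OF uv(1)]] Ev] _ Y])
   fix u' v' assume uv': "u' : cr A" "v' : cr A"
   note c = Ec(1)[OF uv(1)] Ec(1)[OF uv'(1)] Ec(2)[OF Sc[OF uv'(2)]] Ev
   have "E2 A 1 u *[?T] tens_list K A [u', S v'] *[?T] E2 A 2 (S v) =
     (E2 A 1 u *[?T] E2 A 1 u') *[?T] (E2 A 2 (S v') *[?T] E2 A 2 (S v))"
    unfolding tens_list_emb2[OF A uv'(1) Sc[OF uv'(2)]] using c T by (simp add: ka_assoc[OF T])
   also have "... = tens_list K A [u *[A] u', S v' *[A] S v]"
    unfolding ah_mult[OF E(1) uv(1) uv'(1), symmetric] ah_mult[OF E(2) Sc[OF uv'(2)] Sc[OF uv(2)], symmetric]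
    by (rule tens_list_emb2[symmetric, OF A]) (use uv uv' Sc A in simp_all)
   also have "S v' *[A] S v = S (v *[A] v')" using ah_mult[OF So uv(2) uv'(2)] by simp
   finally show "e (tens_list K A [u, v] *[?T] tens_list K A [u', v']) =
     E2 A 1 u *[?T] e (tens_list K A [u', v']) *[?T] E2 A 2 (S v)"
    unfolding tens_list2_mult[OF A uv uv'] et[OF uv'] using uv uv' A by (simp add: et)
  qed
 qed
 define e0 where "e0 = e (comult A \<Lambda>)"
 have e0c: "e0 : cr ?T" unfolding e0_def by (rule lin_closed[OF el dA[OF \<Lambda>(1)]])
 note t = triv_hom[OF bialgebraD(3)[OF bA] T] and tl = ah_lin[OF triv_hom[OF bialgebraD(3)[OF bA] T]]
 note \<Delta>l = ah_lin[OF \<Delta>h]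
 have comm: "E2 A 1 a *[?T] e0 = e0 *[?T] E2 A 2 a" if a: "a : cr A" for a
 proof -
  let ?f = "%u. E2 A 1 u *[?T] e0" and ?g = "%v. E2 A 2 (S v)" and ?t = "triv (counit A) ?T"
  have gh: "cv ?T ?g (E2 A 2) (comult A b) = ?t b" if b: "b : cr A" for b
  proof -
   have "cv ?T ?g (E2 A 2) (comult A b) = E2 A 2 (cv A S (%x. x) (comult A b))"
    by (rule lin_cv[OF A A T E(2) Sl lin_id dA[OF b], symmetric])
   also have "... = ?t b"
    unfolding antipodeD(2)[OF S b] triv_def ah_smult[OF E(2) eA[OF b] ka_closed(6)[OF A]] ah_one[OF E(2)] ..
   finally show ?thesis .
  qed
  \<comment> \<open>Here \<Delta>(b) \<Delta>(\<Lambda>) = \<epsilon>(b) \<Delta>(\<Lambda>) enters.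
    Together with \<open>gh\<close>, inserting S(a_2) a_3 in the second leg moves a from the left of
    \<open>e0\<close> to the right.\<close>
  have fg: "cv ?T ?f ?g (comult A b) = e0 *[?T] ?t b" if b: "b : cr A" for b
  proof -
   have "cv ?T ?f ?g (comult A b) = e (comult A b *[?T] comult A \<Lambda>)"
    unfolding e0_def by (rule eX[OF dA[OF b] dA[OF \<Lambda>(1)], symmetric])
   also have "comult A b *[?T] comult A \<Lambda> = counit A b .[?T] comult A \<Lambda>"
    by (simp only: ah_mult[OF \<Delta>h b \<Lambda>(1), symmetric] int[OF b] ah_smult[OF \<Delta>h eA[OF b] \<Lambda>(1)])
   also have "e (counit A b .[?T] comult A \<Lambda>) = counit A b .[?T] e0"
    unfolding e0_def by (rule lin_smult[OF el eA[OF b] dA[OF \<Lambda>(1)]])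
   also have "... = e0 *[?T] ?t b" using eA[OF b] e0c T by (simp add: triv_def ka_smult[OF T])
   finally show ?thesis .
  qed
  have et: "(%b. e0 *[?T] ?t b) : module_hom K A ?T" by (rule lin_const_right[OF T tl e0c])
  have "?f a = cv ?T ?f ?t (comult A a)" by (rule convolution_counit(2)[OF bA T f[OF e0c] a, symmetric])
  also have "... = cv ?T ?f (%b. cv ?T ?g (E2 A 2) (comult A b)) (comult A a)"
   by (rule cv_cong[OF A T f[OF e0c] tl dA[OF a] refl gh[symmetric]])
  also have "... = cv ?T (%b. cv ?T ?f ?g (comult A b)) (E2 A 2) (comult A a)"
   by (rule convolution_assoc[OF bA T f[OF e0c] ES El(2) a, symmetric])
  also have "... = cv ?T (%b. e0 *[?T] ?t b) (E2 A 2) (comult A a)"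
   by (rule cv_cong[OF A T et El(2) dA[OF a] fg[symmetric] refl, symmetric])
  also have "... = e0 *[?T] cv ?T ?t (E2 A 2) (comult A a)"
   by (rule cv_eqI[OF A T et El(2) lin_const_right[OF T cv_lin[OF A T tl El(2)] e0c] _ dA[OF a], symmetric])
    (use e0c T in \<open>simp add: cv_tens[OF A T tl El(2)] lin_closed[OF tl] Ec(2) ka_assoc[OF T]\<close>)
  also have "... = e0 *[?T] E2 A 2 a" by (simp only: convolution_counit(1)[OF bA T El(2) a])
  finally show ?thesis .
 qed
 have e0_mult: "cv A (%x. x) (%x. x) e0 = \<one>[A]"
 proof -
  have "cv A (%x. x) (%x. x) e0 = cv A (%x. x) S (comult A \<Lambda>)"
   unfolding e0_def e_def by (rule cv_map2[OF A A lin_id Sl A lin_id lin_id dA[OF \<Lambda>(1)]])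
  also have "... = \<one>[A]" using antipodeD(3)[OF S \<Lambda>(1)] \<Lambda>(2) A by (simp add: triv_def)
  finally show ?thesis .
 qed
 show ?thesis
  unfolding semisimple_def
 proof (intro conjI allI impI)
  show "ring A" by (rule kalg_ring[OF A])
  fix L assume L: "left_ideal L A"
  have Ls: "subsp A L" by (rule left_ideal_subsp[OF A L])
  note l = subspD[OF Ls]
  have lm: "a *[A] x : L" if "a : cr A" "x : L" for a x using L that by (simp add: left_ideal_def)
  obtain p where p: "p : module_hom K A A" "!!x. x : cr A ==> p x : L" "!!x. x : L ==> p x = x"
   using ex_projection[OF A Ls] by blast
  note pc = lin_closed[OF p(1)]
  define F where "F x = cv A (%u. u) (%v. p (v *[A] x))" for x
  have pl: "(%v. p (v *[A] x)) : module_hom K A A" if "x : cr A" for x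
   by (rule lin_comp[OF lin_mult_right[OF A that] p(1)])
  have Fl: "F x : module_hom K ?T A" if "x : cr A" for x unfolding F_def by (rule cv_lin[OF A A lin_id pl[OF that]])
  have Ft: "F x (tens_list K A [u, v]) = u *[A] p (v *[A] x)" if "x : cr A" "u : cr A" "v : cr A" for x u v
   unfolding F_def by (rule cv_tens[OF A A lin_id pl[OF that(1)] that(2,3)])
  \<comment> \<open>The sum of \<Lambda>_1 p(S(\<Lambda>_2) x), which is the averaged
    projection.\<close>
  define q where "q x = F x e0" for x
  have qc: "q x : cr A" if "x : cr A" for x unfolding q_def by (rule lin_closed[OF Fl[OF that] e0c])
  have qL: "q x : L" if x: "x : cr A" for x
  proof -
   have "F x Z : L" if "Z : cr ?T" for Z
    using A that
   proof (induction Z rule: tensor2_induct)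
    case (tens a b)
    then show ?case using x A by (simp add: Ft lm p(2))
   next
    case (smult c Z)
    then show ?case by (simp add: lin_smult[OF Fl[OF x]] l(4))
   next
    case (add Z Z')
    then show ?case by (simp add: lin_add[OF Fl[OF x]] l(3))
   qed
   then show ?thesis unfolding q_def using e0c .
  qed
  have qid: "q x = x" if x: "x : L" for x
  proof -
   note xc = l(1)[OF x]
   note ml = cv_lin[OF A A lin_id lin_id]
   have "q x = cv A (%x. x) (%x. x) e0 *[A] x"
    unfolding q_def
   proof (rule lin_eq_tens2[OF A Fl[OF xc] lin_const_left[OF A ml xc] _ e0c])
    fix u v assume uv: "u : cr A" "v : cr A"
    show "F x (tens_list K A [u, v]) = cv A (%x. x) (%x. x) (tens_list K A [u, v]) *[A] x"
     unfolding Ft[OF xc uv] cv_tens[OF A A lin_id lin_id uv] p(3)[OF lm[OF uv(2) x]]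
     by (rule ka_assoc[OF A uv xc, symmetric])
   qed
   then show ?thesis using e0_mult xc A by simp
  qed
  have qm: "q (a *[A] x) = a *[A] q x" if a: "a : cr A" and x: "x : cr A" for a x
  proof -
   note ax = ka_closed(1)[OF A a x]
   have 1: "F x (Z *[?T] E2 A 2 a) = F (a *[A] x) Z" if "Z : cr ?T" for Z
   proof (rule lin_eq_tens2[OF A lin_comp[OF lin_mult_right[OF T Ec(2)[OF a]] Fl[OF x]] Fl[OF ax] _ that])
    fix u v assume uv: "u : cr A" "v : cr A"
    have "tens_list K A [u, v] *[?T] E2 A 2 a = tens_list K A [u, v *[A] a]"
     unfolding tens_list_emb2[OF A uv] tens_list_emb2[OF A uv(1) ka_closed(1)[OF A uv(2) a]] ah_mult[OF E(2) uv(2) a]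
     by (rule ka_assoc[OF T Ec(1)[OF uv(1)] Ec(2)[OF uv(2)] Ec(2)[OF a]])
    then show "F x (tens_list K A [u, v] *[?T] E2 A 2 a) = F (a *[A] x) (tens_list K A [u, v])"
     using uv a x A by (simp add: Ft ka_assoc[OF A])
   qed
   have 2: "F x (E2 A 1 a *[?T] Z) = a *[A] F x Z" if "Z : cr ?T" for Z
   proof (rule lin_eq_tens2[OF A lin_comp[OF lin_mult_left[OF T Ec(1)[OF a]] Fl[OF x]] lin_const_right[OF A Fl[OF x] a] _ that])
    fix u v assume uv: "u : cr A" "v : cr A"
    have "E2 A 1 a *[?T] tens_list K A [u, v] = tens_list K A [a *[A] u, v]"
     unfolding tens_list_emb2[OF A uv] tens_list_emb2[OF A ka_closed(1)[OF A a uv(1)] uv(2)] ah_mult[OF E(1) a uv(1)]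
     by (rule ka_assoc[OF T Ec(1)[OF a] Ec(1)[OF uv(1)] Ec(2)[OF uv(2)], symmetric])
    then show "F x (E2 A 1 a *[?T] tens_list K A [u, v]) = a *[A] F x (tens_list K A [u, v])"
     using uv a x A pc by (simp add: Ft ka_assoc[OF A])
   qed
   show ?thesis unfolding q_def using 1[OF e0c] 2[OF e0c] comm[OF a] by simp
  qed
  have qadd: "q (x +[A] y) = q x +[A] q y" if x: "x : cr A" and y: "y : cr A" for x y
   unfolding q_def
  proof (rule lin_eq_tens2[OF A Fl[OF ka_closed(2)[OF A x y]] lin_add_maps[OF T A Fl[OF x] Fl[OF y]] _ e0c])
   fix u v assume uv: "u : cr A" "v : cr A"
   show "F (x +[A] y) (tens_list K A [u, v]) = F x (tens_list K A [u, v]) +[A] F y (tens_list K A [u, v])"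
    using uv x y A pc by (simp add: Ft ka_simps(3)[OF A] lin_add[OF p(1)])
  qed
  have qs: "q (c .[A] x) = c .[A] q x" if "c : cr K" "x : cr A" for c x
   using qm[of "c .[A] \<one>[A]" x] that qc A by (simp add: ka_smult(1)[OF A])
  have ql: "q : module_hom K A A" by (rule module_homI) (use qc qadd qs in auto)
  note q0 = lin_zero[OF ql A A]
  let ?L' = "{x : cr A. q x = \<zero>[A]}"
  have "subsp A ?L'"
   unfolding subsp_def using q0 qadd qs A by auto
  then have L': "left_ideal ?L' A"
   by (rule left_idealI[OF A]) (use qm A in auto)
  show "EX L'. left_ideal L' A & L \<inter> L' = {\<zero>[A]} & L <+>\<^bsub>A\<^esub> L' = cr A"
  proof (intro exI conjI)
   show "left_ideal ?L' A" by (rule L')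
   show "L \<inter> ?L' = {\<zero>[A]}" using qid l(2) q0 A by auto
   show "L <+>\<^bsub>A\<^esub> ?L' = cr A"
   proof (rule equalityI; rule subsetI)
    show "x : cr A" if "x : L <+>\<^bsub>A\<^esub> ?L'" for x using that l(1) A by (auto simp: set_add_def set_mult_def)
    fix x assume x: "x : cr A"
    have "q (x \<ominus>\<^bsub>A\<^esub> q x) = q x \<ominus>\<^bsub>A\<^esub> q (q x)" by (rule lin_minus[OF ql A A x qc[OF x]])
    also have "... = \<zero>[A]" using qid[OF qL[OF x]] ka_minus_eq_zero[OF A] qc[OF x] by simp
    finally have "x \<ominus>\<^bsub>A\<^esub> q x : ?L'" using x qc[OF x] A by simp
    moreover have "x = q x +[A] (x \<ominus>\<^bsub>A\<^esub> q x)"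
    proof -
     interpret A: abelian_group A by (rule kalg_abelian_group[OF A])
     show ?thesis using x qc[OF x] by (simp add: a_minus_def A.a_lcomm A.r_neg)
    qed
    ultimately show "x : L <+>\<^bsub>A\<^esub> ?L'" unfolding set_add_def set_mult_def using qL[OF x] by force
   qed
  qed
 qed
qed

end

section \<open>Integrals of semisimple bialgebras\<close>

context base_field
begin

lemma semisimple_complement:
 assumes "semisimple A" "left_ideal L A"
 obtains L' where "left_ideal L' A" "L \<inter> L' = {\<zero>[A]}" "!!x. x : cr A ==> EX l:L. EX l':L'. x = l +[A] l'"
proof -
 obtain L' where L': "left_ideal L' A" "L \<inter> L' = {\<zero>[A]}" "L <+>\<^bsub>A\<^esub> L' = cr A"
  using assms unfolding semisimple_def by blast
 have "EX l:L. EX l':L'. x = l +[A] l'" if "x : cr A" for x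
 proof -
  have "x : L <+>\<^bsub>A\<^esub> L'" using that L'(3) by simp
  then show ?thesis unfolding set_add_def set_mult_def by auto
 qed
 with L' show thesis using that by blast
qed

text \<open>A left integral of counit \<open>1\<close> is also a right integral: otherwise some \<open>x = \<theta>b - \<epsilon>(b)\<theta>\<close> would be a
  nonzero left integral with \<open>\<epsilon>(x) = 0\<close>, and \<open>Kx\<close> would be a left ideal of square zero.\<close>

lemma semisimple_integral:
 assumes bA: "bialgebra K A" and ss: "semisimple A"
 obtains \<theta> where "\<theta> : cr A" "counit A \<theta> = \<one>[K]"
  "!!b. b : cr A ==> b *[A] \<theta> = counit A b .[A] \<theta>"
  "!!b. b : cr A ==> \<theta> *[A] b = counit A b .[A] \<theta>"
proof -
 note A = bialgebraD(1)[OF bA] and \<epsilon> = bialgebraD(3)[OF bA] and e = counit_closed[OF bA]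
 note \<epsilon>l = ah_lin[OF \<epsilon>]
 have em: "counit A (a *[A] b) = counit A a *[K] counit A b" if "a : cr A" "b : cr A" for a b
  using ah_mult[OF \<epsilon> that] by simp
 have es: "counit A (c .[A] b) = c *[K] counit A b" if "c : cr K" "b : cr A" for b c
  using ah_smult[OF \<epsilon> that] by simp
 have ea: "counit A (a +[A] b) = counit A a +[K] counit A b" if "a : cr A" "b : cr A" for a b
  using ah_add[OF \<epsilon> that] by simp
 have ez: "counit A \<zero>[A] = \<zero>[K]" using lin_zero[OF \<epsilon>l A self_kalg] by simp
 have eo: "counit A \<one>[A] = \<one>[K]" using ah_one[OF \<epsilon>] by simp
 have en: "counit A (a \<ominus>\<^bsub>A\<^esub> b) = \<zero>[K]" if "a : cr A" "b : cr A" "counit A a = counit A b" for a b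
  using lin_minus[OF \<epsilon>l A self_kalg that(1,2)] that ka_minus_eq_zero[OF self_kalg, of "counit A a" "counit A b"] e by simp
 \<comment> \<open>The kernel of the counit; the component of 1 in a complementary left ideal will
   be the integral.\<close>
 let ?L = "{x : cr A. counit A x = \<zero>[K]}"
 have "subsp A ?L" unfolding subsp_def using ez ea es A by auto
 then have "left_ideal ?L A" by (rule left_idealI[OF A]) (use em e A in auto)
 from semisimple_complement[OF ss this] obtain L' where L': "left_ideal L' A" "?L \<inter> L' = {\<zero>[A]}"
  and dec: "!!x. x : cr A ==> EX l:?L. EX l':L'. x = l +[A] l'" by blast
 note s' = left_ideal_subsp[OF A L'(1)]
 note l' = subspD[OF s']
 have lm: "a *[A] x : L'" if "a : cr A" "x : L'" for a x using L'(1) that by (simp add: left_ideal_def)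
 obtain l0 \<theta> where one: "l0 : ?L" "\<theta> : L'" "\<one>[A] = l0 +[A] \<theta>" using dec[OF ka_closed(6)[OF A]] by blast
 have lc: "\<theta> : cr A" by (rule l'(1)[OF one(2)])
 have l1: "counit A \<theta> = \<one>[K]" using eo ea[of l0 \<theta>] one lc e[OF lc] by simp
 have left: "b *[A] \<theta> = counit A b .[A] \<theta>" if b: "b : cr A" for b
 proof -
  note c = ka_closed(1)[OF A b lc] ka_closed(4)[OF A e[OF b] lc]
  \<comment> \<open>The difference lies in the complement, a left ideal, and in the kernel of the
    counit, hence is 0.\<close>
  have "b *[A] \<theta> \<ominus>\<^bsub>A\<^esub> counit A b .[A] \<theta> : L'"
   by (rule subsp_minus[OF A s' lm[OF b one(2)] l'(4)[OF e[OF b] one(2)]])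
  moreover have "counit A (b *[A] \<theta> \<ominus>\<^bsub>A\<^esub> counit A b .[A] \<theta>) = \<zero>[K]"
   by (rule en[OF c]) (simp add: em es b lc l1 e)
  ultimately have "b *[A] \<theta> \<ominus>\<^bsub>A\<^esub> counit A b .[A] \<theta> : ?L \<inter> L'" using c A by simp
  then show ?thesis unfolding L'(2) using ka_minus_eq_zero[OF A c] by simp
 qed
 have right: "\<theta> *[A] b = counit A b .[A] \<theta>" if b: "b : cr A" for b
 proof -
  note c = ka_closed(1)[OF A lc b] ka_closed(4)[OF A e[OF b] lc]
  define x where "x = \<theta> *[A] b \<ominus>\<^bsub>A\<^esub> counit A b .[A] \<theta>"
  have xc: "x : cr A" using c A by (simp add: x_def)
  have x0: "counit A x = \<zero>[K]" unfolding x_def by (rule en[OF c]) (simp add: em es b lc l1 e)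
  have ax: "a *[A] x = counit A a .[A] x" if a: "a : cr A" for a
  proof -
   note la = lin_mult_left[OF A a]
   have "a *[A] x = a *[A] (\<theta> *[A] b) \<ominus>\<^bsub>A\<^esub> a *[A] (counit A b .[A] \<theta>)"
    unfolding x_def by (rule lin_minus[OF la A A c])
   also have "a *[A] (\<theta> *[A] b) = counit A a .[A] (\<theta> *[A] b)"
    using a b lc e A left[OF a] by (simp add: ka_smult(1)[OF A] flip: ka_assoc[OF A])
   also have "a *[A] (counit A b .[A] \<theta>) = counit A a .[A] (counit A b .[A] \<theta>)"
    using a b lc e A left[OF a] by (simp add: ka_smult(2,5)[OF A] K.m_comm)
   also have "counit A a .[A] (\<theta> *[A] b) \<ominus>\<^bsub>A\<^esub> counit A a .[A] (counit A b .[A] \<theta>) = counit A a .[A] x"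
   proof -
    have "(%y. counit A a .[A] y) : module_hom K A A"
     by (rule module_homI) (use e[OF a] A in \<open>simp_all add: ka_smult[OF A] K.m_comm\<close>)
    from lin_minus[OF this A A c] show ?thesis unfolding x_def by simp
   qed
   finally show ?thesis .
  qed
  define X where "X = {c .[A] x | c. c : cr K}"
  have XI: "c .[A] x : X" if "c : cr K" for c unfolding X_def using that by blast
  have XE: "EX c. u = c .[A] x & c : cr K" if "u : X" for u using that unfolding X_def by blast
  have Xs: "subsp A X"
   unfolding subsp_def
  proof (intro conjI ballI)
   show "X <= cr A" unfolding X_def using xc A by auto
   show "\<zero>[A] : X" using XI[OF K.zero_closed] xc A by simp
   fix u assume "u : X"
   then obtain c where u: "u = c .[A] x" "c : cr K" using XE by blast
   show "u +[A] v : X" if v': "v : X" for v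
   proof -
    obtain d where v: "v = d .[A] x" "d : cr K" using XE[OF v'] by blast
    show ?thesis using XI[OF K.a_closed[OF u(2) v(2)]] u v xc by (simp add: ka_smult(4)[OF A])
   qed
   show "d .[A] u : X" if d: "d : cr K" for d
    using XI[OF K.m_closed[OF d u(2)]] u d xc by (simp add: ka_smult(5)[OF A])
  qed
  have "left_ideal X A"
  proof (rule left_idealI[OF A Xs])
   fix a u assume a: "a : cr A" and "u : X"
   then obtain c where u: "u = c .[A] x" "c : cr K" using XE by blast
   show "a *[A] u : X"
    using XI[OF K.m_closed[OF u(2) e[OF a]]] u a xc ax[OF a] e by (simp add: ka_smult(2,5)[OF A])
  qed
  from semisimple_complement[OF ss this] obtain M where M: "left_ideal M A" "X \<inter> M = {\<zero>[A]}"
   and dec: "!!x'. x' : cr A ==> EX l:X. EX l':M. x' = l +[A] l'" by blast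
  obtain k y where y: "k : cr K" "y : M" "\<one>[A] = k .[A] x +[A] y" using dec[OF ka_closed(6)[OF A]] XE by blast
  have yc: "y : cr A" by (rule subspD(1)[OF left_ideal_subsp[OF A M(1)] y(2)])
  \<comment> \<open>Multiplying 1 = k x + y by x from the left kills the first term, since x^2 =
    \<epsilon>(x) x = 0. So x lies in M as well as in X.\<close>
  have "x = x *[A] (k .[A] x +[A] y)" unfolding y(3)[symmetric] using xc A by simp
  also have "... = x *[A] y"
   using xc yc y(1) A ax[OF xc] x0 by (simp add: ka_simps(3)[OF A] ka_smult(2)[OF A])
  also have "... : M" using M(1) xc y(2) by (simp add: left_ideal_def)
  finally have "x : M" .
  moreover have "x : X" using XI[OF K.one_closed] xc A by simp
  ultimately have "x : X \<inter> M" by simp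
  then have "x = \<zero>[A]" unfolding M(2) by simp
  then show ?thesis unfolding x_def using ka_minus_eq_zero[OF A c] by simp
 qed
 show thesis by (rule that[OF lc l1 left right])
qed

end

section \<open>The integral and the semisimplicity of H\<close>

context twisted_red
begin

context
 fixes \<theta> assumes l0: "\<theta> : cr B" "counit B \<theta> = \<one>[K]"
  and left: "!!b. b : cr B ==> b *[B] \<theta> = counit B b .[B] \<theta>"
  and right: "!!b. b : cr B ==> \<theta> *[B] b = counit B b .[B] \<theta>"
begin

abbreviation (input) "\<theta>m == \<lambda>i\<in>{1..m}. \<theta>"
definition "\<Lambda>0 = tens K B m (\<lambda>i\<in>{1..m}. \<theta>)"

lemma \<theta>m_tup: "\<theta>m : tup B m" using l0 by auto

lemma \<Lambda>0_closed: "\<Lambda>0 : cr R" unfolding \<Lambda>0_def by (rule tens_closed[OF B \<theta>m_tup])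

lemma \<epsilon>R_closed: "a : cr R ==> \<epsilon>R a : cr K"
 using ah_closed[OF tcounit_hom(1)[OF bB]] by simp

lemma \<Lambda>0_counit: "\<epsilon>R \<Lambda>0 = \<one>[K]"
proof -
 note h = tcounit_hom(1)[OF bB, of m]
 have c: "set (map (%i. e i (\<theta>m i)) [1..<Suc m]) <= cr R" using e_closed l0 by auto
 have "\<epsilon>R \<Lambda>0 = list_prod (self_alg K) (map \<epsilon>R (map (%i. e i (\<theta>m i)) [1..<Suc m]))"
  unfolding \<Lambda>0_def tens_prod[OF B \<theta>m_tup] by (rule alg_hom_list_prod[OF h Rk c])
 also have "... = list_prod K (map (%i. \<epsilon>R (e i (\<theta>m i))) [1..<Suc m])" by (simp add: comp_def)
 also have "... = \<one>[K]"
  by (rule list_prod_one[OF K.monoid_axioms]) (use l0 tcounit_hom(2)[OF bB] in auto)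
 finally show ?thesis .
qed

lemma emb_\<Lambda>0:
 assumes i: "i : {1..m}" and b: "b : cr B"
 shows "e i b *[R] \<Lambda>0 = counit B b .[R] \<Lambda>0" "\<Lambda>0 *[R] e i b = counit B b .[R] \<Lambda>0"
proof -
 \<comment> \<open>The constant tuple is written as an update at i, so that multilinearity in
   position i applies.\<close>
 have u: "\<theta>m(i := \<theta>) = \<theta>m" using i by auto
 have s: "tens K B m (\<theta>m(i := counit B b .[B] \<theta>)) = counit B b .[R] \<Lambda>0"
  unfolding mlinD(3)[OF tens_mlin[OF B] \<theta>m_tup i l0(1) eB[OF b]] u \<Lambda>0_def ..
 have "(\<lambda>j\<in>{1..m}. (\<lambda>j\<in>{1..m}. if j = i then b else \<one>[B]) j *[B] \<theta>m j) = \<theta>m(i := counit B b .[B] \<theta>)"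
  using left[OF b] i l0 by (auto simp: fun_eq_iff)
 then show "e i b *[R] \<Lambda>0 = counit B b .[R] \<Lambda>0"
  unfolding \<Lambda>0_def tens_emb_def tens_mult[OF B emb_tup[OF B b] \<theta>m_tup] using s \<Lambda>0_def by simp
 have "(\<lambda>j\<in>{1..m}. \<theta>m j *[B] (\<lambda>j\<in>{1..m}. if j = i then b else \<one>[B]) j) = \<theta>m(i := counit B b .[B] \<theta>)"
  using right[OF b] i l0 by (auto simp: fun_eq_iff)
 then show "\<Lambda>0 *[R] e i b = counit B b .[R] \<Lambda>0"
  unfolding \<Lambda>0_def tens_emb_def tens_mult[OF B \<theta>m_tup emb_tup[OF B b]] using s \<Lambda>0_def by simp
qed

lemma \<Lambda>0_integral:
 assumes "h : cr R"
 shows "h *[R] \<Lambda>0 = \<epsilon>R h .[R] \<Lambda>0 & \<Lambda>0 *[R] h = \<epsilon>R h .[R] \<Lambda>0"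
 using tensor_gens[OF B, of m] assms
proof (induction h rule: gens_induct)
 note eh = tcounit_hom(1)[OF bB, of m] and L = \<Lambda>0_closed
 {
  case (gen h)
  then obtain i b where ib: "h = e i b" "i : {1..m}" "b : cr B" by blast
  show ?case unfolding ib(1) tcounit_hom(2)[OF bB ib(2,3)] by (intro conjI emb_\<Lambda>0[OF ib(2,3)])
 next
  case one
  show ?case unfolding ah_one[OF eh] by (simp only: self_alg_simps ka_basic(1,2,7)[OF Rk L])
 next
  case (add a b)
  then show ?case using ah_add[OF eh add(1,2)] L \<epsilon>R_closed by (simp add: ka_simps(2,3)[OF Rk] ka_smult(4)[OF Rk])
 next
  case (mult a b)
  note c = \<epsilon>R_closed[OF mult(1)] \<epsilon>R_closed[OF mult(2)]
  have "a *[R] b *[R] \<Lambda>0 = a *[R] (b *[R] \<Lambda>0)" by (rule ka_assoc[OF Rk mult(1,2) L])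
  also have "... = (\<epsilon>R b *[K] \<epsilon>R a) .[R] \<Lambda>0" using mult c L by (simp add: ka_smult(2,5)[OF Rk])
  finally have 1: "a *[R] b *[R] \<Lambda>0 = (\<epsilon>R b *[K] \<epsilon>R a) .[R] \<Lambda>0" .
  have "\<Lambda>0 *[R] (a *[R] b) = \<Lambda>0 *[R] a *[R] b" by (rule ka_assoc[OF Rk L mult(1,2), symmetric])
  also have "... = (\<epsilon>R a *[K] \<epsilon>R b) .[R] \<Lambda>0" using mult c L by (simp add: ka_smult(1,5)[OF Rk])
  finally show ?case using 1 ah_mult[OF eh mult(1,2)] c K.m_comm by simp
 next
  case (smult c a)
  then show ?case using ah_smult[OF eh smult(1,2)] L \<epsilon>R_closed by (simp add: ka_smult(1,2,5)[OF Rk])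
 }
qed simp

lemma \<Lambda>0_perm: "w permutes {1..m} ==> tens_perm K B m w \<Lambda>0 = \<Lambda>0"
proof -
 assume w: "w permutes {1..m}"
 have "inv' w i : {1..m}" if "i : {1..m}" for i
  using permutes_in_image[OF permutes_inv[OF w]] that by blast
 then have "(\<lambda>i\<in>{1..m}. \<theta>m (inv' w i)) = \<theta>m" by (auto simp: fun_eq_iff)
 then show ?thesis unfolding \<Lambda>0_def tens_perm_hom(3)[OF B w \<theta>m_tup] by simp
qed

lemma R_integral: "integral (tensor_bialg K B m) \<Lambda>0"
proof -
 have "\<Lambda>0 ~= \<zero>[R]"
  using \<Lambda>0_counit lin_zero[OF ah_lin[OF tcounit_hom(1)[OF bB]] Rk self_kalg, of m] by auto
 then show ?thesis using \<Lambda>0_closed \<Lambda>0_integral by (simp add: integral_def)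
qed

text \<open>\<open>\<Lambda>0\<close> is a two-sided integral of counit 1, so L =
  \<epsilon>(\<Lambda>0) L = \<Lambda>0 L = \<epsilon>(L) \<Lambda>0.\<close>

lemma R_integral_unique:
 assumes L: "integral (tensor_bialg K B m) L"
 shows "EX c:cr K. c ~= \<zero>[K] & L = c .[R] \<Lambda>0"
proof -
 have l: "L : cr R" "L ~= \<zero>[R]" "!!h. h : cr R ==> h *[R] L = \<epsilon>R h .[R] L"
  using L by (simp_all add: integral_def)
 have "L = \<epsilon>R L .[R] \<Lambda>0"
  using l(3)[OF \<Lambda>0_closed] \<Lambda>0_integral[OF l(1)] \<Lambda>0_counit l(1) by simp
 moreover have "\<epsilon>R L ~= \<zero>[K]"
 proof
  assume z: "\<epsilon>R L = \<zero>[K]"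
  have "L = \<zero>[R]" using \<open>L = \<epsilon>R L .[R] \<Lambda>0\<close> unfolding z using \<Lambda>0_closed by simp
  then show False using l(2) by blast
 qed
 ultimately show ?thesis using \<epsilon>R_closed[OF l(1)] by blast
qed

lemma counit_wd: "ws : lists {1..<m} ==> counit H (wd ws) = \<one>[K]"
proof (induction ws rule: list.induct)
 case Nil
 show ?case using ah_one[OF bialgebraD(3)[OF H_bialgebra]] by (simp add: wd_Nil)
next
 case (Cons i ws)
 then have i: "i : {1..<m}" and ws: "ws : lists {1..<m}" by auto
 have "counit H : alg_hom K Q (self_alg K)" using bialgebraD(3)[OF H_bialgebra] by simp
 from ah_mult[OF this S'_closed[OF i] wd_closed[OF ws]] show ?case
  unfolding wd_Cons[OF Cons.prems] H_values(4)[OF i] Cons.IH[OF ws] by simp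
qed

abbreviation (input) "\<Lambda>H == \<kappa> \<Lambda>0 *[Q] (\<Oplus>\<^bsub>Q\<^esub>w\<in>cr \<Sigma>. wbar w)"

text \<open>\<open>\<Lambda>0\<close> absorbs elements of R through their counit and is fixed by
  permutations, so a generator of H merely permutes the terms of the sum. Each of the m! terms has
  counit 1.\<close>

lemma \<Lambda>H:
 shows "\<Lambda>H : cr Q" "!!h. h : cr Q ==> h *[Q] \<Lambda>H = counit H h .[Q] \<Lambda>H"
  "counit H \<Lambda>H = [(fact m :: nat)] \<cdot>\<^bsub>K\<^esub> \<one>[K]"
proof -
 interpret Q: ring Q by (rule kalg_ring[OF Q])
 have ch: "counit H : alg_hom K Q (self_alg K)" using bialgebraD(3)[OF H_bialgebra] by simp
 have cc: "counit H h : cr K" if "h : cr Q" for h using ah_closed[OF ch that] by simp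
 note L = \<Lambda>0_closed and kL = \<kappa>_closed[OF \<Lambda>0_closed]
 define P where "P w = \<kappa> \<Lambda>0 *[Q] wbar w" for w
 have Pc: "P w : cr Q" if "w : cr \<Sigma>" for w unfolding P_def using kL wbar_closed[OF that] by simp
 have wc: "wbar : cr \<Sigma> \<rightarrow> cr Q" using wbar_closed by blast
 have Lsum: "\<Lambda>H = (\<Oplus>\<^bsub>Q\<^esub>w\<in>cr \<Sigma>. P w)"
  unfolding P_def by (rule Q.finsum_rdistr[OF finite_\<Sigma> kL wc])
 show c: "\<Lambda>H : cr Q" by (rule Q.m_closed[OF kL Q.finsum_closed[OF wc]])
 have S'P: "S' i *[Q] P w = P (tr i \<circ> w)" if i: "i : {1..<m}" and w: "w : cr \<Sigma>" for i w
 proof -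
  have v: "tr i \<circ> w : cr \<Sigma>"
   using permutes_compose[of w "{1..m}" "tr i"] transpose_permutes[OF i] w by (simp add: sym_group_carrier)
  note rw = red_word[OF w] and rv = red_word[OF v]
  have iw: "i # red w : lists {1..<m}" using i rw by simp
  have e: "word_perm (i # red w) = word_perm (red (tr i \<circ> w))" using rw rv by (simp only: word_perm_simps)
  obtain r where r: "r : cr R" "wd (i # red w) = \<kappa> r *[Q] wbar (tr i \<circ> w)"
   using wd_same_perm[OF iw conjunct1[OF rv] e] by blast
  \<comment> \<open>The factor r between the two words is not known explicitly, but all words have
    counit 1. Hence so has r, and the integral absorbs it.\<close>
  have "\<one>[K] = counit H (\<kappa> r *[Q] wbar (tr i \<circ> w))" using counit_wd[OF iw] r(2) by simp
  also have "... = \<epsilon>R r"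
   using ah_mult[OF ch \<kappa>_closed[OF r(1)] wbar_closed[OF v]] counit_wd[OF conjunct1[OF rv]] \<epsilon>R_closed[OF r(1)]
   by (simp add: H_values(3)[OF r(1)])
  finally have er: "\<epsilon>R r = \<one>[K]" by simp
  have "S' i *[Q] P w = (S' i *[Q] \<kappa> \<Lambda>0) *[Q] wbar w"
   unfolding P_def by (rule Q.m_assoc[OF S'_closed[OF i] kL wbar_closed[OF w], symmetric])
  also have "... = \<kappa> \<Lambda>0 *[Q] wd (i # red w)"
   unfolding S'_\<kappa>[OF i L] \<Lambda>0_perm[OF transpose_permutes[OF i]] wd_Cons[OF iw]
   by (rule Q.m_assoc[OF kL S'_closed[OF i] wbar_closed[OF w]])
  also have "... = \<kappa> (\<Lambda>0 *[R] r) *[Q] wbar (tr i \<circ> w)"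
   unfolding r(2) ah_mult[OF \<kappa>_hom L r(1)] by (rule Q.m_assoc[OF kL \<kappa>_closed[OF r(1)] wbar_closed[OF v], symmetric])
  also have "\<Lambda>0 *[R] r = \<Lambda>0" using \<Lambda>0_integral[OF r(1)] er L by simp
  finally show ?thesis unfolding P_def .
 qed
 show int: "h *[Q] \<Lambda>H = counit H h .[Q] \<Lambda>H" if h: "h : cr Q" for h
  using Q_gens h
 proof (induction h rule: gens_induct)
  {
   case (gen h)
   then consider a where "a : cr R" "h = \<kappa> a" | i where "i : {1..<m}" "h = S' i" by blast
   then show ?case
   proof cases
    case 1
    note sc = Q.finsum_closed[OF wc]
    have "\<kappa> a *[Q] \<Lambda>H = \<kappa> (a *[R] \<Lambda>0) *[Q] (\<Oplus>\<^bsub>Q\<^esub>w\<in>cr \<Sigma>. wbar w)"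
     unfolding ah_mult[OF \<kappa>_hom 1(1) L] by (rule Q.m_assoc[OF \<kappa>_closed[OF 1(1)] kL sc, symmetric])
    also have "... = \<epsilon>R a .[Q] \<Lambda>H"
     unfolding conjunct1[OF \<Lambda>0_integral[OF 1(1)]] ah_smult[OF \<kappa>_hom \<epsilon>R_closed[OF 1(1)] L]
     by (rule ka_smult(1)[OF Q \<epsilon>R_closed[OF 1(1)] kL sc])
    finally show ?thesis unfolding 1(2) H_values(3)[OF 1(1)] .
   next
    case 2
    have cl: "tr i \<circ> w : cr \<Sigma>" if "w : cr \<Sigma>" for w
     using permutes_compose[of w "{1..m}" "tr i"] transpose_permutes[OF 2(1)] that by (simp add: sym_group_carrier)
    have inv: "tr i \<circ> (tr i \<circ> w) = w" for w :: "nat => nat" by (simp add: fun_eq_iff)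
    have tc: "(%w. tr i \<circ> w) ` cr \<Sigma> = cr \<Sigma>"
    proof (rule equalityI; rule subsetI)
     show "w : cr \<Sigma>" if "w : (%w. tr i \<circ> w) ` cr \<Sigma>" for w using that cl by blast
     show "w : (%w. tr i \<circ> w) ` cr \<Sigma>" if "w : cr \<Sigma>" for w
      by (rule image_eqI[where f = "%w. tr i \<circ> w" and x = "tr i \<circ> w"]) (simp_all only: inv cl[OF that])
    qed
    have "S' i *[Q] \<Lambda>H = (\<Oplus>\<^bsub>Q\<^esub>w\<in>cr \<Sigma>. S' i *[Q] P w)"
     unfolding Lsum by (rule Q.finsum_rdistr[OF finite_\<Sigma> S'_closed[OF 2(1)]]) (use Pc in blast)
    also have "... = (\<Oplus>\<^bsub>Q\<^esub>w\<in>cr \<Sigma>. P (tr i \<circ> w))"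
     by (rule Q.finsum_cong') (use S'P[OF 2(1)] Pc cl in blast)+
    also have "... = (\<Oplus>\<^bsub>Q\<^esub>w\<in>(%w. tr i \<circ> w) ` cr \<Sigma>. P w)"
     by (rule Q.finsum_reindex[symmetric]) (use Pc tc inv in \<open>blast, metis inj_onI\<close>)
    finally show ?thesis unfolding 2(2) H_values(4)[OF 2(1)] tc Lsum[symmetric] by (simp only: ka_basic(7)[OF Q c])
   qed
  next
   case one
   show ?case using ah_one[OF ch] c by simp
  next
   case (add a b)
   have "counit H (a +[Q] b) = counit H a +[K] counit H b" using ah_add[OF ch add(1,2)] by simp
   then show ?case
    unfolding ka_simps(2)[OF Q add(1,2) c] add(3,4)
    by (simp only: ka_smult(4)[OF Q cc[OF add(1)] cc[OF add(2)] c])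
  next
   case (mult a b)
   note k = cc[OF mult(1)] cc[OF mult(2)]
   have "a *[Q] b *[Q] \<Lambda>H = a *[Q] (counit H b .[Q] \<Lambda>H)"
    unfolding mult(4)[symmetric] by (rule ka_assoc[OF Q mult(1,2) c])
   also have "... = (counit H b *[K] counit H a) .[Q] \<Lambda>H"
    unfolding ka_smult(2)[OF Q k(2) mult(1) c] mult(3) by (rule ka_smult(5)[OF Q k(2,1) c])
   finally show ?case using ah_mult[OF ch mult(1,2)] k K.m_comm by simp
  next
   case (smult d a)
   have "d .[Q] a *[Q] \<Lambda>H = d .[Q] (counit H a .[Q] \<Lambda>H)"
    unfolding smult(3)[symmetric] by (rule ka_smult(1)[OF Q smult(1,2) c])
   also have "... = (d *[K] counit H a) .[Q] \<Lambda>H" by (rule ka_smult(5)[OF Q smult(1) cc[OF smult(2)] c])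
   finally show ?case using ah_smult[OF ch smult(1,2)] by simp
  }
 qed simp
 have "counit H \<Lambda>H = (\<Oplus>\<^bsub>K\<^esub>w\<in>cr \<Sigma>. counit H (P w))"
  unfolding Lsum using lin_finsum[OF ah_lin[OF ch] Q self_kalg finite_\<Sigma>, of P] Pc by (simp add: finsum_self)
 also have "... = (\<Oplus>\<^bsub>K\<^esub>w\<in>cr \<Sigma>. \<one>[K])"
 proof (rule K.finsum_cong')
  fix w assume w: "w : cr \<Sigma>"
  show "counit H (P w) = \<one>[K]"
   unfolding P_def using ah_mult[OF ch kL wbar_closed[OF w]] counit_wd[OF conjunct1[OF red_word[OF w]]] \<Lambda>0_counit
   by (simp add: H_values(3)[OF L])
 qed auto
 also have "... = [(card (cr \<Sigma>))] \<cdot>\<^bsub>K\<^esub> \<one>[K]"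
  using K.add.finprod_const[of "\<one>[K]" "cr \<Sigma>"] by (simp add: finsum_def add_pow_def)
 finally show "counit H \<Lambda>H = [(fact m :: nat)] \<cdot>\<^bsub>K\<^esub> \<one>[K]" by (simp add: sym_group_card_carrier)
qed

text \<open>The counit of the integral is m!, which is nonzero in K. Dividing by it gives the
  normalization required by \<open>maschke\<close>; it also shows that the integral does not vanish.
  An arbitrary integral of R is a nonzero multiple of \<open>\<Lambda>0\<close>.\<close>

lemma H_integral:
 assumes char: "[(fact m :: nat)] \<cdot>\<^bsub>K\<^esub> \<one>[K] ~= \<zero>[K]"
 shows "semisimple H" "integral (tensor_bialg K B m) L ==> integral H (\<kappa> L *[Q] (\<Oplus>\<^bsub>Q\<^esub>w\<in>cr \<Sigma>. wbar w))"
proof -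
 let ?n = "[(fact m :: nat)] \<cdot>\<^bsub>K\<^esub> \<one>[K]"
 have ch: "counit H : alg_hom K Q (self_alg K)" using bialgebraD(3)[OF H_bialgebra] by simp
 have cc: "counit H h : cr K" if "h : cr Q" for h using ah_closed[OF ch that] by simp
 have scaled: "c .[Q] \<Lambda>H : cr Q" "h : cr Q ==> h *[Q] (c .[Q] \<Lambda>H) = counit H h .[Q] (c .[Q] \<Lambda>H)"
  "counit H (c .[Q] \<Lambda>H) = c *[K] ?n" if c: "c : cr K" for c h
 proof -
  show "c .[Q] \<Lambda>H : cr Q" by (rule ka_closed(4)[OF Q c \<Lambda>H(1)])
  show "counit H (c .[Q] \<Lambda>H) = c *[K] ?n" using ah_smult[OF ch c \<Lambda>H(1)] by (simp add: \<Lambda>H(3))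
  assume h: "h : cr Q"
  have "h *[Q] (c .[Q] \<Lambda>H) = c .[Q] (counit H h .[Q] \<Lambda>H)"
   unfolding ka_smult(2)[OF Q c h \<Lambda>H(1)] \<Lambda>H(2)[OF h] ..
  also have "... = counit H h .[Q] (c .[Q] \<Lambda>H)"
   unfolding ka_smult(5)[OF Q c cc[OF h] \<Lambda>H(1)] ka_smult(5)[OF Q cc[OF h] c \<Lambda>H(1)] K.m_comm[OF c cc[OF h]] ..
  finally show "h *[Q] (c .[Q] \<Lambda>H) = counit H h .[Q] (c .[Q] \<Lambda>H)" .
 qed
 have n: "?n : cr K" by simp
 have iK: "inv\<^bsub>K\<^esub> ?n : cr K" "inv\<^bsub>K\<^esub> ?n *[K] ?n = \<one>[K]"
  using n char K.field_Units K.Units_l_inv K.Units_inv_closed by auto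
 obtain SH where SH: "antipode K H SH" using H_antipode by blast
 show "semisimple H"
  by (rule maschke[OF H_bialgebra SH, of "inv\<^bsub>K\<^esub> ?n .[Q] \<Lambda>H"]) (use scaled[OF iK(1)] iK(2) in simp_all)
 assume L: "integral (tensor_bialg K B m) L"
 obtain c where c: "c : cr K" "c ~= \<zero>[K]" "L = c .[R] \<Lambda>0" using R_integral_unique[OF L] by blast
 have "(\<Oplus>\<^bsub>Q\<^esub>w\<in>cr \<Sigma>. wbar w) : cr Q"
 proof -
  interpret Q: ring Q by (rule kalg_ring[OF Q])
  show ?thesis by (rule Q.finsum_closed) (use wbar_closed in blast)
 qed
 then have e: "\<kappa> L *[Q] (\<Oplus>\<^bsub>Q\<^esub>w\<in>cr \<Sigma>. wbar w) = c .[Q] \<Lambda>H"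
  unfolding c(3) ah_smult[OF \<kappa>_hom c(1) \<Lambda>0_closed] by (rule ka_smult(1)[OF Q c(1) \<kappa>_closed[OF \<Lambda>0_closed]])
 have "c .[Q] \<Lambda>H ~= \<zero>[Q]"
 proof
  assume "c .[Q] \<Lambda>H = \<zero>[Q]"
  then have "c *[K] ?n = \<zero>[K]"
   using scaled(3)[OF c(1)] lin_zero[OF ah_lin[OF ch] Q self_kalg] by simp
  then show False using K.integral[OF _ c(1) n] c(2) char by blast
 qed
 then show "integral H (\<kappa> L *[Q] (\<Oplus>\<^bsub>Q\<^esub>w\<in>cr \<Sigma>. wbar w))"
  unfolding integral_def e H_simps using scaled(1,2)[OF c(1)] by blast
qed

end

text \<open>Semisimplicity of B enters through its normalized two-sided integral. Existence of an
  integral of R is part of the claim, so that the assertion about all of them is not empty.\<close>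

lemma H_semisimple:
 assumes ss: "semisimple B" and char: "[(fact m :: nat)] \<cdot>\<^bsub>K\<^esub> \<one>[K] ~= \<zero>[K]"
 shows "semisimple H & (EX L. integral (tensor_bialg K B m) L) &
  (ALL L. integral (tensor_bialg K B m) L --> integral H (\<kappa> L *[Q] (\<Oplus>\<^bsub>Q\<^esub>w\<in>cr \<Sigma>. wbar w)))"
proof -
 show ?thesis
 proof (rule semisimple_integral[OF bB ss])
  fix \<theta> assume l: "\<theta> : cr B" "counit B \<theta> = \<one>[K]"
   "!!b. b : cr B ==> b *[B] \<theta> = counit B b .[B] \<theta>"
   "!!b. b : cr B ==> \<theta> *[B] b = counit B b .[B] \<theta>"
  show ?thesis
   by (intro conjI allI impI H_integral(1)[OF l char] exI[of "%L. integral (tensor_bialg K B m) L", OF R_integral[OF l]] H_integral(2)[OF l char])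
 qed
qed

end

section \<open>The cocycle and the isomorphism in the terms of the statement\<close>

lemma center_make_bialg: "Units (make_bialg A d e\<lparr>carrier := center (make_bialg A d e)\<rparr>) = Units (A\<lparr>carrier := center A\<rparr>)"
 by (simp add: Units_def center_def make_bialg_def)

lemma list_prod_make_bialg: "list_prod (make_bialg A d e) = list_prod A"
 by (simp add: list_prod_def fun_eq_iff make_bialg_def)

context twisted_red
begin

lemma two_cocycle_\<gamma>: "two_cocycle K B m \<gamma>"
 unfolding two_cocycle_def Let_def tensor_bialg_eq center_make_bialg
 using \<gamma>_unit \<gamma>_cocycle \<gamma>_id by (simp add: sym_group_carrier)

lemma crossed_product_iso:
 "EX \<gamma>. two_cocycle K B m \<gamma> &
  (EX \<phi>:alg_hom K H (crossed_alg (tensor_bialg K B m) (sym_group m) (tens_perm K B m) \<gamma>).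
   bij_betw \<phi> (cr H) (cr (crossed_alg (tensor_bialg K B m) (sym_group m) (tens_perm K B m) \<gamma>)) &
   (ALL a:cr (tensor_bialg K B m). ALL w:cr \<Sigma>. \<phi> (\<kappa> a *[H] wbar w) = basis_elt (tensor_bialg K B m) w a)) &
  (ALL w:cr \<Sigma>. ALL v:cr \<Sigma>. EX us.
   set us <= {tens_perm K B m u (emb_twist_mult K B m J i (Suc i)) | u i. u : cr \<Sigma> & i : {1..<m}} &
   \<gamma> w v = list_prod (tensor_bialg K B m) us) &
  (ALL w:cr \<Sigma>. ALL v:cr \<Sigma>. counit (tensor_bialg K B m) (\<gamma> w v) = \<one>[K])"
proof (intro exI[of _ \<gamma>] conjI ballI two_cocycle_\<gamma>)
 obtain \<Psi> where \<Psi>: "\<Psi> : alg_hom K Q C.C" "bij_betw \<Psi> (cr Q) (cr C.C)" "!!f. f : cr C.C ==> \<Psi> (\<Phi> f) = f"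
  using crossed_iso by metis
 have "\<Psi> (\<kappa> a *[Q] wbar w) = C.bas w a" if "a : cr R" "w : cr \<Sigma>" for a w
  using \<Psi>(3)[OF C.bas_closed[OF that(2,1)]] \<Phi>_bas[OF that(2,1)] by simp
 then show "EX \<phi>:alg_hom K H (crossed_alg (tensor_bialg K B m) (sym_group m) (tens_perm K B m) \<gamma>).
   bij_betw \<phi> (cr H) (cr (crossed_alg (tensor_bialg K B m) (sym_group m) (tens_perm K B m) \<gamma>)) &
   (ALL a:cr (tensor_bialg K B m). ALL w:cr \<Sigma>. \<phi> (\<kappa> a *[H] wbar w) = basis_elt (tensor_bialg K B m) w a)"
  using \<Psi>(1,2) by (intro bexI[of _ \<Psi>]) simp_all
 fix w v
 have e: "emb_twist_mult K B m J i (Suc i) = tt i" if "i : {1..<m}" for i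
  by (rule emb_twist_mult_eq) (use that in auto)
 have sub: "{tens_perm K B m u (tt i) | u i. u : cr \<Sigma> & i : {1..<m}} <=
   {tens_perm K B m u (emb_twist_mult K B m J i (Suc i)) | u i. u : cr \<Sigma> & i : {1..<m}}" (is "?Y <= ?X")
 proof (rule subsetI)
  fix x assume "x : ?Y"
  then obtain u i where x: "x = tens_perm K B m u (tt i)" "u : cr \<Sigma>" "i : {1..<m}"
   unfolding mem_Collect_eq by (elim exE conjE) (rule that)
  show "x : ?X"
   unfolding mem_Collect_eq x(1) e[OF x(3), symmetric] by (intro exI[of _ u] exI[of _ i] conjI refl x(2,3))
 qed
 from \<gamma>_list_simple[of w v] obtain us where us: "set us <= ?Y & \<gamma> w v = list_prod R us" by (rule exE)
 show "EX us. set us <= ?X & \<gamma> w v = list_prod (tensor_bialg K B m) us"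
  unfolding tensor_bialg_eq list_prod_make_bialg
  by (rule exI[of _ us], rule conjI[OF subset_trans[OF conjunct1[OF us] sub] conjunct2[OF us]])
 show "counit (tensor_bialg K B m) (\<gamma> w v) = \<one>[K]" using \<gamma>_counit by simp
qed

end

theorem theorem6:
  fixes K :: "'k ring" and B :: "('k, 'b) bialg" and S :: "'b \<Rightarrow> 'b"
    and J :: "('k, 'b) tensor" and m :: nat and red :: "(nat \<Rightarrow> nat) \<Rightarrow> nat list"
  defines "R \<equiv> tensor_bialg K B m"
    and "H \<equiv> twisted_hopf K B J m"
    and "\<iota> \<equiv> twisted_incl K B J m"
    and "\<Sigma> \<equiv> carrier (sym_group m)"
    and "wbar \<equiv> (\<lambda>w. twisted_word K B J m (red w))"
    and "BB \<equiv> tensor_pow K B 2"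
    and "B4 \<equiv> tensor_pow K (tensor_pow K B 2) 2"
  assumes field: "field K"
    and char_zero: "\<And>n::nat. n > 0 \<Longrightarrow> [n] \<cdot>\<^bsub>K\<^esub> \<one>\<^bsub>K\<^esub> \<noteq> \<zero>\<^bsub>K\<^esub>"
    and hopf: "bialgebra K B" "antipode K B S"
    and twist: "twist K B J"
    and central: "J \<in> center BB"
    and hyp_i: "twist K (tensor_bialg K B 2) (emb_twist K B 2 J 1 2)"
    and hyp_ii: "comult (tensor_bialg K B 2) J =
      emb_twist K B 2 J 1 2 \<otimes>\<^bsub>B4\<^esub> emb_twist K B 2 J 2 1 \<otimes>\<^bsub>B4\<^esub> tens_list K BB [J, J]"
    and hyp_iii: "tens_map2 K B S S J = J"
      "tens_map2 K B (\<lambda>x. x) S J = inv\<^bsub>BB\<^esub> J" "inv\<^bsub>BB\<^esub> J = tens_map2 K B S (\<lambda>x. x) J"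
    and m: "m \<ge> 2"
    and red: "\<And>w. w \<in> \<Sigma> \<Longrightarrow> reduced_word m w (red w)"
  shows
    "bialg_hom K (skew_bialg K B J m) H (twisted_proj K B J m) \<and>
     hopf_algebra K H \<and>
     (\<forall>\<beta>. vectorspace.basis K B \<beta> \<longrightarrow>
       (\<exists>\<eta>. vectorspace.basis K H \<eta> \<and> \<eta> \<approx> ({1..m} \<rightarrow>\<^sub>E \<beta>) \<times> \<Sigma>)) \<and>
     (vectorspace.fin_dim K B \<longrightarrow>
       vectorspace.fin_dim K H \<and> vectorspace.dim K H = vectorspace.dim K B ^ m * fact m) \<and>
     (hopf_hom K R H \<iota> \<and> inj_on \<iota> (carrier R)) \<and>
     (\<exists>p. hopf_hom K H (group_bialg K (sym_group m)) p \<and>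
       p ` carrier H = carrier (group_bialg K (sym_group m)) \<and>
       (\<forall>a\<in>carrier R. p (\<iota> a) = basis_elt K id (counit R a)) \<and>
       (\<forall>i\<in>{1..<m}. p (twisted_word K B J m [i]) = basis_elt K (transpose i (Suc i)) \<one>\<^bsub>K\<^esub>)) \<and>
     (\<forall>w\<in>\<Sigma>. wbar w \<in> carrier H) \<and>
     (\<forall>h\<in>carrier H. \<exists>!a. a \<in> \<Sigma> \<rightarrow>\<^sub>E carrier R \<and> h = (\<Oplus>\<^bsub>H\<^esub>w\<in>\<Sigma>. \<iota> (a w) \<otimes>\<^bsub>H\<^esub> wbar w)) \<and>
     (\<exists>\<gamma>. two_cocycle K B m \<gamma> \<and>
       (\<exists>\<phi>\<in>alg_hom K H (crossed_alg R (sym_group m) (tens_perm K B m) \<gamma>).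
         bij_betw \<phi> (carrier H) (carrier (crossed_alg R (sym_group m) (tens_perm K B m) \<gamma>)) \<and>
         (\<forall>a\<in>carrier R. \<forall>w\<in>\<Sigma>. \<phi> (\<iota> a \<otimes>\<^bsub>H\<^esub> wbar w) = basis_elt R w a)) \<and>
       (\<forall>w\<in>\<Sigma>. \<forall>v\<in>\<Sigma>. \<exists>us.
         set us \<subseteq> {tens_perm K B m u (emb_twist_mult K B m J i (Suc i)) | u i. u \<in> \<Sigma> \<and> i \<in> {1..<m}} \<and>
         \<gamma> w v = list_prod R us) \<and>
       (\<forall>w\<in>\<Sigma>. \<forall>v\<in>\<Sigma>. counit R (\<gamma> w v) = \<one>\<^bsub>K\<^esub>)) \<and>
     (semisimple B \<longrightarrow>
       semisimple H \<and> (\<exists>\<Lambda>. integral R \<Lambda>) \<and>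
       (\<forall>\<Lambda>. integral R \<Lambda> \<longrightarrow> integral H (\<iota> \<Lambda> \<otimes>\<^bsub>H\<^esub> (\<Oplus>\<^bsub>H\<^esub>w\<in>\<Sigma>. wbar w))))"
proof -
 interpret T: twisted_red K B S J m red
 proof (rule twisted_red.intro)
  have "base_field K" by (rule base_field.intro[OF field])
  then have "central_twist K B S J"
   by (rule central_twist.intro)
    (rule central_twist_axioms.intro; use hopf twist central hyp_ii hyp_iii in \<open>simp add: BB_def B4_def\<close>)
  then show "twisted K B S J" by (rule twisted.intro)
  show "twisted_red_axioms m red" by (rule twisted_red_axioms.intro) (use red in \<open>simp add: \<Sigma>_def\<close>)
 qed
 have fact: "[(fact m :: nat)] \<cdot>\<^bsub>K\<^esub> \<one>[K] ~= \<zero>[K]" by (rule char_zero) simp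
 have carR: "cr (tensor_bialg K B m) = cr (tensor_pow K B m)" and cuR: "counit (tensor_bialg K B m) = T.tcounit B m" by simp_all
 show ?thesis
  unfolding R_def H_def \<iota>_def \<Sigma>_def wbar_def
 proof (intro conjI)
  show "bialg_hom K (skew_bialg K B J m) (twisted_hopf K B J m) (twisted_proj K B J m)" by (rule T.\<pi>_bialg_hom)
  show "hopf_algebra K (twisted_hopf K B J m)" by (rule T.H_hopf)
  show "ALL \<beta>. vectorspace.basis K B \<beta> -->
    (EX \<eta>. vectorspace.basis K (twisted_hopf K B J m) \<eta> & \<eta> \<approx> ({1..m} \<rightarrow>\<^sub>E \<beta>) \<times> cr (sym_group m))"
   using T.H_basis by blast
  show "vectorspace.fin_dim K B --> vectorspace.fin_dim K (twisted_hopf K B J m) &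
    vectorspace.dim K (twisted_hopf K B J m) = vectorspace.dim K B ^ m * fact m"
   using T.H_dim by blast
  show "hopf_hom K (tensor_bialg K B m) (twisted_hopf K B J m) (twisted_incl K B J m)" by (rule T.\<kappa>_hopf_hom)
  show "inj_on (twisted_incl K B J m) (cr (tensor_bialg K B m))" using T.\<kappa>_inj by (simp only: carR)
  show "EX p. hopf_hom K (twisted_hopf K B J m) (group_bialg K (sym_group m)) p &
    p ` cr (twisted_hopf K B J m) = cr (group_bialg K (sym_group m)) &
    (ALL a:cr (tensor_bialg K B m). p (twisted_incl K B J m a) = basis_elt K id (counit (tensor_bialg K B m) a)) &
    (ALL i:{1..<m}. p (twisted_word K B J m [i]) = basis_elt K (transpose i (Suc i)) \<one>[K])"
   using T.ex_group_map unfolding T.S'_eq carR cuR .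
  show "ALL w:cr (sym_group m). twisted_word K B J m (red w) : cr (twisted_hopf K B J m)"
   using T.wbar_closed by (simp only: T.H_simps) blast
  show "ALL h:cr (twisted_hopf K B J m). EX! a. a : cr (sym_group m) \<rightarrow>\<^sub>E cr (tensor_bialg K B m) &
    h = (\<Oplus>\<^bsub>twisted_hopf K B J m\<^esub>w\<in>cr (sym_group m).
     twisted_incl K B J m (a w) *[twisted_hopf K B J m] twisted_word K B J m (red w))"
   unfolding carR T.H_simps by (rule ballI) (rule T.wbar_basis)
  show "semisimple B --> semisimple (twisted_hopf K B J m) & (EX \<Lambda>. integral (tensor_bialg K B m) \<Lambda>) &
    (ALL \<Lambda>. integral (tensor_bialg K B m) \<Lambda> --> integral (twisted_hopf K B J m)
     (twisted_incl K B J m \<Lambda> *[twisted_hopf K B J m] (\<Oplus>\<^bsub>twisted_hopf K B J m\<^esub>w\<in>cr (sym_group m). twisted_word K B J m (red w))))"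
   unfolding T.H_simps using T.H_semisimple[OF _ fact] by blast
 qed (rule T.crossed_product_iso)
qed

end
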